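(* Let $\chi:H\to\overline{\mathbf F}_p^\times$ be a character and $\gamma=\{\chi,\chi^s\}$. Let $\pi$ be a non-zero irreducible quotient of $H_0(X,\mathcal V_\gamma)$. Then $\pi$ is a supersingular representation of $G$.
   Context: All representations are on $\overline{\mathbf F}_p$-vector spaces. $F$ is a non-Archimedean local field with ring of integers $\mathfrak o_F$, maximal ideal $\mathfrak p_F$, fixed uniformiser $\varpi_F$ and residue field $\mathbf F_q$ of characteristic $p$. $G=\mathrm{GL}_2(F)$, $K=\mathrm{GL}_2(\mathfrak o_F)$, $\Gamma=\mathrm{GL}_2(\mathbf F_q)$; $B,H,U\subset\Gamma$ are the upper triangular, diagonal, and unipotent upper triangular matrices. $K_1$ is the kernel of reduction $K\to\Gamma$; $I$, $I_1$ are the preimages of $B$, $U$ in $K$. $\Pi=\begin{pmatrix}0&1\\ \varpi_F&0\end{pmatrix}$, $s=\begin{pmatrix}0&1\\1&0\end{pmatrix}$, $\chi^s(h)=\chi(s^{-1}hs)$. Representations of $\Gamma$ are viewed as representations of $K$ via $K/K_1\cong\Gamma$. Supersingular: a smooth irreducible representation $\pi$ of $G$ with a central character is supersingular if it is not a subquotient of $\mathrm{Ind}_{\tilde B}^G\chi$ for any smooth quasi-character $\chi$ of the group $\tilde B$ of upper triangular matrices in $G$ trivial on its unipotent radical. Irreducibles of $\Gamma$: $J_0(\chi)=\{s\}$ if $\chi=\chi^s$, $\emptyset$ otherwise; for $J\subseteq J_0(\chi)$, $\overline J=J_0(\chi)\setminus J$. If $\chi\neq\chi^s$, $\rho_{\chi,\emptyset}$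 is the unique irreducible representation of $\Gamma$ on whose (one-dimensional) $U$-invariants $B$ acts by $\chi$. If $\chi=\chi^s=\chi'\circ\det$, $\rho_{\chi,\{s\}}=\chi'\circ\det$, $\rho_{\chi,\emptyset}=\mathrm{St}\otimes\chi'\circ\det$, $\mathrm{St}$ the $q$-dimensional Steinberg representation. $\tilde\rho$ is the extension of $\rho$ to $F^\times K$ with $\varpi_F$ acting trivially. Coefficient systems: $X$ is the Bruhat–Tits tree of $G$ (vertices: homothety classes of $\mathfrak o_F$-lattices in $F^2=\langle v_1,v_2\rangle$); $\sigma_0=[\mathfrak o_Fv_1+\mathfrak o_Fv_2]$, $\sigma_1=\{\sigma_0,[\mathfrak o_Fv_1+\mathfrak p_Fv_2]\}$, with $G$-stabilisers $\mathfrak K(\sigma_0)=F^\times K$, $\mathfrak K(\sigma_1)=\langle I,\Pi\rangle$. For a $G$-equivariant coefficient system $\mathcal V$ (vector spaces $V_\sigma$ for simplices $\sigma$, restriction maps $r^{\sigma'}_\sigma:V_{\sigma'}\to V_\sigma$ for $\sigma\subseteq\sigma'$ with $r^\sigma_\sigma=\mathrm{id}$, and compatible maps $g_\sigma:V_\sigma\to V_{g\sigma}$ forming a $G$-action, smooth on stabilisers), $H_0(X,\mathcal V)$ is the cokernel of $\partial:C_1\to C_0$, where $C_0$ is the space of finitely supported $\omega$ on vertices with $\omega(\sigma)\in V_\sigma$, $C_1$ the space of finitely supported $\omega$ on oriented edges with $\omega((\sigma,\sigma'))\in V_{\{\sigma,\sigma'\}}$, $\omega((\sigma',\sigma))=-\omega((\sigma,\sigma'))$,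 and $\partial(\omega)(\sigma)=\sum_{\sigma'}r^{\{\sigma,\sigma'\}}_\sigma(\omega((\sigma,\sigma')))$ over neighbours $\sigma'$ of $\sigma$; it is a smooth $G$-representation. $\mathcal V_\gamma$: choose $J\subseteq J_0(\chi)$ and nonzero $v_{\chi,J}\in\rho_{\chi,J}^{I_1}$, $v_{\chi^s,\overline J}\in\rho_{\chi^s,\overline J}^{I_1}$. Let $D_0=\tilde\rho_{\chi,J}\oplus\tilde\rho_{\chi^s,\overline J}$ (a representation of $\mathfrak K(\sigma_0)$), $D_1=D_0^{I_1}$ with $F^\times I$-action extended to $\mathfrak K(\sigma_1)$ by $\Pi^{-1}v_{\chi,J}=v_{\chi^s,\overline J}$, $\Pi^{-1}v_{\chi^s,\overline J}=v_{\chi,J}$, and $r:D_1\to D_0$ the inclusion. $\mathcal V_\gamma$ is the coefficient system with $V_{g\sigma_i}=\{f\in\text{c-Ind}_{\mathfrak K(\sigma_i)}^GD_i:\mathrm{supp}f\subseteq\mathfrak K(\sigma_i)g^{-1}\}$, $G$ acting by right translation, the restriction map $V_{g\sigma_1}\to V_{g\sigma_0}$ sending $f$ to the element with value $r(f(g^{-1}))$ at $g^{-1}$. It is, up to isomorphism, the unique $G$-equivariant coefficient system with $(V_{\sigma_0},V_{\sigma_1},r^{\sigma_1}_{\sigma_0})\cong(D_0,D_1,r)$, and is independent of the choices up to isomorphism. *)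

theory Defs
  imports "HOL-Analysis.Analysis" "HOL-Algebra.Algebraic_Closure_Type"
    "HOL-Algebra.Multiplicative_Group" "HOL-Algebra.Generated_Groups"
begin

no_notation fps_nth (infixl \<open>$\<close> 75)

section \<open>Coefficients\<close>

text \<open>The type \<open>'c\<close> is an algebraic closure of the prime field of characteristic \<open>p\<close>.
  A polynomial over the prime field is the image of an integer polynomial.\<close>

definition is_Fp_closure :: "'c::alg_closed_field itself \<Rightarrow> nat \<Rightarrow> bool" where
  "is_Fp_closure _ p \<longleftrightarrow> CHAR('c) = p \<and>
     (\<forall>x::'c. \<exists>f::int poly. map_poly of_int f \<noteq> (0::'c poly) \<and> poly (map_poly of_int f) x = 0)"

abbreviation scalars :: "'c::field ring" where
  "scalars \<equiv> ring_of_type_algebra"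

abbreviation characters :: "('g, 'm) monoid_scheme \<Rightarrow> ('g \<Rightarrow> 'c::field) set" where
  "characters G \<equiv> hom G (mult_of scalars)"


section \<open>Representations on vector spaces with an explicit carrier\<close>

text \<open>The underlying vector space is a \<^type>\<open>module\<close> of \<open>HOL-Algebra\<close>; as there, the fields
  \<open>mult\<close> and \<open>one\<close> carry no meaning and are left undefined in the constructions below.\<close>

record ('c, 'v, 'g) rep = "('c, 'v) module" +
  act :: "'g \<Rightarrow> 'v \<Rightarrow> 'v"

definition lin_maps ::
    "('c::field, 'v, 'm) module_scheme \<Rightarrow> ('c, 'w, 'n) module_scheme \<Rightarrow> ('v \<Rightarrow> 'w) set" where
  "lin_maps V W = {\<phi> \<in> hom (add_monoid V) (add_monoid W).
     \<forall>c. \<forall>v\<in>carrier V. \<phi> (c \<odot>\<^bsub>V\<^esub> v) = c \<odot>\<^bsub>W\<^esub> \<phi> v}"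

definition representation :: "'g monoid \<Rightarrow> ('c::field, 'v, 'g) rep \<Rightarrow> bool" where
  "representation G V \<longleftrightarrow> group G \<and> Module.module scalars V \<and>
     (\<forall>g\<in>carrier G. act V g \<in> lin_maps V V) \<and>
     (\<forall>v\<in>carrier V. act V \<one>\<^bsub>G\<^esub> v = v) \<and>
     (\<forall>g\<in>carrier G. \<forall>h\<in>carrier G. \<forall>v\<in>carrier V. act V (g \<otimes>\<^bsub>G\<^esub> h) v = act V g (act V h v))"

definition rep_hom ::
    "'g monoid \<Rightarrow> ('c::field, 'v, 'g) rep \<Rightarrow> ('c, 'w, 'g) rep \<Rightarrow> ('v \<Rightarrow> 'w) set" where
  "rep_hom G V W = {\<phi> \<in> lin_maps V W.
     \<forall>g\<in>carrier G. \<forall>v\<in>carrier V. \<phi> (act V g v) = act W g (\<phi> v)}"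

definition rep_iso :: "'g monoid \<Rightarrow> ('c::field, 'v, 'g) rep \<Rightarrow> ('c, 'w, 'g) rep \<Rightarrow> bool" where
  "rep_iso G V W \<longleftrightarrow> (\<exists>\<phi> \<in> rep_hom G V W. bij_betw \<phi> (carrier V) (carrier W))"

definition subrep :: "'g monoid \<Rightarrow> 'v set \<Rightarrow> ('c::field, 'v, 'g) rep \<Rightarrow> bool" where
  "subrep G W V \<longleftrightarrow> submodule W scalars V \<and> (\<forall>g\<in>carrier G. \<forall>v\<in>W. act V g v \<in> W)"

definition irreducible_rep :: "'g monoid \<Rightarrow> ('c::field, 'v, 'g) rep \<Rightarrow> bool" where
  "irreducible_rep G V \<longleftrightarrow> representation G V \<and> carrier V \<noteq> {\<zero>\<^bsub>V\<^esub>} \<and>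
     (\<forall>W. subrep G W V \<longrightarrow> W = {\<zero>\<^bsub>V\<^esub>} \<or> W = carrier V)"

definition quotient_rep :: "('c, 'v, 'g) rep \<Rightarrow> 'v set \<Rightarrow> ('c, 'v set, 'g) rep" where
  "quotient_rep V N =
     \<lparr>carrier = a_rcosets\<^bsub>V\<^esub> N, mult = undefined, one = undefined, zero = N,
      add = set_add V,
      smult = (\<lambda>c Y. \<Union>x\<in>Y. N +>\<^bsub>V\<^esub> (c \<odot>\<^bsub>V\<^esub> x)),
      act = (\<lambda>g Y. \<Union>x\<in>Y. N +>\<^bsub>V\<^esub> (act V g x))\<rparr>"

definition is_quotient :: "'g monoid \<Rightarrow> ('c::field, 'w, 'g) rep \<Rightarrow> ('c, 'v, 'g) rep \<Rightarrow> bool" where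
  "is_quotient G P V \<longleftrightarrow> (\<exists>N. subrep G N V \<and> rep_iso G P (quotient_rep V N))"

definition is_subquotient :: "'g monoid \<Rightarrow> ('c::field, 'w, 'g) rep \<Rightarrow> ('c, 'v, 'g) rep \<Rightarrow> bool" where
  "is_subquotient G P V \<longleftrightarrow> (\<exists>W. subrep G W V \<and> is_quotient G P (V\<lparr>carrier := W\<rparr>))"

definition invariants :: "('c, 'v, 'g) rep \<Rightarrow> 'g set \<Rightarrow> 'v set" where
  "invariants V S = {v \<in> carrier V. \<forall>g\<in>S. act V g v = v}"

definition char_rep :: "('g \<Rightarrow> 'c) \<Rightarrow> ('c::field, 'c, 'g) rep" where
  "char_rep psi =
     \<lparr>carrier = UNIV, mult = undefined, one = undefined, zero = 0, add = (+),
      smult = (*), act = (\<lambda>g v. psi g * v)\<rparr>"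

definition twist :: "('c, 'v, 'g) rep \<Rightarrow> ('g \<Rightarrow> 'c) \<Rightarrow> ('c, 'v, 'g) rep" where
  "twist V psi = V\<lparr>act := (\<lambda>g v. psi g \<odot>\<^bsub>V\<^esub> act V g v)\<rparr>"

definition direct_sum ::
    "('c, 'v, 'g) rep \<Rightarrow> ('c, 'w, 'g) rep \<Rightarrow> ('c, 'v \<times> 'w, 'g) rep" where
  "direct_sum V W =
     \<lparr>carrier = carrier V \<times> carrier W, mult = undefined, one = undefined,
      zero = (\<zero>\<^bsub>V\<^esub>, \<zero>\<^bsub>W\<^esub>),
      add = (\<lambda>x y. (fst x \<oplus>\<^bsub>V\<^esub> fst y, snd x \<oplus>\<^bsub>W\<^esub> snd y)),
      smult = (\<lambda>c x. (c \<odot>\<^bsub>V\<^esub> fst x, c \<odot>\<^bsub>W\<^esub> snd x)),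
      act = (\<lambda>g x. (act V g (fst x), act W g (snd x)))\<rparr>"


subsection \<open>Induced representations\<close>

text \<open>Functions on \<open>G\<close> are extended by zero outside the carrier of \<open>G\<close>.\<close>

definition equivariant_funs ::
    "'g monoid \<Rightarrow> 'g set \<Rightarrow> ('c, 'v, 'g) rep \<Rightarrow> ('g \<Rightarrow> 'v) set" where
  "equivariant_funs G P D =
     {f. (\<forall>g\<in>carrier G. f g \<in> carrier D) \<and> (\<forall>g. g \<notin> carrier G \<longrightarrow> f g = \<zero>\<^bsub>D\<^esub>) \<and>
         (\<forall>p\<in>P. \<forall>g\<in>carrier G. f (p \<otimes>\<^bsub>G\<^esub> g) = act D p (f g))}"

definition right_transl :: "'g monoid \<Rightarrow> ('c, 'v, 'g) rep \<Rightarrow> 'g \<Rightarrow> ('g \<Rightarrow> 'v) \<Rightarrow> 'g \<Rightarrow> 'v" where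
  "right_transl G D g f = (\<lambda>h. if h \<in> carrier G then f (h \<otimes>\<^bsub>G\<^esub> g) else \<zero>\<^bsub>D\<^esub>)"

definition fun_module :: "('c, 'v, 'g) rep \<Rightarrow> ('g \<Rightarrow> 'v) set \<Rightarrow> ('c, 'g \<Rightarrow> 'v) module" where
  "fun_module D C =
     \<lparr>carrier = C, mult = undefined, one = undefined, zero = (\<lambda>_. \<zero>\<^bsub>D\<^esub>),
      add = (\<lambda>f f' h. f h \<oplus>\<^bsub>D\<^esub> f' h), smult = (\<lambda>c f h. c \<odot>\<^bsub>D\<^esub> f h)\<rparr>"

definition fun_rep ::
    "'g monoid \<Rightarrow> ('c, 'v, 'g) rep \<Rightarrow> ('g \<Rightarrow> 'v) set \<Rightarrow> ('c, 'g \<Rightarrow> 'v, 'g) rep" where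
  "fun_rep G D C = module.extend (fun_module D C) (rep.fields (right_transl G D))"

text \<open>The space of \<open>c-Ind\<close> for an open subgroup \<open>P\<close>: the support is compact modulo \<open>P\<close>, that is,
  a finite union of cosets \<open>P t\<close>.  When \<open>P\<close> is open and \<open>D\<close> is smooth, such functions are
  automatically smooth under right translation.\<close>

definition cInd_space ::
    "'g monoid \<Rightarrow> 'g set \<Rightarrow> ('c, 'v, 'g) rep \<Rightarrow> ('g \<Rightarrow> 'v) set" where
  "cInd_space G P D = {f \<in> equivariant_funs G P D.
     \<exists>T. finite T \<and> T \<subseteq> carrier G \<and> {g \<in> carrier G. f g \<noteq> \<zero>\<^bsub>D\<^esub>} \<subseteq> (\<Union>t\<in>T. P #>\<^bsub>G\<^esub> t)}"


section \<open>Two by two matrices\<close>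

definition GL2 :: "('a::field^2^2) monoid" where
  "GL2 = \<lparr>carrier = {A. invertible A}, mult = (**), one = mat 1\<rparr>"

definition mat2 :: "'a \<Rightarrow> 'a \<Rightarrow> 'a \<Rightarrow> 'a \<Rightarrow> 'a::zero^2^2" where
  "mat2 a b c d = vector [vector [a, b], vector [c, d]]"

definition upper_triangular :: "('a::field^2^2) set" where
  "upper_triangular = {A \<in> carrier GL2. A$2$1 = 0}"

definition diagonal :: "('a::field^2^2) set" where
  "diagonal = {A \<in> carrier GL2. A$1$2 = 0 \<and> A$2$1 = 0}"

definition upper_unipotent :: "('a::field^2^2) set" where
  "upper_unipotent = {A \<in> carrier GL2. A$1$1 = 1 \<and> A$2$1 = 0 \<and> A$2$2 = 1}"

definition weyl_s :: "'a::field^2^2" where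
  "weyl_s = mat2 0 1 1 0"


section \<open>Smooth representations and supersingularity\<close>

definition smooth_rep :: "('c::field, 'v, ('f::{field,metric_space})^2^2) rep \<Rightarrow> bool" where
  "smooth_rep V \<longleftrightarrow> representation GL2 V \<and>
     (\<forall>v\<in>carrier V. openin (top_of_set (carrier GL2)) {g \<in> carrier GL2. act V g v = v})"

definition has_central_character ::
    "('c::field, 'v, ('f::field)^2^2) rep \<Rightarrow> bool" where
  "has_central_character V \<longleftrightarrow>
     (\<exists>zeta \<in> characters (mult_of (ring_of_type_algebra :: 'f ring)).
        \<forall>z. z \<noteq> 0 \<longrightarrow> (\<forall>v\<in>carrier V. act V (mat z) v = zeta z \<odot>\<^bsub>V\<^esub> v))"

definition smooth_borel_character ::
    "(('f::{field,metric_space})^2^2 \<Rightarrow> 'c::field) \<Rightarrow> bool" where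
  "smooth_borel_character psi \<longleftrightarrow> psi \<in> characters (GL2\<lparr>carrier := upper_triangular\<rparr>) \<and>
     openin (top_of_set upper_triangular) {b \<in> upper_triangular. psi b = 1} \<and>
     (\<forall>u\<in>upper_unipotent. psi u = 1)"

definition principal_series ::
    "(('f::{field,metric_space})^2^2 \<Rightarrow> 'c::field) \<Rightarrow> ('c, 'f^2^2 \<Rightarrow> 'c, 'f^2^2) rep" where
  "principal_series psi = fun_rep GL2 (char_rep psi)
     {f \<in> equivariant_funs GL2 upper_triangular (char_rep psi).
        openin (top_of_set (carrier GL2))
          {g \<in> carrier GL2. right_transl GL2 (char_rep psi) g f = f}}"

definition supersingular :: "('c::field, 'v, ('f::{field,metric_space})^2^2) rep \<Rightarrow> bool" where
  "supersingular V \<longleftrightarrow> smooth_rep V \<and> irreducible_rep GL2 V \<and> has_central_character V \<and>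
     \<not> (\<exists>psi. smooth_borel_character psi \<and> is_subquotient GL2 V (principal_series psi))"


section \<open>Irreducible representations of the finite group\<close>

definition conj_s :: "('k::field^2^2 \<Rightarrow> 'c) \<Rightarrow> 'k^2^2 \<Rightarrow> 'c" where
  "conj_s chi h = chi (matrix_inv weyl_s ** h ** weyl_s)"

definition J0 :: "('k::field^2^2 \<Rightarrow> 'c) \<Rightarrow> ('k^2^2) set" where
  "J0 chi = (if \<forall>h\<in>diagonal. chi h = conj_s chi h then {weyl_s} else {})"

text \<open>The Steinberg representation: left \<open>B\<close>-invariant functions modulo constants.\<close>

definition steinberg :: "('c::field, ('k::field^2^2 \<Rightarrow> 'c) set, 'k^2^2) rep" where
  "steinberg = quotient_rep
     (fun_rep GL2 (char_rep (\<lambda>_. 1)) (equivariant_funs GL2 upper_triangular (char_rep (\<lambda>_. 1))))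
     {f. \<exists>c. f = (\<lambda>g. if g \<in> carrier GL2 then c else 0)}"

text \<open>\<open>is_rho chi J R\<close>: the representation \<open>R\<close> belongs to the isomorphism class
  of \<open>\<rho>\<^bsub>\<chi>,J\<^esub>\<close>.  The torus is viewed as a quotient of the Borel subgroup by taking
  diagonal entries.\<close>

definition is_rho ::
    "('k::finite_field^2^2 \<Rightarrow> 'c::field) \<Rightarrow> ('k^2^2) set \<Rightarrow> ('c, 'v, 'k^2^2) rep \<Rightarrow> bool" where
  "is_rho chi J R \<longleftrightarrow> representation GL2 R \<and> J \<subseteq> J0 chi \<and>
     (if J0 chi = {} then
        irreducible_rep GL2 R \<and>
        (\<exists>v\<in>carrier R. v \<noteq> \<zero>\<^bsub>R\<^esub> \<and> invariants R upper_unipotent = {c \<odot>\<^bsub>R\<^esub> v | c. True}) \<and>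
        (\<forall>b\<in>upper_triangular. \<forall>v\<in>invariants R upper_unipotent.
           act R b v = chi (mat2 (b$1$1) 0 0 (b$2$2)) \<odot>\<^bsub>R\<^esub> v)
      else
        (\<exists>chi' \<in> characters (mult_of (ring_of_type_algebra :: 'k ring)).
           (\<forall>h\<in>diagonal. chi h = chi' (det h)) \<and>
           (if weyl_s \<in> J then rep_iso GL2 R (char_rep (\<lambda>g. chi' (det g)))
            else rep_iso GL2 R (twist steinberg (\<lambda>g. chi' (det g))))))"


section \<open>Coefficient systems\<close>

text \<open>Simplices are finite sets of vertices; a vertex \<open>x\<close> is the simplex \<open>{x}\<close>.
  \<open>cs_res V t s\<close> is the restriction map from the space at \<open>t\<close> to the space at a face \<open>s\<close>,
  and \<open>cs_act V g s\<close> maps the space at \<open>s\<close> to the space at \<open>g s\<close>.\<close>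

record ('c, 'x, 'v, 'g) coeff_system =
  cs_space :: "'x set \<Rightarrow> ('c, 'v) module"
  cs_res :: "'x set \<Rightarrow> 'x set \<Rightarrow> 'v \<Rightarrow> 'v"
  cs_act :: "'g \<Rightarrow> 'x set \<Rightarrow> 'v \<Rightarrow> 'v"


section \<open>Non-Archimedean local fields and the tree\<close>

text \<open>\<open>val\<close> is the normalised valuation (its value at 0 is irrelevant), \<open>unif\<close> the chosen
  uniformiser and \<open>red\<close> the reduction map from the ring of integers to the residue field \<open>'k\<close>
  (its values outside the ring of integers are irrelevant).  The metric is the one defined by the
  normalised absolute value, so that the class topology on \<open>'f^2^2\<close> is the usual one.\<close>

locale local_field =
  fixes val :: "'f::{field,metric_space} \<Rightarrow> int"
    and unif :: 'f
    and red :: "'f \<Rightarrow> 'k::finite_field"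
  assumes val_mult: "\<And>x y. x \<noteq> 0 \<Longrightarrow> y \<noteq> 0 \<Longrightarrow> val (x * y) = val x + val y"
    and val_add: "\<And>x y. x \<noteq> 0 \<Longrightarrow> y \<noteq> 0 \<Longrightarrow> x + y \<noteq> 0 \<Longrightarrow> min (val x) (val y) \<le> val (x + y)"
    and uniformiser: "unif \<noteq> 0" "val unif = 1"
    and dist_val: "\<And>x y. dist x y = (if x = y then 0 else real CARD('k) powi (- val (x - y)))"
    and complete: "complete (UNIV :: 'f set)"
    and red_surj: "red ` {x. x = 0 \<or> 0 \<le> val x} = UNIV"
    and red_one: "red 1 = 1"
    and red_add: "\<And>x y. x = 0 \<or> 0 \<le> val x \<Longrightarrow> y = 0 \<or> 0 \<le> val y \<Longrightarrow>
                    red (x + y) = red x + red y"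
    and red_mult: "\<And>x y. x = 0 \<or> 0 \<le> val x \<Longrightarrow> y = 0 \<or> 0 \<le> val y \<Longrightarrow>
                    red (x * y) = red x * red y"
    and red_eq_0: "\<And>x. x = 0 \<or> 0 \<le> val x \<Longrightarrow> red x = 0 \<longleftrightarrow> x = 0 \<or> 1 \<le> val x"
begin

definition integers :: "'f set" where
  "integers = {x. x = 0 \<or> 0 \<le> val x}"

definition max_ideal :: "'f set" where
  "max_ideal = {x. x = 0 \<or> 1 \<le> val x}"

definition GK :: "('f^2^2) set" where
  "GK = {A \<in> carrier GL2. \<forall>i j. A$i$j \<in> integers \<and> matrix_inv A$i$j \<in> integers}"

definition red_mat :: "'f^2^2 \<Rightarrow> 'k^2^2" where
  "red_mat A = (\<chi> i j. red (A$i$j))"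

definition Iw :: "('f^2^2) set" where
  "Iw = {A \<in> GK. red_mat A \<in> upper_triangular}"

definition Iw1 :: "('f^2^2) set" where
  "Iw1 = {A \<in> GK. red_mat A \<in> upper_unipotent}"

definition Pi_mat :: "'f^2^2" where
  "Pi_mat = mat2 0 1 unif 0"

definition stab0 :: "('f^2^2) set" where
  "stab0 = {mat z ** k | z k. z \<noteq> 0 \<and> k \<in> GK}"

definition stab1 :: "('f^2^2) set" where
  "stab1 = generate GL2 (Iw \<union> {Pi_mat})"

subsection \<open>The Bruhat--Tits tree\<close>

definition is_lattice :: "('f^2) set \<Rightarrow> bool" where
  "is_lattice L \<longleftrightarrow> (\<exists>u v. u \<noteq> v \<and> vec.independent {u, v} \<and>
     L = {a *s u + b *s v | a b. a \<in> integers \<and> b \<in> integers})"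

definition homothety_class :: "('f^2) set \<Rightarrow> ('f^2) set set" where
  "homothety_class L = {(\<lambda>x. z *s x) ` L | z. z \<noteq> 0}"

definition vertices :: "('f^2) set set set" where
  "vertices = {homothety_class L | L. is_lattice L}"

definition adjacent :: "('f^2) set set \<Rightarrow> ('f^2) set set \<Rightarrow> bool" where
  "adjacent x y \<longleftrightarrow> x \<in> vertices \<and> y \<in> vertices \<and>
     (\<exists>L\<in>x. \<exists>M\<in>y. (\<lambda>v. unif *s v) ` L \<subset> M \<and> M \<subset> L)"

definition vertex_act :: "'f^2^2 \<Rightarrow> ('f^2) set set \<Rightarrow> ('f^2) set set" where
  "vertex_act g x = (\<lambda>L. (\<lambda>v. g *v v) ` L) ` x"

definition simplex_act :: "'f^2^2 \<Rightarrow> ('f^2) set set set \<Rightarrow> ('f^2) set set set" where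
  "simplex_act g s = vertex_act g ` s"

definition sigma0 :: "('f^2) set set" where
  "sigma0 = homothety_class
     {a *s axis 1 1 + b *s axis 2 1 | a b. a \<in> integers \<and> b \<in> integers}"

definition sigma1 :: "('f^2) set set set" where
  "sigma1 = {sigma0, homothety_class
     {a *s axis 1 1 + b *s axis 2 1 | a b. a \<in> integers \<and> b \<in> max_ideal}}"

subsection \<open>Homology in degree zero\<close>

text \<open>Chains are functions on the vertices, respectively on the oriented edges, that are
  \<^const>\<open>undefined\<close> elsewhere.\<close>

definition chains0 ::
    "('c, ('f^2) set set, 'v, 'f^2^2) coeff_system
       \<Rightarrow> ('c, ('f^2) set set \<Rightarrow> 'v, 'f^2^2) rep" where
  "chains0 V =
     \<lparr>carrier = {om \<in> PiE vertices (\<lambda>x. carrier (cs_space V {x})).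
                   finite {x \<in> vertices. om x \<noteq> \<zero>\<^bsub>cs_space V {x}\<^esub>}},
      mult = undefined, one = undefined,
      zero = (\<lambda>x\<in>vertices. \<zero>\<^bsub>cs_space V {x}\<^esub>),
      add = (\<lambda>om om'. \<lambda>x\<in>vertices. om x \<oplus>\<^bsub>cs_space V {x}\<^esub> om' x),
      smult = (\<lambda>c om. \<lambda>x\<in>vertices. c \<odot>\<^bsub>cs_space V {x}\<^esub> om x),
      act = (\<lambda>g om. \<lambda>x\<in>vertices. let y = vertex_act (matrix_inv g) x in cs_act V g {y} (om y))\<rparr>"

definition chains1 ::
    "('c, ('f^2) set set, 'v, 'f^2^2) coeff_system
       \<Rightarrow> (('f^2) set set \<times> ('f^2) set set \<Rightarrow> 'v) set" where
  "chains1 V =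
     {om \<in> PiE {(x, y). adjacent x y} (\<lambda>(x, y). carrier (cs_space V {x, y})).
        finite {(x, y). adjacent x y \<and> om (x, y) \<noteq> \<zero>\<^bsub>cs_space V {x, y}\<^esub>} \<and>
        (\<forall>x y. adjacent x y \<longrightarrow> om (y, x) = \<ominus>\<^bsub>cs_space V {x, y}\<^esub> om (x, y))}"

text \<open>The index set of the sum is finite because the residue field is.\<close>

definition boundary ::
    "('c, ('f^2) set set, 'v, 'f^2^2) coeff_system
       \<Rightarrow> (('f^2) set set \<times> ('f^2) set set \<Rightarrow> 'v) \<Rightarrow> ('f^2) set set \<Rightarrow> 'v" where
  "boundary V om = (\<lambda>x\<in>vertices.
     finsum (cs_space V {x}) (\<lambda>y. cs_res V {x, y} {x} (om (x, y))) {y. adjacent x y})"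

definition H0 ::
    "('c, ('f^2) set set, 'v, 'f^2^2) coeff_system
       \<Rightarrow> ('c, (('f^2) set set \<Rightarrow> 'v) set, 'f^2^2) rep" where
  "H0 V = quotient_rep (chains0 V) (boundary V ` chains1 V)"

subsection \<open>The coefficient system attached to a character\<close>

text \<open>The representation of \<open>F\<^sup>\<times> K\<close> extending a representation of the finite group inflated to
  \<open>K\<close>, with the uniformiser acting trivially.\<close>

definition tilde :: "('c, 'v, 'k^2^2) rep \<Rightarrow> ('c, 'v, 'f^2^2) rep" where
  "tilde R = module.extend (module.truncate R)
     (rep.fields (\<lambda>g. act R (red_mat (THE k. k \<in> GK \<and> (\<exists>n::int. g = mat (unif powi n) ** k)))))"

definition D0_rep ::
    "('c, 'v, 'k^2^2) rep \<Rightarrow> ('c, 'u, 'k^2^2) rep \<Rightarrow> ('c, 'v \<times> 'u, 'f^2^2) rep" where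
  "D0_rep R S = direct_sum (tilde R) (tilde S)"

text \<open>These conditions determine \<open>E\<close> on its carrier, since \<open>stab1\<close> is generated by \<open>Iw\<close> and
  \<open>Pi_mat\<close>, and \<open>(a, 0)\<close>, \<open>(0, b)\<close> span the \<open>Iw1\<close>-invariants.\<close>

definition is_D1 ::
    "('c::field, 'v, 'k^2^2) rep \<Rightarrow> ('c, 'u, 'k^2^2) rep \<Rightarrow> 'v \<Rightarrow> 'u
       \<Rightarrow> ('c, 'v \<times> 'u, 'f^2^2) rep \<Rightarrow> bool" where
  "is_D1 R S a b E \<longleftrightarrow>
     representation (GL2\<lparr>carrier := stab1\<rparr>) E \<and>
     (\<exists>T. E = (D0_rep R S)\<lparr>carrier := invariants (D0_rep R S) Iw1, act := T\<rparr>) \<and>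
     (\<forall>z k. z \<noteq> 0 \<longrightarrow> k \<in> Iw \<longrightarrow> (\<forall>v\<in>carrier E. act E (mat z ** k) v = act (D0_rep R S) (mat z ** k) v)) \<and>
     act E (matrix_inv Pi_mat) (a, \<zero>\<^bsub>S\<^esub>) = (\<zero>\<^bsub>R\<^esub>, b) \<and>
     act E (matrix_inv Pi_mat) (\<zero>\<^bsub>R\<^esub>, b) = (a, \<zero>\<^bsub>S\<^esub>)"

text \<open>For a simplex \<open>t = g s\<close>: the functions in \<open>c-Ind\<close> from the stabiliser \<open>P\<close> of \<open>s\<close>
  supported on \<open>P g\<^sup>-\<^sup>1\<close>; this coset depends only on \<open>t\<close>.\<close>

definition cInd_at ::
    "('f^2^2) set \<Rightarrow> ('c, 'v, 'f^2^2) rep \<Rightarrow> ('f^2) set set set \<Rightarrow> ('f^2) set set set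
       \<Rightarrow> ('c, 'f^2^2 \<Rightarrow> 'v) module" where
  "cInd_at P D s t = fun_module D
     {f \<in> cInd_space GL2 P D. \<exists>g\<in>carrier GL2. t = simplex_act g s \<and>
        {h \<in> carrier GL2. f h \<noteq> \<zero>\<^bsub>D\<^esub>} \<subseteq> P #>\<^bsub>GL2\<^esub> matrix_inv g}"

text \<open>The system built from a representation \<open>D\<close> of \<open>stab0\<close>, a representation \<open>E\<close> of \<open>stab1\<close>
  and a map \<open>r\<close> from \<open>E\<close> to \<open>D\<close>, both with the same underlying type and zero.\<close>

definition cs_of ::
    "('c, 'v, 'f^2^2) rep \<Rightarrow> ('c, 'v, 'f^2^2) rep \<Rightarrow> ('v \<Rightarrow> 'v)
       \<Rightarrow> ('c, ('f^2) set set, 'f^2^2 \<Rightarrow> 'v, 'f^2^2) coeff_system" where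
  "cs_of D E r =
    (let sp = (\<lambda>t. if \<exists>x. t = {x} then cInd_at stab0 D {sigma0} t else cInd_at stab1 E sigma1 t)
     in \<lparr>cs_space = sp,
         cs_res = (\<lambda>t s f. if s = t then f else
            (THE f'. f' \<in> carrier (sp s) \<and>
               (\<exists>g\<in>carrier GL2. t = simplex_act g sigma1 \<and> s = simplex_act g {sigma0} \<and>
                  f' (matrix_inv g) = r (f (matrix_inv g))))),
         cs_act = (\<lambda>g t. right_transl GL2 D g)\<rparr>)"

definition V_gamma ::
    "('c, 'v, 'k^2^2) rep \<Rightarrow> ('c, 'u, 'k^2^2) rep \<Rightarrow> ('c, 'v \<times> 'u, 'f^2^2) rep
       \<Rightarrow> ('c, ('f^2) set set, 'f^2^2 \<Rightarrow> 'v \<times> 'u, 'f^2^2) coeff_system" where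
  "V_gamma R S E = cs_of (D0_rep R S) E id"

end

end

theory Submission
  imports Defs
begin

text \<open>
  An irreducible quotient \<open>\<pi>\<close> of \<open>H\<^sub>0\<close> receives a nonzero map from \<open>D\<^sub>0\<close> which commutes with
  \<open>F\<^sup>\<times> K\<close> and, on \<open>D\<^sub>1\<close>, with \<open>\<Pi>\<close>.  The images \<open>w\<^sub>1\<close>, \<open>w\<^sub>2\<close> of the two
  distinguished vectors are nonzero, fixed by \<open>I\<^sub>1\<close>, exchanged by \<open>\<Pi>\<close>, and are eigenvectors of
  \<open>T = \<Sum>\<^sub>a u(a) s\<close> (\<open>a\<close> in the residue field) with eigenvalues \<open>l\<^sub>1\<close>, \<open>l\<^sub>2\<close>.
  If \<open>\<chi> \<noteq> \<chi>\<^sup>s\<close> both eigenvalues vanish; otherwise exactly one does, namely that of the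
  one-dimensional factor.  Smoothness and the central character spread from \<open>w\<^sub>1\<close> to \<open>\<pi>\<close> by
  irreducibility.

  Suppose \<open>\<pi> = W / N\<close> with \<open>N \<subseteq> W \<subseteq> Ind \<psi>\<close>.  Over the Borel subgroup the functions in
  \<open>Ind \<psi>\<close> that vanish at \<open>1\<close> form an irreducible representation, because finite \<open>p\<close>-groups
  have nonzero fixed vectors in characteristic \<open>p\<close>.  Hence an element of \<open>N\<close> is determined by its
  value at \<open>1\<close>, and equally by its value at \<open>s\<close>, so that vectors of \<open>W\<close> which are invariant
  modulo \<open>N\<close> under the upper unipotent matrices over the integers, or the lower unipotent ones over
  the maximal ideal, are invariant.  A vector invariant under both is the pair of its values at \<open>1\<close>
  and \<open>s\<close>, and on these pairs \<open>T\<close> and \<open>\<Pi>\<close> act by explicit matrices.  If \<open>N = 0\<close> they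
  force \<open>l\<^sub>1 = l\<^sub>2 = 0\<close> and \<open>\<chi> = \<chi>\<^sup>s\<close>; if \<open>N\<close> is a line they force
  \<open>l\<^sub>1 = l\<^sub>2 \<noteq> 0\<close>.
\<close>

section \<open>Generalities on representations\<close>

text \<open>The obstacle is that \<open>\<pi>\<close> is only a subquotient: taking invariants of a
  pro-p group is not exact in characteristic p, so a fixed vector of \<open>W / N\<close> need not
  lift to a fixed vector of \<open>W\<close>. For an upper unipotent \<open>u\<close> the defect
  \<open>u f - f\<close> lies in \<open>N\<close>; the unipotent radical acts trivially on the left,
  so the defect is zero at 1, and this kills it because \<open>N\<close> is proper. For lower
  unipotents the value at \<open>s\<close> plays the same role. On pairs (value at 1, value at
  \<open>s\<close>) the operator \<open>T\<close> sends (x, y) to (0, x + kap y): the first entry is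
  a sum of q equal terms, and q = 0 in the coefficients. If \<open>N\<close> is a line through (x0,
  y0), with both entries nonzero, then \<open>T = 0\<close> on it reads x0 + kap y0 = 0, and
  \<open>T\<close> is multiplication by kap modulo this line. So kap is nonzero whatever
  \<open>\<psi>\<close> is. The sets \<open>J\<close> chosen for the two factors are complementary,
  and this separates the eigenvalues when \<open>\<chi> = \<chi>\<^sup>s\<close>: the Steinberg
  factor counts q - 1 points, the one-dimensional one counts q.\<close>

lemma scalars_simps [simp]:
  "carrier (scalars :: 'c::field ring) = UNIV" "monoid.mult (scalars :: 'c ring) = (*)"
  "one (scalars :: 'c ring) = 1" "zero (scalars :: 'c ring) = 0" "add (scalars :: 'c ring) = (+)"
  by (auto simp: ring_of_type_algebra_def)

locale group_rep =
  fixes G :: "'g monoid" and V :: "('c::field, 'v, 'g) rep" (structure)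
  assumes representation: "representation G V"

sublocale group_rep \<subseteq> Module.module "scalars :: 'c ring" V
  using representation by (simp add: representation_def)

context group_rep
begin

lemma group: "group G"
  using representation by (simp add: representation_def)

lemma G_closed: "\<one>\<^bsub>G\<^esub> \<in> carrier G" "g \<in> carrier G \<Longrightarrow> h \<in> carrier G \<Longrightarrow> g \<otimes>\<^bsub>G\<^esub> h \<in> carrier G"
  using group.is_monoid[OF group] by (auto simp: monoid.m_closed)

lemma act_in: "g \<in> carrier G \<Longrightarrow> act V g \<in> lin_maps V V"
  using representation by (simp add: representation_def)

lemma act_closed [simp]: "g \<in> carrier G \<Longrightarrow> v \<in> carrier V \<Longrightarrow> act V g v \<in> carrier V"
  using act_in[of g] by (auto simp: lin_maps_def hom_def)

lemma act_add: "g \<in> carrier G \<Longrightarrow> v \<in> carrier V \<Longrightarrow> w \<in> carrier V \<Longrightarrow>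
    act V g (v \<oplus> w) = act V g v \<oplus> act V g w"
  using act_in[of g] by (auto simp: lin_maps_def hom_def)

lemma act_smult: "g \<in> carrier G \<Longrightarrow> v \<in> carrier V \<Longrightarrow> act V g (c \<odot> v) = c \<odot> act V g v"
  using act_in[of g] by (auto simp: lin_maps_def)

lemma act_one [simp]: "v \<in> carrier V \<Longrightarrow> act V \<one>\<^bsub>G\<^esub> v = v"
  using representation by (simp add: representation_def)

lemma act_mult: "g \<in> carrier G \<Longrightarrow> h \<in> carrier G \<Longrightarrow> v \<in> carrier V \<Longrightarrow>
    act V (g \<otimes>\<^bsub>G\<^esub> h) v = act V g (act V h v)"
  using representation by (simp add: representation_def)

lemma smult_zero_scalar [simp]: "v \<in> carrier V \<Longrightarrow> 0 \<odot> v = \<zero>"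
  using smult_l_null[of v] by simp

lemma smult_one_scalar [simp]: "v \<in> carrier V \<Longrightarrow> 1 \<odot> v = v"
  using smult_one[of v] by simp

lemma smult_cl [simp]: "v \<in> carrier V \<Longrightarrow> c \<odot> v \<in> carrier V"
  using smult_closed[of c v] by simp

lemma smult_zero_vec [simp]: "c \<odot> \<zero> = \<zero>"
  using smult_r_null[of c] by simp

lemma smult_assoc: "v \<in> carrier V \<Longrightarrow> (a * b) \<odot> v = a \<odot> (b \<odot> v)"
  using smult_assoc1[of a b v] by simp

lemma smult_add_vec: "v \<in> carrier V \<Longrightarrow> w \<in> carrier V \<Longrightarrow> c \<odot> (v \<oplus> w) = c \<odot> v \<oplus> c \<odot> w"
  using smult_r_distr[of c v w] by simp

lemma smult_add_scalar: "v \<in> carrier V \<Longrightarrow> (a + b) \<odot> v = a \<odot> v \<oplus> b \<odot> v"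
  using smult_l_distr[of a b v] by simp

lemma smult_minus_one: "v \<in> carrier V \<Longrightarrow> (- 1) \<odot> v = \<ominus> v"
  using smult_add_scalar[of v "-1" 1] by (metis add.inv_closed smult_cl add.inv_equality
      smult_one_scalar smult_zero_scalar left_minus)

lemma smult_eq_zeroD:
  assumes "v \<in> carrier V" "c \<odot> v = \<zero>" shows "c = 0 \<or> v = \<zero>"
proof (rule disjCI)
  assume "v \<noteq> \<zero>"
  show "c = 0"
  proof (rule ccontr)
    assume "c \<noteq> 0"
    then have "v = (inverse c * c) \<odot> v" using assms by simp
    also have "\<dots> = \<zero>" using assms by (simp only: smult_assoc assms(2) smult_zero_vec)
    finally show False using \<open>v \<noteq> \<zero>\<close> by simp
  qed
qed

lemma act_zero [simp]: "g \<in> carrier G \<Longrightarrow> act V g \<zero> = \<zero>"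
  using act_smult[of g \<zero> 0] by simp

lemma act_inv_act: "g \<in> carrier G \<Longrightarrow> v \<in> carrier V \<Longrightarrow> act V (inv\<^bsub>G\<^esub> g) (act V g v) = v"
  using act_mult[of "inv\<^bsub>G\<^esub> g" g v] group by (simp add: group.inv_closed group.l_inv)

lemma act_act_inv: "g \<in> carrier G \<Longrightarrow> v \<in> carrier V \<Longrightarrow> act V g (act V (inv\<^bsub>G\<^esub> g) v) = v"
  using act_mult[of g "inv\<^bsub>G\<^esub> g" v] group by (simp add: group.inv_closed group.r_inv)

end

lemma group_rep_of: "representation G V \<Longrightarrow> group_rep G V"
  by (rule group_rep.intro)

text \<open>Additive inverses come from the scalar \<open>- 1\<close>, so that a representation is
  recognised by pointwise identities alone.\<close>

lemma representationI:
  fixes V :: "('c::field, 'v, 'g) rep" (structure)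
  assumes "group G"
    and zero: "\<zero> \<in> carrier V"
    and add: "\<And>x y. x \<in> carrier V \<Longrightarrow> y \<in> carrier V \<Longrightarrow> x \<oplus> y \<in> carrier V"
    and assoc: "\<And>x y z. x \<in> carrier V \<Longrightarrow> y \<in> carrier V \<Longrightarrow> z \<in> carrier V \<Longrightarrow>
      (x \<oplus> y) \<oplus> z = x \<oplus> (y \<oplus> z)"
    and comm: "\<And>x y. x \<in> carrier V \<Longrightarrow> y \<in> carrier V \<Longrightarrow> x \<oplus> y = y \<oplus> x"
    and zero_add: "\<And>x. x \<in> carrier V \<Longrightarrow> \<zero> \<oplus> x = x"
    and smult: "\<And>c x. x \<in> carrier V \<Longrightarrow> c \<odot> x \<in> carrier V"
    and smult_add: "\<And>c x y. x \<in> carrier V \<Longrightarrow> y \<in> carrier V \<Longrightarrow> c \<odot> (x \<oplus> y) = c \<odot> x \<oplus> c \<odot> y"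
    and add_smult: "\<And>c d x. x \<in> carrier V \<Longrightarrow> (c + d) \<odot> x = c \<odot> x \<oplus> d \<odot> x"
    and mult_smult: "\<And>c d x. x \<in> carrier V \<Longrightarrow> (c * d) \<odot> x = c \<odot> (d \<odot> x)"
    and one_smult: "\<And>x. x \<in> carrier V \<Longrightarrow> 1 \<odot> x = x"
    and zero_smult: "\<And>x. x \<in> carrier V \<Longrightarrow> 0 \<odot> x = \<zero>"
    and act: "\<And>g x. g \<in> carrier G \<Longrightarrow> x \<in> carrier V \<Longrightarrow> act V g x \<in> carrier V"
    and act_add: "\<And>g x y. g \<in> carrier G \<Longrightarrow> x \<in> carrier V \<Longrightarrow> y \<in> carrier V \<Longrightarrow>
      act V g (x \<oplus> y) = act V g x \<oplus> act V g y"
    and act_smult: "\<And>g c x. g \<in> carrier G \<Longrightarrow> x \<in> carrier V \<Longrightarrow> act V g (c \<odot> x) = c \<odot> act V g x"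
    and act_one: "\<And>x. x \<in> carrier V \<Longrightarrow> act V \<one>\<^bsub>G\<^esub> x = x"
    and act_mult: "\<And>g h x. g \<in> carrier G \<Longrightarrow> h \<in> carrier G \<Longrightarrow> x \<in> carrier V \<Longrightarrow>
      act V (g \<otimes>\<^bsub>G\<^esub> h) x = act V g (act V h x)"
  shows "representation G V"
proof -
  have "abelian_group V"
  proof (rule abelian_groupI)
    fix x assume x: "x \<in> carrier V"
    have "(- 1) \<odot> x \<oplus> 1 \<odot> x = 0 \<odot> x" using add_smult[of x "-1" 1] x by simp
    then show "\<exists>y\<in>carrier V. y \<oplus> x = \<zero>"
      using x smult[of x "-1"] by (auto simp: one_smult zero_smult)
  qed (use assms in auto)
  moreover have "cring (scalars :: 'c ring)" by (rule cring_from_type_algebra)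
  ultimately have "Module.module scalars V"
    by (intro moduleI) (use assms in auto)
  then show ?thesis
    unfolding representation_def lin_maps_def hom_def using assms by auto
qed

lemma rep_hom_closed: "\<phi> \<in> rep_hom G V W \<Longrightarrow> v \<in> carrier V \<Longrightarrow> \<phi> v \<in> carrier W"
  by (auto simp: rep_hom_def lin_maps_def hom_def)

lemma rep_hom_add: "\<phi> \<in> rep_hom G V W \<Longrightarrow> v \<in> carrier V \<Longrightarrow> w \<in> carrier V \<Longrightarrow>
    \<phi> (v \<oplus>\<^bsub>V\<^esub> w) = \<phi> v \<oplus>\<^bsub>W\<^esub> \<phi> w"
  by (auto simp: rep_hom_def lin_maps_def hom_def)

lemma rep_hom_smult: "\<phi> \<in> rep_hom G V W \<Longrightarrow> v \<in> carrier V \<Longrightarrow>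
    \<phi> (c \<odot>\<^bsub>V\<^esub> v) = c \<odot>\<^bsub>W\<^esub> \<phi> v"
  by (auto simp: rep_hom_def lin_maps_def hom_def)

lemma rep_hom_act: "\<phi> \<in> rep_hom G V W \<Longrightarrow> v \<in> carrier V \<Longrightarrow> g \<in> carrier G \<Longrightarrow>
    \<phi> (act V g v) = act W g (\<phi> v)"
  by (auto simp: rep_hom_def)

lemma rep_homI:
  assumes "\<And>v. v \<in> carrier V \<Longrightarrow> \<phi> v \<in> carrier W"
    "\<And>v w. v \<in> carrier V \<Longrightarrow> w \<in> carrier V \<Longrightarrow> \<phi> (v \<oplus>\<^bsub>V\<^esub> w) = \<phi> v \<oplus>\<^bsub>W\<^esub> \<phi> w"
    "\<And>c v. v \<in> carrier V \<Longrightarrow> \<phi> (c \<odot>\<^bsub>V\<^esub> v) = c \<odot>\<^bsub>W\<^esub> \<phi> v"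
    "\<And>g v. g \<in> carrier G \<Longrightarrow> v \<in> carrier V \<Longrightarrow> \<phi> (act V g v) = act W g (\<phi> v)"
  shows "\<phi> \<in> rep_hom G V W"
  using assms by (auto simp: rep_hom_def lin_maps_def hom_def)

lemma rep_hom_zero:
  assumes "representation G V" "representation G W" "\<phi> \<in> rep_hom G V W"
  shows "\<phi> \<zero>\<^bsub>V\<^esub> = \<zero>\<^bsub>W\<^esub>"
proof -
  interpret V: group_rep G V by (rule group_rep_of) fact
  interpret W: group_rep G W by (rule group_rep_of) fact
  show ?thesis
    using rep_hom_smult[OF assms(3), of "\<zero>\<^bsub>V\<^esub>" 0] rep_hom_closed[OF assms(3), of "\<zero>\<^bsub>V\<^esub>"] by simp
qed

lemma rep_hom_finsum:
  assumes "representation G V" "representation G W" "\<phi> \<in> rep_hom G V W"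
    and "finite A" "f \<in> A \<rightarrow> carrier V"
  shows "\<phi> (finsum V f A) = finsum W (\<lambda>a. \<phi> (f a)) A"
proof -
  interpret V: group_rep G V by (rule group_rep_of) fact
  interpret W: group_rep G W by (rule group_rep_of) fact
  show ?thesis using assms(4,5)
  proof (induction A)
    case empty
    then show ?case using rep_hom_zero[OF assms(1-3)] by simp
  next
    case (insert a A)
    then show ?case using rep_hom_closed[OF assms(3)]
      by (simp add: Pi_iff rep_hom_add[OF assms(3)] V.finsum_insert W.finsum_insert)
  qed
qed

lemma subrepI:
  assumes "representation G V" "W \<subseteq> carrier V" "\<zero>\<^bsub>V\<^esub> \<in> W"
    and "\<And>x y. x \<in> W \<Longrightarrow> y \<in> W \<Longrightarrow> x \<oplus>\<^bsub>V\<^esub> y \<in> W"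
    and "\<And>c x. x \<in> W \<Longrightarrow> c \<odot>\<^bsub>V\<^esub> x \<in> W"
    and "\<And>g x. g \<in> carrier G \<Longrightarrow> x \<in> W \<Longrightarrow> act V g x \<in> W"
  shows "subrep G W V"
proof -
  interpret V: group_rep G V by (rule group_rep_of) fact
  have "submodule W scalars V"
    by (rule V.submoduleI) (use assms V.smult_minus_one in \<open>auto simp: subset_iff simp flip: V.smult_minus_one\<close>)
  then show ?thesis using assms by (auto simp: subrep_def)
qed

lemma subrepD:
  assumes "representation G V" "subrep G W V"
  shows "W \<subseteq> carrier V" "\<zero>\<^bsub>V\<^esub> \<in> W"
    "\<And>x y. x \<in> W \<Longrightarrow> y \<in> W \<Longrightarrow> x \<oplus>\<^bsub>V\<^esub> y \<in> W"
    "\<And>x. x \<in> W \<Longrightarrow> \<ominus>\<^bsub>V\<^esub> x \<in> W"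
    "\<And>c x. x \<in> W \<Longrightarrow> c \<odot>\<^bsub>V\<^esub> x \<in> W"
    "\<And>g x. g \<in> carrier G \<Longrightarrow> x \<in> W \<Longrightarrow> act V g x \<in> W"
proof -
  interpret V: group_rep G V by (rule group_rep_of) fact
  have s: "submodule W scalars V" using assms by (simp add: subrep_def)
  note * = V.submoduleE[OF s]
  show "W \<subseteq> carrier V" and "\<And>x y. x \<in> W \<Longrightarrow> y \<in> W \<Longrightarrow> x \<oplus>\<^bsub>V\<^esub> y \<in> W"
    and "\<And>x. x \<in> W \<Longrightarrow> \<ominus>\<^bsub>V\<^esub> x \<in> W" and "\<And>c x. x \<in> W \<Longrightarrow> c \<odot>\<^bsub>V\<^esub> x \<in> W"
    using * by auto
  show "\<zero>\<^bsub>V\<^esub> \<in> W"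
    using *(1,2,3,5) by (metis V.r_neg ex_in_conv subsetD)
  show "\<And>g x. g \<in> carrier G \<Longrightarrow> x \<in> W \<Longrightarrow> act V g x \<in> W"
    using assms by (simp add: subrep_def)
qed

lemma representation_subrep:
  assumes "representation G V" "subrep G W V"
  shows "representation G (V\<lparr>carrier := W\<rparr>)"
proof -
  interpret V: group_rep G V by (rule group_rep_of) fact
  note * = subrepD[OF assms]
  have c: "x \<in> W \<Longrightarrow> x \<in> carrier V" for x using *(1) by blast
  show ?thesis
    by (rule representationI) (use V.group * c in
        \<open>auto simp: V.add.m_assoc intro: V.a_comm simp:  V.smult_add_vec V.smult_add_scalar V.smult_assoc V.act_add V.act_smult V.act_mult\<close>)
qed

lemma irreducible_subrep_eq:
  assumes "irreducible_rep G V" "subrep G W V" "v \<in> W" "v \<noteq> \<zero>\<^bsub>V\<^esub>"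
  shows "W = carrier V"
  using assms by (auto simp: irreducible_rep_def)

section \<open>Quotients by a subrepresentation\<close>

context
  fixes G :: "'g monoid" and V :: "('c::field, 'v, 'g) rep" and N :: "'v set"
  assumes V: "representation G V" and N: "subrep G N V"
begin

interpretation V: group_rep G V by (rule group_rep_of) (rule V)

lemma abelian_subgroup_subrep: "abelian_subgroup N V"
  using N by (intro abelian_subgroupI3 additive_subgroupI V.abelian_group_axioms)
    (simp add: subrep_def submodule_def)

interpretation N: abelian_subgroup N V by (rule abelian_subgroup_subrep)

lemmas N_closed = subrepD[OF V N]

lemma coset_eq_iff:
  assumes "x \<in> carrier V" "y \<in> carrier V"
  shows "N +>\<^bsub>V\<^esub> x = N +>\<^bsub>V\<^esub> y \<longleftrightarrow> x \<ominus>\<^bsub>V\<^esub> y \<in> N"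
proof
  assume "N +>\<^bsub>V\<^esub> x = N +>\<^bsub>V\<^esub> y"
  then have "x \<in> N +>\<^bsub>V\<^esub> y" using N.a_rcos_self[OF assms(1)] by simp
  then show "x \<ominus>\<^bsub>V\<^esub> y \<in> N" using N.a_rcos_module_imp[of y x] assms by (simp add: a_minus_def)
next
  assume "x \<ominus>\<^bsub>V\<^esub> y \<in> N"
  then have "x \<in> N +>\<^bsub>V\<^esub> y" using N.a_rcos_module_rev[of y x] assms by (simp add: a_minus_def)
  then show "N +>\<^bsub>V\<^esub> x = N +>\<^bsub>V\<^esub> y" using N.a_repr_independence' assms by metis
qed

text \<open>The unions in \<open>quotient_rep\<close> run over all representatives of a coset. They
  collapse to one coset because \<open>T\<close> is additive and preserves \<open>N\<close>; this
  applies to scalars as well as to group elements.\<close>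

lemma coset_map_eq:
  assumes T: "\<And>y. y \<in> carrier V \<Longrightarrow> T y \<in> carrier V"
    "\<And>y z. y \<in> carrier V \<Longrightarrow> z \<in> carrier V \<Longrightarrow> T (y \<oplus>\<^bsub>V\<^esub> z) = T y \<oplus>\<^bsub>V\<^esub> T z"
    "\<And>y. y \<in> N \<Longrightarrow> T y \<in> N"
    and x: "x \<in> carrier V"
  shows "(\<Union>y\<in>N +>\<^bsub>V\<^esub> x. N +>\<^bsub>V\<^esub> T y) = N +>\<^bsub>V\<^esub> T x"
proof -
  have "N +>\<^bsub>V\<^esub> T y = N +>\<^bsub>V\<^esub> T x" if "y \<in> N +>\<^bsub>V\<^esub> x" for y
  proof -
    from that obtain n where n: "n \<in> N" "y = n \<oplus>\<^bsub>V\<^esub> x" by (auto simp: a_r_coset_def')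
    have nc: "n \<in> carrier V" using n N_closed(1) by blast
    have "T y \<ominus>\<^bsub>V\<^esub> T x = T n" using n nc x T by (simp add: a_minus_def V.a_assoc V.r_neg)
    then show ?thesis using n T x nc by (subst coset_eq_iff) auto
  qed
  moreover have "x \<in> N +>\<^bsub>V\<^esub> x" by (rule N.a_rcos_self) fact
  ultimately show ?thesis by blast
qed

lemma quotient_rep_canonical:
  shows "representation G (quotient_rep V N)"
    and "(\<lambda>x. N +>\<^bsub>V\<^esub> x) \<in> rep_hom G V (quotient_rep V N)"
    and "(\<lambda>x. N +>\<^bsub>V\<^esub> x) ` carrier V = carrier (quotient_rep V N)"
    and "x \<in> carrier V \<Longrightarrow> N +>\<^bsub>V\<^esub> x = \<zero>\<^bsub>quotient_rep V N\<^esub> \<longleftrightarrow> x \<in> N"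
proof -
  let ?Q = "quotient_rep V N" and ?q = "\<lambda>x. N +>\<^bsub>V\<^esub> x"
  have car: "carrier ?Q = ?q ` carrier V"
    by (auto simp: quotient_rep_def A_RCOSETS_def')
  have add: "?q x \<oplus>\<^bsub>?Q\<^esub> ?q y = ?q (x \<oplus>\<^bsub>V\<^esub> y)" if "x \<in> carrier V" "y \<in> carrier V" for x y
    using N.a_rcos_sum that by (simp add: quotient_rep_def)
  have smult: "c \<odot>\<^bsub>?Q\<^esub> ?q x = ?q (c \<odot>\<^bsub>V\<^esub> x)" if "x \<in> carrier V" for x c
    using that N_closed by (simp add: quotient_rep_def coset_map_eq V.smult_add_vec)
  have act: "act ?Q g (?q x) = ?q (act V g x)" if "x \<in> carrier V" "g \<in> carrier G" for x g
    using that N_closed by (simp add: quotient_rep_def coset_map_eq V.act_add)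
  have zero: "\<zero>\<^bsub>?Q\<^esub> = ?q \<zero>\<^bsub>V\<^esub>"
    using N_closed(1,2) by (simp add: quotient_rep_def N.a_subset)
  show "?q ` carrier V = carrier ?Q" by (simp add: car)
  show "representation G ?Q"
    by (rule representationI)
      (auto simp: car add smult act zero V.group V.smult_add_vec V.smult_add_scalar V.smult_assoc
        V.act_add V.act_smult V.act_mult V.a_ac V.G_closed)
  show "?q \<in> rep_hom G V ?Q"
    by (rule rep_homI) (auto simp: car add smult act)
  show "?q x = \<zero>\<^bsub>?Q\<^esub> \<longleftrightarrow> x \<in> N" if "x \<in> carrier V"
    using that V.smult_minus_one[of "\<zero>\<^bsub>V\<^esub>"] by (simp add: zero coset_eq_iff a_minus_def)
qed

end

lemma rep_hom_compose:
  "\<phi> \<in> rep_hom G U V \<Longrightarrow> \<psi> \<in> rep_hom G V W \<Longrightarrow> (\<lambda>x. \<psi> (\<phi> x)) \<in> rep_hom G U W"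
  by (auto simp: rep_hom_def lin_maps_def hom_def Pi_iff)

lemma rep_iso_inverse:
  assumes V: "representation G V" and "\<phi> \<in> rep_hom G V W" "bij_betw \<phi> (carrier V) (carrier W)"
  shows "inv_into (carrier V) \<phi> \<in> rep_hom G W V"
proof -
  interpret V: group_rep G V by (rule group_rep_of) fact
  let ?i = "inv_into (carrier V) \<phi>"
  have i: "?i w \<in> carrier V" "\<phi> (?i w) = w" if "w \<in> carrier W" for w
    using that assms(3) by (auto simp: bij_betw_def inv_into_into f_inv_into_f)
  have e: "?i (\<phi> v) = v" if "v \<in> carrier V" for v
    using that assms(3) by (auto simp: bij_betw_def inv_into_f_f)
  show ?thesis
  proof (rule rep_homI)
    fix v w assume "v \<in> carrier W" "w \<in> carrier W"
    then show "?i (v \<oplus>\<^bsub>W\<^esub> w) = ?i v \<oplus>\<^bsub>V\<^esub> ?i w"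
      using rep_hom_add[OF assms(2), of "?i v" "?i w"] i e[of "?i v \<oplus>\<^bsub>V\<^esub> ?i w"] by simp
  next
    fix c v assume "v \<in> carrier W"
    then show "?i (c \<odot>\<^bsub>W\<^esub> v) = c \<odot>\<^bsub>V\<^esub> ?i v"
      using rep_hom_smult[OF assms(2), of "?i v" c] i e[of "c \<odot>\<^bsub>V\<^esub> ?i v"] by simp
  next
    fix g v assume "v \<in> carrier W" "g \<in> carrier G"
    then show "?i (act W g v) = act V g (?i v)"
      using rep_hom_act[OF assms(2), of "?i v" g] i e[of "act V g (?i v)"] by simp
  qed (rule i)
qed

text \<open>The isomorphism in \<open>is_quotient\<close> starts at \<open>P\<close>. Its inverse
  after the coset map gives a surjection from \<open>V\<close> onto \<open>P\<close>, which is
  easier to work with than the quotient itself.\<close>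

lemma is_quotientE:
  assumes "representation G V" "representation G P" "is_quotient G P V"
  obtains \<phi> where "\<phi> \<in> rep_hom G V P" "\<phi> ` carrier V = carrier P"
proof -
  from assms(3) obtain N \<alpha> where N: "subrep G N V"
    and a: "\<alpha> \<in> rep_hom G P (quotient_rep V N)" "bij_betw \<alpha> (carrier P) (carrier (quotient_rep V N))"
    by (auto simp: is_quotient_def rep_iso_def)
  let ?i = "inv_into (carrier P) \<alpha>"
  note q = quotient_rep_canonical[OF assms(1) N]
  have "(\<lambda>x. ?i (N +>\<^bsub>V\<^esub> x)) \<in> rep_hom G V P"
    by (rule rep_hom_compose[OF q(2) rep_iso_inverse[OF assms(2) a]])
  moreover have "(\<lambda>x. ?i (N +>\<^bsub>V\<^esub> x)) ` carrier V = carrier P"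
    using a(2) by (simp flip: q(3) image_image) (simp add: q(3) bij_betw_def inv_into_image_cancel
        bij_betw_imp_surj_on[OF bij_betw_inv_into[OF a(2)]])
  ultimately show thesis by (rule that)
qed

section \<open>Two by two matrices\<close>

lemma mat2_nth [simp]:
  "mat2 a b c d $ 1 $ 1 = a" "mat2 a b c d $ 1 $ 2 = b"
  "mat2 a b c d $ 2 $ 1 = c" "mat2 a b c d $ 2 $ 2 = d"
  by (auto simp: mat2_def)

lemma mat2_eq_iff: "A = B \<longleftrightarrow> A$1$1 = B$1$1 \<and> A$1$2 = B$1$2 \<and> A$2$1 = B$2$1 \<and> A$2$2 = B$2$2"
  for A B :: "'a^2^2"
  by (auto simp: vec_eq_iff forall_2)

lemma mat2_eta: "A = mat2 (A$1$1) (A$1$2) (A$2$1) (A$2$2)"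
  by (simp add: mat2_eq_iff)

lemma mat2_inject [simp]: "mat2 a b c d = mat2 a' b' c' d' \<longleftrightarrow> a = a' \<and> b = b' \<and> c = c' \<and> d = d'"
  by (auto simp: mat2_eq_iff)

lemma mat2_mult: "mat2 a b c d ** mat2 a' b' c' d' =
    mat2 (a * a' + b * c') (a * b' + b * d') (c * a' + d * c') (c * b' + d * (d' :: 'a::semiring_1))"
  by (simp add: mat2_eq_iff matrix_matrix_mult_def sum_2)

lemma mat_as_mat2: "mat z = mat2 z 0 0 (z :: 'a::zero)"
  by (simp add: mat2_eq_iff mat_def)

lemma det_mat2 [simp]: "det (mat2 a b c d) = a * d - b * (c :: 'a::comm_ring_1)"
  by (simp add: det_2)

lemma mat2_cases: obtains a b c d where "A = mat2 a b c (d :: 'a::zero)"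
  using mat2_eta by blast

lemma GL2_simps [simp]: "monoid.mult GL2 = (**)" "one GL2 = mat 1"
  by (auto simp: GL2_def)

lemma in_GL2_iff: "A \<in> carrier GL2 \<longleftrightarrow> det A \<noteq> 0" for A :: "'a::field^2^2"
  by (simp add: GL2_def invertible_det_nz)

lemma mat2_in_GL2 [simp]: "mat2 a b c d \<in> carrier GL2 \<longleftrightarrow> a * d - b * c \<noteq> (0 :: 'a::field)"
  by (simp add: in_GL2_iff)

lemma mat_in_GL2 [simp]: "mat z \<in> carrier GL2 \<longleftrightarrow> z \<noteq> (0 :: 'a::field)"
  by (simp add: mat_as_mat2)

lemma GL2_mult_closed [simp]: "A \<in> carrier GL2 \<Longrightarrow> B \<in> carrier GL2 \<Longrightarrow> A ** B \<in> carrier GL2"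
  by (simp add: in_GL2_iff det_mul)

lemma matrix_inv_GL2:
  assumes "A \<in> carrier (GL2 :: ('a::field^2^2) monoid)"
  shows "A ** matrix_inv A = mat 1" "matrix_inv A ** A = mat 1" "matrix_inv A \<in> carrier GL2"
proof -
  have "invertible A" using assms by (simp add: GL2_def)
  then show *: "A ** matrix_inv A = mat 1" "matrix_inv A ** A = mat 1"
    using someI_ex[OF \<open>invertible A\<close>[unfolded invertible_def]] by (simp_all add: matrix_inv_def)
  then show "matrix_inv A \<in> carrier GL2" by (auto simp: GL2_def invertible_def)
qed

lemma matrix_inv_cancel:
  assumes "A \<in> carrier (GL2 :: ('a::field^2^2) monoid)"
  shows "A ** (matrix_inv A ** B) = B" "matrix_inv A ** (A ** B) = B"
    "(B ** A) ** matrix_inv A = B" "(B ** matrix_inv A) ** A = B"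
  using matrix_inv_GL2[OF assms]
  by (simp_all add: matrix_mul_assoc) (simp_all add: matrix_mul_assoc[symmetric])

lemma matrix_inv_eqI:
  assumes "A ** B = mat (1 :: 'a::field)" shows "matrix_inv A = (B :: 'a^2^2)"
proof -
  have A: "A \<in> carrier GL2"
    using assms by (auto simp: GL2_def invertible_def matrix_left_right_inverse)
  have "matrix_inv A = matrix_inv A ** (A ** B)" by (simp add: assms)
  then show ?thesis using matrix_inv_cancel[OF A] by simp
qed

lemma group_GL2: "group (GL2 :: ('a::field^2^2) monoid)"
  by (rule groupI) (auto simp: matrix_mul_assoc intro: matrix_inv_GL2)

lemma inv_GL2: "A \<in> carrier GL2 \<Longrightarrow> inv\<^bsub>GL2\<^esub> A = matrix_inv (A :: 'a::field^2^2)"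
  using group.inv_equality[OF group_GL2, of "matrix_inv A" A] matrix_inv_GL2[of A] by simp

lemma matrix_inv_mult:
  "A \<in> carrier GL2 \<Longrightarrow> B \<in> carrier GL2 \<Longrightarrow>
    matrix_inv (A ** B) = matrix_inv B ** matrix_inv (A :: 'a::field^2^2)"
  using group.inv_mult_group[OF group_GL2, of A B] by (simp add: inv_GL2)

lemma matrix_inv_inv: "A \<in> carrier GL2 \<Longrightarrow> matrix_inv (matrix_inv A) = (A :: 'a::field^2^2)"
  using matrix_inv_GL2[of A] by (intro matrix_inv_eqI)

lemma matrix_inv_mat: "z \<noteq> 0 \<Longrightarrow> matrix_inv (mat z) = (mat (inverse z) :: 'a::field^2^2)"
  by (intro matrix_inv_eqI) (simp add: mat_as_mat2 mat2_mult)

lemma matrix_inv_mat2: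
  assumes "a * d - b * c \<noteq> (0 :: 'a::field)"
  shows "matrix_inv (mat2 a b c d) =
    mat2 (d / (a * d - b * c)) (- b / (a * d - b * c)) (- c / (a * d - b * c)) (a / (a * d - b * c))"
proof (rule matrix_inv_eqI)
  let ?e = "a * d - b * c"
  have "a * (d / ?e) + b * (- c / ?e) = 1" "c * (- b / ?e) + d * (a / ?e) = 1"
    using assms by (simp_all add: diff_divide_distrib[symmetric] mult.commute)
  moreover have "a * (- b / ?e) + b * (a / ?e) = 0" "c * (d / ?e) + d * (- c / ?e) = 0"
    by simp_all
  ultimately show "mat2 a b c d ** mat2 (d / ?e) (- b / ?e) (- c / ?e) (a / ?e) = mat 1"
    by (simp add: mat2_mult mat_as_mat2)
qed

lemma mat_commute: "mat z ** A = A ** (mat z :: 'a::comm_semiring_1^2^2)"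
  for A :: "'a::comm_semiring_1^2^2"
  by (cases A rule: mat2_cases) (simp add: mat_as_mat2 mat2_mult mult.commute)

lemma mat_mult_mat: "mat x ** mat y = (mat (x * y) :: 'a::comm_semiring_1^2^2)"
  by (simp add: mat_as_mat2 mat2_mult)

lemma upper_triangular_iff: "A \<in> upper_triangular \<longleftrightarrow> A$2$1 = 0 \<and> A$1$1 \<noteq> 0 \<and> A$2$2 \<noteq> 0"
  for A :: "'a::field^2^2"
  by (auto simp: upper_triangular_def in_GL2_iff det_2)

lemma diagonal_iff: "A \<in> diagonal \<longleftrightarrow> A$1$2 = 0 \<and> A$2$1 = 0 \<and> A$1$1 \<noteq> 0 \<and> A$2$2 \<noteq> 0"
  for A :: "'a::field^2^2"
  by (auto simp: diagonal_def in_GL2_iff det_2)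

lemma upper_unipotent_iff: "A \<in> upper_unipotent \<longleftrightarrow> (\<exists>b. A = mat2 1 b 0 (1 :: 'a::field))"
  by (auto simp: upper_unipotent_def in_GL2_iff det_2 mat2_eq_iff)

lemma weyl_s_in_GL2 [simp]: "weyl_s \<in> carrier (GL2 :: ('a::field^2^2) monoid)"
  by (simp add: weyl_s_def)

lemma matrix_inv_weyl_s: "matrix_inv weyl_s = (weyl_s :: 'a::field^2^2)"
  by (rule matrix_inv_eqI) (simp add: weyl_s_def mat2_mult mat_as_mat2)

lemma conj_s_mat2: "conj_s chi (mat2 a 0 0 d) = chi (mat2 d 0 0 (a :: 'a::field))"
  by (simp add: conj_s_def matrix_inv_weyl_s) (simp add: weyl_s_def mat2_mult)

section \<open>Local fields\<close>

context local_field
begin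

lemma val_one [simp]: "val 1 = 0"
  using val_mult[of 1 1] by simp

lemma val_minus [simp]: "val (- x) = val x"
proof (cases "x = 0")
  case False
  have "val (-1) = 0" using val_mult[of "-1" "-1"] by simp
  then show ?thesis using val_mult[of "-1" x] False by simp
qed simp

lemma val_inverse: "x \<noteq> 0 \<Longrightarrow> val (inverse x) = - val x"
  using val_mult[of x "inverse x"] by simp

lemma val_divide: "x \<noteq> 0 \<Longrightarrow> y \<noteq> 0 \<Longrightarrow> val (x / y) = val x - val y"
  using val_mult[of x "inverse y"] val_inverse[of y] by (simp add: field_simps)

lemma val_power: "x \<noteq> 0 \<Longrightarrow> val (x ^ n) = int n * val x"
  by (induction n) (auto simp: val_mult algebra_simps)

lemma unif_powi_nonzero [simp]: "unif powi n \<noteq> 0"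
  using uniformiser by simp

lemma val_unif_powi [simp]: "val (unif powi n) = n"
  using val_power[OF uniformiser(1)] uniformiser
  by (auto simp: power_int_def val_inverse power_inverse)

text \<open>The fractional ideals, negative exponents included. Zero is put in by hand because
  \<open>val 0\<close> carries no information.\<close>

definition ideal_pow :: "int \<Rightarrow> 'f set" where
  "ideal_pow n = {x. x = 0 \<or> n \<le> val x}"

lemma integers_eq: "integers = ideal_pow 0"
  by (simp add: integers_def ideal_pow_def)

lemma max_ideal_eq: "max_ideal = ideal_pow 1"
  by (simp add: max_ideal_def ideal_pow_def)

lemma ideal_pow_zero [simp]: "0 \<in> ideal_pow n"
  by (simp add: ideal_pow_def)

lemma ideal_pow_mono: "m \<le> n \<Longrightarrow> x \<in> ideal_pow n \<Longrightarrow> x \<in> ideal_pow m"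
  by (auto simp: ideal_pow_def)

lemma ideal_pow_add: "x \<in> ideal_pow n \<Longrightarrow> y \<in> ideal_pow n \<Longrightarrow> x + y \<in> ideal_pow n"
  using val_add[of x y] by (force simp: ideal_pow_def)

lemma ideal_pow_uminus [simp]: "- x \<in> ideal_pow n \<longleftrightarrow> x \<in> ideal_pow n"
  by (simp add: ideal_pow_def)

lemma ideal_pow_diff: "x \<in> ideal_pow n \<Longrightarrow> y \<in> ideal_pow n \<Longrightarrow> x - y \<in> ideal_pow n"
  using ideal_pow_add[of x n "- y"] by simp

lemma ideal_pow_mult: "x \<in> ideal_pow m \<Longrightarrow> y \<in> ideal_pow n \<Longrightarrow> x * y \<in> ideal_pow (m + n)"
  by (cases "x = 0 \<or> y = 0") (auto simp: ideal_pow_def val_mult)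

lemma ideal_pow_unif_powi: "unif powi k * x \<in> ideal_pow n \<longleftrightarrow> x \<in> ideal_pow (n - k)"
  by (cases "x = 0") (auto simp: ideal_pow_def val_mult simp del: power_int_eq_0_iff)

lemma ideal_pow_val: "x \<in> ideal_pow (val x)"
  by (simp add: ideal_pow_def)

lemma integers_closed [simp]:
  "0 \<in> integers" "1 \<in> integers" "x \<in> integers \<Longrightarrow> y \<in> integers \<Longrightarrow> x + y \<in> integers"
  "x \<in> integers \<Longrightarrow> y \<in> integers \<Longrightarrow> x - y \<in> integers" "- x \<in> integers \<longleftrightarrow> x \<in> integers"
  "x \<in> integers \<Longrightarrow> y \<in> integers \<Longrightarrow> x * y \<in> integers"
  using ideal_pow_add[of x 0 y] ideal_pow_diff[of x 0 y] ideal_pow_mult[of x 0 y 0]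
  by (auto simp: integers_eq) (simp add: ideal_pow_def)

lemma max_ideal_subset: "x \<in> max_ideal \<Longrightarrow> x \<in> integers"
  by (auto simp: max_ideal_def integers_def)

lemma max_ideal_mult:
  "x \<in> integers \<Longrightarrow> y \<in> max_ideal \<Longrightarrow> x * y \<in> max_ideal"
  "x \<in> max_ideal \<Longrightarrow> y \<in> integers \<Longrightarrow> x * y \<in> max_ideal"
  using ideal_pow_mult[of x 0 y 1] ideal_pow_mult[of x 1 y 0]
  by (simp_all add: integers_eq max_ideal_eq)

lemma max_ideal_closed [simp]:
  "0 \<in> max_ideal" "x \<in> max_ideal \<Longrightarrow> y \<in> max_ideal \<Longrightarrow> x + y \<in> max_ideal"
  "x \<in> max_ideal \<Longrightarrow> y \<in> max_ideal \<Longrightarrow> x - y \<in> max_ideal" "- x \<in> max_ideal \<longleftrightarrow> x \<in> max_ideal"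
  using ideal_pow_add[of x 1 y] ideal_pow_diff[of x 1 y] by (auto simp: max_ideal_eq)

lemma unif_mult_max_ideal: "unif * x \<in> max_ideal \<longleftrightarrow> x \<in> integers"
  using ideal_pow_unif_powi[of 1 x 1] by (simp add: max_ideal_eq integers_eq)

lemma unif_in_max_ideal [simp]: "unif \<in> max_ideal" "unif \<in> integers"
  using uniformiser by (auto simp: max_ideal_def integers_def)

lemma unif_nonzero [simp]: "unif \<noteq> 0"
  by (rule uniformiser)

lemma max_ideal_divide: "x \<in> max_ideal \<longleftrightarrow> x / unif \<in> integers"
  using unif_mult_max_ideal[of "x / unif"] by simp

lemma unit_iff: "x \<in> integers \<Longrightarrow> x \<notin> max_ideal \<longleftrightarrow> x \<noteq> 0 \<and> inverse x \<in> integers"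
  by (auto simp: integers_def max_ideal_def val_inverse)

lemma unit_iff_val: "x \<in> integers \<and> x \<notin> max_ideal \<longleftrightarrow> x \<noteq> 0 \<and> val x = 0"
  by (auto simp: integers_def max_ideal_def)

lemma red_0 [simp]: "red 0 = 0"
  using red_eq_0[of 0] by simp

lemma red_plus: "x \<in> integers \<Longrightarrow> y \<in> integers \<Longrightarrow> red (x + y) = red x + red y"
  using red_add by (simp add: integers_def)

lemma red_times: "x \<in> integers \<Longrightarrow> y \<in> integers \<Longrightarrow> red (x * y) = red x * red y"
  using red_mult by (simp add: integers_def)

lemma red_uminus: "x \<in> integers \<Longrightarrow> red (- x) = - red x"
  using red_plus[of x "- x"] by (simp add: eq_neg_iff_add_eq_0 add.commute)

lemma red_minus: "x \<in> integers \<Longrightarrow> y \<in> integers \<Longrightarrow> red (x - y) = red x - red y"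
  using red_plus[of x "- y"] by (simp add: red_uminus)

lemma red_zero_iff: "x \<in> integers \<Longrightarrow> red x = 0 \<longleftrightarrow> x \<in> max_ideal"
  using red_eq_0 by (simp add: integers_def max_ideal_def)

lemma red_eq_iff: "x \<in> integers \<Longrightarrow> y \<in> integers \<Longrightarrow> red x = red y \<longleftrightarrow> x - y \<in> max_ideal"
  using red_zero_iff[of "x - y"] by (simp add: red_minus)

lemma red_max_ideal [simp]: "x \<in> max_ideal \<Longrightarrow> red x = 0"
  using red_zero_iff max_ideal_subset by blast

declare red_one [simp]

lemma red_of_nat: "of_nat n \<in> integers \<and> red (of_nat n) = of_nat n"
  by (induction n) (auto simp: red_plus)

text \<open>An arbitrary set-theoretic section of the reduction map: it is not claimed to be
  additive or multiplicative, and \<open>lift 0\<close> is only known to lie in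
  \<open>max_ideal\<close>.\<close>

definition lift :: "'k \<Rightarrow> 'f" where
  "lift a = (SOME x. x \<in> integers \<and> red x = a)"

lemma lift [simp]: "lift a \<in> integers" "red (lift a) = a"
proof -
  have "a \<in> red ` {x. x = 0 \<or> 0 \<le> val x}" by (simp add: red_surj)
  then have "\<exists>x. x \<in> integers \<and> red x = a" by (auto simp: integers_def)
  from someI_ex[OF this] show "lift a \<in> integers" "red (lift a) = a" by (auto simp: lift_def)
qed

lemma lift_red: "x \<in> integers \<Longrightarrow> x - lift (red x) \<in> max_ideal"
  by (simp flip: red_eq_iff)

lemma lift_unit: "a \<noteq> 0 \<Longrightarrow> lift a \<noteq> 0 \<and> val (lift a) = 0 \<and> lift a \<notin> max_ideal"
  using unit_iff_val[of "lift a"] red_zero_iff[of "lift a"] by auto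

subsection \<open>Compact subgroups\<close>

text \<open>If a matrix and its inverse are integral, then so are both determinants, which are
  inverse to each other, and the determinant is a unit. The converse is the adjugate formula for the
  inverse.\<close>

lemma GK_iff:
  "A \<in> GK \<longleftrightarrow> (\<forall>i j. A$i$j \<in> integers) \<and> det A \<noteq> 0 \<and> val (det A) = 0"
proof (cases A rule: mat2_cases)
  case (1 a b c d)
  let ?e = "a * d - b * c"
  have inv: "matrix_inv A = mat2 (d / ?e) (- b / ?e) (- c / ?e) (a / ?e)" if "?e \<noteq> 0"
    using matrix_inv_mat2[OF that] 1 by simp
  show ?thesis
  proof
    assume A: "A \<in> GK"
    then have e: "?e \<noteq> 0" and int: "a \<in> integers" "b \<in> integers" "c \<in> integers" "d \<in> integers"
      and int': "d / ?e \<in> integers" "- b / ?e \<in> integers" "- c / ?e \<in> integers" "a / ?e \<in> integers"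
      using 1 inv by (auto simp: GK_def forall_2)
    have "(a / ?e) * (d / ?e) - (- b / ?e) * (- c / ?e) = (a * d - b * c) / (?e * ?e)"
      by (simp add: diff_divide_distrib)
    also have "\<dots> = inverse ?e"
      using e by (metis nonzero_divide_mult_cancel_left inverse_eq_divide)
    finally have "(a / ?e) * (d / ?e) - (- b / ?e) * (- c / ?e) = inverse ?e" .
    then have "inverse ?e \<in> integers" using int' by (metis integers_closed(4,6))
    moreover have "?e \<in> integers" using int by simp
    ultimately have "val ?e = 0" using e by (auto simp: integers_def val_inverse)
    then show "(\<forall>i j. A$i$j \<in> integers) \<and> det A \<noteq> 0 \<and> val (det A) = 0"
      using int e 1 by (simp add: forall_2)
  next
    assume A: "(\<forall>i j. A$i$j \<in> integers) \<and> det A \<noteq> 0 \<and> val (det A) = 0"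
    then have e: "?e \<noteq> 0" "val ?e = 0"
      and int: "a \<in> integers" "b \<in> integers" "c \<in> integers" "d \<in> integers"
      using 1 by (auto simp: forall_2)
    have "inverse ?e \<in> integers" using e by (simp add: integers_def val_inverse)
    then have "x / ?e \<in> integers" if "x \<in> integers" for x
      using integers_closed(6)[OF that] by (simp add: divide_inverse)
    then show "A \<in> GK" using e int inv 1 by (simp add: GK_def forall_2)
  qed
qed

lemma mat2_in_GK: "mat2 a b c d \<in> GK \<longleftrightarrow> a \<in> integers \<and> b \<in> integers \<and> c \<in> integers \<and> d \<in> integers \<and>
    a * d - b * c \<noteq> 0 \<and> val (a * d - b * c) = 0"
  by (auto simp: GK_iff forall_2)

lemma GK_in_GL2: "A \<in> GK \<Longrightarrow> A \<in> carrier GL2"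
  by (simp add: GK_def)

lemma GK_entry: "A \<in> GK \<Longrightarrow> A$i$j \<in> integers"
  by (simp add: GK_def)

lemma GK_one [simp]: "mat 1 \<in> GK"
  by (simp add: mat_as_mat2 mat2_in_GK)

lemma GK_mult: "A \<in> GK \<Longrightarrow> B \<in> GK \<Longrightarrow> A ** B \<in> GK"
proof -
  assume A: "A \<in> GK" "B \<in> GK"
  then have "(A ** B)$i$j \<in> integers" for i j
    by (simp add: GK_iff matrix_matrix_mult_def sum_2)
  then show ?thesis using A by (simp add: GK_iff det_mul val_mult)
qed

lemma GK_inv: "A \<in> GK \<Longrightarrow> matrix_inv A \<in> GK"
  by (auto simp: GK_def matrix_inv_GL2 matrix_inv_inv)

lemma weyl_s_in_GK [simp]: "weyl_s \<in> GK"
  by (simp add: weyl_s_def mat2_in_GK)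

lemma red_mat_mat2 [simp]: "red_mat (mat2 a b c d) = mat2 (red a) (red b) (red c) (red d)"
  by (simp add: red_mat_def mat2_eq_iff)

lemma red_mat_nth [simp]: "red_mat A $ i $ j = red (A $ i $ j)"
  by (simp add: red_mat_def)

lemma red_mat_mult: "A \<in> GK \<Longrightarrow> B \<in> GK \<Longrightarrow> red_mat (A ** B) = red_mat A ** red_mat B"
  by (simp add: mat2_eq_iff matrix_matrix_mult_def sum_2 red_plus red_times GK_entry)

lemma red_mat_one [simp]: "red_mat (mat 1) = mat 1"
  by (simp add: mat_as_mat2)

lemma det_red_mat: "A \<in> GK \<Longrightarrow> det (red_mat A) = red (det A)"
  by (simp add: det_2 red_minus red_times GK_entry)

lemma det_GK: "A \<in> GK \<Longrightarrow> det A \<in> integers \<and> det A \<notin> max_ideal"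
  by (auto simp: GK_iff unit_iff_val)

lemma red_mat_in_GL2: "A \<in> GK \<Longrightarrow> red_mat A \<in> carrier GL2"
  using det_GK[of A] by (simp add: in_GL2_iff det_red_mat red_zero_iff)

lemma red_mat_weyl_s [simp]: "red_mat weyl_s = weyl_s"
  by (simp add: weyl_s_def)

lemma GK_lift:
  assumes "g \<in> carrier GL2"
  obtains A where "A \<in> GK" "red_mat A = g"
proof
  let ?A = "mat2 (lift (g$1$1)) (lift (g$1$2)) (lift (g$2$1)) (lift (g$2$2))"
  show r: "red_mat ?A = g" by (simp add: mat2_eq_iff)
  have "red (det ?A) = det g"
    by (simp add: det_2 red_minus red_times)
  then have "det ?A \<notin> max_ideal" using assms by (auto simp: in_GL2_iff)
  moreover have "det ?A \<in> integers" by simp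
  ultimately have "det ?A \<noteq> 0 \<and> val (det ?A) = 0" using unit_iff_val by blast
  then show "?A \<in> GK" by (simp add: mat2_in_GK)
qed

lemma Iw_iff: "A \<in> Iw \<longleftrightarrow> A \<in> GK \<and> A$2$1 \<in> max_ideal"
  by (auto simp: Iw_def upper_triangular_def red_mat_in_GL2 red_zero_iff GK_entry)

lemma Iw1_iff: "A \<in> Iw1 \<longleftrightarrow> A \<in> GK \<and> red_mat A \<in> upper_unipotent"
  by (simp add: Iw1_def)

lemma Iw_subset: "A \<in> Iw \<Longrightarrow> A \<in> GK"
  by (simp add: Iw_def)

lemma Iw1_subset: "A \<in> Iw1 \<Longrightarrow> A \<in> Iw"
  by (auto simp: Iw_def Iw1_def upper_unipotent_def upper_triangular_def)

subsection \<open>Congruence subgroups and the topology\<close>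

text \<open>For \<open>n \<ge> 1\<close> these are the principal congruence subgroups, a
  neighbourhood basis of the identity. They replace the topology in the smoothness arguments
  below.\<close>

definition congr_group :: "int \<Rightarrow> ('f^2^2) set" where
  "congr_group n = {A. \<forall>i j. (A - mat 1)$i$j \<in> ideal_pow n}"

lemma congr_group_subset_GK:
  assumes "A \<in> congr_group n" "1 \<le> n" shows "A \<in> GK" "red_mat A = mat 1"
proof -
  obtain a b c d where A: "A = mat2 a b c d" by (rule mat2_cases)
  have *: "a - 1 \<in> max_ideal" "b \<in> max_ideal" "c \<in> max_ideal" "d - 1 \<in> max_ideal"
    using assms ideal_pow_mono[OF assms(2)]
    by (auto simp: congr_group_def A forall_2 mat_as_mat2 max_ideal_eq)
  have int: "a \<in> integers" "b \<in> integers" "c \<in> integers" "d \<in> integers"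
    using *[THEN max_ideal_subset] integers_closed(3)[of "a - 1" 1] integers_closed(3)[of "d - 1" 1]
    by auto
  have r: "red a = 1" "red d = 1" "red b = 0" "red c = 0"
    using * int red_eq_iff[of a 1] red_eq_iff[of d 1] by auto
  then have "red (a * d - b * c) = 1" using int by (simp add: red_minus red_times)
  then have "a * d - b * c \<notin> max_ideal" by auto
  then show "A \<in> GK" using int unit_iff_val[of "a * d - b * c"] by (simp add: A mat2_in_GK)
  show "red_mat A = mat 1" using r by (simp add: A mat_as_mat2)
qed

lemma card_k_gt_1: "1 < real CARD('k)"
proof -
  have "card {0, 1 :: 'k} \<le> CARD('k)" by (rule card_mono) auto
  then show ?thesis by simp
qed

lemma dist_le_iff: "dist x y \<le> real CARD('k) powi (- n) \<longleftrightarrow> x - y \<in> ideal_pow n"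
proof -
  have "real CARD('k) powi a \<le> real CARD('k) powi b \<longleftrightarrow> a \<le> b" for a b
    using card_k_gt_1 power_int_increasing[of a b "real CARD('k)"]
      power_int_strict_increasing[of b a "real CARD('k)"] by force
  from this[of "- val (x - y)" "- n"] show ?thesis
    using card_k_gt_1 by (auto simp: dist_val ideal_pow_def)
qed

lemma ideal_pow_small:
  assumes "0 < (e :: real)"
  obtains n where "1 \<le> n" "real CARD('k) powi (- n) < e"
proof -
  have "inverse (real CARD('k)) < 1" using card_k_gt_1 by (simp add: inverse_less_1_iff)
  then obtain m where m: "inverse (real CARD('k)) ^ m < e"
    using real_arch_pow_inv[OF assms] by blast
  \<comment> \<open>Raising the exponent by one keeps the bound and makes the exponent positive;
    positivity is what places the congruence subgroup inside \<open>GK\<close>.\<close>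
  have "inverse (real CARD('k)) ^ Suc m \<le> inverse (real CARD('k)) ^ m"
    using card_k_gt_1 by (intro power_decreasing) (auto simp: inverse_le_1_iff)
  also have "inverse (real CARD('k)) ^ Suc m = real CARD('k) powi (- int (Suc m))"
    by (simp only: power_int_minus power_int_of_nat power_inverse)
  finally show thesis using m by (intro that[of "int (Suc m)"]) auto
qed

lemma openin_imp_congr_group:
  assumes "openin (top_of_set (carrier GL2)) S" "mat 1 \<in> S"
  obtains n where "1 \<le> n" "congr_group n \<subseteq> S"
proof -
  from assms obtain e where e: "e > 0" "ball (mat 1) e \<inter> carrier GL2 \<subseteq> S"
    by (auto simp: openin_contains_ball)
  \<comment> \<open>The distance of two matrices is bounded by the sum of the four distances of
    their entries.\<close>
  from e(1) have "0 < e / 4" by simp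
  then obtain n where n: "1 \<le> n" "real CARD('k) powi (- n) < e / 4" by (rule ideal_pow_small)
  have "A \<in> S" if A: "A \<in> congr_group n" for A
  proof -
    have d: "dist (mat 1 $ i $ j) (A $ i $ j) < e / 4" for i j
      using A n dist_le_iff[of "A $ i $ j" "mat 1 $ i $ j" n]
      by (auto simp: congr_group_def dist_commute intro: le_less_trans)
    have "dist (mat 1) A \<le> (\<Sum>i\<in>UNIV. dist (mat 1 $ i) (A $ i))"
      unfolding dist_vec_def by (rule L2_set_le_sum) simp
    also have "\<dots> \<le> (\<Sum>i\<in>UNIV. \<Sum>j\<in>UNIV. dist (mat 1 $ i $ j) (A $ i $ j))"
      by (rule sum_mono) (auto simp: dist_vec_def intro: L2_set_le_sum)
    also have "\<dots> < e"
      using d[of 1 1] d[of 1 2] d[of 2 1] d[of 2 2] by (simp add: sum_2)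
    finally show ?thesis using e(2) congr_group_subset_GK[OF A n(1)] GK_in_GL2 by auto
  qed
  then show thesis using n by (intro that) auto
qed

lemma matrix_ideal_pow_bound:
  fixes A :: "'f^2^2"
  obtains m where "\<And>i j. A$i$j \<in> ideal_pow m"
proof
  \<comment> \<open>A zero entry contributes the meaningless number \<open>val 0\<close>, which can
    only lower the bound.\<close>
  define m where "m = Min ((\<lambda>(i, j). val (A$i$j)) ` UNIV)"
  show "A$i$j \<in> ideal_pow m" for i j
    by (rule ideal_pow_mono[OF _ ideal_pow_val]) (auto simp: m_def intro!: Min_le image_eqI[of _ _ "(i, j)"])
qed

lemma matrix_mult_ideal_pow:
  fixes A B :: "'f^2^2"
  assumes "\<And>i j. A$i$j \<in> ideal_pow m" "\<And>i j. B$i$j \<in> ideal_pow n"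
  shows "(A ** B)$i$j \<in> ideal_pow (m + n)"
  using ideal_pow_mult[OF assms] by (auto simp: matrix_matrix_mult_def sum_2 intro!: ideal_pow_add)

text \<open>If the entries of the inverse of \<open>g\<close> lie in the ideal of exponent
  \<open>m\<close>, then a matrix congruent to \<open>g\<close> in exponent \<open>n - m\<close> is
  \<open>g\<close> times an element of \<open>congr_group n\<close>. This explains the radius of the
  ball.\<close>

lemma openin_if_congr_group:
  assumes "S \<subseteq> carrier GL2" "\<And>g k. g \<in> S \<Longrightarrow> k \<in> congr_group n \<Longrightarrow> g ** k \<in> S"
  shows "openin (top_of_set (carrier GL2)) S"
  unfolding openin_contains_ball
proof (intro conjI ballI)
  fix g assume g: "g \<in> S"
  then have gG: "g \<in> carrier GL2" using assms by blast
  obtain m where m: "\<And>i j. matrix_inv g$i$j \<in> ideal_pow m"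
    using matrix_ideal_pow_bound[of "matrix_inv g"] by blast
  let ?e = "real CARD('k) powi (- (n - m))"
  show "\<exists>e>0. ball g e \<inter> carrier GL2 \<subseteq> S"
  proof (intro exI conjI subsetI)
    show "?e > 0" using card_k_gt_1 by (simp add: zero_less_power_int)
    fix h assume h: "h \<in> ball g ?e \<inter> carrier GL2"
    have "dist (h$i$j) (g$i$j) \<le> ?e" for i j
      using h dist_vec_nth_le[of "h$i" j "g$i"] dist_vec_nth_le[of h i g] by (simp add: dist_commute)
    then have d: "(h - g)$i$j \<in> ideal_pow (n - m)" for i j by (simp only: dist_le_iff vector_minus_component)
    have "matrix_inv g ** h - mat 1 = matrix_inv g ** (h - g)"
      using matrix_inv_GL2[OF gG] by (simp add: mat2_eq_iff matrix_matrix_mult_def sum_2 algebra_simps)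
    moreover have "(matrix_inv g ** (h - g))$i$j \<in> ideal_pow n" for i j
      using ideal_pow_mult[OF m d] by (auto simp: matrix_matrix_mult_def sum_2 intro!: ideal_pow_add)
    ultimately have "matrix_inv g ** h \<in> congr_group n"
      by (simp add: congr_group_def del: vector_minus_component)
    then show "h \<in> S" using assms(2)[OF g] by (metis matrix_inv_cancel(1) gG)
  qed
qed (use assms in auto)

lemma congr_group_conj:
  assumes "g \<in> carrier GL2"
  obtains m where "1 \<le> m" "\<And>k. k \<in> congr_group m \<Longrightarrow> matrix_inv g ** k ** g \<in> congr_group n"
proof -
  obtain a where a: "\<And>i j. matrix_inv g$i$j \<in> ideal_pow a"
    using matrix_ideal_pow_bound[of "matrix_inv g"] by blast
  obtain b where b: "\<And>i j. g$i$j \<in> ideal_pow b"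
    using matrix_ideal_pow_bound[of g] by blast
  \<comment> \<open>Conjugation multiplies \<open>k - 1\<close> by the inverse of \<open>g\<close>
    on the left and by \<open>g\<close> on the right, which shifts exponents by
    \<open>a + b\<close>. The maximum with 1 keeps the new level inside \<open>GK\<close>.\<close>
  let ?m = "max 1 (n - a - b)"
  have "matrix_inv g ** k ** g \<in> congr_group n" if "k \<in> congr_group ?m" for k
  proof -
    have k: "(k - mat 1)$i$j \<in> ideal_pow ?m" for i j using that by (simp add: congr_group_def)
    have "matrix_inv g ** k ** g - mat 1 = matrix_inv g ** (k - mat 1) ** g"
    proof -
      have "matrix_inv g ** (k - mat 1) ** g = matrix_inv g ** k ** g - matrix_inv g ** mat 1 ** g"
        by (simp add: mat2_eq_iff matrix_matrix_mult_def sum_2 algebra_simps)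
      then show ?thesis by (simp add: matrix_inv_GL2[OF assms])
    qed
    moreover have "(matrix_inv g ** (k - mat 1) ** g)$i$j \<in> ideal_pow (a + ?m + b)" for i j
      by (intro matrix_mult_ideal_pow a b k)
    ultimately show ?thesis unfolding congr_group_def
      using ideal_pow_mono[of n "a + ?m + b"] by (simp del: vector_minus_component)
  qed
  then show thesis by (intro that[of ?m]) auto
qed

end

section \<open>Fixed vectors of p-groups\<close>

text \<open>The difference operator is X - 1 with X the shift of sequences, so its powers are
  expanded by the coefficients of the polynomial (X - 1)^n.\<close>

lemma fdiff_power:
  fixes u :: "nat \<Rightarrow> 'a::comm_ring_1"
  shows "((\<lambda>v k. v (Suc k) - v k) ^^ n) u k = (\<Sum>j\<le>n. poly.coeff ([:- 1, 1:] ^ n) j * u (k + j))"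
proof (induction n arbitrary: k)
  case 0
  then show ?case by simp
next
  case (Suc n)
  let ?c = "poly.coeff ([:- 1, 1:] ^ n) :: nat \<Rightarrow> 'a"
  have top: "?c (Suc n) = 0"
    by (rule Polynomial.coeff_eq_0) (rule le_less_trans[OF degree_power_le], simp)
  have "(\<Sum>j\<le>Suc n. poly.coeff ([:- 1, 1:] ^ Suc n) j * u (k + j)) =
      (\<Sum>j\<le>Suc n. poly.coeff (pCons 0 ([:- 1, 1:] ^ n)) j * u (k + j)) - (\<Sum>j\<le>Suc n. ?c j * u (k + j))"
    by (simp add: sum_subtractf[symmetric] algebra_simps del: sum.atMost_Suc)
  also have "(\<Sum>j\<le>Suc n. poly.coeff (pCons 0 ([:- 1, 1:] ^ n)) j * u (k + j)) = (\<Sum>j\<le>n. ?c j * u (Suc k + j))"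
    by (simp add: sum.atMost_Suc_shift del: sum.atMost_Suc)
  also have "(\<Sum>j\<le>Suc n. ?c j * u (k + j)) = (\<Sum>j\<le>n. ?c j * u (k + j))"
    by (simp add: top)
  finally show ?case by (simp add: Suc)
qed

text \<open>In characteristic p and for q a power of p, (X - 1)^q = X^q - 1.\<close>

lemma fdiff_prime_power:
  fixes u :: "nat \<Rightarrow> 'a::field"
  assumes "Factorial_Ring.prime CHAR('a)" and "q = CHAR('a) ^ r"
  shows "((\<lambda>v k. v (Suc k) - v k) ^^ q) u k = u (k + q) - u k"
proof -
  have q: "q > 0" using assms by (simp add: prime_gt_0_nat)
  have "([:- 1, 1:] + 1) ^ q = [:- 1, 1:] ^ q + (1 :: 'a poly) ^ q"
    using assms by (intro freshmans_dream'[of q r]) simp_all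
  moreover have "[:- 1, 1:] + 1 = (Polynomial.monom 1 1 :: 'a poly)"
    by (simp add: Polynomial.monom_altdef one_pCons)
  ultimately have "[:- 1, 1:] ^ q = Polynomial.monom 1 q - (1 :: 'a poly)"
    by (simp add: monom_power algebra_simps)
  then have "poly.coeff ([:- 1, 1:] ^ q) j = (if j = q then 1 else 0) - (if j = 0 then 1 else (0 :: 'a))" for j
    by (auto simp: Polynomial.coeff_1)
  then show ?thesis
    by (simp add: fdiff_power left_diff_distrib sum_subtractf if_distrib[of "\<lambda>x. x * _"] cong: if_cong)
qed

text \<open>An operator \<open>T\<close> with \<open>T\<^sup>q = 1\<close>, \<open>q\<close> a power of the characteristic, is unipotent.\<close>

lemma fixed_function_of_p_power_order:
  fixes M :: "('x \<Rightarrow> 'c::field) set"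
  assumes p: "Factorial_Ring.prime CHAR('c)"
    and T: "\<And>f. f \<in> M \<Longrightarrow> (\<lambda>g. f (t g)) \<in> M"
    and minus: "\<And>f f'. f \<in> M \<Longrightarrow> f' \<in> M \<Longrightarrow> (\<lambda>g. f g - f' g) \<in> M"
    and q: "\<And>f g. f \<in> M \<Longrightarrow> f ((t ^^ (CHAR('c) ^ r)) g) = f g"
    and f: "f \<in> M" "f \<noteq> (\<lambda>_. 0)"
  obtains f' where "f' \<in> M" "f' \<noteq> (\<lambda>_. 0)" "\<And>g. f' (t g) = f' g"
proof -
  define D where "D = (\<lambda>f g. f (t g) - f g :: 'c)"
  have DM: "(D ^^ j) f \<in> M" for j
    by (induction j) (auto simp: D_def f T minus)
  have "(D ^^ j) f ((t ^^ k) g) = ((\<lambda>v k. v (Suc k) - v k) ^^ j) (\<lambda>k. f ((t ^^ k) g)) k" for j g k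
  proof (induction j arbitrary: k)
    case (Suc j)
    have "(D ^^ Suc j) f ((t ^^ k) g) = (D ^^ j) f ((t ^^ Suc k) g) - (D ^^ j) f ((t ^^ k) g)"
      by (simp add: D_def)
    also have "\<dots> = ((\<lambda>v k. v (Suc k) - v k) ^^ Suc j) (\<lambda>k. f ((t ^^ k) g)) k"
      unfolding Suc by simp
    finally show ?case .
  qed simp
  from this[of "CHAR('c) ^ r" 0] have "(D ^^ (CHAR('c) ^ r)) f = (\<lambda>_. 0)"
    using fdiff_prime_power[OF p refl, of r] q[OF f(1)] by (intro ext) simp
  then have ex: "\<exists>j. (D ^^ j) f = (\<lambda>_. 0)" by blast
  \<comment> \<open>The last nonzero iterate of \<open>D\<close> is killed by \<open>D\<close>, that
    is, fixed by \<open>t\<close>. The least \<open>j\<close> is positive because \<open>f\<close>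
    itself is nonzero.\<close>
  define j where "j = (LEAST j. (D ^^ j) f = (\<lambda>_. 0))"
  have j: "(D ^^ j) f = (\<lambda>_. 0)" unfolding j_def by (rule LeastI_ex) (rule ex)
  with f(2) obtain i where i: "j = Suc i" by (cases j) auto
  have nz: "(D ^^ i) f \<noteq> (\<lambda>_. 0)"
    using not_less_Least[of i "\<lambda>j. (D ^^ j) f = (\<lambda>_. 0)"] i by (simp add: j_def)
  have "(D ^^ i) f (t g) = (D ^^ i) f g" for g
  proof -
    have "D ((D ^^ i) f) g = 0" using j by (simp add: i)
    moreover have "D F g = F (t g) - F g" for F by (simp add: D_def)
    ultimately show ?thesis by simp
  qed
  with DM nz show thesis by (rule that)
qed

text \<open>Since the operators commute, each of them preserves the functions fixed by the previous
  ones. The case of a single operator is therefore applied inside a shrinking but nonzero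
  set.\<close>

lemma common_fixed_function:
  fixes M :: "('x \<Rightarrow> 'c::field) set"
  assumes p: "Factorial_Ring.prime CHAR('c)" and "finite A"
    and T: "\<And>a f. a \<in> A \<Longrightarrow> f \<in> M \<Longrightarrow> (\<lambda>g. f (t a g)) \<in> M"
    and comm: "\<And>a b g f. a \<in> A \<Longrightarrow> b \<in> A \<Longrightarrow> t a (t b g) = t b (t a g)"
    and minus: "\<And>f f'. f \<in> M \<Longrightarrow> f' \<in> M \<Longrightarrow> (\<lambda>g. f g - f' g) \<in> M"
    and q: "\<And>a f g. a \<in> A \<Longrightarrow> f \<in> M \<Longrightarrow> f ((t a ^^ (CHAR('c) ^ r)) g) = f g"
    and f: "f \<in> M" "f \<noteq> (\<lambda>_. 0)"
  obtains f' where "f' \<in> M" "f' \<noteq> (\<lambda>_. 0)" "\<And>a g. a \<in> A \<Longrightarrow> f' (t a g) = f' g"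
proof -
  have "\<exists>f' \<in> M. f' \<noteq> (\<lambda>_. 0) \<and> (\<forall>a\<in>B. \<forall>g. f' (t a g) = f' g)" if "B \<subseteq> A" for B
    using finite_subset[OF that \<open>finite A\<close>] that
  proof (induction B)
    case empty
    then show ?case using f by auto
  next
    case (insert b B)
    let ?M = "{f \<in> M. \<forall>a\<in>B. \<forall>g. f (t a g) = f g}"
    from insert obtain f1 where f1: "f1 \<in> ?M" "f1 \<noteq> (\<lambda>_. 0)" by auto
    have b: "b \<in> A" "B \<subseteq> A" using insert by auto
    have "f (t b (t a g)) = f (t b g)" if "f \<in> ?M" "a \<in> B" for f a g
      using that b comm[of b a g] by auto
    then obtain f' where "f' \<in> ?M" "f' \<noteq> (\<lambda>_. 0)" "\<And>g. f' (t b g) = f' g"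
      using f1 b by (elim fixed_function_of_p_power_order[OF p, of ?M "t b" r f1, rotated -1])
        (auto simp: T minus q)
    then show ?case by auto
  qed
  from this[OF order_refl] show thesis using that by (elim bexE conjE) simp
qed

section \<open>Principal series\<close>

definition upper_unip :: "'a::{zero,one} \<Rightarrow> 'a^2^2" where "upper_unip x = mat2 1 x 0 1"
definition lower_unip :: "'a::{zero,one} \<Rightarrow> 'a^2^2" where "lower_unip x = mat2 1 0 x 1"

lemma up_in_GL2 [simp]: "upper_unip x \<in> carrier (GL2 :: ('a::field^2^2) monoid)"
  and lo_in_GL2 [simp]: "lower_unip x \<in> carrier (GL2 :: ('a::field^2^2) monoid)"
  by (simp_all add: upper_unip_def lower_unip_def)

lemma up_add: "upper_unip x ** upper_unip y = upper_unip (x + y :: 'a::comm_ring_1)"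
  by (simp add: upper_unip_def mat2_mult add.commute)

lemma up_0: "upper_unip 0 = mat (1 :: 'a::semiring_1)"
  by (simp add: upper_unip_def mat_as_mat2)

lemma s_up: "weyl_s ** upper_unip y = mat2 0 1 1 (y :: 'a::field)"
  by (simp add: weyl_s_def upper_unip_def mat2_mult)

text \<open>The inverse \<open>1 / y\<close> is small when \<open>y\<close> is large: this identity
  describes the big cell near its missing point, the coset of the identity.\<close>

lemma s_up_decomp: "y \<noteq> 0 \<Longrightarrow> weyl_s ** upper_unip y = mat2 (- (1 / y)) 1 0 y ** lower_unip (1 / y :: 'a::field)"
  by (simp add: s_up lower_unip_def mat2_mult)

lemma s_up_s: "weyl_s ** upper_unip y ** weyl_s = lower_unip (y :: 'a::field)"
  by (simp add: s_up) (simp add: weyl_s_def lower_unip_def mat2_mult)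

text \<open>Left multiplication by the Borel subgroup changes the bottom row only by a scalar. So
  the row \<open>(c, d)\<close> decides the cell, and in the big cell \<open>d / c\<close> is the
  unipotent coordinate.\<close>

lemma bruhat_cases:
  fixes g :: "'a::field^2^2"
  assumes "g \<in> carrier GL2"
  obtains "g \<in> upper_triangular" | b y where "b \<in> upper_triangular" "g = b ** (weyl_s ** upper_unip y)"
proof (cases "g$2$1 = 0")
  case True
  then show ?thesis using assms that(1) by (simp add: upper_triangular_def)
next
  case False
  obtain a b c d where g: "g = mat2 a b c d" by (rule mat2_cases)
  with False have c: "c \<noteq> 0" by simp
  then have "g = mat2 (b - a * d / c) a 0 c ** (weyl_s ** upper_unip (d / c))"
    by (simp add: g s_up mat2_mult)
  moreover have "mat2 (b - a * d / c) a 0 c \<in> upper_triangular"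
    using assms c by (auto simp: g upper_triangular_iff field_simps)
  ultimately show ?thesis using that(2) by blast
qed

lemma borel_in_GL2: "b \<in> upper_triangular \<Longrightarrow> b \<in> carrier GL2"
  by (simp add: upper_triangular_def)

text \<open>Equality of the two characteristics has two uses: translations of p-power order act
  unipotently on functions, and the number of residue classes vanishes in the coefficients.\<close>

locale principal_series_loc = local_field val unif red
  for val :: "'f::{field,metric_space} \<Rightarrow> int" and unif :: 'f and red :: "'f \<Rightarrow> 'k::finite_field" +
  fixes psi :: "'f^2^2 \<Rightarrow> 'c::field"
  assumes psi: "psi \<in> characters (GL2\<lparr>carrier := upper_triangular\<rparr>)"
    and psi_up: "psi (upper_unip x) = 1"
    and char_c: "CHAR('c) = CHAR('k)"
begin

abbreviation "PS \<equiv> principal_series psi"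

lemma psi_nonzero: "b \<in> upper_triangular \<Longrightarrow> psi b \<noteq> 0"
  using psi by (auto simp: hom_def mult_of_def)

lemma prime_char: "Factorial_Ring.prime CHAR('c)"
  by (simp add: char_c)

lemma PS_simps [simp]:
  "\<zero>\<^bsub>PS\<^esub> = (\<lambda>_. 0)" "f \<oplus>\<^bsub>PS\<^esub> f' = (\<lambda>h. f h + f' h)" "c \<odot>\<^bsub>PS\<^esub> f = (\<lambda>h. c * f h)"
  "act PS g f = (\<lambda>h. if h \<in> carrier GL2 then f (h ** g) else 0)"
  by (auto simp: principal_series_def fun_rep_def fun_module_def module.defs rep.defs char_rep_def
      right_transl_def)

text \<open>The stabiliser of \<open>f\<close> is right-stable under every congruence subgroup that
  fixes \<open>f\<close>, and an open set around the identity contains such a subgroup. Openness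
  thus becomes invariance under one level.\<close>

lemma in_PS_iff:
  "f \<in> carrier PS \<longleftrightarrow> (\<forall>g. g \<notin> carrier GL2 \<longrightarrow> f g = 0) \<and>
     (\<forall>b\<in>upper_triangular. \<forall>g\<in>carrier GL2. f (b ** g) = psi b * f g) \<and>
     (\<exists>n\<ge>1. \<forall>g\<in>carrier GL2. \<forall>k\<in>congr_group n. f (g ** k) = f g)"
    (is "_ \<longleftrightarrow> ?A \<and> ?B \<and> ?C")
proof -
  let ?S = "{g \<in> carrier GL2. right_transl GL2 (char_rep psi) g f = f}"
  have rt: "right_transl GL2 (char_rep psi) g f = (\<lambda>h. if h \<in> carrier GL2 then f (h ** g) else 0)" for g
    by (auto simp: right_transl_def char_rep_def)
  have "f \<in> carrier PS \<longleftrightarrow> ?A \<and> ?B \<and> openin (top_of_set (carrier GL2)) ?S"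
    by (simp add: principal_series_def fun_rep_def fun_module_def module.defs rep.defs
        equivariant_funs_def) (auto simp: char_rep_def)
  moreover have "openin (top_of_set (carrier GL2)) ?S \<longleftrightarrow> ?C" if A: ?A
  proof
    assume "openin (top_of_set (carrier GL2)) ?S"
    moreover have "mat 1 \<in> ?S" using A by (auto simp: rt)
    ultimately obtain n where n: "1 \<le> n" "congr_group n \<subseteq> ?S" by (rule openin_imp_congr_group)
    have "f (g ** k) = f g" if "g \<in> carrier GL2" "k \<in> congr_group n" for g k
    proof -
      have "right_transl GL2 (char_rep psi) k f = f" using n that by blast
      then show ?thesis using that by (auto simp: rt dest: fun_cong[of _ _ g])
    qed
    then show ?C using n by blast
  next
    assume ?C
    then obtain n where n: "n \<ge> 1" "\<And>g k. g \<in> carrier GL2 \<Longrightarrow> k \<in> congr_group n \<Longrightarrow> f (g ** k) = f g"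
      by blast
    show "openin (top_of_set (carrier GL2)) ?S"
    proof (rule openin_if_congr_group[where n = n])
      fix g k assume g: "g \<in> ?S" and k: "k \<in> congr_group n"
      have kG: "k \<in> carrier GL2" using congr_group_subset_GK[OF k n(1)] GK_in_GL2 by blast
      have "f (h ** (g ** k)) = f h" if h: "h \<in> carrier GL2" for h
      proof -
        have "f (h ** (g ** k)) = f (h ** g)" using n(2)[of "h ** g" k] g h k
          by (simp add: matrix_mul_assoc)
        also have "\<dots> = f h" using g h by (auto simp: rt dest: fun_cong[of _ _ h])
        finally show ?thesis .
      qed
      then show "g ** k \<in> ?S" using g kG A by (auto simp: rt)
    qed auto
  qed
  ultimately show ?thesis by blast
qed

lemma PS_outside: "f \<in> carrier PS \<Longrightarrow> g \<notin> carrier GL2 \<Longrightarrow> f g = 0"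
  by (simp add: in_PS_iff)

lemma PS_borel: "f \<in> carrier PS \<Longrightarrow> b \<in> upper_triangular \<Longrightarrow> g \<in> carrier GL2 \<Longrightarrow> f (b ** g) = psi b * f g"
  by (simp add: in_PS_iff)

lemma PS_smooth:
  assumes "f \<in> carrier PS"
  obtains n where "1 \<le> n" "\<And>g k. g \<in> carrier GL2 \<Longrightarrow> k \<in> congr_group n \<Longrightarrow> f (g ** k) = f g"
  using assms unfolding in_PS_iff by blast

lemma PS_borel_one: "f \<in> carrier PS \<Longrightarrow> b \<in> upper_triangular \<Longrightarrow> f b = psi b * f (mat 1)"
  using PS_borel[of f b "mat 1"] by simp

text \<open>By the Bruhat decomposition the identity and the elements
  \<open>weyl_s ** upper_unip y\<close> represent all left cosets of the Borel subgroup.\<close>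

lemma PS_eqI:
  assumes "f \<in> carrier PS" "f' \<in> carrier PS" "f (mat 1) = f' (mat 1)"
    "\<And>y. f (weyl_s ** upper_unip y) = f' (weyl_s ** upper_unip y)"
  shows "f = f'"
proof
  fix g show "f g = f' g"
  proof (cases "g \<in> carrier GL2")
    case True
    then show ?thesis
      by (cases rule: bruhat_cases) (use assms in \<open>auto simp: PS_borel PS_borel_one\<close>)
  qed (use assms in \<open>simp add: PS_outside\<close>)
qed

lemma congr_group_mono: "m \<le> n \<Longrightarrow> k \<in> congr_group n \<Longrightarrow> k \<in> congr_group m"
  using ideal_pow_mono by (auto simp: congr_group_def)

lemma in_PS_I:
  assumes "\<And>g. g \<notin> carrier GL2 \<Longrightarrow> f g = 0"
    and "\<And>b g. b \<in> upper_triangular \<Longrightarrow> g \<in> carrier GL2 \<Longrightarrow> f (b ** g) = psi b * f g"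
    and "1 \<le> n" "\<And>g k. g \<in> carrier GL2 \<Longrightarrow> k \<in> congr_group n \<Longrightarrow> f (g ** k) = f g"
  shows "f \<in> carrier PS"
  using assms unfolding in_PS_iff by blast

lemma representation_PS: "representation GL2 PS"
proof (rule representationI)
  show "\<zero>\<^bsub>PS\<^esub> \<in> carrier PS" by (rule in_PS_I[of _ 1]) simp_all
next
  fix f f' assume ff: "f \<in> carrier PS" "f' \<in> carrier PS"
  obtain n where n: "1 \<le> n" "\<And>g k. g \<in> carrier GL2 \<Longrightarrow> k \<in> congr_group n \<Longrightarrow> f (g ** k) = f g"
    using PS_smooth[OF ff(1)] by blast
  obtain n' where n': "1 \<le> n'" "\<And>g k. g \<in> carrier GL2 \<Longrightarrow> k \<in> congr_group n' \<Longrightarrow> f' (g ** k) = f' g"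
    using PS_smooth[OF ff(2)] by blast
  show "f \<oplus>\<^bsub>PS\<^esub> f' \<in> carrier PS"
  proof (rule in_PS_I)
    show "1 \<le> max n n'" using n by simp
    show "(f \<oplus>\<^bsub>PS\<^esub> f') (g ** k) = (f \<oplus>\<^bsub>PS\<^esub> f') g" if "g \<in> carrier GL2" "k \<in> congr_group (max n n')" for g k
      using that n n' congr_group_mono[of n "max n n'" k] congr_group_mono[of n' "max n n'" k] by simp
  qed (use ff in \<open>simp_all add: PS_outside PS_borel distrib_left\<close>)
next
  fix f :: "'f^2^2 \<Rightarrow> 'c" and c :: 'c assume f: "f \<in> carrier PS"
  obtain n where n: "1 \<le> n" "\<And>g k. g \<in> carrier GL2 \<Longrightarrow> k \<in> congr_group n \<Longrightarrow> f (g ** k) = f g"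
    using PS_smooth[OF f] by blast
  show "c \<odot>\<^bsub>PS\<^esub> f \<in> carrier PS"
    by (rule in_PS_I[of _ n]) (use f n in \<open>simp_all add: PS_outside PS_borel mult_ac\<close>)
next
  fix f g assume f: "f \<in> carrier PS" and g: "g \<in> carrier (GL2 :: ('f^2^2) monoid)"
  obtain n where n: "1 \<le> n" "\<And>g k. g \<in> carrier GL2 \<Longrightarrow> k \<in> congr_group n \<Longrightarrow> f (g ** k) = f g"
    using PS_smooth[OF f] by blast
  \<comment> \<open>A translate of \<open>f\<close> is invariant under a conjugate of the subgroup
    fixing \<open>f\<close>, and this conjugate contains a deeper congruence subgroup.\<close>
  obtain m where m: "1 \<le> m" "\<And>k. k \<in> congr_group m \<Longrightarrow> matrix_inv g ** k ** g \<in> congr_group n"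
    using congr_group_conj[OF g] by blast
  have *: "f (h ** k ** g) = f (h ** g)" if "h \<in> carrier GL2" "k \<in> congr_group m" for h k
  proof -
    have "h ** k ** g = (h ** g) ** (matrix_inv g ** k ** g)"
      by (simp add: matrix_mul_assoc[symmetric] matrix_inv_cancel[OF g])
    then show ?thesis using n(2)[OF _ m(2)[OF that(2)], of "h ** g"] that g by simp
  qed
  have **: "k \<in> carrier GL2" if "k \<in> congr_group m" for k
    using congr_group_subset_GK[OF that m(1)] GK_in_GL2 by blast
  show "act PS g f \<in> carrier PS"
  proof (rule in_PS_I[of _ m])
    show "act PS g f (b ** h) = psi b * act PS g f h" if "b \<in> upper_triangular" "h \<in> carrier GL2" for b h
      using that f g by (simp add: PS_borel borel_in_GL2 matrix_mul_assoc[symmetric])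
    show "act PS g f (h ** k) = act PS g f h" if "h \<in> carrier GL2" "k \<in> congr_group m" for h k
      using that * ** by simp
  qed (use m in simp_all)
next
  fix f assume "f \<in> carrier PS"
  then show "act PS \<one>\<^bsub>GL2\<^esub> f = f"
    by (auto simp: PS_outside)
next
  fix f :: "'f^2^2 \<Rightarrow> 'c" and g h :: "'f^2^2" assume "g \<in> carrier GL2" "h \<in> carrier GL2"
  then show "act PS (g \<otimes>\<^bsub>GL2\<^esub> h) f = act PS g (act PS h f)"
    by (simp only: PS_simps GL2_simps) (auto simp: matrix_mul_assoc)
next
  show "group (GL2 :: ('f^2^2) monoid)" by (rule group_GL2)
next
  fix f f' f'' :: "'f^2^2 \<Rightarrow> 'c" and c d :: 'c
  show "f \<oplus>\<^bsub>PS\<^esub> f' \<oplus>\<^bsub>PS\<^esub> f'' = f \<oplus>\<^bsub>PS\<^esub> (f' \<oplus>\<^bsub>PS\<^esub> f'')"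
    by (simp only: PS_simps add.assoc)
  show "f \<oplus>\<^bsub>PS\<^esub> f' = f' \<oplus>\<^bsub>PS\<^esub> f"
    by (simp only: PS_simps add.commute)
  show "\<zero>\<^bsub>PS\<^esub> \<oplus>\<^bsub>PS\<^esub> f = f" by simp
  show "c \<odot>\<^bsub>PS\<^esub> (f \<oplus>\<^bsub>PS\<^esub> f') = c \<odot>\<^bsub>PS\<^esub> f \<oplus>\<^bsub>PS\<^esub> c \<odot>\<^bsub>PS\<^esub> f'" by (simp add: distrib_left)
  show "(c + d) \<odot>\<^bsub>PS\<^esub> f = c \<odot>\<^bsub>PS\<^esub> f \<oplus>\<^bsub>PS\<^esub> d \<odot>\<^bsub>PS\<^esub> f" by (simp add: distrib_right)
  show "(c * d) \<odot>\<^bsub>PS\<^esub> f = c \<odot>\<^bsub>PS\<^esub> (d \<odot>\<^bsub>PS\<^esub> f)" by (simp add: mult.assoc)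
  show "1 \<odot>\<^bsub>PS\<^esub> f = f" "0 \<odot>\<^bsub>PS\<^esub> f = \<zero>\<^bsub>PS\<^esub>" by simp_all
next
  fix f f' :: "'f^2^2 \<Rightarrow> 'c" and c and g :: "'f^2^2"
  show "act PS g (f \<oplus>\<^bsub>PS\<^esub> f') = act PS g f \<oplus>\<^bsub>PS\<^esub> act PS g f'" by auto
  show "act PS g (c \<odot>\<^bsub>PS\<^esub> f) = c \<odot>\<^bsub>PS\<^esub> act PS g f" by auto
qed

end

section \<open>Finite quotients of fractional ideals\<close>

context local_field
begin

text \<open>Digit expansion in the uniformiser: each induction step appends one digit
  \<open>lift c\<close>, chosen from the residue of the scaled remainder.\<close>

lemma residue_representatives:
  obtains R where "finite R" "R \<subseteq> ideal_pow n"
    "\<And>y. y \<in> ideal_pow n \<Longrightarrow> \<exists>r\<in>R. y - r \<in> ideal_pow (n + int d)"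
proof -
  have "\<exists>R. finite R \<and> R \<subseteq> ideal_pow n \<and> (\<forall>y\<in>ideal_pow n. \<exists>r\<in>R. y - r \<in> ideal_pow (n + int d))"
  proof (induction d)
    case 0
    show ?case by (rule exI[of _ "{0}"]) auto
  next
    case (Suc d)
    then obtain R where R: "finite R" "R \<subseteq> ideal_pow n"
      "\<And>y. y \<in> ideal_pow n \<Longrightarrow> \<exists>r\<in>R. y - r \<in> ideal_pow (n + int d)" by blast
    let ?m = "n + int d"
    let ?R = "(\<lambda>(r, c). r + unif powi ?m * lift c) ` (R \<times> UNIV)"
    have "unif powi ?m * lift c \<in> ideal_pow n" for c
      using ideal_pow_mono[of "n - ?m" 0 "lift c"] by (simp add: ideal_pow_unif_powi flip: integers_eq)
    then have "?R \<subseteq> ideal_pow n" using R(2) by (auto intro!: ideal_pow_add)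
    moreover have "\<exists>r\<in>?R. y - r \<in> ideal_pow (n + int (Suc d))" if y: "y \<in> ideal_pow n" for y
    proof -
      obtain r where r: "r \<in> R" "y - r \<in> ideal_pow ?m" using R(3)[OF y] by blast
      define z where "z = unif powi (- ?m) * (y - r)"
      have z: "z \<in> integers" using r by (simp add: z_def ideal_pow_unif_powi integers_eq add.commute)
      have e: "y - r = unif powi ?m * z" by (simp add: z_def flip: power_int_add mult.assoc)
      have "y - (r + unif powi ?m * lift (red z)) = unif powi ?m * (z - lift (red z))"
        using e by (simp add: algebra_simps)
      also have "\<dots> \<in> ideal_pow (n + int (Suc d))"
        using lift_red[OF z] by (simp add: ideal_pow_unif_powi max_ideal_eq)
      finally show ?thesis using r(1) by (intro bexI[of _ "r + unif powi ?m * lift (red z)"]) auto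
    qed
    ultimately show ?case using R(1) by (intro exI[of _ ?R]) auto
  qed
  then show thesis using that by blast
qed

text \<open>The residue characteristic reduces to 0 and so lies in the maximal ideal; this covers
  equal and mixed characteristic alike. It bounds the order of translations modulo a power of the
  ideal.\<close>

lemma residue_char_power: "of_nat (CHAR('k) ^ r) \<in> ideal_pow (int r)"
proof (induction r)
  case (Suc r)
  have "of_nat CHAR('k) \<in> max_ideal"
    using red_of_nat[of "CHAR('k)"] red_zero_iff[of "of_nat CHAR('k)"] by simp
  then show ?case using ideal_pow_mult[OF _ Suc, of _ 1] by (simp add: max_ideal_eq algebra_simps)
qed (simp add: ideal_pow_def)

lemma up_in_congr_group: "x \<in> ideal_pow n \<Longrightarrow> upper_unip x \<in> congr_group n"
  and lo_in_congr_group: "x \<in> ideal_pow n \<Longrightarrow> lower_unip x \<in> congr_group n"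
  by (simp_all add: congr_group_def upper_unip_def lower_unip_def mat_as_mat2 forall_2)

end

section \<open>Functions on the big cell and subrepresentations of the principal series\<close>

context principal_series_loc
begin

text \<open>Outside the ideal of exponent \<open>- n\<close> the point
  \<open>weyl_s ** upper_unip y\<close> is a Borel element times a lower unipotent of level
  \<open>n\<close>, so the value of \<open>f\<close> there is a multiple of
  \<open>f (mat 1)\<close>.\<close>

lemma PS_compact_support:
  assumes f: "f \<in> carrier PS" "f (mat 1) = 0"
  obtains n where "\<And>y. y \<notin> ideal_pow n \<Longrightarrow> f (weyl_s ** upper_unip y) = 0"
proof -
  obtain n where n: "1 \<le> n" "\<And>g k. g \<in> carrier GL2 \<Longrightarrow> k \<in> congr_group n \<Longrightarrow> f (g ** k) = f g"
    using PS_smooth[OF f(1)] by blast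
  have "f (weyl_s ** upper_unip y) = 0" if "y \<notin> ideal_pow (- n)" for y
  proof -
    from that have y: "y \<noteq> 0" "val y < - n" by (auto simp: ideal_pow_def)
    then have "1 / y \<in> ideal_pow n" by (simp add: ideal_pow_def val_divide)
    then have "f (lower_unip (1 / y)) = 0"
      using n(2)[of "mat 1" "lower_unip (1 / y)"] f(2) lo_in_congr_group by simp
    then show ?thesis using y f(1) by (simp add: s_up_decomp PS_borel upper_triangular_iff)
  qed
  then show thesis by (rule that)
qed

lemma PS_locally_constant:
  assumes f: "f \<in> carrier PS"
  obtains m where "\<And>x y. x \<in> ideal_pow m \<Longrightarrow> f (weyl_s ** upper_unip (y + x)) = f (weyl_s ** upper_unip y)"
proof -
  obtain n where n: "1 \<le> n" "\<And>g k. g \<in> carrier GL2 \<Longrightarrow> k \<in> congr_group n \<Longrightarrow> f (g ** k) = f g"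
    using PS_smooth[OF f(1)] by blast
  have "f (weyl_s ** upper_unip (y + x)) = f (weyl_s ** upper_unip y)" if "x \<in> ideal_pow n" for x y
    using n(2)[of "weyl_s ** upper_unip y" "upper_unip x"] up_in_congr_group[OF that]
    by (simp add: up_add flip: matrix_mul_assoc)
  then show thesis by (rule that)
qed

lemma act_up_one: "f \<in> carrier PS \<Longrightarrow> act PS (upper_unip x) f (mat 1) = f (mat 1)"
  using PS_borel_one[of f "upper_unip x"] psi_up[of x] by (simp add: upper_triangular_iff upper_unip_def)

lemma act_up_s: "act PS (upper_unip x) f (weyl_s ** upper_unip y) = f (weyl_s ** upper_unip (y + x))"
  by (simp add: up_add flip: matrix_mul_assoc)

text \<open>Right multiplication by a unipotent matrix preserves singular matrices, where
  \<open>f\<close> is 0. So the case distinction in the action disappears and the action is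
  composition with a map, as \<open>common_fixed_function\<close> expects.\<close>

lemma act_up_eq:
  assumes "f \<in> carrier PS" shows "act PS (upper_unip x) f = (\<lambda>g. f (g ** upper_unip x))"
proof
  fix g :: "'f^2^2"
  have "g ** upper_unip x \<notin> carrier GL2" if "g \<notin> carrier GL2"
    using that by (simp add: in_GL2_iff det_mul upper_unip_def)
  then show "act PS (upper_unip x) f g = f (g ** upper_unip x)" using assms by (simp add: PS_outside)
qed

lemma up_power: "((\<lambda>g. g ** upper_unip a) ^^ k) g = g ** upper_unip (of_nat k * (a :: 'f))"
  by (induction k) (simp_all add: up_0 up_add algebra_simps flip: matrix_mul_assoc)

text \<open>Moving a diagonal matrix to the left past \<open>weyl_s\<close> exchanges its entries;
  conjugating the unipotent factor rescales the coordinate.\<close>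

lemma act_diag_s:
  assumes f: "f \<in> carrier PS" and ad: "a \<noteq> 0" "d \<noteq> 0"
  shows "act PS (mat2 a 0 0 d) f (weyl_s ** upper_unip y) = psi (mat2 d 0 0 a) * f (weyl_s ** upper_unip (y * d / a))"
proof -
  have "weyl_s ** upper_unip y ** mat2 a 0 0 d = mat2 d 0 0 a ** (weyl_s ** upper_unip (y * d / a))"
    using ad by (simp add: s_up mat2_mult)
  then show ?thesis using PS_borel[OF f, of "mat2 d 0 0 a" "weyl_s ** upper_unip (y * d / a)"] ad
    by (simp add: upper_triangular_iff)
qed

lemma act_diag_one:
  assumes f: "f \<in> carrier PS" and ad: "a \<noteq> 0" "d \<noteq> 0"
  shows "act PS (mat2 a 0 0 d) f (mat 1) = psi (mat2 a 0 0 d) * f (mat 1)"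
  using PS_borel_one[OF f, of "mat2 a 0 0 d"] ad by (simp add: upper_triangular_iff)

text \<open>In the coordinate \<open>y \<mapsto> f (s u(y))\<close> the functions in \<open>PS\<close> vanishing at \<open>1\<close> are the locally
  constant compactly supported functions on \<open>F\<close>, with translations and scalings acting.  A nonzero
  translation-stable subspace contains the indicator function of some ball; scalings and
  translations of it span everything.\<close>

lemma subrep_PS_eq_carrier:
  assumes N: "subrep GL2 N PS" and f: "f \<in> N" "f \<noteq> (\<lambda>_. 0)" "f (mat 1) = 0"
  shows "N = carrier PS"
proof -
  interpret PS: group_rep GL2 PS by (rule group_rep_of[OF representation_PS])
  note N_sub = subrepD[OF representation_PS N]
  have NC: "f \<in> N \<Longrightarrow> f \<in> carrier PS" for f using N_sub(1) by blast
  have N_add: "f \<in> N \<Longrightarrow> f' \<in> N \<Longrightarrow> (\<lambda>h. f h + f' h) \<in> N" for f f' using N_sub(3)[of f f'] by simp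
  have N_smult: "f \<in> N \<Longrightarrow> (\<lambda>h. c * f h) \<in> N" for f c using N_sub(5)[of f c] by simp
  have N_diff: "f \<in> N \<Longrightarrow> f' \<in> N \<Longrightarrow> (\<lambda>h. f h - f' h) \<in> N" for f f'
    using N_add[OF _ N_smult[of f' "- 1"], of f] by simp
  have PS_diff: "f \<in> carrier PS \<Longrightarrow> f' \<in> carrier PS \<Longrightarrow> (\<lambda>h. f h - c * f' h) \<in> carrier PS" for f f' c
    using PS.a_closed[of f "(- c) \<odot>\<^bsub>PS\<^esub> f'"] PS.smult_cl[of f' "- c"] by simp
  obtain n where n: "\<And>y. y \<notin> ideal_pow n \<Longrightarrow> f (weyl_s ** upper_unip y) = 0"
    using PS_compact_support[OF NC[OF f(1)] f(3)] by blast
  obtain m' where m': "\<And>x y. x \<in> ideal_pow m' \<Longrightarrow> f (weyl_s ** upper_unip (y + x)) = f (weyl_s ** upper_unip y)"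
    using PS_locally_constant[OF NC[OF f(1)]] by blast
  \<comment> \<open>With this \<open>d\<close> the exponent \<open>n + int d\<close> is at least
    \<open>m'\<close>, so \<open>f\<close> is still invariant under the smaller ideal, and the
    quotient of the two ideals has finitely many representatives.\<close>
  define d where "d = nat (m' - n)"
  let ?m = "n + int d"
  obtain R where R: "finite R" "R \<subseteq> ideal_pow n" "\<And>y. y \<in> ideal_pow n \<Longrightarrow> \<exists>r\<in>R. y - r \<in> ideal_pow ?m"
    using residue_representatives[of n d] by blast
  \<comment> \<open>In the coordinate \<open>y\<close> these are functions on the finite quotient of
    the ideal of exponent \<open>n\<close> by that of exponent \<open>?m\<close>, on which the
    translations by \<open>R\<close> commute.\<close>
  let ?M = "{f \<in> N. f (mat 1) = 0 \<and> (\<forall>y. y \<notin> ideal_pow n \<longrightarrow> f (weyl_s ** upper_unip y) = 0) \<and>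
    (\<forall>x y. x \<in> ideal_pow ?m \<longrightarrow> f (weyl_s ** upper_unip (y + x)) = f (weyl_s ** upper_unip y))}"
  obtain e where e: "e \<in> ?M" "e \<noteq> (\<lambda>_. 0)" "\<And>a g. a \<in> R \<Longrightarrow> e (g ** upper_unip a) = e g"
  proof (rule common_fixed_function[OF prime_char R(1), of ?M "\<lambda>a g. g ** upper_unip a" d f])
    show "f \<in> ?M"
    proof -
      have "ideal_pow ?m \<subseteq> ideal_pow m'" using ideal_pow_mono[of m' ?m] by (auto simp: d_def)
      then show ?thesis using f n m' by auto
    qed
    show "f \<noteq> (\<lambda>_. 0)" by fact
    show "(\<lambda>g. f (g ** upper_unip a)) \<in> ?M" if a: "a \<in> R" and f: "f \<in> ?M" for a f
    proof -
      have an: "a \<in> ideal_pow n" using a R by blast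
      have "y + a \<in> ideal_pow n \<longleftrightarrow> y \<in> ideal_pow n" for y
        using ideal_pow_add[OF _ an, of y] ideal_pow_diff[OF _ an, of "y + a"] by auto
      then have "act PS (upper_unip a) f \<in> ?M"
        using f N_sub(6)[of "upper_unip a" f] act_up_one[of f a] NC[of f]
        by (simp only: mem_Collect_eq act_up_s) (auto simp: add.assoc add.left_commute add.commute)
      then show ?thesis using f NC by (simp add: act_up_eq del: PS_simps)
    qed
    show "g ** upper_unip b ** upper_unip a = g ** upper_unip a ** upper_unip b" for a b :: 'f and g
      by (simp add: up_add add.commute flip: matrix_mul_assoc)
    show "(\<lambda>g. f g - f' g) \<in> ?M" if "f \<in> ?M" "f' \<in> ?M" for f f'
      using that N_diff by simp
    show "f (((\<lambda>g. g ** upper_unip a) ^^ (CHAR('c) ^ d)) g) = f g" if a: "a \<in> R" and f: "f \<in> ?M" for a f g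
    proof -
      \<comment> \<open>Translating by \<open>a\<close> this many times is translation by
        \<open>?x\<close>, which lies in the smaller ideal and hence fixes every function of
        \<open>?M\<close>.\<close>
      let ?x = "of_nat (CHAR('k) ^ d) * a"
      have x: "?x \<in> ideal_pow ?m"
        using ideal_pow_mult[OF residue_char_power[of d], of a n] a R(2) by (auto simp: add.commute)
      have fc: "f \<in> carrier PS" using f NC by simp
      have "act PS (upper_unip ?x) f = f"
      proof (rule PS_eqI)
        show "act PS (upper_unip ?x) f \<in> carrier PS" using fc by (intro PS.act_closed) simp_all
        show "act PS (upper_unip ?x) f (mat 1) = f (mat 1)" by (rule act_up_one[OF fc])
        show "act PS (upper_unip ?x) f (weyl_s ** upper_unip y) = f (weyl_s ** upper_unip y)" for y
          using f x by (simp only: act_up_s mem_Collect_eq)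
      qed (rule fc)
      then show ?thesis unfolding up_power char_c using act_up_eq[OF fc, of ?x] by metis
    qed
  qed (rule that)
  have eN: "e \<in> N" and e1: "e (mat 1) = 0" and en: "\<And>y. y \<notin> ideal_pow n \<Longrightarrow> e (weyl_s ** upper_unip y) = 0"
    using e(1) by auto
  have e_const: "e (weyl_s ** upper_unip y) = e (weyl_s ** upper_unip 0)" if y: "y \<in> ideal_pow n" for y
  proof -
    obtain r where r: "r \<in> R" "y - r \<in> ideal_pow ?m" using R(3)[OF y] by blast
    have "e (weyl_s ** upper_unip (r + (y - r))) = e (weyl_s ** upper_unip r)"
      using e(1) r(2) by blast
    also have "\<dots> = e (weyl_s ** upper_unip 0)"
      using e(3)[OF r(1), of "weyl_s ** upper_unip 0"] by (simp add: up_add flip: matrix_mul_assoc)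
    finally show ?thesis by simp
  qed
  have e0: "e (weyl_s ** upper_unip 0) \<noteq> 0"
  proof
    assume "e (weyl_s ** upper_unip 0) = 0"
    then have "e (weyl_s ** upper_unip y) = 0" for y using en e_const by metis
    then have "e = \<zero>\<^bsub>PS\<^esub>" using e1 NC[OF eN] PS.zero_closed by (intro PS_eqI) simp_all
    then show False using e(2) by simp
  qed
  \<comment> \<open>The function \<open>e\<close> is a multiple of the indicator of the ideal of
    exponent \<open>n\<close>. The diagonal matrix with entry \<open>unif powi (n - k)\<close>
    rescales this ideal to exponent \<open>k\<close>, and a translation recentres it at
    \<open>r\<close>.\<close>
  have ball: "\<exists>e\<in>N. e (mat 1) = 0 \<and> (\<forall>y. e (weyl_s ** upper_unip y) = (if y - r \<in> ideal_pow k then 1 else 0))" for r k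
  proof -
    let ?d = "unif powi (n - k)"
    define e1 where "e1 = act PS (mat2 1 0 0 ?d) e"
    define e2 where "e2 = act PS (upper_unip (- r)) e1"
    define c where "c = psi (mat2 ?d 0 0 1) * e (weyl_s ** upper_unip 0)"
    have c: "c \<noteq> 0" using e0 psi_nonzero[of "mat2 ?d 0 0 1"] by (simp add: c_def upper_triangular_iff del: power_int_eq_0_iff)
    have e1N: "e1 \<in> N" unfolding e1_def by (rule N_sub(6)[OF _ eN]) (simp del: power_int_eq_0_iff)
    have e2N: "e2 \<in> N" unfolding e2_def by (rule N_sub(6)[OF _ e1N]) simp
    have "e2 (mat 1) = 0"
      using act_up_one[OF NC[OF e1N], of "- r"] act_diag_one[OF NC[OF eN], of 1 ?d] \<open>e (mat 1) = 0\<close>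
      by (simp add: e2_def e1_def del: PS_simps power_int_eq_0_iff)
    moreover have "e2 (weyl_s ** upper_unip y) = (if y - r \<in> ideal_pow k then c else 0)" for y
    proof -
      have "e2 (weyl_s ** upper_unip y) = psi (mat2 ?d 0 0 1) * e (weyl_s ** upper_unip ((y - r) * ?d))"
        unfolding e2_def act_up_s unfolding e1_def
        using act_diag_s[OF NC[OF eN], of 1 ?d "y - r"] by (simp del: PS_simps power_int_eq_0_iff)
      moreover have "(y - r) * ?d \<in> ideal_pow n \<longleftrightarrow> y - r \<in> ideal_pow k"
        using ideal_pow_unif_powi[of "n - k" "y - r" n] by (simp add: mult.commute)
      ultimately show ?thesis using en[of "(y - r) * ?d"] e_const[of "(y - r) * ?d"] by (simp add: c_def)
    qed
    ultimately show ?thesis using c N_smult[OF e2N, of "inverse c"]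
      by (intro bexI[of _ "\<lambda>h. inverse c * e2 h"]) auto
  qed
  \<comment> \<open>\<open>R\<close> lists centres of balls of exponent \<open>k\<close> that cover
    the support. Subtracting a multiple of one indicator function empties one ball.\<close>
  have span: "f \<in> N" if "finite R" "f \<in> carrier PS" "f (mat 1) = 0"
      "\<And>x y. x \<in> ideal_pow k \<Longrightarrow> f (weyl_s ** upper_unip (y + x)) = f (weyl_s ** upper_unip y)"
      "\<And>y. f (weyl_s ** upper_unip y) \<noteq> 0 \<Longrightarrow> \<exists>r\<in>R. y - r \<in> ideal_pow k" for f R k
    using that
  proof (induction R arbitrary: f)
    case empty
    then have "f = \<zero>\<^bsub>PS\<^esub>" using PS.zero_closed by (intro PS_eqI) auto
    then show ?case using N_sub(2) by simp
  next
    case (insert r R)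
    obtain e where e: "e \<in> N" "e (mat 1) = 0"
      "\<And>y. e (weyl_s ** upper_unip y) = (if y - r \<in> ideal_pow k then 1 else 0)" using ball by blast
    define c where "c = f (weyl_s ** upper_unip r)"
    let ?f = "\<lambda>h. f h - c * e h"
    have near: "f (weyl_s ** upper_unip y) = c" if "y - r \<in> ideal_pow k" for y
      using insert.prems(3)[OF that, of r] by (simp add: c_def)
    have "?f \<in> N"
    proof (rule insert.IH)
      show "?f \<in> carrier PS" using PS_diff insert.prems(1) NC[OF e(1)] by blast
      show "?f (mat 1) = 0" using insert.prems e by simp
      show "?f (weyl_s ** upper_unip (y + x)) = ?f (weyl_s ** upper_unip y)" if x: "x \<in> ideal_pow k" for x y
      proof -
        have "y + x - r \<in> ideal_pow k \<longleftrightarrow> y - r \<in> ideal_pow k"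
          using ideal_pow_add[OF _ x, of "y - r"] ideal_pow_diff[OF _ x, of "y + x - r"]
          by (auto simp: algebra_simps)
        then show ?thesis using insert.prems(3)[OF x] e(3) by simp
      qed
      show "\<exists>r\<in>R. y - r \<in> ideal_pow k" if "?f (weyl_s ** upper_unip y) \<noteq> 0" for y
        using that near[of y] e(3)[of y] insert.prems(4)[of y] by (auto split: if_splits)
    qed
    then have "(\<lambda>h. ?f h + c * e h) \<in> N" using N_add N_smult[OF e(1)] by blast
    then show ?case by simp
  qed
  have vanishing: "f \<in> N" if f: "f \<in> carrier PS" "f (mat 1) = 0" for f
  proof -
    obtain n where n: "\<And>y. y \<notin> ideal_pow n \<Longrightarrow> f (weyl_s ** upper_unip y) = 0"
      using PS_compact_support[OF f] by blast
    obtain m' where m': "\<And>x y. x \<in> ideal_pow m' \<Longrightarrow> f (weyl_s ** upper_unip (y + x)) = f (weyl_s ** upper_unip y)"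
      using PS_locally_constant[OF f(1)] by blast
    define d where "d = nat (m' - n)"
    have sub: "x \<in> ideal_pow (n + int d) \<Longrightarrow> x \<in> ideal_pow m'" for x
      using ideal_pow_mono[of m' "n + int d" x] by (auto simp: d_def)
    obtain R where R: "finite R" "R \<subseteq> ideal_pow n"
      "\<And>y. y \<in> ideal_pow n \<Longrightarrow> \<exists>r\<in>R. y - r \<in> ideal_pow (n + int d)"
      using residue_representatives[of n d] by blast
    show ?thesis
    proof (rule span[OF R(1) f, of "n + int d"])
      show "f (weyl_s ** upper_unip (y + x)) = f (weyl_s ** upper_unip y)" if "x \<in> ideal_pow (n + int d)" for x y
        using m'[OF sub[OF that]] .
      show "\<exists>r\<in>R. y - r \<in> ideal_pow (n + int d)" if "f (weyl_s ** upper_unip y) \<noteq> 0" for y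
        using n[of y] that R(3)[of y] by blast
    qed
  qed
  obtain e where e: "e \<in> N" "e (mat 1) = 0"
    "\<And>y. e (weyl_s ** upper_unip y) = (if y - 0 \<in> ideal_pow 0 then 1 else 0)" using ball by blast
  \<comment> \<open>This translate takes the value 1 at the identity, so subtracting a multiple of
    it reduces an arbitrary function to one vanishing there.\<close>
  define e' where "e' = act PS weyl_s e"
  have e'N: "e' \<in> N" unfolding e'_def by (rule N_sub(6)[OF _ e(1)]) simp
  have e'1: "e' (mat 1) = 1" using e(3)[of 0] by (simp add: e'_def up_0)
  have "f \<in> N" if f: "f \<in> carrier PS" for f
  proof -
    have "(\<lambda>h. f h - f (mat 1) * e' h) \<in> N"
      by (rule vanishing) (use PS_diff[OF f NC[OF e'N]] e'1 in auto)
    then have "(\<lambda>h. (f h - f (mat 1) * e' h) + f (mat 1) * e' h) \<in> N"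
      using N_add N_smult[OF e'N] by blast
    then show ?thesis by simp
  qed
  then show ?thesis using N_sub(1) by blast
qed

end

text \<open>The sum of all elements does not change when every element is increased by 1, although
  each of the summands contributes an extra 1.\<close>

lemma of_nat_card_finite_field: "of_nat CARD('k) = (0 :: 'k::finite_field)"
proof -
  have "(\<Sum>a\<in>UNIV. a) = (\<Sum>a\<in>UNIV. a + (1 :: 'k))"
    by (rule sum.reindex_bij_witness[of _ "\<lambda>a. a + 1" "\<lambda>a. a - 1"]) auto
  then show ?thesis by (simp add: sum.distrib)
qed

section \<open>Iwahori-fixed vectors and the operator \<open>T\<close> on a principal series\<close>

context principal_series_loc
begin

lemma of_nat_card_residue_field: "of_nat CARD('k) = (0 :: 'c)"
  using of_nat_card_finite_field[where 'k = 'k] by (simp add: of_nat_eq_0_iff_char_dvd char_c)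

text \<open>The share of the nonzero residues in the value at \<open>weyl_s\<close>: for
  \<open>y = lift a\<close> the lower unipotent with entry \<open>y\<close> lies in the big cell,
  and its Borel factor has diagonal entries \<open>- (1 / y)\<close> and \<open>y\<close>.\<close>

definition kap :: 'c where
  "kap = (\<Sum>a\<in>UNIV - {0 :: 'k}. psi (mat2 (- (1 / lift a)) 1 0 (lift a)))"

text \<open>The value of \<open>f\<close> at \<open>s u(lift a) s\<close> is obtained from the Bruhat decomposition of this
  lower unipotent matrix.\<close>

lemma hecke_sum_values:
  assumes f: "f \<in> carrier PS"
    and inv_up: "\<And>x. x \<in> integers \<Longrightarrow> act PS (upper_unip x) f = f"
    and inv_lo: "\<And>x. x \<in> max_ideal \<Longrightarrow> act PS (lower_unip x) f = f"
  shows "(\<Sum>a\<in>UNIV. f (upper_unip (lift a) ** weyl_s)) = 0"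
    and "(\<Sum>a\<in>UNIV. f (weyl_s ** (upper_unip (lift a) ** weyl_s))) = f (mat 1) + kap * f weyl_s"
proof -
  have "f (upper_unip (lift a) ** weyl_s) = f weyl_s" for a
    using PS_borel[OF f, of "upper_unip (lift a)" weyl_s] psi_up[of "lift a"]
    by (simp add: upper_unip_def upper_triangular_iff)
  then show "(\<Sum>a\<in>UNIV. f (upper_unip (lift a) ** weyl_s)) = 0"
    by (simp add: of_nat_card_residue_field)
  \<comment> \<open>The element \<open>lift 0\<close> need not be 0, but it lies in
    \<open>max_ideal\<close>, so the corresponding lower unipotent fixes \<open>f\<close>.\<close>
  have 0: "f (weyl_s ** (upper_unip (lift 0) ** weyl_s)) = f (mat 1)"
  proof -
    have "f (mat 1 ** lower_unip (lift 0)) = f (mat 1)"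
      using fun_cong[OF inv_lo, of "lift 0" "mat 1"] red_zero_iff[of "lift 0"] by simp
    then show ?thesis by (simp add: matrix_mul_assoc s_up_s)
  qed
  have nz: "f (weyl_s ** (upper_unip (lift a) ** weyl_s)) = psi (mat2 (- (1 / lift a)) 1 0 (lift a)) * f weyl_s"
    if "a \<noteq> 0" for a
  proof -
    let ?y = "lift a"
    have y: "?y \<noteq> 0" "1 / ?y \<in> integers"
      using lift_unit[OF that] unit_iff[of ?y] by (simp_all add: divide_inverse)
    have "weyl_s ** (upper_unip ?y ** weyl_s) = mat2 (- (1 / ?y)) 1 0 ?y ** (weyl_s ** upper_unip (1 / ?y))"
      using y by (simp add: matrix_mul_assoc s_up_s) (simp add: lower_unip_def s_up mat2_mult flip: matrix_mul_assoc)
    then have "f (weyl_s ** (upper_unip ?y ** weyl_s)) =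
        psi (mat2 (- (1 / ?y)) 1 0 ?y) * f (weyl_s ** upper_unip (1 / ?y))"
      using PS_borel[OF f] y by (simp add: upper_triangular_iff)
    moreover have "f (weyl_s ** upper_unip (1 / ?y)) = f weyl_s"
      using fun_cong[OF inv_up[OF y(2)], of weyl_s] by simp
    ultimately show ?thesis by simp
  qed
  have "(\<Sum>a\<in>UNIV. f (weyl_s ** (upper_unip (lift a) ** weyl_s))) =
      f (weyl_s ** (upper_unip (lift 0) ** weyl_s)) + (\<Sum>a\<in>UNIV - {0}. f (weyl_s ** (upper_unip (lift a) ** weyl_s)))"
    by (rule sum.remove) auto
  then show "(\<Sum>a\<in>UNIV. f (weyl_s ** (upper_unip (lift a) ** weyl_s))) = f (mat 1) + kap * f weyl_s"
    by (simp add: 0 nz kap_def sum_distrib_right)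
qed

text \<open>A point of the big cell with integral coordinate is moved to \<open>weyl_s\<close> by an
  integral upper unipotent. If the coordinate \<open>y\<close> is not integral, then
  \<open>1 / y\<close> lies in \<open>max_ideal\<close>, and a lower unipotent moves the Borel coset
  to that of 1.\<close>

lemma iwahori_invariant_eq_0:
  assumes f: "f \<in> carrier PS" and "f (mat 1) = 0" "f weyl_s = 0"
    and inv_up: "\<And>x. x \<in> integers \<Longrightarrow> act PS (upper_unip x) f = f"
    and inv_lo: "\<And>x. x \<in> max_ideal \<Longrightarrow> act PS (lower_unip x) f = f"
  shows "f = (\<lambda>_. 0)"
proof -
  interpret PS: group_rep GL2 PS by (rule group_rep_of[OF representation_PS])
  have "f (weyl_s ** upper_unip y) = 0" for y
  proof (cases "y \<in> integers")
    case True
    then show ?thesis using fun_cong[OF inv_up[OF True], of weyl_s] assms(3) by simp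
  next
    case False
    then have y: "y \<noteq> 0" "1 / y \<in> max_ideal"
      by (auto simp: integers_def max_ideal_def val_divide)
    then have "f (lower_unip (1 / y)) = 0"
      using fun_cong[OF inv_lo[OF y(2)], of "mat 1"] assms(2) by simp
    then show ?thesis using y f by (simp add: s_up_decomp PS_borel upper_triangular_iff)
  qed
  then have "f = \<zero>\<^bsub>PS\<^esub>" using f assms(2) PS.zero_closed by (intro PS_eqI) simp_all
  then show ?thesis by simp
qed

lemma Pi_values:
  assumes f: "f \<in> carrier PS"
  shows "act PS Pi_mat f (mat 1) = psi (mat2 1 0 0 unif) * f weyl_s"
    and "act PS Pi_mat f weyl_s = psi (mat2 unif 0 0 1) * f (mat 1)"
proof -
  have "Pi_mat = mat2 1 0 0 unif ** weyl_s" "weyl_s ** Pi_mat = mat2 unif 0 0 1"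
    by (simp_all add: Pi_mat_def weyl_s_def mat2_mult)
  then show "act PS Pi_mat f (mat 1) = psi (mat2 1 0 0 unif) * f weyl_s"
    and "act PS Pi_mat f weyl_s = psi (mat2 unif 0 0 1) * f (mat 1)"
    using PS_borel[OF f, of "mat2 1 0 0 unif" weyl_s] PS_borel_one[OF f, of "mat2 unif 0 0 1"]
    by (simp_all add: upper_triangular_iff)
qed

text \<open>Here \<open>P\<close> is \<open>W / N\<close> with \<open>N\<close> the kernel of
  \<open>\<Phi>\<close>, and \<open>f1\<close>, \<open>f2\<close> are lifts of \<open>w1\<close>,
  \<open>w2\<close>. On the pair (value at 1, value at \<open>weyl_s\<close>) the Hecke sum sends
  (x, y) to (0, x + kap y), and \<open>Pi_mat\<close> sends it to (A y, B x). The contradiction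
  comes from comparing these matrices with the eigenvalues \<open>l1\<close> and
  \<open>l2\<close>.\<close>

lemma no_supersingular_subquotient:
  fixes P :: "('c, 'w, 'f^2^2) rep"
  assumes P: "representation GL2 P" and W: "subrep GL2 W PS"
    and \<Phi>: "\<Phi> \<in> rep_hom GL2 (PS\<lparr>carrier := W\<rparr>) P" "\<Phi> ` W = carrier P"
    and w1: "w1 \<in> carrier P" "w1 \<noteq> \<zero>\<^bsub>P\<^esub>"
    and w2: "w2 = act P Pi_mat w1" "act P Pi_mat w2 = w1"
    and fix_up: "\<And>w x. w \<in> {w1, w2} \<Longrightarrow> x \<in> integers \<Longrightarrow> act P (upper_unip x) w = w"
    and fix_lo: "\<And>w x. w \<in> {w1, w2} \<Longrightarrow> x \<in> max_ideal \<Longrightarrow> act P (lower_unip x) w = w"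
    and T1: "finsum P (\<lambda>a. act P (upper_unip (lift a) ** weyl_s) w1) UNIV = l1 \<odot>\<^bsub>P\<^esub> w1"
    and T2: "finsum P (\<lambda>a. act P (upper_unip (lift a) ** weyl_s) w2) UNIV = l2 \<odot>\<^bsub>P\<^esub> w2"
    and l: "l1 = 0 \<or> l2 = 0"
    and regular: "l1 = 0 \<Longrightarrow> l2 = 0 \<Longrightarrow> \<exists>a d c1 c2. a \<noteq> 0 \<and> d \<noteq> 0 \<and> c1 \<noteq> c2 \<and>
      act P (mat2 a 0 0 d) w1 = c1 \<odot>\<^bsub>P\<^esub> w1 \<and> act P (mat2 d 0 0 a) w1 = c2 \<odot>\<^bsub>P\<^esub> w1"
  shows False
proof -
  let ?W = "PS\<lparr>carrier := W\<rparr>"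
  interpret PS: group_rep GL2 PS by (rule group_rep_of[OF representation_PS])
  interpret P: group_rep GL2 P by (rule group_rep_of[OF P])
  have RW: "representation GL2 ?W" by (rule representation_subrep[OF representation_PS W])
  note W_sub = subrepD[OF representation_PS W]
  have WC: "f \<in> W \<Longrightarrow> f \<in> carrier PS" for f using W_sub(1) by blast
  have W_add: "f \<in> W \<Longrightarrow> f' \<in> W \<Longrightarrow> (\<lambda>h. f h + f' h) \<in> W" for f f' using W_sub(3)[of f f'] by simp
  have W_smult: "f \<in> W \<Longrightarrow> (\<lambda>h. c * f h) \<in> W" for f c using W_sub(5)[of f c] by simp
  have \<Phi>_closed: "f \<in> W \<Longrightarrow> \<Phi> f \<in> carrier P" for f using rep_hom_closed[OF \<Phi>(1)] by simp
  have \<Phi>_add: "f \<in> W \<Longrightarrow> f' \<in> W \<Longrightarrow> \<Phi> (\<lambda>h. f h + f' h) = \<Phi> f \<oplus>\<^bsub>P\<^esub> \<Phi> f'" for f f'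
    using rep_hom_add[OF \<Phi>(1), of f f'] by simp
  have \<Phi>_smult: "f \<in> W \<Longrightarrow> \<Phi> (\<lambda>h. c * f h) = c \<odot>\<^bsub>P\<^esub> \<Phi> f" for f c
    using rep_hom_smult[OF \<Phi>(1), of f c] by simp
  have \<Phi>_act: "f \<in> W \<Longrightarrow> g \<in> carrier GL2 \<Longrightarrow> \<Phi> (act PS g f) = act P g (\<Phi> f)" for f g
    using rep_hom_act[OF \<Phi>(1), of f g] by simp
  have \<Phi>_zero: "\<Phi> (\<lambda>_. 0) = \<zero>\<^bsub>P\<^esub>" using rep_hom_zero[OF RW P \<Phi>(1)] by simp
  define N where "N = {f \<in> W. \<Phi> f = \<zero>\<^bsub>P\<^esub>}"
  have N: "subrep GL2 N PS"
    by (rule subrepI[OF representation_PS])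
      (use W_sub WC W_add W_smult \<Phi>_add \<Phi>_smult \<Phi>_act \<Phi>_zero in
        \<open>auto simp: N_def simp del: PS_simps(4)\<close>)
  note N_sub = subrepD[OF representation_PS N]
  have NC: "f \<in> N \<Longrightarrow> f \<in> carrier PS" for f using N_sub(1) by blast
  have cong_N: "(\<lambda>h. f h - c * f' h) \<in> N" if "f \<in> W" "f' \<in> W" "\<Phi> f = c \<odot>\<^bsub>P\<^esub> \<Phi> f'" for f f' c
  proof -
    have "(\<lambda>h. f h + (- c) * f' h) \<in> W" using that W_add W_smult by blast
    moreover have "\<Phi> (\<lambda>h. f h + (- c) * f' h) = c \<odot>\<^bsub>P\<^esub> \<Phi> f' \<oplus>\<^bsub>P\<^esub> (- c) \<odot>\<^bsub>P\<^esub> \<Phi> f'"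
      by (simp only: \<Phi>_add[OF that(1) W_smult[OF that(2)]] \<Phi>_smult[OF that(2)] that(3))
    moreover have "c \<odot>\<^bsub>P\<^esub> \<Phi> f' \<oplus>\<^bsub>P\<^esub> (- c) \<odot>\<^bsub>P\<^esub> \<Phi> f' = \<zero>\<^bsub>P\<^esub>"
      using \<Phi>_closed[OF that(2)] by (simp flip: P.smult_add_scalar)
    ultimately show ?thesis by (simp add: N_def)
  qed
  obtain f1 where f1: "f1 \<in> W" "\<Phi> f1 = w1" using w1(1)[folded \<Phi>(2)] by (elim imageE) simp
  have "f1 \<notin> N" using f1 w1 by (simp add: N_def)
  \<comment> \<open>A lift of the nonzero vector \<open>w1\<close> is outside the kernel. Properness
    is what forbids a nonzero element of \<open>N\<close> that vanishes at 1.\<close>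
  then have "N \<noteq> carrier PS" using WC[OF f1(1)] by blast
  then have N_one: "f = (\<lambda>_. 0)" if "f \<in> N" "f (mat 1) = 0" for f
    using subrep_PS_eq_carrier[OF N that(1) _ that(2)] by blast
  \<comment> \<open>The action of \<open>weyl_s\<close> moves the value at \<open>weyl_s\<close> to
    the identity.\<close>
  have N_s: "f = (\<lambda>_. 0)" if f: "f \<in> N" "f weyl_s = 0" for f
  proof -
    have "act PS weyl_s f = (\<lambda>_. 0)"
      by (rule N_one) (use f N_sub(6)[of weyl_s f] in simp_all)
    then have "act PS (inv\<^bsub>GL2\<^esub> weyl_s) (act PS weyl_s f) = act PS (inv\<^bsub>GL2\<^esub> weyl_s) \<zero>\<^bsub>PS\<^esub>" by simp
    then show ?thesis
      using PS.act_inv_act[of weyl_s f] PS.act_zero[of "inv\<^bsub>GL2\<^esub> weyl_s"] NC[OF f(1)] by (simp add: inv_GL2 matrix_inv_weyl_s del: PS_simps(4))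
  qed
  have inv_up: "act PS (upper_unip x) f = f"
    if f: "f \<in> W" "act P (upper_unip x) (\<Phi> f) = \<Phi> f" for f x
  proof -
    have u: "act PS (upper_unip x) f \<in> W" using W_sub(6)[of "upper_unip x" f] f by simp
    have "(\<lambda>h. act PS (upper_unip x) f h - 1 * f h) \<in> N"
      by (rule cong_N) (use f u \<Phi>_act[of f "upper_unip x"] \<Phi>_closed in \<open>simp_all del: PS_simps(4)\<close>)
    then have "(\<lambda>h. act PS (upper_unip x) f h - 1 * f h) = (\<lambda>_. 0)"
      by (rule N_one) (use act_up_one[OF WC[OF f(1)], of x] in \<open>simp del: PS_simps(4)\<close>)
    then show ?thesis by (simp add: fun_eq_iff del: PS_simps(4))
  qed
  have inv_lo: "act PS (lower_unip x) f = f"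
    if f: "f \<in> W" "act P (lower_unip x) (\<Phi> f) = \<Phi> f" for f x
  proof -
    have u: "act PS (lower_unip x) f \<in> W" using W_sub(6)[of "lower_unip x" f] f by simp
    have "(\<lambda>h. act PS (lower_unip x) f h - 1 * f h) \<in> N"
      by (rule cong_N) (use f u \<Phi>_act[of f "lower_unip x"] \<Phi>_closed in \<open>simp_all del: PS_simps(4)\<close>)
    moreover have "act PS (lower_unip x) f weyl_s = f weyl_s"
    proof -
      \<comment> \<open>Conjugation by \<open>weyl_s\<close> turns the lower unipotent into an upper
        one, on which \<open>psi\<close> is trivial; hence the value at \<open>weyl_s\<close> is
        unchanged and the difference falls under \<open>N_s\<close>.\<close>
      have "weyl_s ** lower_unip x = upper_unip x ** weyl_s" by (simp add: weyl_s_def lower_unip_def upper_unip_def mat2_mult)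
      then show ?thesis using PS_borel[OF WC[OF f(1)], of "upper_unip x" weyl_s] psi_up[of x]
        by (simp add: upper_unip_def upper_triangular_iff)
    qed
    ultimately have "(\<lambda>h. act PS (lower_unip x) f h - 1 * f h) = (\<lambda>_. 0)"
      by (intro N_s) (simp_all del: PS_simps(4))
    then show ?thesis by (simp add: fun_eq_iff del: PS_simps(4))
  qed
  have finsum_W: "finsum ?W F A = (\<lambda>h. \<Sum>a\<in>A. F a h)" if "finite A" "F \<in> A \<rightarrow> W" for F and A :: "'k set"
  proof -
    interpret W: group_rep GL2 ?W by (rule group_rep_of[OF RW])
    show ?thesis using that
    proof (induction A)
      case empty
      then show ?case using W.finsum_empty by simp
    next
      case (insert a A)
      then show ?case by (subst W.finsum_insert) (auto simp: Pi_iff)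
    qed
  qed
  let ?T = "\<lambda>f h. \<Sum>a\<in>UNIV. act PS (upper_unip (lift a) ** weyl_s) f h"
  have T: "?T f \<in> W \<and> \<Phi> (?T f) = finsum P (\<lambda>a. act P (upper_unip (lift a) ** weyl_s) (\<Phi> f)) UNIV"
    if f: "f \<in> W" for f
  proof -
    interpret W: group_rep GL2 ?W by (rule group_rep_of[OF RW])
    let ?F = "\<lambda>a. act PS (upper_unip (lift a) ** weyl_s) f"
    have F: "?F \<in> UNIV \<rightarrow> W" using f W_sub(6) by (auto simp del: PS_simps(4))
    have e: "finsum ?W ?F UNIV = ?T f" using F by (intro finsum_W) simp_all
    have "?T f \<in> W" using W.finsum_closed[of ?F UNIV] F unfolding e by simp
    moreover have "\<Phi> (?T f) = finsum P (\<lambda>a. \<Phi> (?F a)) UNIV"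
      using rep_hom_finsum[OF RW P \<Phi>(1), of UNIV ?F] F unfolding e by simp
    ultimately show ?thesis using \<Phi>_act[OF f] by (simp del: PS_simps(4))
  qed
  have T_values: "?T f (mat 1) = 0 \<and> ?T f weyl_s = f (mat 1) + kap * f weyl_s"
    if f: "f \<in> W" "\<And>x. x \<in> integers \<Longrightarrow> act PS (upper_unip x) f = f"
      "\<And>x. x \<in> max_ideal \<Longrightarrow> act PS (lower_unip x) f = f" for f
    using hecke_sum_values[OF WC[OF f(1)] f(2,3)] by simp
  define f2 where "f2 = act PS Pi_mat f1"
  have PiG: "Pi_mat \<in> carrier GL2" by (simp add: Pi_mat_def)
  have f2: "f2 \<in> W" "\<Phi> f2 = w2"
    using f1 PiG W_sub(6) \<Phi>_act by (auto simp: f2_def w2(1) simp del: PS_simps(4))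
  define x y where "x = f1 (mat 1)" and "y = f1 weyl_s"
  define A B where "A = psi (mat2 1 0 0 unif)" and "B = psi (mat2 unif 0 0 1)"
  have AB: "A \<noteq> 0" "B \<noteq> 0" using psi_nonzero by (auto simp: A_def B_def upper_triangular_iff)
  have f2_values: "f2 (mat 1) = A * y" "f2 weyl_s = B * x"
    using Pi_values[OF WC[OF f1(1)]] by (simp_all add: f2_def A_def B_def x_def y_def del: PS_simps(4))
  have f1_up: "\<And>x. x \<in> integers \<Longrightarrow> act PS (upper_unip x) f1 = f1" and f1_lo: "\<And>x. x \<in> max_ideal \<Longrightarrow> act PS (lower_unip x) f1 = f1"
    using inv_up inv_lo f1 fix_up fix_lo by (auto simp del: PS_simps(4))
  have f2_up: "\<And>x. x \<in> integers \<Longrightarrow> act PS (upper_unip x) f2 = f2" and f2_lo: "\<And>x. x \<in> max_ideal \<Longrightarrow> act PS (lower_unip x) f2 = f2"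
    using inv_up inv_lo f2 fix_up fix_lo by (auto simp del: PS_simps(4))
  have E1: "(\<lambda>h. ?T f1 h - l1 * f1 h) \<in> N"
    by (rule cong_N) (use T[OF f1(1)] f1 T1 in \<open>simp_all del: PS_simps(4)\<close>)
  have E2: "(\<lambda>h. ?T f2 h - l2 * f2 h) \<in> N"
    by (rule cong_N) (use T[OF f2(1)] f2 T2 in \<open>simp_all del: PS_simps(4)\<close>)
  note V1 = T_values[OF f1(1) f1_up f1_lo] and V2 = T_values[OF f2(1) f2_up f2_lo]
  show False
  proof (cases "N = {\<lambda>_. 0}")
    case True
    have N0: "F h = 0" if "F \<in> N" for F h using that True by simp
    have e1: "?T f1 h = l1 * f1 h" for h using N0[OF E1, of h] by (simp del: PS_simps(4))
    have e2: "?T f2 h = l2 * f2 h" for h using N0[OF E2, of h] by (simp del: PS_simps(4))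
    have "f1 \<noteq> (\<lambda>_. 0)" using f1 w1 \<Phi>_zero by auto
    then have xy: "x \<noteq> 0 \<or> y \<noteq> 0"
      using iwahori_invariant_eq_0[OF WC[OF f1(1)] _ _ f1_up f1_lo] by (auto simp: x_def y_def)
    have q: "l1 * x = 0" "x + kap * y = l1 * y" "l2 * (A * y) = 0" "A * y + kap * (B * x) = l2 * (B * x)"
      using V1 V2 e1[of "mat 1"] e1[of weyl_s] e2[of "mat 1"] e2[of weyl_s]
      unfolding f2_values x_def[symmetric] y_def[symmetric] by metis+
    \<comment> \<open>A nonzero \<open>l1\<close> would give \<open>x = 0\<close> and
      \<open>l2 = 0\<close>, and then the fourth equation gives \<open>y = 0\<close>; a nonzero
      \<open>l2\<close> is excluded symmetrically.\<close>
    have l0: "l1 = 0" "l2 = 0" using q xy l AB by auto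
    then have xy': "x \<noteq> 0" "y \<noteq> 0" using q xy AB by auto
    from regular[OF l0] obtain a d c1 c2 where r: "a \<noteq> 0" "d \<noteq> 0" "c1 \<noteq> c2"
      "act P (mat2 a 0 0 d) w1 = c1 \<odot>\<^bsub>P\<^esub> w1" "act P (mat2 d 0 0 a) w1 = c2 \<odot>\<^bsub>P\<^esub> w1" by blast
    have h: "act PS (mat2 a 0 0 d) f1 h = c1 * f1 h"
      if "a \<noteq> 0" "d \<noteq> 0" "act P (mat2 a 0 0 d) w1 = c1 \<odot>\<^bsub>P\<^esub> w1" for a d c1 h
    proof -
      have "(\<lambda>h. act PS (mat2 a 0 0 d) f1 h - c1 * f1 h) \<in> N"
        by (rule cong_N) (use f1 W_sub(6)[of "mat2 a 0 0 d" f1] \<Phi>_act[of f1 "mat2 a 0 0 d"] that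
            in \<open>simp_all del: PS_simps(4)\<close>)
      from N0[OF this, of h] show ?thesis by (simp del: PS_simps(4))
    qed
    note diag = act_diag_one[OF WC[OF f1(1)]] act_diag_s[OF WC[OF f1(1)], where y = 0]
    \<comment> \<open>Evaluating the action of the matrix with entries \<open>a\<close>,
      \<open>d\<close> at \<open>weyl_s\<close>, and that of the matrix with \<open>d\<close>,
      \<open>a\<close> at 1, produces the same value of \<open>psi\<close>. Both evaluations are
      possible because neither \<open>x\<close> nor \<open>y\<close> is zero.\<close>
    have "psi (mat2 d 0 0 a) = c1"
      using diag(2)[OF r(1,2)] h[OF r(1,2,4), of weyl_s] xy'(2) by (simp add: up_0 y_def del: PS_simps(4))
    moreover have "psi (mat2 d 0 0 a) = c2"
      using diag(1)[OF r(2,1)] h[OF r(2,1,5), of "mat 1"] xy'(1) by (simp add: x_def del: PS_simps(4))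
    ultimately show False using r(3) by simp
  next
    case False
    then obtain f0 where f0: "f0 \<in> N" "f0 \<noteq> (\<lambda>_. 0)" using N_sub(2) by auto
    define x0 y0 where "x0 = f0 (mat 1)" and "y0 = f0 weyl_s"
    have xy0: "x0 \<noteq> 0" "y0 \<noteq> 0" using N_one N_s f0 by (auto simp: x0_def y0_def)
    have f0W: "f0 \<in> W" "\<Phi> f0 = \<zero>\<^bsub>P\<^esub>" using f0 by (auto simp: N_def)
    have f0_up: "\<And>x. act PS (upper_unip x) f0 = f0" and f0_lo: "\<And>x. act PS (lower_unip x) f0 = f0"
      using inv_up inv_lo f0W by (auto simp del: PS_simps(4))
    have V0: "?T f0 (mat 1) = 0 \<and> ?T f0 weyl_s = x0 + kap * y0"
      using T_values[OF f0W(1) f0_up f0_lo] by (simp only: x0_def y0_def)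
    \<comment> \<open>The Hecke sum preserves \<open>N\<close>, and its result vanishes at 1; so it
      is zero, and its value at \<open>weyl_s\<close> relates \<open>x0\<close>, \<open>y0\<close>
      and \<open>kap\<close>.\<close>
    have "(\<lambda>h. ?T f0 h - 0 * f0 h) \<in> N"
      by (rule cong_N) (use T[OF f0W(1)] f0W in \<open>simp_all del: PS_simps(4)\<close>)
    then have "?T f0 \<in> N" by (simp del: PS_simps(4))
    then have "?T f0 = (\<lambda>_. 0)" using N_one V0 by blast
    from fun_cong[OF this, of weyl_s] have k0: "x0 + kap * y0 = 0" using V0 by argo
    \<comment> \<open>\<open>N\<close> is a line: an element of \<open>N\<close> minus the multiple
      of \<open>f0\<close> with the same value at 1 vanishes at 1 and hence everywhere.\<close>
    have proportional: "n weyl_s * x0 = n (mat 1) * y0" if n: "n \<in> N" for n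
    proof -
      have "(\<lambda>h. n h - (n (mat 1) / x0) * f0 h) \<in> N"
        by (rule cong_N) (use n f0W in \<open>auto simp: N_def\<close>)
      then have "(\<lambda>h. n h - (n (mat 1) / x0) * f0 h) = (\<lambda>_. 0)"
        by (rule N_one) (use xy0 in \<open>simp add: x0_def\<close>)
      then have "n weyl_s = n (mat 1) / x0 * y0"
        using fun_cong[of _ _ weyl_s] by (fastforce simp: y0_def)
      then show ?thesis using xy0 by simp
    qed
    \<comment> \<open>Were the two pairs of values proportional, then \<open>f\<close> minus a
      multiple of \<open>f0\<close> would be Iwahori-fixed with both values zero, hence zero, and
      \<open>f\<close> would lie in the kernel of \<open>\<Phi>\<close>.\<close>
    have not_prop: "f weyl_s * x0 \<noteq> f (mat 1) * y0"
      if f: "f \<in> W" "\<Phi> f \<noteq> \<zero>\<^bsub>P\<^esub>" "\<And>x. x \<in> integers \<Longrightarrow> act PS (upper_unip x) f = f"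
        "\<And>x. x \<in> max_ideal \<Longrightarrow> act PS (lower_unip x) f = f" for f
    proof
      assume e: "f weyl_s * x0 = f (mat 1) * y0"
      let ?c = "f (mat 1) / x0" and ?g = "\<lambda>h. f h - (f (mat 1) / x0) * f0 h"
      have g: "?g \<in> W" using W_add[OF f(1) W_smult[OF f0W(1), of "- ?c"]] by simp
      have "?g = (\<lambda>_. 0)"
      proof (rule iwahori_invariant_eq_0)
        show "?g \<in> carrier PS" using g WC by blast
        show "?g (mat 1) = 0" "?g weyl_s = 0"
          using xy0 e by (simp_all add: x0_def y0_def[symmetric] field_simps) 
        show "act PS (upper_unip x) ?g = ?g" if x: "x \<in> integers" for x
        proof
          fix h show "act PS (upper_unip x) ?g h = ?g h"
            using fun_cong[OF f(3)[OF x], of h] fun_cong[OF f0_up[of x], of h] by (simp split: if_splits)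
        qed
        show "act PS (lower_unip x) ?g = ?g" if x: "x \<in> max_ideal" for x
        proof
          fix h show "act PS (lower_unip x) ?g h = ?g h"
            using fun_cong[OF f(4)[OF x], of h] fun_cong[OF f0_lo[of x], of h] by (simp split: if_splits)
        qed
      qed
      then have "f h = ?c * f0 h" for h using fun_cong[of ?g "\<lambda>_. 0" h] by (simp only: right_minus_eq)
      then have "f = (\<lambda>h. ?c * f0 h)" by blast
      from arg_cong[OF this, of \<Phi>] have "\<Phi> f = ?c \<odot>\<^bsub>P\<^esub> \<Phi> f0" unfolding \<Phi>_smult[OF f0W(1)] .
      then show False using f(2) f0W(2) by simp
    qed
    \<comment> \<open>The pair of \<open>?T f - l f\<close> is proportional to
      \<open>(x0, y0)\<close>. Substituting \<open>x0 = - kap * y0\<close> makes the relation a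
      product of \<open>kap - l\<close> and the determinant of the two pairs, which
      \<open>not_prop\<close> shows to be nonzero.\<close>
    have key: "l = kap" if f: "f \<in> W" "\<Phi> f \<noteq> \<zero>\<^bsub>P\<^esub>" "\<And>x. x \<in> integers \<Longrightarrow> act PS (upper_unip x) f = f"
        "\<And>x. x \<in> max_ideal \<Longrightarrow> act PS (lower_unip x) f = f" and E: "(\<lambda>h. ?T f h - l * f h) \<in> N" for f l
    proof -
      have V: "?T f (mat 1) = 0" "?T f weyl_s = f (mat 1) + kap * f weyl_s"
        using T_values[OF f(1,3,4)] by blast+
      have "(f (mat 1) + kap * f weyl_s - l * f weyl_s) * x0 = (0 - l * f (mat 1)) * y0"
        using proportional[OF E] unfolding V .
      moreover have "x0 = - (kap * y0)" using k0 by (simp add: eq_neg_iff_add_eq_0)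
      ultimately have "(kap - l) * (f weyl_s * x0 - f (mat 1) * y0) = 0" by (simp add: algebra_simps)
      then show ?thesis using not_prop[OF f] by simp
    qed
    have "w2 \<noteq> \<zero>\<^bsub>P\<^esub>" using w1 w2 PiG by auto
    then have "l1 = kap" "l2 = kap"
      using key[OF f1(1) _ f1_up f1_lo E1] key[OF f2(1) _ f2_up f2_lo E2] f1(2) f2(2) w1(2) by blast+
    \<comment> \<open>One of the eigenvalues is 0, so \<open>kap = 0\<close>, and the relation
      \<open>k0\<close> leaves \<open>x0 = 0\<close>.\<close>
    then show False using l k0 xy0 by auto
  qed
qed

end

section \<open>Representations of the finite group\<close>

context group_rep
begin

lemma act_finsum:
  assumes "g \<in> carrier G" "finite A" "f \<in> A \<rightarrow> carrier V"
  shows "act V g (finsum V f A) = finsum V (\<lambda>a. act V g (f a)) A"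
  using assms(2,3)
proof (induction A)
  case empty
  then show ?case using assms(1) by simp
next
  case (insert a A)
  then show ?case using assms(1) by (simp add: Pi_iff act_add)
qed

lemma smult_finsum:
  assumes "finite A" "f \<in> A \<rightarrow> carrier V"
  shows "c \<odot> finsum V f A = finsum V (\<lambda>a. c \<odot> f a) A"
  using assms
proof (induction A)
  case (insert a A)
  then show ?case by (simp add: Pi_iff smult_add_vec)
qed simp

lemma finsum_const_smult:
  assumes "finite A" "v \<in> carrier V"
  shows "finsum V (\<lambda>_. v) A = of_nat (card A) \<odot> v"
  using assms by (induction A) (simp_all add: smult_add_scalar)

end

lemma subrep_finsum:
  assumes "representation G V" "subrep G W V" "finite A" "f \<in> A \<rightarrow> W"
  shows "finsum V f A \<in> W"
proof -
  interpret V: group_rep G V by (rule group_rep_of) fact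
  note W = subrepD[OF assms(1,2)]
  show ?thesis using assms(3,4)
  proof (induction A)
    case (insert a A)
    then show ?case using W(1,3) by (subst V.finsum_insert) (auto simp: Pi_iff)
  qed (simp add: W(2))
qed

text \<open>What the later argument retains of a weight and its U-fixed vector: the torus character,
  the eigenvalue \<open>l\<close> of the finite analogue of \<open>T\<close>, and that the vector
  generates. The kinds of irreducible representation then differ only through \<open>chi\<close> and
  \<open>l\<close>.\<close>

definition eigen_generator ::
    "('k::finite_field^2^2 \<Rightarrow> 'c::field) \<Rightarrow> 'c \<Rightarrow> ('c, 'v, 'k^2^2) rep \<Rightarrow> 'v \<Rightarrow> bool" where
  "eigen_generator chi l R v \<longleftrightarrow>
     (\<forall>a d. a \<noteq> 0 \<longrightarrow> d \<noteq> 0 \<longrightarrow> act R (mat2 a 0 0 d) v = chi (mat2 a 0 0 d) \<odot>\<^bsub>R\<^esub> v) \<and>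
     finsum R (\<lambda>a. act R (upper_unip a ** weyl_s) v) UNIV = l \<odot>\<^bsub>R\<^esub> v \<and>
     (\<forall>W. subrep GL2 W R \<longrightarrow> v \<in> W \<longrightarrow> W = carrier R)"

lemma eigen_generator_iso:
  assumes R: "representation GL2 R" and S: "representation GL2 S"
    and \<phi>: "\<phi> \<in> rep_hom GL2 R S" "bij_betw \<phi> (carrier R) (carrier S)"
    and v: "v \<in> carrier R" and e: "eigen_generator chi l S (\<phi> v)"
  shows "eigen_generator chi l R v"
proof -
  interpret R: group_rep GL2 R by (rule group_rep_of) fact
  interpret S: group_rep GL2 S by (rule group_rep_of) fact
  have inj: "x = y" if "x \<in> carrier R" "y \<in> carrier R" "\<phi> x = \<phi> y" for x y
    using \<phi>(2) that by (auto simp: bij_betw_def inj_on_def)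
  have "act R (mat2 a 0 0 d) v = chi (mat2 a 0 0 d) \<odot>\<^bsub>R\<^esub> v" if "a \<noteq> 0" "d \<noteq> 0" for a d
    using that e v by (intro inj) (simp_all add: eigen_generator_def rep_hom_act[OF \<phi>(1)] rep_hom_smult[OF \<phi>(1)])
  moreover have "finsum R (\<lambda>a. act R (upper_unip a ** weyl_s) v) UNIV = l \<odot>\<^bsub>R\<^esub> v"
  proof (rule inj)
    have "\<phi> (finsum R (\<lambda>a. act R (upper_unip a ** weyl_s) v) UNIV) =
        finsum S (\<lambda>a. \<phi> (act R (upper_unip a ** weyl_s) v)) UNIV"
      using v by (intro rep_hom_finsum[OF R S \<phi>(1)]) auto
    then show "\<phi> (finsum R (\<lambda>a. act R (upper_unip a ** weyl_s) v) UNIV) = \<phi> (l \<odot>\<^bsub>R\<^esub> v)"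
      using e v by (simp add: eigen_generator_def rep_hom_act[OF \<phi>(1)] rep_hom_smult[OF \<phi>(1)])
  qed (use v in auto)
  moreover have "W = carrier R" if W: "subrep GL2 W R" "v \<in> W" for W
  proof -
    note Ws = subrepD[OF R W(1)]
    have Wc: "x \<in> W \<Longrightarrow> x \<in> carrier R" for x using Ws(1) by blast
    have "subrep GL2 (\<phi> ` W) S"
    proof (rule subrepI[OF S])
      show "\<phi> ` W \<subseteq> carrier S" using Wc rep_hom_closed[OF \<phi>(1)] by blast
      show "\<zero>\<^bsub>S\<^esub> \<in> \<phi> ` W" using Ws(2) rep_hom_zero[OF R S \<phi>(1)] by force
      show "x \<oplus>\<^bsub>S\<^esub> y \<in> \<phi> ` W" if "x \<in> \<phi> ` W" "y \<in> \<phi> ` W" for x y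
        using that Wc Ws(3) by (auto simp flip: rep_hom_add[OF \<phi>(1)])
      show "c \<odot>\<^bsub>S\<^esub> x \<in> \<phi> ` W" if "x \<in> \<phi> ` W" for c x
        using that Wc Ws(5) by (auto simp flip: rep_hom_smult[OF \<phi>(1)])
      show "act S g x \<in> \<phi> ` W" if "g \<in> carrier GL2" "x \<in> \<phi> ` W" for g x
        using that Wc Ws(6) by (auto simp flip: rep_hom_act[OF \<phi>(1)])
    qed
    then have "\<phi> ` W = carrier S" using e W(2) unfolding eigen_generator_def by blast
    then show ?thesis
      using \<phi>(2) Ws(1) by (metis bij_betw_def inj_on_image_eq_iff order_refl)
  qed
  ultimately show ?thesis unfolding eigen_generator_def by blast
qed

text \<open>For \<open>c \<noteq> 0\<close> exactly one \<open>x\<close> is excluded, which leaves q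
  - 1 = -1 in the coefficients. For \<open>c = 0\<close> the condition always holds, and q =
  0.\<close>

lemma up_zero_sum: "(\<Sum>x\<in>(UNIV :: 'k::finite_field set). if c * x + d \<noteq> 0 then 1 else (0 :: 'c::field)) =
    (if c \<noteq> 0 then - 1 else 0)" if "CHAR('c) = CHAR('k)" "c \<noteq> 0 \<or> d \<noteq> 0"
proof -
  have q: "of_nat CARD('k) = (0 :: 'c)"
    using of_nat_card_finite_field[where 'k = 'k] that(1) by (simp add: of_nat_eq_0_iff_char_dvd)
  show ?thesis
  proof (cases "c = 0")
    case True
    then show ?thesis using that q by simp
  next
    case False
    then have "{x. c * x + d \<noteq> 0} = UNIV - {- d / c}" by (auto simp: field_simps add_eq_0_iff)
    then have "card {x. c * x + d \<noteq> 0} = CARD('k) - 1" by simp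
    then have "of_nat (card {x. c * x + d \<noteq> 0}) = (of_nat CARD('k) - 1 :: 'c)"
      by (simp add: of_nat_diff Suc_leI)
    then show ?thesis using False q by (simp add: sum.If_cases)
  qed
qed

context
  fixes chi :: "'k::finite_field^2^2 \<Rightarrow> 'c::field" and R :: "('c, 'v, 'k^2^2) rep" and v :: 'v
  assumes R: "representation GL2 R" and char: "CHAR('c) = CHAR('k)"
    and v: "v \<in> carrier R" "v \<noteq> \<zero>\<^bsub>R\<^esub>"
begin

interpretation R: group_rep GL2 R by (rule group_rep_of) (rule R)

text \<open>The sum \<open>?x\<close> is again U-invariant, so the torus acts on it through
  \<open>chi\<close>. But carrying \<open>h\<close> past \<open>weyl_s\<close> inside the sum makes
  it act on \<open>v\<close> through the conjugate character. Since the two differ at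
  \<open>h\<close>, the sum is zero.\<close>

lemma eigen_generator_regular:
  assumes irr: "irreducible_rep GL2 R"
    and u: "\<And>x. act R (upper_unip x) v = v"
    and b: "\<And>b v. b \<in> upper_triangular \<Longrightarrow> v \<in> carrier R \<Longrightarrow> (\<And>x. act R (upper_unip x) v = v) \<Longrightarrow>
      act R b v = chi (mat2 (b$1$1) 0 0 (b$2$2)) \<odot>\<^bsub>R\<^esub> v"
    and h: "h \<in> diagonal" "chi h \<noteq> conj_s chi h"
  shows "eigen_generator chi 0 R v"
proof -
  let ?x = "finsum R (\<lambda>a. act R (upper_unip a ** weyl_s) v) UNIV"
  have xc: "?x \<in> carrier R" using v by (intro R.finsum_closed) auto
  have x_up: "act R (upper_unip y) ?x = ?x" for y
  proof -
    have "act R (upper_unip y) ?x = finsum R (\<lambda>a. act R (upper_unip (y + a) ** weyl_s) v) UNIV"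
      using v by (subst R.act_finsum) (auto simp: R.act_mult[symmetric] up_add matrix_mul_assoc
          intro!: R.finsum_cong')
    also have "\<dots> = finsum R (\<lambda>a. act R (upper_unip a ** weyl_s) v) ((\<lambda>a. y + a) ` UNIV)"
      using v by (intro R.finsum_reindex[symmetric]) auto
    finally show ?thesis by (simp add: surj_plus)
  qed
  obtain a d where h_eq: "h = mat2 a 0 0 d" and ad: "a \<noteq> 0" "d \<noteq> 0"
    using h(1) mat2_eta[of h] by (auto simp: diagonal_iff)
  have "chi h \<odot>\<^bsub>R\<^esub> ?x = act R h ?x"
    using b[OF _ xc x_up, of h] ad by (simp add: h_eq upper_triangular_iff)
  also have "act R h ?x = finsum R (\<lambda>x. act R (h ** (upper_unip x ** weyl_s)) v) UNIV"
    using v ad by (subst R.act_finsum) (auto simp: R.act_mult[symmetric] h_eq intro!: R.finsum_cong')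
  also have "\<dots> = finsum R (\<lambda>x. conj_s chi h \<odot>\<^bsub>R\<^esub> act R (upper_unip (a / d * x) ** weyl_s) v) UNIV"
  proof (rule R.finsum_cong'[OF refl])
    fix x
    \<comment> \<open>The factor \<open>a / d\<close> only permutes the summation index; the torus
      element comes out on the right with its entries exchanged.\<close>
    have "h ** (upper_unip x ** weyl_s) = (upper_unip (a / d * x) ** weyl_s) ** mat2 d 0 0 a"
      using ad by (simp add: h_eq upper_unip_def weyl_s_def mat2_mult)
    then have "act R (h ** (upper_unip x ** weyl_s)) v = act R (upper_unip (a / d * x) ** weyl_s) (act R (mat2 d 0 0 a) v)"
      using v ad R.act_mult[of "upper_unip (a / d * x) ** weyl_s" "mat2 d 0 0 a" v] by simp
    also have "act R (mat2 d 0 0 a) v = conj_s chi h \<odot>\<^bsub>R\<^esub> v"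
      using b[OF _ v(1) u, of "mat2 d 0 0 a"] ad by (simp add: h_eq upper_triangular_iff conj_s_mat2)
    finally show "act R (h ** (upper_unip x ** weyl_s)) v = conj_s chi h \<odot>\<^bsub>R\<^esub> act R (upper_unip (a / d * x) ** weyl_s) v"
      using v by (simp add: R.act_smult)
  qed (use v in auto)
  also have "\<dots> = conj_s chi h \<odot>\<^bsub>R\<^esub> finsum R (\<lambda>x. act R (upper_unip (a / d * x) ** weyl_s) v) UNIV"
    using v by (subst R.smult_finsum) auto
  also have "finsum R (\<lambda>x. act R (upper_unip (a / d * x) ** weyl_s) v) UNIV =
      finsum R (\<lambda>a. act R (upper_unip a ** weyl_s) v) ((\<lambda>x. a / d * x) ` UNIV)"
    using v ad by (intro R.finsum_reindex[symmetric]) (auto intro!: inj_onI)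
  also have "(\<lambda>x. a / d * x) ` UNIV = UNIV"
    using ad by (intro surjI[of _ "\<lambda>y. y * d / a"]) simp
  finally have "chi h \<odot>\<^bsub>R\<^esub> ?x = conj_s chi h \<odot>\<^bsub>R\<^esub> ?x" .
  then have "(chi h + - conj_s chi h) \<odot>\<^bsub>R\<^esub> ?x = (conj_s chi h + - conj_s chi h) \<odot>\<^bsub>R\<^esub> ?x"
    using xc by (simp only: R.smult_add_scalar)
  then have "(chi h - conj_s chi h) \<odot>\<^bsub>R\<^esub> ?x = \<zero>\<^bsub>R\<^esub>" using xc by simp
  from R.smult_eq_zeroD[OF xc this] h(2) have "?x = \<zero>\<^bsub>R\<^esub>" by (simp only: right_minus_eq simp_thms)
  moreover have "act R (mat2 a 0 0 d) v = chi (mat2 a 0 0 d) \<odot>\<^bsub>R\<^esub> v" if "a \<noteq> 0" "d \<noteq> 0" for a d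
    using b[OF _ v(1) u, of "mat2 a 0 0 d"] that by (simp add: upper_triangular_iff)
  ultimately show ?thesis
    using irreducible_subrep_eq[OF irr] v by (auto simp: eigen_generator_def)
qed

text \<open>Every summand is the same multiple of \<open>v\<close>, since each matrix has
  determinant \<open>- 1\<close>, and the number of summands is 0 in the coefficients. Any nonzero
  vector generates because the representation is a line.\<close>

lemma eigen_generator_det_char:
  assumes chi: "\<And>h. h \<in> diagonal \<Longrightarrow> chi h = chi' (det h)"
    and iso: "rep_iso GL2 R (char_rep (\<lambda>g. chi' (det g)))"
  shows "eigen_generator chi 0 R v"
proof -
  let ?C = "char_rep (\<lambda>g :: 'k^2^2. chi' (det g))"
  obtain \<phi> where \<phi>: "\<phi> \<in> rep_hom GL2 R ?C" "bij_betw \<phi> (carrier R) (carrier ?C)"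
    using iso by (auto simp: rep_iso_def)
  have inj: "x = y" if "x \<in> carrier R" "y \<in> carrier R" "\<phi> x = \<phi> y" for x y
    using \<phi>(2) that by (auto simp: bij_betw_def inj_on_def)
  have sm: "\<phi> (c \<odot>\<^bsub>R\<^esub> x) = c * \<phi> x" if "x \<in> carrier R" for c x
    using rep_hom_smult[OF \<phi>(1) that] by (simp add: char_rep_def)
  have ac: "act R g x = chi' (det g) \<odot>\<^bsub>R\<^esub> x" if "g \<in> carrier GL2" "x \<in> carrier R" for g x
    using that rep_hom_act[OF \<phi>(1) that(2,1)] by (intro inj) (simp_all add: sm, simp add: char_rep_def)
  have "finsum R (\<lambda>a. act R (upper_unip a ** weyl_s) v) UNIV = finsum R (\<lambda>a. chi' (- 1) \<odot>\<^bsub>R\<^esub> v) (UNIV :: 'k set)"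
    using v by (intro R.finsum_cong') (auto simp: ac det_mul upper_unip_def weyl_s_def)
  also have "\<dots> = of_nat CARD('k) \<odot>\<^bsub>R\<^esub> (chi' (- 1) \<odot>\<^bsub>R\<^esub> v)"
    using v by (subst R.finsum_const_smult) auto
  also have "\<dots> = 0 \<odot>\<^bsub>R\<^esub> v"
  proof -
    have "of_nat CARD('k) = (0 :: 'c)"
      using of_nat_card_finite_field[where 'k = 'k] char by (simp add: of_nat_eq_0_iff_char_dvd)
    then show ?thesis using v by simp
  qed
  finally have "finsum R (\<lambda>a. act R (upper_unip a ** weyl_s) v) UNIV = 0 \<odot>\<^bsub>R\<^esub> v" .
  moreover have "W = carrier R" if W: "subrep GL2 W R" "v \<in> W" for W
  proof
    note Ws = subrepD[OF R W(1)]
    show "W \<subseteq> carrier R" by (rule Ws)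
    have "\<phi> v \<noteq> 0"
    proof
      assume "\<phi> v = 0"
      then have "\<phi> v = \<phi> (0 \<odot>\<^bsub>R\<^esub> v)" using v by (simp only: sm mult_zero_left)
      then show False using inj[of v "0 \<odot>\<^bsub>R\<^esub> v"] v by simp
    qed
    then have "x = (\<phi> x / \<phi> v) \<odot>\<^bsub>R\<^esub> v" if "x \<in> carrier R" for x
      using that v by (intro inj) (simp_all add: sm)
    then show "carrier R \<subseteq> W" using Ws(5)[OF W(2)] by (metis subsetI)
  qed
  ultimately show ?thesis
    using v by (auto simp: eigen_generator_def ac chi diagonal_iff)
qed

end

section \<open>Functions on the finite flag variety and the Steinberg representation\<close>

abbreviation flag_rep :: "('c::field, 'k::field^2^2 \<Rightarrow> 'c, 'k^2^2) rep" where
  "flag_rep \<equiv> fun_rep GL2 (char_rep (\<lambda>_. 1)) (equivariant_funs GL2 upper_triangular (char_rep (\<lambda>_. 1)))"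

lemma flag_rep_simps:
  "\<zero>\<^bsub>flag_rep\<^esub> = (\<lambda>_. 0)" "f \<oplus>\<^bsub>flag_rep\<^esub> f' = (\<lambda>h. f h + f' h)"
  "c \<odot>\<^bsub>flag_rep\<^esub> f = (\<lambda>h. c * f h)"
  "act flag_rep g f = (\<lambda>h. if h \<in> carrier GL2 then f (h ** g) else 0)"
  by (auto simp: fun_rep_def fun_module_def module.defs rep.defs char_rep_def right_transl_def)

lemma in_flag_rep:
  "f \<in> carrier flag_rep \<longleftrightarrow> (\<forall>g. g \<notin> carrier GL2 \<longrightarrow> f g = 0) \<and>
     (\<forall>b\<in>upper_triangular. \<forall>g\<in>carrier GL2. f (b ** g) = f g)"
  by (simp add: fun_rep_def fun_module_def module.defs rep.defs equivariant_funs_def char_rep_def)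

lemma flag_rep_borel:
  assumes "f \<in> carrier flag_rep" "b \<in> upper_triangular"
  shows "f b = f (mat 1)"
proof -
  have "\<forall>g\<in>carrier GL2. f (b ** g) = f g" using assms unfolding in_flag_rep by blast
  from bspec[OF this, of "mat 1"] show ?thesis by simp
qed

lemma flag_rep_eqI:
  assumes "f \<in> carrier flag_rep" "f' \<in> carrier flag_rep" "f (mat 1) = f' (mat 1)"
    "\<And>y. f (weyl_s ** upper_unip y) = f' (weyl_s ** upper_unip y)"
  shows "f = f'"
proof
  fix g show "f g = f' g"
  proof (cases "g \<in> carrier GL2")
    case True
    then show ?thesis
    proof (cases rule: bruhat_cases)
      case 1
      then show ?thesis using flag_rep_borel[OF assms(1)] flag_rep_borel[OF assms(2)] assms(3) by simp
    next
      case (2 b y)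
      then show ?thesis using assms by (simp add: in_flag_rep)
    qed
  qed (use assms in \<open>simp add: in_flag_rep\<close>)
qed

lemma representation_flag_rep:
  "representation GL2 (flag_rep :: ('a::field, 'b::field^2^2 \<Rightarrow> 'a, 'b^2^2) rep)"
proof (rule representationI)
  show "group (GL2 :: ('b^2^2) monoid)" by (rule group_GL2)
next
  fix f assume "f \<in> carrier flag_rep"
  then show "act flag_rep \<one>\<^bsub>GL2\<^esub> f = f" by (auto simp: in_flag_rep flag_rep_simps)
next
  fix f :: "'b^2^2 \<Rightarrow> 'a" and g :: "'b^2^2"
  assume "g \<in> carrier GL2" "f \<in> carrier flag_rep"
  then show "act flag_rep g f \<in> carrier flag_rep"
    by (simp add: in_flag_rep flag_rep_simps borel_in_GL2 flip: matrix_mul_assoc)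
next
  fix f :: "'b^2^2 \<Rightarrow> 'a" and g h :: "'b^2^2" assume "g \<in> carrier GL2" "h \<in> carrier GL2"
  then show "act flag_rep (g \<otimes>\<^bsub>GL2\<^esub> h) f = act flag_rep g (act flag_rep h f)"
    by (simp add: flag_rep_simps fun_eq_iff matrix_mul_assoc)
qed (auto simp: flag_rep_simps in_flag_rep algebra_simps)

lemma representation_twist:
  assumes V: "representation G V" and psi: "psi \<one>\<^bsub>G\<^esub> = 1"
    "\<And>g h. g \<in> carrier G \<Longrightarrow> h \<in> carrier G \<Longrightarrow> psi (g \<otimes>\<^bsub>G\<^esub> h) = psi g * psi h"
  shows "representation G (twist V psi)"
proof -
  interpret V: group_rep G V by (rule group_rep_of) fact
  show ?thesis
    by (rule representationI)
      (simp_all add: twist_def V.group V.smult_add_vec V.smult_add_scalar V.smult_assoc psi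
        V.act_add V.act_smult V.act_mult V.a_ac flip: V.smult_assoc, simp_all add: mult_ac)
qed

lemma constants_subrep:
  "subrep GL2 {f. \<exists>c. f = (\<lambda>g. if g \<in> carrier GL2 then c else 0)} flag_rep"
proof (rule subrepI[OF representation_flag_rep])
  show "act flag_rep g f \<in> {f. \<exists>c. f = (\<lambda>g. if g \<in> carrier GL2 then c else 0)}"
    if "g \<in> carrier GL2" "f \<in> {f. \<exists>c. f = (\<lambda>g. if g \<in> carrier GL2 then c else 0)}" for g f
    using that by (auto simp: flag_rep_simps fun_eq_iff)
qed (auto simp: in_flag_rep flag_rep_simps fun_eq_iff borel_in_GL2 intro: exI[of _ 0])

lemma representation_steinberg: "representation GL2 steinberg"
  unfolding steinberg_def by (rule quotient_rep_canonical(1)[OF representation_flag_rep constants_subrep])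

lemma finsum_flag_rep:
  assumes "finite A" "F \<in> A \<rightarrow> carrier flag_rep"
  shows "finsum flag_rep F A = (\<lambda>h. \<Sum>a\<in>A. F a h)"
proof -
  interpret W: group_rep GL2 flag_rep by (rule group_rep_of[OF representation_flag_rep])
  show ?thesis using assms
  proof (induction A)
    case empty
    then show ?case using W.finsum_empty by (simp add: flag_rep_simps)
  next
    case (insert a A)
    then show ?case by (subst W.finsum_insert) (auto simp: Pi_iff flag_rep_simps)
  qed
qed

text \<open>A \<open>U\<close>-invariant vector of the Steinberg representation is represented by a multiple of the
  indicator function of the big cell.\<close>

lemma eigen_generator_steinberg:
  fixes v :: "('k::finite_field^2^2 \<Rightarrow> 'c::field) set"
  assumes char: "CHAR('c) = CHAR('k)"
    and v: "v \<in> carrier steinberg" "v \<noteq> \<zero>\<^bsub>steinberg\<^esub>" "\<And>x. act steinberg (upper_unip x) v = v"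
  shows "eigen_generator (\<lambda>_. 1) (- 1) steinberg v"
proof -
  let ?F = "flag_rep :: ('c, 'k^2^2 \<Rightarrow> 'c, 'k^2^2) rep" and ?S = "steinberg :: ('c, ('k^2^2 \<Rightarrow> 'c) set, 'k^2^2) rep"
  let ?C = "{f :: 'k^2^2 \<Rightarrow> 'c. \<exists>c. f = (\<lambda>g. if g \<in> carrier GL2 then c else 0)}"
  define q where "q = (\<lambda>f. ?C +>\<^bsub>?F\<^esub> f)"
  interpret F: group_rep GL2 ?F by (rule group_rep_of[OF representation_flag_rep])
  interpret S: group_rep GL2 ?S by (rule group_rep_of[OF representation_steinberg])
  note can = quotient_rep_canonical[OF representation_flag_rep constants_subrep, folded steinberg_def]
  have q_hom: "q \<in> rep_hom GL2 ?F ?S" unfolding q_def by (rule can(2))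
  have q_surj: "q ` carrier ?F = carrier ?S" unfolding q_def by (rule can(3))
  have q_zero: "q x = \<zero>\<^bsub>?S\<^esub> \<longleftrightarrow> x \<in> ?C" if "x \<in> carrier ?F" for x
    unfolding q_def by (rule can(4)[OF that])
  note q = rep_hom_closed[OF q_hom] rep_hom_add[OF q_hom] rep_hom_smult[OF q_hom] rep_hom_act[OF q_hom]
  have cC: "(\<lambda>g. if g \<in> carrier GL2 then c else 0) \<in> carrier ?F" for c
    by (simp add: in_flag_rep borel_in_GL2)
  obtain f where f: "f \<in> carrier ?F" "v = q f" using v(1)[folded q_surj] by (elim imageE)
  define k where "k = f (mat 1)"
  \<comment> \<open>Subtracting the constant \<open>f (mat 1)\<close> chooses, in the class of
    \<open>v\<close>, the representative that vanishes at the identity.\<close>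
  define f1 where "f1 = (\<lambda>h. f h + (if h \<in> carrier GL2 then - k else 0))"
  have f1c: "f1 \<in> carrier ?F" using F.a_closed[OF f(1) cC[of "- k"]] by (simp add: f1_def flag_rep_simps)
  have "q (\<lambda>g. if g \<in> carrier GL2 then - k else 0) = \<zero>\<^bsub>?S\<^esub>" by (subst q_zero[OF cC]) blast
  then have qf1: "v = q f1"
    using q(2)[OF f(1) cC[of "- k"]] f S.r_zero[OF v(1)] by (simp add: f1_def flag_rep_simps)
  have f1_1: "f1 (mat 1) = 0" by (simp add: f1_def k_def)
  have f1_borel: "f1 (b ** g) = f1 g" if "b \<in> upper_triangular" "g \<in> carrier GL2" for b g
    using f1c that by (simp add: in_flag_rep)
  define c0 where "c0 = f1 weyl_s"
  \<comment> \<open>Invariance of the class says that translation changes \<open>f1\<close> by a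
    constant; evaluation at the identity, where both terms vanish, shows that this constant is
    0.\<close>
  have f1_s: "f1 (weyl_s ** upper_unip y) = c0" for y
  proof -
    have a: "act ?F (upper_unip y) f1 \<in> carrier ?F" using f1c by simp
    have "q (act ?F (upper_unip y) f1) = q f1" using q(4)[OF f1c, of "upper_unip y"] v(3)[of y] qf1 by simp
    then have "act ?F (upper_unip y) f1 \<ominus>\<^bsub>?F\<^esub> f1 \<in> ?C"
      using coset_eq_iff[OF representation_flag_rep constants_subrep a f1c] by (simp add: q_def)
    moreover have "act ?F (upper_unip y) f1 \<ominus>\<^bsub>?F\<^esub> f1 = (\<lambda>h. act ?F (upper_unip y) f1 h - f1 h)"
      using f1c F.smult_minus_one[OF f1c] by (simp add: a_minus_def flag_rep_simps flip: F.smult_minus_one)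
    ultimately obtain e where e: "(\<lambda>h. act ?F (upper_unip y) f1 h - f1 h) = (\<lambda>g. if g \<in> carrier GL2 then e else 0)"
      by auto
    have "f1 (upper_unip y ** mat 1) = f1 (mat 1)" by (rule f1_borel) (simp_all add: upper_unip_def upper_triangular_iff)
    then have "e = 0" using fun_cong[OF e, of "mat 1"] by (simp add: flag_rep_simps)
    then show ?thesis using fun_cong[OF e, of weyl_s] by (simp add: flag_rep_simps c0_def)
  qed
  have f1_eq: "f1 g = (if g$2$1 \<noteq> 0 then c0 else 0)" if g: "g \<in> carrier GL2" for g
    using g
  proof (cases rule: bruhat_cases)
    case 1
    then show ?thesis using flag_rep_borel[OF f1c 1] f1_1 by (simp add: upper_triangular_iff)
  next
    case (2 b y)
    have "g$2$1 \<noteq> 0" using 2 by (cases b rule: mat2_cases) (auto simp: s_up mat2_mult upper_triangular_iff)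
    then show ?thesis using 2 f1_borel[of b "weyl_s ** upper_unip y"] f1_s by simp
  qed
  have c0: "c0 \<noteq> 0"
  proof
    assume "c0 = 0"
    then have "f1 g = (if g \<in> carrier GL2 then 0 else 0)" for g
      using f1_eq[of g] f1c by (cases "g \<in> carrier GL2") (simp_all add: in_flag_rep)
    then have "f1 \<in> ?C" by blast
    then show False using q_zero[OF f1c] v(2) qf1 by simp
  qed
  have "act ?S (mat2 a 0 0 d) v = 1 \<odot>\<^bsub>?S\<^esub> v" if ad: "a \<noteq> 0" "d \<noteq> 0" for a d
  proof -
    have "act ?F (mat2 a 0 0 d) f1 = f1"
    proof
      fix g show "act ?F (mat2 a 0 0 d) f1 g = f1 g"
        using ad f1c by (cases "g \<in> carrier GL2"; cases g rule: mat2_cases)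
          (simp_all add: flag_rep_simps f1_eq GL2_mult_closed mat2_mult in_flag_rep in_GL2_iff)
    qed
    then show ?thesis using q(4)[OF f1c, of "mat2 a 0 0 d"] qf1 v(1) ad by simp
  qed
  moreover have "finsum ?S (\<lambda>a. act ?S (upper_unip a ** weyl_s) v) UNIV = (- 1) \<odot>\<^bsub>?S\<^esub> v"
  proof -
    let ?A = "\<lambda>a. act ?F (upper_unip a ** weyl_s) f1"
    have "finsum ?F ?A UNIV = (\<lambda>h. \<Sum>a\<in>UNIV. ?A a h)"
      using f1c by (intro finsum_flag_rep) auto
    also have "\<dots> = (- 1) \<odot>\<^bsub>?F\<^esub> f1"
    proof
      fix h :: "'k^2^2"
      show "(\<Sum>a\<in>UNIV. ?A a h) = ((- 1) \<odot>\<^bsub>?F\<^esub> f1) h"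
      proof (cases "h \<in> carrier GL2")
        case True
        obtain a b c d where h: "h = mat2 a b c d" by (rule mat2_cases)
        have cd: "c \<noteq> 0 \<or> d \<noteq> 0" using True by (auto simp: h)
        have "h ** (upper_unip x ** weyl_s) \<in> carrier GL2" for x using True by simp
        \<comment> \<open>Only the bottom row of \<open>h\<close> matters, because \<open>f1\<close>
          is \<open>c0\<close> times the indicator of a nonzero lower left entry. The Hecke sum thus
          becomes a count of the \<open>x\<close> with \<open>c * x + d \<noteq> 0\<close>.\<close>
        moreover have "(h ** (upper_unip x ** weyl_s))$2$1 = c * x + d" for x
          by (simp add: h upper_unip_def weyl_s_def mat2_mult)
        ultimately have "?A x h = c0 * (if c * x + d \<noteq> 0 then 1 else 0)" for x
          using True by (simp add: flag_rep_simps f1_eq)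
        then have "(\<Sum>x\<in>UNIV. ?A x h) = c0 * (\<Sum>x\<in>UNIV. if c * x + d \<noteq> 0 then 1 else 0)"
          by (simp only: sum_distrib_left)
        also have "\<dots> = - f1 h" using True by (simp add: up_zero_sum[OF char cd] f1_eq) (simp add: h)
        finally show ?thesis by (simp add: flag_rep_simps)
      qed (use f1c in \<open>simp add: flag_rep_simps in_flag_rep\<close>)
    qed
    finally have "q (finsum ?F ?A UNIV) = (- 1) \<odot>\<^bsub>?S\<^esub> v" using q(3)[OF f1c] qf1 by simp
    moreover have "q (finsum ?F ?A UNIV) = finsum ?S (\<lambda>a. q (?A a)) UNIV"
      using f1c by (intro rep_hom_finsum[OF representation_flag_rep representation_steinberg q_hom]) auto
    ultimately show ?thesis using q(4)[OF f1c] qf1 by simp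
  qed
  moreover have "W = carrier ?S" if W: "subrep GL2 W ?S" "v \<in> W" for W
  proof
    note Ws = subrepD[OF representation_steinberg W(1)]
    show "W \<subseteq> carrier ?S" by (rule Ws)
    define W' where "W' = {f \<in> carrier ?F. q f \<in> W}"
    have W': "subrep GL2 W' ?F"
      by (rule subrepI[OF representation_flag_rep])
        (use Ws q rep_hom_zero[OF representation_flag_rep representation_steinberg q_hom] in
          \<open>auto simp: W'_def simp flip: flag_rep_simps\<close>)
    note W's = subrepD[OF representation_flag_rep W']
    have CW: "(\<lambda>g. if g \<in> carrier GL2 then c else 0) \<in> W'" for c
    proof -
      have "q (\<lambda>g. if g \<in> carrier GL2 then c else 0) = \<zero>\<^bsub>?S\<^esub>" by (subst q_zero[OF cC]) blast
      then show ?thesis using cC Ws(2) by (simp add: W'_def)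
    qed
    have f1W: "f1 \<in> W'" using f1c W(2) qf1 by (simp add: W'_def)
    \<comment> \<open>This is the indicator function of the Borel subgroup. It and its translates
      \<open>?e x\<close> are the indicators of all Borel cosets, so they span every function on the
      flag variety.\<close>
    define e where "e = (\<lambda>h. (if h \<in> carrier GL2 then 1 else 0) + (- 1 / c0) * f1 h)"
    have eW: "e \<in> W'" using W's(3)[OF CW[of 1] W's(5)[OF f1W, of "- 1 / c0"]]
      unfolding flag_rep_simps e_def .
    have e_eq: "e g = (if g$2$1 = 0 then 1 else 0)" if "g \<in> carrier GL2" for g
      using c0 that by (simp add: e_def f1_eq)
    let ?e = "\<lambda>x. act ?F (upper_unip (- x) ** weyl_s) e"
    have e1: "?e x (mat 1) = 0" for x
      by (simp add: flag_rep_simps e_eq) (simp add: upper_unip_def weyl_s_def mat2_mult)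
    have es: "?e x (weyl_s ** upper_unip y) = (if x = y then 1 else 0)" for x y
    proof -
      have "weyl_s ** upper_unip y ** (upper_unip (- x) ** weyl_s) = lower_unip (y - x)"
        by (simp add: upper_unip_def weyl_s_def lower_unip_def mat2_mult)
      then show ?thesis by (simp add: flag_rep_simps e_eq) (simp add: lower_unip_def)
    qed
    have "g \<in> W'" if g: "g \<in> carrier ?F" for g
    proof -
      let ?s = "finsum ?F (\<lambda>x. g (weyl_s ** upper_unip x) \<odot>\<^bsub>?F\<^esub> ?e x) UNIV"
      have eW': "?e x \<in> W'" for x by (rule W's(6)[OF _ eW]) simp
      have sW: "?s \<in> W'" using eW' W's(5)
        by (intro subrep_finsum[OF representation_flag_rep W']) auto
      have s: "?s = (\<lambda>h. \<Sum>x\<in>UNIV. g (weyl_s ** upper_unip x) * ?e x h)"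
        using eW' W's(1,5) by (subst finsum_flag_rep) (auto simp: flag_rep_simps(3))
      have "g = g (mat 1) \<odot>\<^bsub>?F\<^esub> e \<oplus>\<^bsub>?F\<^esub> ?s"
      proof (rule flag_rep_eqI[OF g])
        show "g (mat 1) \<odot>\<^bsub>?F\<^esub> e \<oplus>\<^bsub>?F\<^esub> ?s \<in> carrier ?F" using eW sW W's(1,3,5) by blast
        show "g (mat 1) = (g (mat 1) \<odot>\<^bsub>?F\<^esub> e \<oplus>\<^bsub>?F\<^esub> ?s) (mat 1)"
          unfolding s using e1 by (simp add: flag_rep_simps(2,3) e_eq) (simp add: mat_as_mat2)
        show "g (weyl_s ** upper_unip y) = (g (mat 1) \<odot>\<^bsub>?F\<^esub> e \<oplus>\<^bsub>?F\<^esub> ?s) (weyl_s ** upper_unip y)" for y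
        proof -
          have "e (weyl_s ** upper_unip y) = 0" by (subst e_eq) (simp_all add: s_up)
          then show ?thesis unfolding s using es
            by (simp add: flag_rep_simps(2,3) if_distrib[of "\<lambda>t. _ * t"] cong: if_cong)
        qed
      qed
      moreover have "g (mat 1) \<odot>\<^bsub>?F\<^esub> e \<oplus>\<^bsub>?F\<^esub> ?s \<in> W'" by (rule W's(3)[OF W's(5)[OF eW] sW])
      ultimately show ?thesis by argo
    qed
    then show "carrier ?S \<subseteq> W" unfolding q_surj[symmetric] by (auto simp: W'_def)
  qed
  ultimately show ?thesis unfolding eigen_generator_def by blast
qed

text \<open>The matrix \<open>upper_unip a ** weyl_s\<close> has determinant \<open>- 1\<close>,
  whence the factor \<open>chi' (- 1)\<close>. Values of \<open>chi'\<close> are invertible, so the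
  twisted and untwisted actions have the same stable subspaces.\<close>

lemma eigen_generator_twist:
  fixes V :: "('c::field, 'v, 'k::finite_field^2^2) rep"
  assumes V: "representation GL2 V" and chi': "chi' \<in> characters (mult_of (ring_of_type_algebra :: 'k ring))"
    and chi: "\<And>h. h \<in> diagonal \<Longrightarrow> chi h = chi' (det h)"
    and v: "v \<in> carrier V" and e: "eigen_generator (\<lambda>_. 1) l V v"
  shows "representation GL2 (twist V (\<lambda>g. chi' (det g)))" (is "representation GL2 ?T")
    and "eigen_generator chi (chi' (- 1) * l) (twist V (\<lambda>g. chi' (det g))) v"
proof -
  interpret V: group_rep GL2 V by (rule group_rep_of) fact
  have nz: "chi' a \<noteq> 0" if "a \<noteq> 0" for a using chi' that by (auto simp: hom_def mult_of_def)
  have mult: "chi' (a * b) = chi' a * chi' b" if "a \<noteq> 0" "b \<noteq> 0" for a b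
    using chi' that by (auto simp: hom_def mult_of_def)
  have one: "chi' 1 = 1" using mult[of 1 1] nz[of 1] by simp
  show T: "representation GL2 ?T"
    by (rule representation_twist[OF V]) (simp_all add: one mult det_mul in_GL2_iff)
  have simps: "carrier ?T = carrier V" "add ?T = add V" "\<zero>\<^bsub>?T\<^esub> = \<zero>\<^bsub>V\<^esub>" "smult ?T = smult V"
    "act ?T g x = chi' (det g) \<odot>\<^bsub>V\<^esub> act V g x" for g x
    by (simp_all add: twist_def)
  have finsum_eq: "finsum ?T f A = finsum V f A" for f and A :: "'k set"
    by (simp add: finsum_def simps finprod_def)
  have "act ?T (mat2 a 0 0 d) v = chi (mat2 a 0 0 d) \<odot>\<^bsub>?T\<^esub> v" if "a \<noteq> 0" "d \<noteq> 0" for a d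
    using e that v by (simp add: simps eigen_generator_def chi diagonal_iff)
  moreover have "finsum ?T (\<lambda>a. act ?T (upper_unip a ** weyl_s) v) UNIV = (chi' (- 1) * l) \<odot>\<^bsub>?T\<^esub> v"
  proof -
    have "finsum ?T (\<lambda>a. act ?T (upper_unip a ** weyl_s) v) UNIV =
        finsum V (\<lambda>a. chi' (- 1) \<odot>\<^bsub>V\<^esub> act V (upper_unip a ** weyl_s) v) UNIV"
      by (simp add: finsum_eq simps det_mul upper_unip_def weyl_s_def)
    also have "\<dots> = chi' (- 1) \<odot>\<^bsub>V\<^esub> finsum V (\<lambda>a. act V (upper_unip a ** weyl_s) v) UNIV"
      using v by (intro V.smult_finsum[symmetric]) auto
    also have "finsum V (\<lambda>a. act V (upper_unip a ** weyl_s) v) UNIV = l \<odot>\<^bsub>V\<^esub> v"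
      using e by (simp add: eigen_generator_def)
    finally show ?thesis using v by (simp add: simps V.smult_assoc)
  qed
  moreover have "W = carrier ?T" if W: "subrep GL2 W ?T" "v \<in> W" for W
  proof -
    note Ws = subrepD[OF T W(1), unfolded simps]
    have "act V g x \<in> W" if "g \<in> carrier GL2" "x \<in> W" for g x
    proof -
      have "inverse (chi' (det g)) \<odot>\<^bsub>V\<^esub> (chi' (det g) \<odot>\<^bsub>V\<^esub> act V g x) \<in> W"
        using Ws(5,6) that by blast
      then show ?thesis using that Ws(1) nz[of "det g"] by (simp add: in_GL2_iff subset_iff flip: V.smult_assoc)
    qed
    then have "subrep GL2 W V" using Ws by (intro subrepI[OF V]) auto
    then show ?thesis using e W(2) by (simp add: eigen_generator_def simps)
  qed
  ultimately show "eigen_generator chi (chi' (- 1) * l) ?T v"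
    unfolding eigen_generator_def by blast
qed

text \<open>The eigenvalue is 0 for a regular character and for a determinant character, and
  \<open>- chi' (- 1)\<close> for a twist of the Steinberg representation. Only the last is nonzero,
  and it occurs exactly when \<open>weyl_s\<close> is not in a nonempty-type
  \<open>J\<close>.\<close>

lemma rho_eigen_generator:
  fixes chi :: "'k::finite_field^2^2 \<Rightarrow> 'c::field" and R :: "('c, 'v, 'k^2^2) rep"
  assumes rho: "is_rho chi J R" and char: "CHAR('c) = CHAR('k)"
    and v: "v \<in> carrier R" "v \<noteq> \<zero>\<^bsub>R\<^esub>" "\<And>x. act R (upper_unip x) v = v"
  obtains l where "eigen_generator chi l R v" "J0 chi = {} \<Longrightarrow> l = 0"
    "J0 chi \<noteq> {} \<Longrightarrow> l = 0 \<longleftrightarrow> weyl_s \<in> J"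
proof (cases "J0 chi = {}")
  case True
  have R: "representation GL2 R" using rho by (simp add: is_rho_def)
  from True obtain h where h: "h \<in> diagonal" "chi h \<noteq> conj_s chi h"
    by (auto simp: J0_def split: if_splits)
  have "eigen_generator chi 0 R v"
  proof (rule eigen_generator_regular[OF R char v(1,2) _ v(3) _ h])
    show "irreducible_rep GL2 R" using rho True by (simp add: is_rho_def)
    fix b :: "'k^2^2" and v assume "b \<in> upper_triangular" "v \<in> carrier R" "\<And>x. act R (upper_unip x) v = v"
    moreover from this have "v \<in> invariants R upper_unipotent"
      by (auto simp: invariants_def upper_unipotent_iff upper_unip_def)
    ultimately show "act R b v = chi (mat2 (b$1$1) 0 0 (b$2$2)) \<odot>\<^bsub>R\<^esub> v"
      using rho True by (simp add: is_rho_def)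
  qed
  then show thesis using True that by blast
next
  case False
  have R: "representation GL2 R" using rho by (simp add: is_rho_def)
  from rho False obtain chi' where chi': "chi' \<in> characters (mult_of (ring_of_type_algebra :: 'k ring))"
    and chi: "\<And>h. h \<in> diagonal \<Longrightarrow> chi h = chi' (det h)"
    and iso: "if weyl_s \<in> J then rep_iso GL2 R (char_rep (\<lambda>g. chi' (det g)))
            else rep_iso GL2 R (twist steinberg (\<lambda>g. chi' (det g)))"
    unfolding is_rho_def by auto
  show thesis
  proof (cases "weyl_s \<in> J")
    case True
    then have "eigen_generator chi 0 R v"
      using iso chi by (intro eigen_generator_det_char[OF R char v(1,2), of chi chi']) simp_all
    then show thesis using True False that by blast
  next
    case nJ: False
    let ?St = "steinberg :: ('c, ('k^2^2 \<Rightarrow> 'c) set, 'k^2^2) rep"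
    let ?T = "twist ?St (\<lambda>g. chi' (det g))"
    have nz: "chi' a \<noteq> 0" if "a \<noteq> 0" for a using chi' that by (auto simp: hom_def mult_of_def)
    have "chi' (a * b) = chi' a * chi' b" if "a \<noteq> 0" "b \<noteq> 0" for a b
      using chi' that by (auto simp: hom_def mult_of_def)
    from this[of 1 1] have one: "chi' 1 = 1" using nz[of 1] by simp
    interpret St: group_rep GL2 ?St by (rule group_rep_of[OF representation_steinberg])
    obtain \<phi> where \<phi>: "\<phi> \<in> rep_hom GL2 R ?T" "bij_betw \<phi> (carrier R) (carrier ?T)"
      using iso nJ unfolding rep_iso_def by auto
    have \<phi>v: "\<phi> v \<in> carrier ?St" using rep_hom_closed[OF \<phi>(1) v(1)] by (simp add: twist_def)
    have T: "representation GL2 ?T"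
    proof (rule representation_twist[OF representation_steinberg])
      show "chi' (det (g \<otimes>\<^bsub>GL2\<^esub> h)) = chi' (det g) * chi' (det h)"
        if "g \<in> carrier GL2" "h \<in> carrier GL2" for g h :: "'k^2^2"
        using chi' that by (auto simp: hom_def mult_of_def det_mul in_GL2_iff)
    qed (simp add: one)
    have "eigen_generator (\<lambda>_. 1) (- 1) ?St (\<phi> v)"
    proof (rule eigen_generator_steinberg[OF char \<phi>v])
      show "\<phi> v \<noteq> \<zero>\<^bsub>?St\<^esub>"
      proof
        interpret R: group_rep GL2 R by (rule group_rep_of[OF R])
        assume "\<phi> v = \<zero>\<^bsub>?St\<^esub>"
        then have "\<phi> v = \<phi> \<zero>\<^bsub>R\<^esub>" using rep_hom_zero[OF R T \<phi>(1)] by (simp add: twist_def)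
        then show False using \<phi>(2) v(1,2) R.zero_closed unfolding bij_betw_def inj_on_def by blast
      qed
      show "act ?St (upper_unip x) (\<phi> v) = \<phi> v" for x
      proof -
        have "chi' (det (upper_unip x)) \<odot>\<^bsub>?St\<^esub> act ?St (upper_unip x) (\<phi> v) = \<phi> v"
          using rep_hom_act[OF \<phi>(1) v(1), of "upper_unip x"] v(3)[of x] by (simp add: twist_def)
        then show ?thesis using \<phi>v by (simp add: upper_unip_def one)
      qed
    qed
    then have "eigen_generator chi (chi' (- 1) * - 1) ?T (\<phi> v)"
      using chi by (intro eigen_generator_twist(2)[OF representation_steinberg chi' _ \<phi>v]) simp_all
    then have "eigen_generator chi (chi' (- 1) * - 1) R v"
      by (rule eigen_generator_iso[OF R T \<phi> v(1)])
    then show thesis using that False nJ nz[of "- 1"] by (metis mult_eq_0_iff neg_equal_0_iff_equal one_neq_zero)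
  qed
qed

section \<open>The tree\<close>

lemma vec2_eq_iff: "x = y \<longleftrightarrow> x$1 = y$1 \<and> x$2 = y$2" for x y :: "'a^2"
  by (auto simp: vec_eq_iff forall_2)

lemma mat2_vec_nth:
  "(mat2 a b c d *v x)$1 = a * x$1 + b * x$2" "(mat2 a b c d *v x)$2 = c * x$1 + d * (x$2 :: 'a::semiring_1)"
  by (simp_all add: matrix_vector_mult_def sum_2)

lemma mat_vec: "mat z *v x = z *s (x :: 'a::semiring_1^2)"
  by (simp add: vec2_eq_iff mat_as_mat2 mat2_vec_nth)

lemma independent_pair_iff:
  fixes u v :: "'a::field^2"
  shows "u \<noteq> v \<and> vec.independent {u, v} \<longleftrightarrow> u$1 * v$2 - v$1 * u$2 \<noteq> 0"
proof -
  have "u \<noteq> v \<and> vec.independent {u, v} \<longleftrightarrow> v \<noteq> 0 \<and> (\<forall>k. u \<noteq> k *s v)"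
  proof -
    have "u \<noteq> v \<Longrightarrow> vec.independent {u, v} \<longleftrightarrow> u \<notin> vec.span {v} \<and> v \<noteq> 0"
      by (auto simp: vec.independent_insert)
    moreover have "vec.span {v} = range (\<lambda>k. k *s v)" by (rule vec.span_singleton)
    ultimately show ?thesis by (metis (no_types, lifting) imageE rangeI vec.scale_one)
  qed
  also have "\<dots> \<longleftrightarrow> u$1 * v$2 - v$1 * u$2 \<noteq> 0"
  proof
    assume L: "v \<noteq> 0 \<and> (\<forall>k. u \<noteq> k *s v)"
    show "u$1 * v$2 - v$1 * u$2 \<noteq> 0"
    proof
      assume e: "u$1 * v$2 - v$1 * u$2 = 0"
      show False
      proof (cases "v$1 = 0")
        case True
        then have v2: "v$2 \<noteq> 0" using L by (auto simp: vec2_eq_iff)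
        then have "u = (u$2 / v$2) *s v" using e True by (simp add: vec2_eq_iff)
        then show False using L by blast
      next
        case False
        then have "u = (u$1 / v$1) *s v" using e by (simp add: vec2_eq_iff field_simps)
        then show False using L by blast
      qed
    qed
  qed (auto simp: mult_ac)
  finally show ?thesis .
qed

context local_field
begin

definition L0 :: "('f^2) set" where "L0 = {x. x$1 \<in> integers \<and> x$2 \<in> integers}"
definition L1 :: "('f^2) set" where "L1 = {x. x$1 \<in> integers \<and> x$2 \<in> max_ideal}"
text \<open>The end of \<open>sigma1\<close> other than \<open>sigma0\<close>; \<open>Pi_mat\<close>
  exchanges the two.\<close>

definition sigma0' :: "('f^2) set set" where "sigma0' = homothety_class L1"

abbreviation gimage :: "'f^2^2 \<Rightarrow> ('f^2) set \<Rightarrow> ('f^2) set" where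
  "gimage g L \<equiv> (\<lambda>v. g *v v) ` L"

lemma axis_sum: "{a *s axis 1 1 + b *s axis 2 1 | a b. a \<in> A \<and> b \<in> B} = {x :: 'f^2. x$1 \<in> A \<and> x$2 \<in> B}"
proof (intro Set.set_eqI iffI)
  fix x :: "'f^2" assume "x \<in> {x. x$1 \<in> A \<and> x$2 \<in> B}"
  moreover have "x = x$1 *s axis 1 1 + x$2 *s axis 2 1" by (simp add: vec2_eq_iff axis_def)
  ultimately show "x \<in> {a *s axis 1 1 + b *s axis 2 1 | a b. a \<in> A \<and> b \<in> B}" by blast
qed (auto simp: axis_def)

lemma sigma0_eq: "sigma0 = homothety_class L0"
  by (simp only: sigma0_def axis_sum L0_def)

lemma sigma1_eq: "sigma1 = {sigma0, sigma0'}"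
  by (simp only: sigma1_def axis_sum L1_def sigma0'_def)

lemma gimage_mult: "gimage (g ** h) L = gimage g (gimage h L)"
  by (simp add: image_image matrix_vector_mul_assoc)

lemma gimage_one: "gimage (mat 1) L = L"
  by simp

lemma gimage_mat: "gimage (mat z) L = (\<lambda>x. z *s x) ` L"
  by (simp add: mat_vec)

lemma homothety_class_eq: "homothety_class L = {gimage (mat z) L | z. z \<noteq> 0}"
  by (simp only: homothety_class_def gimage_mat)

lemma homothety_class_self: "L \<in> homothety_class L"
  unfolding homothety_class_eq using gimage_one[of L] by (metis (mono_tags, lifting) mem_Collect_eq zero_neq_one)

lemma homothety_class_scale:
  assumes "z \<noteq> 0" shows "homothety_class (gimage (mat z) L) = homothety_class L"
proof (intro Set.set_eqI iffI)
  fix M assume "M \<in> homothety_class (gimage (mat z) L)"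
  then obtain y where "y \<noteq> 0" "M = gimage (mat (y * z)) L"
    unfolding homothety_class_eq by (auto simp: mat_mult_mat simp flip: gimage_mult)
  then show "M \<in> homothety_class L" using assms unfolding homothety_class_eq by (auto intro!: exI[of _ "y * z"])
next
  fix M assume "M \<in> homothety_class L"
  then obtain y where y: "y \<noteq> 0" "M = gimage (mat y) L" unfolding homothety_class_eq by blast
  then have "M = gimage (mat (y / z)) (gimage (mat z) L)"
    using assms by (simp add: mat_mult_mat flip: gimage_mult)
  then show "M \<in> homothety_class (gimage (mat z) L)" using y assms unfolding homothety_class_eq
    by (intro CollectI exI[of _ "y / z"]) simp
qed

lemma gimage_commute: "gimage g (gimage (mat z) L) = gimage (mat z) (gimage g L)"
proof -
  have "gimage (g ** mat z) L = gimage (mat z ** g) L" by (simp only: mat_commute[of z g])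
  then show ?thesis by (simp only: gimage_mult)
qed

lemma vertex_act_class: "vertex_act g (homothety_class L) = homothety_class (gimage g L)"
proof -
  have "vertex_act g (homothety_class L) = {gimage g (gimage (mat z) L) | z. z \<noteq> 0}"
    unfolding homothety_class_eq vertex_act_def by blast
  then show ?thesis by (simp only: homothety_class_eq gimage_commute)
qed

lemma vertex_act_mult: "vertex_act (g ** h) x = vertex_act g (vertex_act h x)"
  by (simp add: vertex_act_def image_image matrix_vector_mul_assoc)

lemma vertex_act_one [simp]: "vertex_act (mat 1) x = x"
  by (simp add: vertex_act_def)

lemma vertex_act_inv:
  assumes "g \<in> carrier GL2"
  shows "vertex_act g (vertex_act (matrix_inv g) x) = x" "vertex_act (matrix_inv g) (vertex_act g x) = x"
  using matrix_inv_GL2[OF assms] by (simp_all flip: vertex_act_mult)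

lemma vertex_act_eq_iff:
  "g \<in> carrier GL2 \<Longrightarrow> vertex_act g x = vertex_act g y \<longleftrightarrow> x = y"
  by (metis vertex_act_inv(2))

lemma gimage_GK:
  assumes "k \<in> GK" shows "gimage k L0 = L0"
proof -
  have sub: "gimage k L0 \<subseteq> L0" if "k \<in> GK" for k
    using GK_entry[OF that] by (auto simp: L0_def matrix_vector_mult_def sum_2)
  have "L0 = gimage k (gimage (matrix_inv k) L0)"
    using matrix_inv_GL2(1)[OF GK_in_GL2[OF assms]] by (simp flip: gimage_mult)
  also have "\<dots> \<subseteq> gimage k L0" by (intro image_mono sub GK_inv assms)
  finally show ?thesis using sub[OF assms] by blast
qed

lemma gimage_L0_imp_GK:
  assumes g: "g \<in> carrier GL2" and e: "gimage g L0 = L0" shows "g \<in> GK"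
proof -
  have entries: "h$i$j \<in> integers" if "gimage h L0 \<subseteq> L0" for h i j
  proof -
    have "axis j 1 \<in> L0" by (auto simp: L0_def axis_def)
    then have "h *v axis j 1 \<in> L0" using that by blast
    moreover have "(h *v axis j 1)$i = h$i$j"
      by (simp add: matrix_vector_mult_def axis_def if_distrib cong: if_cong)
    ultimately show ?thesis using exhaust_2[of i] by (auto simp: L0_def)
  qed
  have "gimage (matrix_inv g) L0 = gimage (matrix_inv g) (gimage g L0)" by (simp only: e)
  then have "gimage (matrix_inv g) L0 = L0" using matrix_inv_GL2[OF g] by (simp flip: gimage_mult)
  then show ?thesis using entries[of g] entries[of "matrix_inv g"] g e by (simp add: GK_def)
qed

lemma stab0_in_GL2: "g \<in> stab0 \<Longrightarrow> g \<in> carrier GL2"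
  by (auto simp: stab0_def GK_in_GL2)

text \<open>A matrix fixing the class of \<open>L0\<close> carries \<open>L0\<close> to a multiple
  \<open>z L0\<close>; after division by \<open>z\<close> it stabilises the lattice itself and is
  therefore in \<open>GK\<close>.\<close>

lemma vertex_act_sigma0_iff:
  assumes g: "g \<in> carrier GL2" shows "vertex_act g sigma0 = sigma0 \<longleftrightarrow> g \<in> stab0"
proof
  assume "vertex_act g sigma0 = sigma0"
  then have "gimage g L0 \<in> homothety_class L0"
    using homothety_class_self[of "gimage g L0"] by (simp add: sigma0_eq vertex_act_class)
  then obtain z where z: "z \<noteq> 0" "gimage g L0 = gimage (mat z) L0" unfolding homothety_class_eq by blast
  let ?k = "mat (inverse z) ** g"
  have "gimage ?k L0 = gimage (mat (inverse z)) (gimage (mat z) L0)" by (simp only: gimage_mult z(2))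
  then have "gimage ?k L0 = L0" using z(1) by (simp add: mat_mult_mat flip: gimage_mult)
  then have "?k \<in> GK" using g z by (intro gimage_L0_imp_GK) simp_all
  moreover have "g = mat z ** ?k" using z by (simp add: matrix_mul_assoc mat_mult_mat)
  ultimately show "g \<in> stab0" using z(1) unfolding stab0_def by blast
next
  assume "g \<in> stab0"
  then obtain z k where "g = mat z ** k" "z \<noteq> 0" "k \<in> GK" by (auto simp: stab0_def)
  then show "vertex_act g sigma0 = sigma0"
    by (simp only: sigma0_eq vertex_act_class gimage_mult gimage_GK homothety_class_scale not_False_eq_True)
qed

lemma span_L0: "(\<lambda>x. x$1 *s u + x$2 *s v) ` L0 = {a *s u + b *s v | a b. a \<in> integers \<and> b \<in> integers}"
  for u v :: "'f^2"
proof (intro Set.set_eqI iffI)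
  fix w assume "w \<in> {a *s u + b *s v | a b. a \<in> integers \<and> b \<in> integers}"
  then obtain a b where "w = a *s u + b *s v" "a \<in> integers" "b \<in> integers" by blast
  then show "w \<in> (\<lambda>x. x$1 *s u + x$2 *s v) ` L0"
    by (intro image_eqI[of _ _ "vector [a, b]"]) (simp_all add: L0_def)
qed (auto simp: L0_def)

lemma lattice_iff: "is_lattice L \<longleftrightarrow> (\<exists>g\<in>carrier GL2. L = gimage g L0)"
proof
  assume "is_lattice L"
  then obtain u v where uv: "u \<noteq> v" "vec.independent {u, v}"
    and L: "L = {a *s u + b *s v | a b. a \<in> integers \<and> b \<in> integers}" by (auto simp: is_lattice_def)
  let ?g = "mat2 (u$1) (v$1) (u$2) (v$2)"
  have "u$1 * v$2 - v$1 * u$2 \<noteq> 0" using uv independent_pair_iff[of u v] by blast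
  then have "?g \<in> carrier GL2" by simp
  moreover have "?g *v x = x$1 *s u + x$2 *s v" for x
    by (simp add: vec2_eq_iff mat2_vec_nth mult.commute)
  then have "gimage ?g L0 = L" by (simp only: L span_L0)
  ultimately show "\<exists>g\<in>carrier GL2. L = gimage g L0" by blast
next
  assume "\<exists>g\<in>carrier GL2. L = gimage g L0"
  then obtain g where g: "g \<in> carrier GL2" "L = gimage g L0" by blast
  let ?u = "vector [g$1$1, g$2$1] :: 'f^2" and ?v = "vector [g$1$2, g$2$2] :: 'f^2"
  have "?u \<noteq> ?v \<and> vec.independent {?u, ?v}"
    using g(1) unfolding independent_pair_iff by (simp add: in_GL2_iff det_2 mult.commute)
  moreover have gv: "g *v x = x$1 *s ?u + x$2 *s ?v" for x
    by (simp add: vec2_eq_iff matrix_vector_mult_def sum_2 mult.commute)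
  have "L = {a *s ?u + b *s ?v | a b. a \<in> integers \<and> b \<in> integers}"
    by (simp only: g(2) gv span_L0)
  ultimately show "is_lattice L" unfolding is_lattice_def by blast
qed

lemma vertex_iff: "x \<in> vertices \<longleftrightarrow> (\<exists>g\<in>carrier GL2. x = vertex_act g sigma0)"
  unfolding vertices_def sigma0_eq vertex_act_class by (auto simp: lattice_iff)

lemma vertex_act_vertices: "g \<in> carrier GL2 \<Longrightarrow> x \<in> vertices \<Longrightarrow> vertex_act g x \<in> vertices"
  by (auto simp: vertex_iff simp flip: vertex_act_mult)

section \<open>The basic edge, neighbours and edge stabilisers\<close>

lemma Pi_mat_in_GL2 [simp]: "Pi_mat \<in> carrier GL2"
  by (simp add: Pi_mat_def)

lemma gimage_Pi: "gimage Pi_mat L0 = L1" "gimage Pi_mat L1 = gimage (mat unif) L0"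
proof -
  have img: "gimage Pi_mat {x. x$1 \<in> A \<and> x$2 \<in> B} = {x. x$1 \<in> B \<and> x$2 / unif \<in> A}" for A B
  proof (intro Set.set_eqI iffI)
    fix x :: "'f^2" assume "x \<in> {x. x$1 \<in> B \<and> x$2 / unif \<in> A}"
    then show "x \<in> gimage Pi_mat {x. x$1 \<in> A \<and> x$2 \<in> B}"
      by (intro image_eqI[of _ _ "vector [x$2 / unif, x$1]"]) (simp_all add: vec2_eq_iff Pi_mat_def mat2_vec_nth)
  qed (auto simp: Pi_mat_def mat2_vec_nth)
  show "gimage Pi_mat L0 = L1"
    unfolding L0_def L1_def img by (simp add: max_ideal_divide)
  have img': "gimage (mat unif) {x. x$1 \<in> A \<and> x$2 \<in> B} = {x. x$1 / unif \<in> A \<and> x$2 / unif \<in> B}" for A B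
  proof (intro Set.set_eqI iffI)
    fix x :: "'f^2" assume "x \<in> {x. x$1 / unif \<in> A \<and> x$2 / unif \<in> B}"
    then show "x \<in> gimage (mat unif) {x. x$1 \<in> A \<and> x$2 \<in> B}"
      by (intro image_eqI[of _ _ "vector [x$1 / unif, x$2 / unif]"]) (simp_all add: vec2_eq_iff mat_vec)
  qed (auto simp: mat_vec)
  show "gimage Pi_mat L1 = gimage (mat unif) L0"
    unfolding L0_def L1_def img img' by (simp add: max_ideal_divide)
qed

lemma vertex_act_Pi: "vertex_act Pi_mat sigma0 = sigma0'" "vertex_act Pi_mat sigma0' = sigma0"
  by (simp_all only: sigma0_eq sigma0'_def vertex_act_class gimage_Pi homothety_class_scale unif_nonzero not_False_eq_True)

lemma sigma0_vertex [simp]: "sigma0 \<in> vertices" "sigma0' \<in> vertices"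
  using vertex_act_one[of sigma0] vertex_act_Pi(1) Pi_mat_in_GL2 mat_in_GL2[of 1]
  by (metis vertex_iff zero_neq_one)+

text \<open>Scalars contribute an even valuation and \<open>GK\<close> contributes 0. This parity
  separates \<open>Pi_mat\<close> from \<open>stab0\<close>, and hence the two ends of the basic
  edge from each other.\<close>

lemma val_det_stab0: "g \<in> stab0 \<Longrightarrow> even (val (det g))"
  by (auto simp: stab0_def GK_iff det_mul mat_as_mat2 val_mult)

lemma Pi_mat_notin_stab0: "Pi_mat \<notin> stab0"
  using val_det_stab0[of Pi_mat] uniformiser by (auto simp: Pi_mat_def)

lemma sigma0_neq: "sigma0 \<noteq> sigma0'"
  using Pi_mat_notin_stab0 vertex_act_sigma0_iff[OF Pi_mat_in_GL2] by (auto simp: vertex_act_Pi)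

text \<open>Such an \<open>M\<close> is a line in the plane \<open>L0 / unif L0\<close> over the
  residue field. A vector \<open>m\<close> of \<open>M\<close> outside \<open>unif L0\<close> has a
  unit coordinate and is completed by a standard vector \<open>e\<close> to a basis of
  \<open>L0\<close>; these are the columns of \<open>k\<close>. The description by residues depends
  on finitely many data, which bounds the number of neighbours.\<close>

lemma sublattice_normal_form:
  assumes sub: "gimage (mat unif) L0 \<subset> M" "M \<subset> L0"
    and add: "\<And>x y. x \<in> M \<Longrightarrow> y \<in> M \<Longrightarrow> x + y \<in> M" and smult: "\<And>c x. c \<in> integers \<Longrightarrow> x \<in> M \<Longrightarrow> c *s x \<in> M"
  obtains k where "k \<in> GK" "M = gimage k L1"
    and "M = {x \<in> L0. red (x$1) * red (k$2$1) = red (x$2) * red (k$1$1)}"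
proof -
  have uL0: "x \<in> gimage (mat unif) L0 \<longleftrightarrow> x$1 \<in> max_ideal \<and> x$2 \<in> max_ideal" for x
  proof
    assume "x$1 \<in> max_ideal \<and> x$2 \<in> max_ideal"
    then show "x \<in> gimage (mat unif) L0"
      by (intro image_eqI[of _ _ "vector [x$1 / unif, x$2 / unif]"])
        (simp_all add: vec2_eq_iff mat_vec L0_def max_ideal_divide)
  qed (auto simp: mat_vec L0_def unif_mult_max_ideal)
  obtain m where m: "m \<in> M" "m \<notin> gimage (mat unif) L0" using sub(1) by blast
  define a b where "a = m$1" and "b = m$2"
  have ab: "a \<in> integers" "b \<in> integers" "a \<notin> max_ideal \<or> b \<notin> max_ideal"
    using m sub(2) uL0[of m] by (auto simp: a_def b_def L0_def)
  have unit: "inverse c \<in> integers" "c \<noteq> 0" "val c = 0" if "c \<in> integers" "c \<notin> max_ideal" for c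
    using that unit_iff[of c] unit_iff_val[of c] by auto
  obtain k e where k: "k \<in> GK" "k$1$1 = a" "k$2$1 = b" and e: "e \<in> L0" "\<And>x. k *v x = x$1 *s m + x$2 *s e"
  proof (cases "a \<in> max_ideal")
    case False
    have "mat2 a 0 b 1 \<in> GK" using ab unit[OF ab(1) False] by (simp add: mat2_in_GK)
    then show thesis
      by (rule that[of _ "vector [0, 1]"]) (simp_all add: L0_def vec2_eq_iff mat2_vec_nth a_def b_def mult.commute)
  next
    case True
    then have "b \<notin> max_ideal" using ab by blast
    then have "mat2 a 1 b 0 \<in> GK" using ab unit[OF ab(2)] by (simp add: mat2_in_GK)
    then show thesis
      by (rule that[of _ "vector [1, 0]"]) (simp_all add: L0_def vec2_eq_iff mat2_vec_nth a_def b_def mult.commute)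
  qed
  have eM: "e \<notin> M"
  proof
    assume "e \<in> M"
    then have "gimage k L0 \<subseteq> M" using add smult m(1) e(2) by (auto simp: L0_def)
    then show False using gimage_GK[OF k(1)] sub(2) by blast
  qed
  have "gimage k L1 \<subseteq> M"
  proof
    fix x assume "x \<in> gimage k L1"
    then obtain y where y: "y \<in> L1" "x = k *v y" by blast
    have "y$2 *s e \<in> gimage (mat unif) L0"
      using y e(1) unfolding uL0 by (simp add: L0_def L1_def max_ideal_mult)
    then show "x \<in> M" using y e(2) add smult m(1) sub(1) by (auto simp: L1_def)
  qed
  moreover have "M \<subseteq> gimage k L1"
  proof
    fix x assume x: "x \<in> M"
    then have "x \<in> gimage k L0" using sub(2) gimage_GK[OF k(1)] by blast
    then obtain y where y: "y \<in> L0" "x = k *v y" by blast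
    have "y$2 \<in> max_ideal"
    proof (rule ccontr)
      assume n: "y$2 \<notin> max_ideal"
      have y': "y$1 \<in> integers" "y$2 \<in> integers" using y by (auto simp: L0_def)
      have "x + (- (y$1)) *s m \<in> M" using add[OF x smult[OF _ m(1), of "- (y$1)"]] y' by simp
      then have "inverse (y$2) *s (x + (- (y$1)) *s m) \<in> M" using smult unit(1)[OF y'(2) n] by blast
      moreover have "inverse (y$2) *s (x + (- (y$1)) *s m) = e"
        using unit(2)[OF y'(2) n] e(2)[of y] y(2) by (simp add: vec2_eq_iff field_simps)
      ultimately show False using eM by simp
    qed
    then show "x \<in> gimage k L1" using y by (auto simp: L0_def L1_def)
  qed
  ultimately have Mk: "M = gimage k L1" by blast
  moreover have "gimage k L1 = {x \<in> L0. red (x$1) * red b = red (x$2) * red a}"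
  proof (intro Set.set_eqI)
    fix x
    show "x \<in> gimage k L1 \<longleftrightarrow> x \<in> {x \<in> L0. red (x$1) * red b = red (x$2) * red a}"
    proof (cases "x \<in> L0")
      case False
      then show ?thesis using Mk sub(2) by blast
    next
      case True
      then obtain y where y: "y \<in> L0" "x = k *v y" using gimage_GK[OF k(1)] by blast
      have y': "y$1 \<in> integers" "y$2 \<in> integers" using y by (auto simp: L0_def)
      have inj: "k *v y \<in> gimage k L1 \<longleftrightarrow> y \<in> L1"
      proof
        assume "k *v y \<in> gimage k L1"
        then obtain z where z: "z \<in> L1" "k *v y = k *v z" by blast
        then have "matrix_inv k *v (k *v y) = matrix_inv k *v (k *v z)" by simp
        then show "y \<in> L1" using z(1) matrix_inv_GL2[OF GK_in_GL2[OF k(1)]] by (simp add: matrix_vector_mul_assoc)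
      qed blast
      obtain c d where kk: "k = mat2 a c b d" using k mat2_eta[of k] by metis
      have cd: "c \<in> integers" "d \<in> integers" using k(1) by (simp_all add: kk mat2_in_GK)
      \<comment> \<open>The component along \<open>m = (a, b)\<close> cancels in this cross product,
        which leaves the component along \<open>e\<close> times the determinant, a unit.\<close>
      have "x$1 * b - x$2 * a = - (y$2 * (a * d - c * b))"
        by (simp add: y(2) kk mat2_vec_nth algebra_simps)
      then have "red (x$1) * red b - red (x$2) * red a = - (red (y$2) * red (a * d - c * b))"
        using True ab cd y' by (simp add: L0_def flip: red_times red_minus red_uminus)
      moreover have "red (a * d - c * b) \<noteq> 0"
        using det_GK[OF k(1)] red_zero_iff[of "a * d - c * b"] by (simp add: kk)
      ultimately have "red (x$1) * red b = red (x$2) * red a \<longleftrightarrow> red (y$2) = 0" by auto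
      also have "\<dots> \<longleftrightarrow> y \<in> L1" using y' by (simp add: L1_def red_zero_iff)
      finally show ?thesis using True inj y(2) by simp
    qed
  qed
  ultimately show thesis using k by (intro that[of k]) simp_all
qed

lemma L0_L1_strict: "gimage (mat unif) L0 \<subset> L1" "L1 \<subset> L0"
proof -
  have "gimage (mat unif) L0 \<subseteq> L1" by (auto simp: L0_def L1_def mat_vec unif_mult_max_ideal)
  moreover have "(vector [1, 0] :: 'f^2) \<in> L1" by (simp add: L1_def)
  moreover have "(vector [1, 0] :: 'f^2) \<notin> gimage (mat unif) L0"
  proof
    assume "(vector [1, 0] :: 'f^2) \<in> gimage (mat unif) L0"
    then obtain x where x: "x \<in> L0" "vector [1, 0] = unif *s x" by (auto simp: mat_vec)
    then have "unif * x$1 \<in> max_ideal" by (simp add: L0_def unif_mult_max_ideal)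
    moreover have "unif * x$1 = 1" using arg_cong[OF x(2), of "\<lambda>v. v$1"] by simp
    ultimately have "(1 :: 'f) \<in> max_ideal" by simp
    then show False by (simp add: max_ideal_def)
  qed
  ultimately show "gimage (mat unif) L0 \<subset> L1" by blast
  have "(vector [0, 1] :: 'f^2) \<in> L0 - L1" by (simp add: L0_def L1_def) (simp add: max_ideal_def)
  moreover have "L1 \<subseteq> L0" using max_ideal_subset by (auto simp: L0_def L1_def)
  ultimately show "L1 \<subset> L0" by blast
qed

lemma gimage_strict: "g \<in> carrier GL2 \<Longrightarrow> gimage g A \<subset> gimage g B \<longleftrightarrow> A \<subset> B"
proof -
  assume g: "g \<in> carrier GL2"
  have "inj (\<lambda>v. g *v v)"
    by (rule inj_on_inverseI[of _ "\<lambda>v. matrix_inv g *v v"])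
      (simp add: matrix_vector_mul_assoc matrix_inv_GL2[OF g])
  then show ?thesis by (simp add: inj_image_subset_iff psubset_eq inj_image_eq_iff)
qed

lemma adjacent_act:
  assumes g: "g \<in> carrier GL2" shows "adjacent (vertex_act g x) (vertex_act g y) \<longleftrightarrow> adjacent x y"
proof -
  have "adjacent (vertex_act g x) (vertex_act g y)" if g: "g \<in> carrier GL2" and a: "adjacent x y" for g x y
  proof -
    obtain L M where LM: "L \<in> x" "M \<in> y" "gimage (mat unif) L \<subset> M" "M \<subset> L" and v: "x \<in> vertices" "y \<in> vertices"
      using a by (auto simp: adjacent_def gimage_mat)
    have 1: "gimage (mat unif) (gimage g L) \<subset> gimage g M"
      using LM(3) gimage_strict[OF g, of "gimage (mat unif) L" M] by (simp only: gimage_commute)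
    have 2: "gimage g M \<subset> gimage g L" using LM(4) gimage_strict[OF g, of M L] by (rule rev_iffD2)
    have 3: "gimage g L \<in> vertex_act g x" and 4: "gimage g M \<in> vertex_act g y"
      unfolding vertex_act_def using LM(1,2) by (simp_all only: imageI)
    note v' = vertex_act_vertices[OF g v(1)] vertex_act_vertices[OF g v(2)]
    show ?thesis
      unfolding adjacent_def gimage_mat[symmetric]
      by (rule conjI[OF v'(1) conjI[OF v'(2)]], rule bexI[OF _ 3], rule bexI[OF _ 4], rule conjI[OF 1 2])
  qed
  from this[OF g] this[OF matrix_inv_GL2(3)[OF g], of "vertex_act g x" "vertex_act g y"] show ?thesis
    by (auto simp: vertex_act_inv[OF g])
qed

lemma adjacent_sigma0:
  "adjacent sigma0 sigma0'"
  unfolding adjacent_def gimage_mat[symmetric]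
  by (intro conjI bexI[of _ L0] bexI[of _ L1])
    (simp_all only: sigma0_vertex L0_L1_strict, simp_all only: sigma0_eq sigma0'_def homothety_class_self)

text \<open>The definition of adjacency allows any lattice in the class of \<open>sigma0\<close>.
  Rescaling the pair makes the larger one \<open>L0\<close> and leaves the vertex \<open>y\<close>
  unchanged, so that the normal form applies.\<close>

lemma neighbour_of_sigma0:
  assumes "adjacent sigma0 y"
  obtains k where "k \<in> GK" "y = vertex_act k sigma0'"
    "y = homothety_class {x \<in> L0. red (x$1) * red (k$2$1) = red (x$2) * red (k$1$1)}"
proof -
  obtain L M where LM: "L \<in> sigma0" "M \<in> y" "gimage (mat unif) L \<subset> M" "M \<subset> L" and v: "y \<in> vertices"
    using assms by (auto simp: adjacent_def gimage_mat)
  obtain z where z: "z \<noteq> 0" "L = gimage (mat z) L0" using LM(1) unfolding sigma0_eq homothety_class_eq by blast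
  let ?z = "mat (inverse z) :: 'f^2^2"
  have zG: "?z \<in> carrier GL2" using z by simp
  define M' where "M' = gimage ?z M"
  have "gimage ?z L = L0" using z by (simp add: mat_mult_mat flip: gimage_mult)
  moreover have "gimage ?z (gimage (mat unif) L) = gimage (mat unif) (gimage ?z L)"
    by (rule gimage_commute)
  ultimately have sub: "gimage (mat unif) L0 \<subset> M'" "M' \<subset> L0"
    using LM(3,4) gimage_strict[OF zG] unfolding M'_def by metis+
  obtain h where h: "h \<in> carrier GL2" "y = homothety_class (gimage h L0)"
    using v by (auto simp: vertex_iff sigma0_eq vertex_act_class)
  obtain z' where z': "z' \<noteq> 0" "M = gimage (mat z') (gimage h L0)"
    using LM(2) unfolding h(2) homothety_class_eq[of "gimage h L0"] by blast
  have M': "M' = gimage (?z ** (mat z' ** h)) L0" by (simp only: M'_def z'(2) gimage_mult)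
  have yM': "y = homothety_class M'"
  proof -
    have "homothety_class M' = homothety_class (gimage (mat z') (gimage h L0))"
      unfolding M'_def z'(2) using z(1) by (intro homothety_class_scale) simp
    then show ?thesis using homothety_class_scale[OF z'(1), of "gimage h L0"] h(2) by argo
  qed
  obtain k where k: "k \<in> GK" "M' = gimage k L1" "M' = {x \<in> L0. red (x$1) * red (k$2$1) = red (x$2) * red (k$1$1)}"
  proof (rule sublattice_normal_form[OF sub])
    fix x y assume "x \<in> M'" "y \<in> M'"
    then obtain x' y' where "x' \<in> L0" "y' \<in> L0" "x = (?z ** (mat z' ** h)) *v x'" "y = (?z ** (mat z' ** h)) *v y'"
      unfolding M' by blast
    then have "x + y = (?z ** (mat z' ** h)) *v (x' + y')" "x' + y' \<in> L0"
      by (simp_all add: matrix_vector_right_distrib L0_def)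
    then show "x + y \<in> M'" unfolding M' by blast
  next
    fix c x assume "c \<in> integers" "x \<in> M'"
    then obtain x' where "x' \<in> L0" "x = (?z ** (mat z' ** h)) *v x'"
      unfolding M' by blast
    then have "c *s x = (?z ** (mat z' ** h)) *v (c *s x')" "c *s x' \<in> L0"
      using \<open>c \<in> integers\<close> by (simp_all add: vector_scalar_commute L0_def)
    then show "c *s x \<in> M'" unfolding M' by blast
  qed (rule that)
  show thesis
    using that[OF k(1)] k(2,3) yM' by (simp add: sigma0'_def vertex_act_class)
qed

text \<open>Transitivity on oriented edges: transitivity on vertices moves the first end to
  \<open>sigma0\<close>, and the neighbours of \<open>sigma0\<close> form one orbit under
  \<open>GK\<close>, which fixes \<open>sigma0\<close>.\<close>

lemma adjacent_iff:
  "adjacent x y \<longleftrightarrow> (\<exists>g\<in>carrier GL2. x = vertex_act g sigma0 \<and> y = vertex_act g sigma0')"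
proof
  assume a: "adjacent x y"
  then obtain g where g: "g \<in> carrier GL2" "x = vertex_act g sigma0" by (auto simp: adjacent_def vertex_iff)
  have "adjacent sigma0 (vertex_act (matrix_inv g) y)"
    using a adjacent_act[OF g(1), of sigma0 "vertex_act (matrix_inv g) y"] by (simp add: g(2) vertex_act_inv[OF g(1)])
  then obtain k where k: "k \<in> GK" "vertex_act (matrix_inv g) y = vertex_act k sigma0'"
    by (rule neighbour_of_sigma0)
  have "vertex_act k sigma0 = sigma0" using k(1) by (simp add: sigma0_eq vertex_act_class gimage_GK)
  then have "x = vertex_act (g ** k) sigma0" by (simp add: vertex_act_mult g(2))
  moreover have "y = vertex_act (g ** k) sigma0'"
    using k(2) vertex_act_inv(1)[OF g(1), of y] by (simp add: vertex_act_mult)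
  ultimately show "\<exists>g\<in>carrier GL2. x = vertex_act g sigma0 \<and> y = vertex_act g sigma0'"
    using g(1) k(1) GK_in_GL2 by (intro bexI[of _ "g ** k"]) simp_all
qed (auto simp: adjacent_act adjacent_sigma0)

text \<open>The definition treats the two ends differently, but \<open>Pi_mat\<close> reverses the
  basic edge and all oriented edges are its translates.\<close>

lemma adjacent_sym: "adjacent x y \<Longrightarrow> adjacent y x"
proof -
  assume "adjacent x y"
  then obtain g where g: "g \<in> carrier GL2" "x = vertex_act g sigma0" "y = vertex_act g sigma0'"
    unfolding adjacent_iff by blast
  then have "y = vertex_act (g ** Pi_mat) sigma0" "x = vertex_act (g ** Pi_mat) sigma0'"
    by (simp_all add: vertex_act_mult vertex_act_Pi)
  then show "adjacent y x" unfolding adjacent_iff using g(1) Pi_mat_in_GL2 GL2_mult_closed by blast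
qed

lemma adjacent_neq: "adjacent x y \<Longrightarrow> x \<noteq> y"
  using sigma0_neq by (auto simp: adjacent_iff vertex_act_eq_iff)

lemma adjacent_vertices: "adjacent x y \<Longrightarrow> x \<in> vertices \<and> y \<in> vertices"
  by (simp add: adjacent_def)

lemma finite_neighbours: "finite {y. adjacent x y}"
proof (cases "x \<in> vertices")
  case False
  then show ?thesis by (simp add: adjacent_def)
next
  case True
  then obtain g where g: "g \<in> carrier GL2" "x = vertex_act g sigma0" by (auto simp: vertex_iff)
  \<comment> \<open>The index \<open>(a, b)\<close> is the residue of the first column of the normal
    form, a pair in a finite set; pairs that belong to no neighbour do no harm to the bound.\<close>
  let ?S = "(\<lambda>(a, b). homothety_class {x \<in> L0. red (x$1) * b = red (x$2) * a}) ` (UNIV :: ('k \<times> 'k) set)"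
  have "{y. adjacent x y} \<subseteq> vertex_act g ` ?S"
  proof
    fix y assume "y \<in> {y. adjacent x y}"
    then have "adjacent sigma0 (vertex_act (matrix_inv g) y)"
      using adjacent_act[OF g(1), of sigma0 "vertex_act (matrix_inv g) y"] by (simp add: g(2) vertex_act_inv[OF g(1)])
    then obtain k where "k \<in> GK" "vertex_act (matrix_inv g) y = vertex_act k sigma0'" "vertex_act (matrix_inv g) y =
        homothety_class {x \<in> L0. red (x$1) * red (k$2$1) = red (x$2) * red (k$1$1)}"
      by (rule neighbour_of_sigma0)
    then have "vertex_act (matrix_inv g) y \<in> ?S"
      by (intro image_eqI[of _ _ "(red (k$1$1), red (k$2$1))"]) (simp_all only: case_prod_conv UNIV_I)
    from imageI[OF this, of "vertex_act g"] show "y \<in> vertex_act g ` ?S" by (simp only: vertex_act_inv(1)[OF g(1)])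
  qed
  then show ?thesis by (rule finite_subset) simp
qed

text \<open>Conjugation by \<open>Pi_mat\<close> converts fixing \<open>sigma0'\<close> into fixing
  \<open>sigma0\<close>. The conjugate \<open>?h\<close> of \<open>k\<close> has unit determinant,
  so its scalar part is a unit and its entries are integral; its upper right entry is
  \<open>c / unif\<close>, which puts \<open>c\<close> in the maximal ideal.\<close>

lemma edge_stabiliser:
  assumes g: "g \<in> carrier GL2" and s: "vertex_act g sigma0 = sigma0" "vertex_act g sigma0' = sigma0'"
  obtains z k where "z \<noteq> 0" "k \<in> Iw" "g = mat z ** k"
proof -
  obtain z k where zk: "z \<noteq> 0" "k \<in> GK" "g = mat z ** k"
    using s(1) by (auto simp: vertex_act_sigma0_iff[OF g] stab0_def)
  obtain a b c d where k: "k = mat2 a b c d" by (rule mat2_cases)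
  let ?h = "mat2 d (c / unif) (b * unif) a"
  have det: "a * d - b * c \<noteq> 0" "val (a * d - b * c) = 0" using zk(2) by (auto simp: k mat2_in_GK)
  have kP: "k ** Pi_mat = Pi_mat ** ?h" by (simp add: k Pi_mat_def mat2_mult)
  have hG: "?h \<in> carrier GL2" using det by (simp add: mult.commute)
  have "vertex_act k sigma0' = sigma0'"
    using s(2) by (simp only: zk(3) vertex_act_mult sigma0'_def vertex_act_class gimage_mult homothety_class_scale[OF zk(1)])
  moreover have "vertex_act Pi_mat (vertex_act ?h sigma0) = vertex_act k (vertex_act Pi_mat sigma0)"
    by (simp only: kP flip: vertex_act_mult)
  ultimately have "vertex_act Pi_mat (vertex_act ?h sigma0) = vertex_act Pi_mat sigma0"
    by (simp only: vertex_act_Pi)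
  then have "vertex_act ?h sigma0 = sigma0" by (simp add: vertex_act_eq_iff)
  then have "?h \<in> stab0" using vertex_act_sigma0_iff[OF hG] by simp
  then obtain z' k' where h: "?h = mat z' ** k'" "z' \<noteq> 0" "k' \<in> GK" by (auto simp: stab0_def)
  have "val (det ?h) = 2 * val z'"
    using h by (simp only: h(1)) (simp add: det_mul mat_as_mat2 GK_iff val_mult)
  then have z': "val z' = 0" using det by (simp add: mult.commute)
  have "?h$1$2 = z' * k'$1$2"
    by (simp only: h(1)) (simp add: mat_as_mat2 matrix_matrix_mult_def sum_2)
  then have "c / unif \<in> integers"
    using h(2) z' GK_entry[OF h(3), of 1 2]
    by (cases "k'$1$2 = 0") (simp_all add: integers_def val_mult)
  then have "c \<in> max_ideal" by (simp add: max_ideal_divide)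
  then have "k \<in> Iw" using zk(2) by (simp add: Iw_iff k)
  then show thesis using zk that by blast
qed

end

section \<open>The coefficient system and its homology\<close>

lemma representation_direct_sum:
  assumes V: "representation G V" and W: "representation G W"
  shows "representation G (direct_sum V W)"
proof -
  interpret V: group_rep G V by (rule group_rep_of) fact
  interpret W: group_rep G W by (rule group_rep_of) fact
  show ?thesis
    by (rule representationI) (auto simp: direct_sum_def V.group V.a_ac W.a_ac V.smult_add_vec W.smult_add_vec
        V.smult_add_scalar W.smult_add_scalar V.smult_assoc W.smult_assoc V.act_add W.act_add
        V.act_smult W.act_smult V.act_mult W.act_mult)
qed

lemma fun_module_simps:
  "carrier (fun_module D C) = C" "\<zero>\<^bsub>fun_module D C\<^esub> = (\<lambda>_. \<zero>\<^bsub>D\<^esub>)"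
  "f \<oplus>\<^bsub>fun_module D C\<^esub> f' = (\<lambda>h. f h \<oplus>\<^bsub>D\<^esub> f' h)" "c \<odot>\<^bsub>fun_module D C\<^esub> f = (\<lambda>h. c \<odot>\<^bsub>D\<^esub> f h)"
  by (simp_all add: fun_module_def)

text \<open>The spaces at vertices and edges are modules of functions. Negatives and finite sums in
  them can thus be read off value by value in \<open>D\<close>.\<close>

lemma abelian_group_fun_module:
  fixes D :: "('c, 'v, 'g) rep"
  assumes D: "abelian_group D" and C: "\<And>f h. f \<in> C \<Longrightarrow> f h \<in> carrier D"
    and zero: "(\<lambda>_. \<zero>\<^bsub>D\<^esub>) \<in> C" and add: "\<And>f f'. f \<in> C \<Longrightarrow> f' \<in> C \<Longrightarrow> (\<lambda>h. f h \<oplus>\<^bsub>D\<^esub> f' h) \<in> C"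
    and neg: "\<And>f. f \<in> C \<Longrightarrow> (\<lambda>h. \<ominus>\<^bsub>D\<^esub> f h) \<in> C"
  shows "abelian_group (fun_module D C)"
    and "f \<in> C \<Longrightarrow> \<ominus>\<^bsub>fun_module D C\<^esub> f = (\<lambda>h. \<ominus>\<^bsub>D\<^esub> f h)"
    and "finite A \<Longrightarrow> F \<in> A \<rightarrow> C \<Longrightarrow> finsum (fun_module D C) F A = (\<lambda>h. finsum D (\<lambda>y. F y h) A)"
proof -
  interpret D: abelian_group D by (rule D)
  show ab: "abelian_group (fun_module D C)"
  proof (rule abelian_groupI, unfold fun_module_simps)
    fix f assume "f \<in> C"
    then show "\<exists>f'\<in>C. (\<lambda>h. f' h \<oplus>\<^bsub>D\<^esub> f h) = (\<lambda>_. \<zero>\<^bsub>D\<^esub>)"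
      using neg C by (intro bexI[of _ "\<lambda>h. \<ominus>\<^bsub>D\<^esub> f h"]) (auto simp: D.l_neg)
  qed (auto simp: zero add C D.a_ac)
  interpret F: abelian_group "fun_module D C" by (rule ab)
  show "\<ominus>\<^bsub>fun_module D C\<^esub> f = (\<lambda>h. \<ominus>\<^bsub>D\<^esub> f h)" if "f \<in> C"
    using that neg C by (intro F.add.inv_equality[of "\<lambda>h. \<ominus>\<^bsub>D\<^esub> f h" f, folded a_inv_def, symmetric, THEN sym])
      (auto simp: fun_module_simps D.l_neg)
  show "finsum (fun_module D C) F A = (\<lambda>h. finsum D (\<lambda>y. F y h) A)" if "finite A" "F \<in> A \<rightarrow> C"
    using that
  proof (induction A)
    case empty
    then show ?case by (simp add: F.finsum_empty fun_module_simps)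
  next
    case (insert a A)
    have "finsum (fun_module D C) F (insert a A) = F a \<oplus>\<^bsub>fun_module D C\<^esub> finsum (fun_module D C) F A"
      using insert by (intro F.finsum_insert) (auto simp: fun_module_simps)
    also have "\<dots> = (\<lambda>h. F a h \<oplus>\<^bsub>D\<^esub> finsum D (\<lambda>y. F y h) A)"
      using insert by (simp add: fun_module_simps)
    also have "\<dots> = (\<lambda>h. finsum D (\<lambda>y. F y h) (insert a A))"
      using insert C by (intro ext D.finsum_insert[symmetric]) auto
    finally show ?case .
  qed
qed

context local_field
begin

lemma tilde_simps:
  "carrier (tilde R) = carrier R" "add (tilde R) = add R" "\<zero>\<^bsub>tilde R\<^esub> = \<zero>\<^bsub>R\<^esub>" "smult (tilde R) = smult R"
  by (simp_all add: tilde_def module.defs rep.defs)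

text \<open>The definite description in \<open>tilde\<close> is meaningful: the valuation of the
  determinant is \<open>2 * n\<close>, so the exponent, and then \<open>k\<close>, are determined by
  the product.\<close>

lemma act_tilde:
  assumes k: "k \<in> GK"
  shows "act (tilde R) (mat (unif powi n) ** k) v = act R (red_mat k) v"
proof -
  have "k' = k" if k': "k' \<in> GK" "mat (unif powi n) ** k = mat (unif powi m) ** k'" for k' and m :: int
  proof -
    have "val (det (mat (unif powi n) ** k)) = 2 * n" "val (det (mat (unif powi m) ** k')) = 2 * m"
      using k k'(1) by (simp_all add: det_mul GK_iff val_mult mat_as_mat2 del: power_int_eq_0_iff)
    then have "n = m" using k'(2) by simp
    then have "mat (unif powi n) ** k = mat (unif powi n) ** k'" using k'(2) by simp
    then have "matrix_inv (mat (unif powi n)) ** (mat (unif powi n) ** k) =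
        matrix_inv (mat (unif powi n)) ** (mat (unif powi n) ** k')" by simp
    then show ?thesis by (simp add: matrix_inv_cancel del: power_int_eq_0_iff)
  qed
  then have "(THE k'. k' \<in> GK \<and> (\<exists>m::int. mat (unif powi n) ** k = mat (unif powi m) ** k')) = k"
    using k by (intro the_equality) blast+
  then show ?thesis by (simp add: tilde_def module.defs rep.defs)
qed

lemma act_tilde_GK: "k \<in> GK \<Longrightarrow> act (tilde R) k v = act R (red_mat k) v"
  using act_tilde[of k R 0 v] by simp

text \<open>The unit part of the scalar is absorbed into \<open>GK\<close>, which leaves a power of
  the uniformiser, as in the definition of \<open>tilde\<close>.\<close>

lemma stab0_cases:
  assumes "g \<in> stab0" obtains n k where "k \<in> GK" "g = mat (unif powi n) ** k"
proof -
  obtain z k where zk: "z \<noteq> 0" "k \<in> GK" "g = mat z ** k" using assms by (auto simp: stab0_def)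
  define u where "u = unif powi (- val z) * z"
  have u: "u \<noteq> 0" "val u = 0" using zk(1) by (simp_all add: u_def val_mult del: power_int_eq_0_iff)
  have "mat u \<in> GK" using u by (simp add: mat_as_mat2 mat2_in_GK integers_def val_mult)
  then have "mat u ** k \<in> GK" using zk by (intro GK_mult)
  moreover have "z = unif powi (val z) * u"
    by (simp add: u_def flip: power_int_add mult.assoc)
  from arg_cong[OF this, of "mat :: 'f \<Rightarrow> 'f^2^2"] have "mat z = mat (unif powi (val z)) ** (mat u :: 'f^2^2)"
    by (simp only: mat_mult_mat)
  then have "g = mat (unif powi (val z)) ** (mat u ** k)" by (simp only: zk(3) matrix_mul_assoc)
  ultimately show thesis by (rule that)
qed

lemma mat_in_stab0: "z \<noteq> 0 \<Longrightarrow> mat z \<in> stab0"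
  unfolding stab0_def using GK_one by (metis (mono_tags, lifting) matrix_mul_rid mem_Collect_eq)

lemma GK_in_stab0: "k \<in> GK \<Longrightarrow> k \<in> stab0"
  unfolding stab0_def by (metis (mono_tags, lifting) matrix_mul_lid mem_Collect_eq zero_neq_one)

lemma stab0_mult: "g \<in> stab0 \<Longrightarrow> h \<in> stab0 \<Longrightarrow> g ** h \<in> stab0"
  using vertex_act_sigma0_iff stab0_in_GL2 GL2_mult_closed by (metis vertex_act_mult)

lemma stab0_inv: "g \<in> stab0 \<Longrightarrow> matrix_inv g \<in> stab0"
  using vertex_act_sigma0_iff stab0_in_GL2 matrix_inv_GL2(3) vertex_act_inv(2) by metis

lemma subgroup_stab0: "subgroup stab0 GL2"
  by (rule group.subgroupI[OF group_GL2])
    (use stab0_in_GL2 stab0_mult stab0_inv mat_in_stab0[of 1] in \<open>auto simp: inv_GL2\<close>)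

lemma representation_tilde:
  assumes "representation GL2 R"
  shows "representation (GL2\<lparr>carrier := stab0\<rparr>) (tilde R)"
proof -
  interpret R: group_rep GL2 R by (rule group_rep_of) fact
  have act: "\<exists>k\<in>carrier GL2. \<forall>x. act (tilde R) g x = act R k x" if "g \<in> stab0" for g
    using that by (elim stab0_cases) (auto simp: act_tilde intro: red_mat_in_GL2)
  show ?thesis
  proof (rule representationI, unfold tilde_simps)
    show "group (GL2\<lparr>carrier := stab0\<rparr>)"
      by (rule group.subgroup_imp_group[OF group_GL2 subgroup_stab0])
    show "act (tilde R) \<one>\<^bsub>GL2\<lparr>carrier := stab0\<rparr>\<^esub> x = x" if "x \<in> carrier R" for x
      using that act_tilde_GK[OF GK_one, of R x] R.act_one[OF that] by simp
    show "act (tilde R) (g \<otimes>\<^bsub>GL2\<lparr>carrier := stab0\<rparr>\<^esub> h) x = act (tilde R) g (act (tilde R) h x)"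
      if "g \<in> carrier (GL2\<lparr>carrier := stab0\<rparr>)" "h \<in> carrier (GL2\<lparr>carrier := stab0\<rparr>)" "x \<in> carrier R" for g h x
    proof -
      obtain m k where k: "k \<in> GK" "g = mat (unif powi m) ** k" using \<open>g \<in> _\<close> by (auto elim: stab0_cases)
      obtain n l where l: "l \<in> GK" "h = mat (unif powi n) ** l" using \<open>h \<in> _\<close> by (auto elim: stab0_cases)
      \<comment> \<open>Powers of the uniformiser are central, so the exponents add and the
        \<open>GK\<close> parts multiply in order.\<close>
      have "g ** h = mat (unif powi m) ** (k ** mat (unif powi n)) ** l"
        by (simp only: k l matrix_mul_assoc)
      also have "k ** mat (unif powi n) = mat (unif powi n) ** k" by (rule mat_commute[symmetric])
      also have "mat (unif powi m) ** (mat (unif powi n) ** k) ** l = mat (unif powi (m + n)) ** (k ** l)"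
        by (simp add: matrix_mul_assoc mat_mult_mat power_int_add)
      finally have gh: "g ** h = mat (unif powi (m + n)) ** (k ** l)" .
      have "act (tilde R) (g ** h) x = act R (red_mat k ** red_mat l) x"
        unfolding gh using k l by (simp add: act_tilde GK_mult red_mat_mult)
      also have "\<dots> = act (tilde R) g (act (tilde R) h x)"
        using R.act_mult[of "red_mat k" "red_mat l" x] k l that(3) by (simp add: act_tilde red_mat_in_GL2)
      finally show ?thesis by simp
    qed
  qed (use act in \<open>auto simp: R.a_ac R.smult_add_vec R.smult_add_scalar R.smult_assoc R.act_add R.act_smult dest!: act\<close>)
qed

end

section \<open>The coefficient system attached to the pair of representations \<open>D\<close> and
  \<open>E\<close>\<close>

locale basic_diagram = local_field val unif red
  for val :: "'f::{field,metric_space} \<Rightarrow> int" and unif :: 'f and red :: "'f \<Rightarrow> 'k::finite_field" +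
  fixes R :: "('c::field, 'v, 'k^2^2) rep" and S :: "('c, 'u, 'k^2^2) rep" and a :: 'v and b :: 'u
    and E :: "('c, 'v \<times> 'u, 'f^2^2) rep"
  assumes repR: "representation GL2 R" and repS: "representation GL2 S" and D1: "is_D1 R S a b E"
begin

abbreviation "G0 \<equiv> GL2\<lparr>carrier := stab0\<rparr>"
abbreviation "G1 \<equiv> GL2\<lparr>carrier := stab1\<rparr>"
abbreviation "D \<equiv> D0_rep R S"
abbreviation "V \<equiv> V_gamma R S E"

lemma repD: "representation G0 D"
  unfolding D0_rep_def by (intro representation_direct_sum representation_tilde repR repS)

lemma repE: "representation G1 E"
  using D1 by (simp add: is_D1_def)

sublocale D: group_rep G0 D by (rule group_rep_of[OF repD])
sublocale E: group_rep G1 E by (rule group_rep_of[OF repE])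

lemma E_simps: "carrier E = invariants D Iw1" "add E = add D" "\<zero>\<^bsub>E\<^esub> = \<zero>\<^bsub>D\<^esub>" "smult E = smult D"
  using D1 by (auto simp: is_D1_def)

lemma E_closed: "v \<in> carrier E \<Longrightarrow> v \<in> carrier D"
  by (simp add: E_simps invariants_def)

lemma act_E: "z \<noteq> 0 \<Longrightarrow> k \<in> Iw \<Longrightarrow> v \<in> carrier E \<Longrightarrow> act E (mat z ** k) v = act D (mat z ** k) v"
  using D1 unfolding is_D1_def by blast

lemma actD_mult: "g \<in> stab0 \<Longrightarrow> h \<in> stab0 \<Longrightarrow> v \<in> carrier D \<Longrightarrow> act D (g ** h) v = act D g (act D h v)"
  using D.act_mult[of g h v] by simp

lemma actD_one: "v \<in> carrier D \<Longrightarrow> act D (mat 1) v = v"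
  using D.act_one[of v] by simp

lemma neg_E: "v \<in> carrier E \<Longrightarrow> \<ominus>\<^bsub>E\<^esub> v = \<ominus>\<^bsub>D\<^esub> v"
  using E.smult_minus_one[of v] D.smult_minus_one[of v] E_closed by (simp add: E_simps)

lemma Pi_in_stab1: "Pi_mat \<in> stab1"
  unfolding stab1_def by (rule generate.incl) simp

lemma Iw_in_stab1: "k \<in> Iw \<Longrightarrow> k \<in> stab1"
  unfolding stab1_def by (rule generate.incl) simp

lemma subgroup_stab1: "subgroup stab1 GL2"
  unfolding stab1_def by (rule group.generate_is_subgroup[OF group_GL2])
    (use Iw_subset GK_in_GL2 Pi_mat_in_GL2 in auto)

lemma stab1_in_GL2: "g \<in> stab1 \<Longrightarrow> g \<in> carrier GL2"
  using subgroup.subset[OF subgroup_stab1] by blast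

lemma stab1_mult: "g \<in> stab1 \<Longrightarrow> h \<in> stab1 \<Longrightarrow> g ** h \<in> stab1"
  using subgroup.m_closed[OF subgroup_stab1, of g h] by simp

lemma stab1_inv: "g \<in> stab1 \<Longrightarrow> matrix_inv g \<in> stab1"
  using subgroup.m_inv_closed[OF subgroup_stab1, of g] stab1_in_GL2[of g] by (simp add: inv_GL2)

lemma stab1_one: "mat 1 \<in> stab1"
  using subgroup.one_closed[OF subgroup_stab1] by simp

text \<open>The square of \<open>Pi_mat\<close> is the scalar \<open>unif\<close>, which supplies
  all powers of the uniformiser; scalar units already lie in \<open>Iw\<close>.\<close>

lemma mat_in_stab1:
  assumes "z \<noteq> 0" shows "mat z \<in> stab1"
proof -
  have pow: "mat (unif ^ n) \<in> stab1" for n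
  proof (induction n)
    case (Suc n)
    have "Pi_mat ** Pi_mat = mat unif" by (simp add: Pi_mat_def mat2_mult mat_as_mat2)
    then have "mat (unif ^ Suc n) = Pi_mat ** Pi_mat ** mat (unif ^ n)" by (simp add: mat_mult_mat)
    then show ?case using Suc Pi_in_stab1 stab1_mult by simp
  qed (simp add: stab1_one)
  have powi: "mat (unif powi n) \<in> stab1" for n
  proof (cases "0 \<le> n")
    case False
    then have "mat (unif powi n) = (matrix_inv (mat (unif ^ nat (- n))) :: 'f^2^2)"
      using matrix_inv_mat[of "unif ^ nat (- n)"] by (simp add: power_int_def power_inverse)
    then show ?thesis using pow stab1_inv by simp
  qed (simp add: power_int_def pow)
  define u where "u = unif powi (- val z) * z"
  have u: "u \<noteq> 0" "val u = 0" using assms by (simp_all add: u_def val_mult del: power_int_eq_0_iff)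
  have "mat u \<in> Iw" using u by (simp add: Iw_iff) (simp add: mat_as_mat2 mat2_in_GK integers_def val_mult)
  moreover have "z = unif powi (val z) * u"
    by (simp add: u_def flip: power_int_add mult.assoc)
  from arg_cong[OF this, of "mat :: 'f \<Rightarrow> 'f^2^2"] have "mat z = mat (unif powi (val z)) ** (mat u :: 'f^2^2)"
    by (simp only: mat_mult_mat)
  ultimately show ?thesis using powi Iw_in_stab1 stab1_mult by simp
qed

subsection \<open>The spaces at vertices and edges\<close>

text \<open>The equivariant function supported on one coset of \<open>stab0\<close> whose value at
  the inverse of \<open>g\<close> is \<open>d\<close>. For fixed \<open>g\<close> it identifies
  \<open>D\<close> with the space at the vertex \<open>g sigma0\<close>.\<close>

definition indf :: "'f^2^2 \<Rightarrow> 'v \<times> 'u \<Rightarrow> 'f^2^2 \<Rightarrow> 'v \<times> 'u" where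
  "indf g d = (\<lambda>h. if h \<in> carrier GL2 \<and> h ** g \<in> stab0 then act D (h ** g) d else \<zero>\<^bsub>D\<^esub>)"

abbreviation "rt \<equiv> right_transl GL2 D"

definition Sp :: "('f^2) set set \<Rightarrow> ('f^2^2 \<Rightarrow> 'v \<times> 'u) set" where
  "Sp x = carrier (cs_space V {x})"

definition Se :: "('f^2) set set \<Rightarrow> ('f^2) set set \<Rightarrow> ('f^2^2 \<Rightarrow> 'v \<times> 'u) set" where
  "Se x y = carrier (cs_space V {x, y})"

definition res :: "('f^2) set set \<Rightarrow> ('f^2) set set \<Rightarrow> ('f^2^2 \<Rightarrow> 'v \<times> 'u) \<Rightarrow> 'f^2^2 \<Rightarrow> 'v \<times> 'u" where
  "res x y = cs_res V {x, y} {x}"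

lemma cs_space_vertex: "cs_space V {x} = fun_module D (Sp x)"
  by (simp add: Sp_def V_gamma_def cs_of_def cInd_at_def fun_module_simps)

lemma cs_space_edge: "x \<noteq> y \<Longrightarrow> cs_space V {x, y} = fun_module E (Se x y)"
  by (simp add: Se_def V_gamma_def cs_of_def cInd_at_def fun_module_simps doubleton_eq_iff)

lemma cs_act_eq: "cs_act V g t = rt g"
  by (simp add: V_gamma_def cs_of_def)

lemma indf_at: "g \<in> carrier GL2 \<Longrightarrow> d \<in> carrier D \<Longrightarrow> indf g d (matrix_inv g) = d"
  using mat_in_stab0[of 1] by (simp add: indf_def matrix_inv_GL2 actD_one)

lemma stab0_left_cancel: "p \<in> stab0 \<Longrightarrow> h \<in> carrier GL2 \<Longrightarrow> p ** h \<in> stab0 \<longleftrightarrow> h \<in> stab0"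
  using stab0_mult[of p h] stab0_mult[OF stab0_inv, of p "p ** h"] matrix_inv_cancel(2)[OF stab0_in_GL2]
  by metis

lemma stab0_right_cancel: "p \<in> stab0 \<Longrightarrow> h \<in> carrier GL2 \<Longrightarrow> h ** p \<in> stab0 \<longleftrightarrow> h \<in> stab0"
  using stab0_mult[of h p] stab0_mult[OF _ stab0_inv, of "h ** p" p] matrix_inv_cancel(3)[OF stab0_in_GL2]
  by metis

text \<open>An equivariant function supported on a single coset is determined by one value, here at
  \<open>matrix_inv g\<close>. Another matrix \<open>g'\<close> leading to the same vertex differs
  from \<open>g\<close> by an element of \<open>stab0\<close>, so it names the same coset.\<close>

lemma Sp_iff:
  assumes g: "g \<in> carrier GL2"
  shows "f \<in> Sp (vertex_act g sigma0) \<longleftrightarrow> (\<exists>d\<in>carrier D. f = indf g d)"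
proof -
  have Sp: "f \<in> Sp (vertex_act g sigma0) \<longleftrightarrow> f \<in> cInd_space GL2 stab0 D \<and>
      (\<exists>g'\<in>carrier GL2. vertex_act g sigma0 = vertex_act g' sigma0 \<and>
        {h \<in> carrier GL2. f h \<noteq> \<zero>\<^bsub>D\<^esub>} \<subseteq> stab0 #>\<^bsub>GL2\<^esub> matrix_inv g')"
    by (simp add: Sp_def V_gamma_def cs_of_def cInd_at_def fun_module_simps simplex_act_def)
  show ?thesis
  proof
    assume "f \<in> Sp (vertex_act g sigma0)"
    then obtain g' where f: "f \<in> cInd_space GL2 stab0 D" and g': "g' \<in> carrier GL2"
      "vertex_act g sigma0 = vertex_act g' sigma0"
      "{h \<in> carrier GL2. f h \<noteq> \<zero>\<^bsub>D\<^esub>} \<subseteq> stab0 #>\<^bsub>GL2\<^esub> matrix_inv g'" by (auto simp: Sp)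
    have f1: "\<And>g. g \<in> carrier GL2 \<Longrightarrow> f g \<in> carrier D" "\<And>g. g \<notin> carrier GL2 \<Longrightarrow> f g = \<zero>\<^bsub>D\<^esub>"
      "\<And>p g. p \<in> stab0 \<Longrightarrow> g \<in> carrier GL2 \<Longrightarrow> f (p ** g) = act D p (f g)"
      using f by (simp_all add: cInd_space_def equivariant_funs_def)
    have ig: "matrix_inv g \<in> carrier GL2" "matrix_inv g' \<in> carrier GL2"
      using matrix_inv_GL2(3) g g' by blast+
    have "vertex_act (matrix_inv g' ** g) sigma0 = sigma0"
      by (simp add: vertex_act_mult g'(2) vertex_act_inv[OF g'(1)])
    then have j: "matrix_inv g' ** g \<in> stab0"
      using vertex_act_sigma0_iff[of "matrix_inv g' ** g"] ig(2) g by simp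
    have "f h = indf g (f (matrix_inv g)) h" for h
    proof (cases "h \<in> carrier GL2")
      case h: True
      show ?thesis
      proof (cases "h ** g \<in> stab0")
        case True
        then show ?thesis using f1(3)[OF True ig(1)] h matrix_inv_cancel(3)[OF g, of h] by (simp add: indf_def)
      next
        case False
        have "f h = \<zero>\<^bsub>D\<^esub>"
        proof (rule ccontr)
          assume "f h \<noteq> \<zero>\<^bsub>D\<^esub>"
          then obtain p where p: "p \<in> stab0" "h = p ** matrix_inv g'"
            using g'(3) h by (auto simp: r_coset_def)
          then have "h ** g = p ** (matrix_inv g' ** g)" by (simp add: matrix_mul_assoc)
          then show False using False p(1) j stab0_mult by simp
        qed
        then show ?thesis using False by (simp add: indf_def)
      qed
    qed (simp add: indf_def f1(2))
    then show "\<exists>d\<in>carrier D. f = indf g d" using f1(1)[OF ig(1)] by blast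
  next
    assume "\<exists>d\<in>carrier D. f = indf g d"
    then obtain d where d: "d \<in> carrier D" "f = indf g d" by blast
    have supp: "{h \<in> carrier GL2. f h \<noteq> \<zero>\<^bsub>D\<^esub>} \<subseteq> stab0 #>\<^bsub>GL2\<^esub> matrix_inv g"
    proof
      fix h assume "h \<in> {h \<in> carrier GL2. f h \<noteq> \<zero>\<^bsub>D\<^esub>}"
      then have h: "h \<in> carrier GL2" "h ** g \<in> stab0" by (auto simp: d indf_def split: if_splits)
      then show "h \<in> stab0 #>\<^bsub>GL2\<^esub> matrix_inv g"
        using matrix_inv_cancel(3)[OF g, of h] by (auto simp: r_coset_def intro!: bexI[of _ "h ** g"])
    qed
    have "f (p ** h) = act D p (f h)" if p: "p \<in> stab0" "h \<in> carrier GL2" for p h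
    proof -
      have e: "p ** h ** g \<in> stab0 \<longleftrightarrow> h ** g \<in> stab0"
        using stab0_left_cancel[OF p(1), of "h ** g"] p g by (simp add: matrix_mul_assoc)
      show ?thesis
      proof (cases "h ** g \<in> stab0")
        case True
        then show ?thesis using e p d actD_mult[of p "h ** g" d] stab0_in_GL2[OF p(1)]
          by (simp add: indf_def matrix_mul_assoc)
      next
        case False
        then show ?thesis using e p D.act_zero[of p] by (simp add: indf_def d)
      qed
    qed
    then have "f \<in> cInd_space GL2 stab0 D"
      using d supp g matrix_inv_GL2(3) by (auto simp: cInd_space_def equivariant_funs_def indf_def
          intro!: exI[of _ "{matrix_inv g}"])
    then show "f \<in> Sp (vertex_act g sigma0)" using supp g by (auto simp: Sp)
  qed
qed

lemma indf_add: "d \<in> carrier D \<Longrightarrow> d' \<in> carrier D \<Longrightarrow> indf g (d \<oplus>\<^bsub>D\<^esub> d') = (\<lambda>h. indf g d h \<oplus>\<^bsub>D\<^esub> indf g d' h)"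
  using D.act_add by (auto simp: indf_def fun_eq_iff)

lemma indf_smult: "d \<in> carrier D \<Longrightarrow> indf g (c \<odot>\<^bsub>D\<^esub> d) = (\<lambda>h. c \<odot>\<^bsub>D\<^esub> indf g d h)"
  using D.act_smult by (auto simp: indf_def fun_eq_iff)

lemma indf_zero: "indf g \<zero>\<^bsub>D\<^esub> = (\<lambda>_. \<zero>\<^bsub>D\<^esub>)"
  using D.act_zero by (auto simp: indf_def fun_eq_iff)

lemma indf_rt: "x \<in> carrier GL2 \<Longrightarrow> rt x (indf g d) = indf (x ** g) d"
  by (auto simp: indf_def right_transl_def fun_eq_iff matrix_mul_assoc)

lemma indf_stab0:
  assumes "g \<in> carrier GL2" "k \<in> stab0" "d \<in> carrier D" shows "indf (g ** k) d = indf g (act D k d)"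
  using assms stab0_right_cancel[OF assms(2)] actD_mult[OF _ assms(2,3)]
  by (auto simp: indf_def fun_eq_iff matrix_mul_assoc)

lemma Sp_cases:
  assumes "x \<in> vertices" "f \<in> Sp x"
  obtains g d where "g \<in> carrier GL2" "x = vertex_act g sigma0" "d \<in> carrier D" "f = indf g d"
  using assms Sp_iff by (auto simp: vertex_iff)

lemma Sp_value: "x \<in> vertices \<Longrightarrow> f \<in> Sp x \<Longrightarrow> f h \<in> carrier D"
  by (erule (1) Sp_cases) (auto simp: indf_def)

lemma Sp_outside: "x \<in> vertices \<Longrightarrow> f \<in> Sp x \<Longrightarrow> h \<notin> carrier GL2 \<Longrightarrow> f h = \<zero>\<^bsub>D\<^esub>"
  by (erule (1) Sp_cases) (auto simp: indf_def)

lemma Sp_closed: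
  assumes "x \<in> vertices"
  shows "(\<lambda>_. \<zero>\<^bsub>D\<^esub>) \<in> Sp x" "f \<in> Sp x \<Longrightarrow> f' \<in> Sp x \<Longrightarrow> (\<lambda>h. f h \<oplus>\<^bsub>D\<^esub> f' h) \<in> Sp x"
    "f \<in> Sp x \<Longrightarrow> (\<lambda>h. c \<odot>\<^bsub>D\<^esub> f h) \<in> Sp x" "f \<in> Sp x \<Longrightarrow> (\<lambda>h. \<ominus>\<^bsub>D\<^esub> f h) \<in> Sp x"
    "f \<in> Sp x \<Longrightarrow> g \<in> carrier GL2 \<Longrightarrow> rt g f \<in> Sp (vertex_act g x)"
proof -
  obtain g where g: "g \<in> carrier GL2" "x = vertex_act g sigma0" using assms by (auto simp: vertex_iff)
  note S = Sp_iff[OF g(1), folded g(2)]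
  show "(\<lambda>_. \<zero>\<^bsub>D\<^esub>) \<in> Sp x" unfolding S using D.zero_closed by (intro bexI[of _ "\<zero>\<^bsub>D\<^esub>"]) (simp_all add: indf_zero)
  show "(\<lambda>h. f h \<oplus>\<^bsub>D\<^esub> f' h) \<in> Sp x" if "f \<in> Sp x" "f' \<in> Sp x"
  proof -
    from that obtain d d' where d: "d \<in> carrier D" "f = indf g d" "d' \<in> carrier D" "f' = indf g d'"
      unfolding S by (elim bexE)
    show ?thesis unfolding S d(2,4) indf_add[OF d(1,3), symmetric]
      by (intro bexI[of _ "d \<oplus>\<^bsub>D\<^esub> d'"] refl D.a_closed d)
  qed
  show sm: "(\<lambda>h. c \<odot>\<^bsub>D\<^esub> f h) \<in> Sp x" if "f \<in> Sp x" for c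
  proof -
    from that obtain d where d: "d \<in> carrier D" "f = indf g d" unfolding S by (elim bexE)
    show ?thesis unfolding S d(2) indf_smult[OF d(1), symmetric]
      by (intro bexI[of _ "c \<odot>\<^bsub>D\<^esub> d"] refl D.smult_cl d)
  qed
  show "(\<lambda>h. \<ominus>\<^bsub>D\<^esub> f h) \<in> Sp x" if "f \<in> Sp x"
    using sm[OF that, of "- 1"] Sp_value[OF assms that] by (simp add: D.smult_minus_one)
  show "rt h f \<in> Sp (vertex_act h x)" if "f \<in> Sp x" "h \<in> carrier GL2" for h
    using that Sp_iff[of "h ** g"] g unfolding S by (auto simp: indf_rt g(2) vertex_act_mult)
qed

end

section \<open>Spaces on edges, restriction maps and chains\<close>

context basic_diagram
begin

lemma simplex_act_sigma1: "simplex_act g sigma1 = {vertex_act g sigma0, vertex_act g sigma0'}"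
  by (simp add: simplex_act_def sigma1_eq)

lemma simplex_act_sigma0: "simplex_act g {sigma0} = {vertex_act g sigma0}"
  by (simp add: simplex_act_def)

text \<open>A matrix preserving the unordered edge fixes both ends or exchanges them; multiplication
  by \<open>Pi_mat\<close> reduces the second case to the first.\<close>

lemma edge_set_stabiliser:
  assumes g: "g \<in> carrier GL2" and e: "{vertex_act g sigma0, vertex_act g sigma0'} = {sigma0, sigma0'}"
  shows "g \<in> stab1"
proof -
  have fix_both: "h \<in> stab1" if h: "h \<in> carrier GL2" "vertex_act h sigma0 = sigma0" "vertex_act h sigma0' = sigma0'" for h
    using edge_stabiliser[OF h] mat_in_stab1 Iw_in_stab1 stab1_mult by metis
  from e consider "vertex_act g sigma0 = sigma0" "vertex_act g sigma0' = sigma0'"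
    | "vertex_act g sigma0 = sigma0'" "vertex_act g sigma0' = sigma0"
    unfolding doubleton_eq_iff by blast
  then show ?thesis
  proof cases
    case 1
    then show ?thesis using fix_both g by blast
  next
    case 2
    have "Pi_mat ** g \<in> stab1"
      by (rule fix_both) (use 2 g vertex_act_Pi in \<open>simp_all add: vertex_act_mult\<close>)
    then have "matrix_inv Pi_mat ** (Pi_mat ** g) \<in> stab1" using stab1_mult stab1_inv Pi_in_stab1 by blast
    then show ?thesis by (simp add: matrix_inv_cancel)
  qed
qed

lemma Se_iff:
  assumes g: "g \<in> carrier GL2"
  shows "f \<in> Se (vertex_act g sigma0) (vertex_act g sigma0') \<longleftrightarrow> f \<in> equivariant_funs GL2 stab1 E \<and>
    (\<forall>h\<in>carrier GL2. f h \<noteq> \<zero>\<^bsub>D\<^esub> \<longrightarrow> h ** g \<in> stab1)"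
proof -
  have ne: "vertex_act g sigma0 \<noteq> vertex_act g sigma0'" using sigma0_neq vertex_act_eq_iff[OF g] by simp
  have Se: "f \<in> Se (vertex_act g sigma0) (vertex_act g sigma0') \<longleftrightarrow> f \<in> cInd_space GL2 stab1 E \<and>
      (\<exists>g'\<in>carrier GL2. {vertex_act g sigma0, vertex_act g sigma0'} = {vertex_act g' sigma0, vertex_act g' sigma0'} \<and>
        {h \<in> carrier GL2. f h \<noteq> \<zero>\<^bsub>D\<^esub>} \<subseteq> stab1 #>\<^bsub>GL2\<^esub> matrix_inv g')"
    using ne by (simp add: Se_def V_gamma_def cs_of_def cInd_at_def fun_module_simps simplex_act_sigma1
        E_simps(3) doubleton_eq_iff)
  have supp: "{h \<in> carrier GL2. f h \<noteq> \<zero>\<^bsub>D\<^esub>} \<subseteq> stab1 #>\<^bsub>GL2\<^esub> matrix_inv g"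
    if "\<forall>h\<in>carrier GL2. f h \<noteq> \<zero>\<^bsub>D\<^esub> \<longrightarrow> h ** g \<in> stab1"
  proof
    fix h assume "h \<in> {h \<in> carrier GL2. f h \<noteq> \<zero>\<^bsub>D\<^esub>}"
    then have "h ** g \<in> stab1" using that by blast
    then show "h \<in> stab1 #>\<^bsub>GL2\<^esub> matrix_inv g"
      using matrix_inv_cancel(3)[OF g, of h] by (auto simp: r_coset_def intro!: bexI[of _ "h ** g"])
  qed
  show ?thesis
  proof
    assume "f \<in> Se (vertex_act g sigma0) (vertex_act g sigma0')"
    then obtain g' where f: "f \<in> cInd_space GL2 stab1 E" and g': "g' \<in> carrier GL2"
      "{vertex_act g sigma0, vertex_act g sigma0'} = {vertex_act g' sigma0, vertex_act g' sigma0'}"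
      "{h \<in> carrier GL2. f h \<noteq> \<zero>\<^bsub>D\<^esub>} \<subseteq> stab1 #>\<^bsub>GL2\<^esub> matrix_inv g'" unfolding Se by blast
    have "vertex_act (matrix_inv g') ` {vertex_act g sigma0, vertex_act g sigma0'} = {sigma0, sigma0'}"
      unfolding g'(2) by (simp add: vertex_act_inv[OF g'(1)])
    then have "{vertex_act (matrix_inv g' ** g) sigma0, vertex_act (matrix_inv g' ** g) sigma0'} = {sigma0, sigma0'}"
      by (simp add: vertex_act_mult)
    then have j: "matrix_inv g' ** g \<in> stab1"
      by (intro edge_set_stabiliser) (simp_all add: g g'(1) matrix_inv_GL2)
    have "h ** g \<in> stab1" if "h \<in> carrier GL2" "f h \<noteq> \<zero>\<^bsub>D\<^esub>" for h
    proof -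
      have "h \<in> stab1 #>\<^bsub>GL2\<^esub> matrix_inv g'" using g'(3) that by blast
      then obtain p where p: "p \<in> stab1" "h = p ** matrix_inv g'" by (auto simp: r_coset_def)
      then have "h ** g = p ** (matrix_inv g' ** g)" by (simp add: matrix_mul_assoc)
      then show ?thesis using p(1) j stab1_mult by simp
    qed
    then show "f \<in> equivariant_funs GL2 stab1 E \<and> (\<forall>h\<in>carrier GL2. f h \<noteq> \<zero>\<^bsub>D\<^esub> \<longrightarrow> h ** g \<in> stab1)"
      using f by (simp add: cInd_space_def)
  next
    assume L: "f \<in> equivariant_funs GL2 stab1 E \<and> (\<forall>h\<in>carrier GL2. f h \<noteq> \<zero>\<^bsub>D\<^esub> \<longrightarrow> h ** g \<in> stab1)"
    then have "f \<in> cInd_space GL2 stab1 E"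
      using supp matrix_inv_GL2(3)[OF g]
      by (auto simp: cInd_space_def E_simps(3) intro!: exI[of _ "{matrix_inv g}"])
    then show "f \<in> Se (vertex_act g sigma0) (vertex_act g sigma0')" unfolding Se using supp L g by blast
  qed
qed

lemma Se_commute: "Se x y = Se y x"
  by (simp add: Se_def insert_commute)

lemma equivariant_E:
  "f \<in> equivariant_funs GL2 stab1 E \<longleftrightarrow> (\<forall>g\<in>carrier GL2. f g \<in> carrier E) \<and> (\<forall>g. g \<notin> carrier GL2 \<longrightarrow> f g = \<zero>\<^bsub>D\<^esub>) \<and>
     (\<forall>p\<in>stab1. \<forall>g\<in>carrier GL2. f (p ** g) = act E p (f g))"
  by (simp add: equivariant_funs_def E_simps(3))

lemma Se_value:
  assumes "adjacent x y" "f \<in> Se x y" shows "f h \<in> carrier E"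
proof -
  obtain g where g: "g \<in> carrier GL2" "x = vertex_act g sigma0" "y = vertex_act g sigma0'"
    using assms(1) by (auto simp: adjacent_iff)
  then show ?thesis using assms(2) Se_iff[OF g(1)] E.zero_closed
    by (cases "h \<in> carrier GL2") (auto simp: equivariant_E E_simps(3))
qed

lemma Se_closed:
  assumes "adjacent x y"
  shows "(\<lambda>_. \<zero>\<^bsub>D\<^esub>) \<in> Se x y" "f \<in> Se x y \<Longrightarrow> f' \<in> Se x y \<Longrightarrow> (\<lambda>h. f h \<oplus>\<^bsub>D\<^esub> f' h) \<in> Se x y"
    "f \<in> Se x y \<Longrightarrow> (\<lambda>h. c \<odot>\<^bsub>D\<^esub> f h) \<in> Se x y" "f \<in> Se x y \<Longrightarrow> (\<lambda>h. \<ominus>\<^bsub>D\<^esub> f h) \<in> Se x y"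
    "f \<in> Se x y \<Longrightarrow> g \<in> carrier GL2 \<Longrightarrow> rt g f \<in> Se (vertex_act g x) (vertex_act g y)"
proof -
  obtain g where g: "g \<in> carrier GL2" "x = vertex_act g sigma0" "y = vertex_act g sigma0'"
    using assms by (auto simp: adjacent_iff)
  note S = Se_iff[OF g(1), folded g(2,3), unfolded equivariant_E]
  have zE: "\<zero>\<^bsub>D\<^esub> \<in> carrier E" using E.zero_closed by (simp add: E_simps(3))
  have aE: "u \<oplus>\<^bsub>D\<^esub> v \<in> carrier E" if "u \<in> carrier E" "v \<in> carrier E" for u v
    using E.a_closed[OF that] by (simp add: E_simps(2))
  have sE: "c \<odot>\<^bsub>D\<^esub> u \<in> carrier E" if "u \<in> carrier E" for u c
    using E.smult_cl[OF that(1), of c] by (simp add: E_simps(4))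
  have act_aE: "act E p (u \<oplus>\<^bsub>D\<^esub> v) = act E p u \<oplus>\<^bsub>D\<^esub> act E p v"
    if "u \<in> carrier E" "v \<in> carrier E" "p \<in> stab1" for u v p
    using E.act_add[of p u v] that by (simp add: E_simps(2))
  have act_sE: "act E p (c \<odot>\<^bsub>D\<^esub> u) = c \<odot>\<^bsub>D\<^esub> act E p u" if "u \<in> carrier E" "p \<in> stab1" for u c p
    using E.act_smult[of p u c] that by (simp add: E_simps(4))
  have act_zE: "act E p \<zero>\<^bsub>D\<^esub> = \<zero>\<^bsub>D\<^esub>" if "p \<in> stab1" for p
    using E.act_zero[of p] that by (simp add: E_simps(3))
  show "(\<lambda>_. \<zero>\<^bsub>D\<^esub>) \<in> Se x y" unfolding S using zE by (simp add: act_zE)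
  show "(\<lambda>h. f h \<oplus>\<^bsub>D\<^esub> f' h) \<in> Se x y" if f: "f \<in> Se x y" "f' \<in> Se x y"
  proof -
    note f' = f[unfolded S]
    have ne: "f h \<noteq> \<zero>\<^bsub>D\<^esub> \<or> f' h \<noteq> \<zero>\<^bsub>D\<^esub>" if "f h \<oplus>\<^bsub>D\<^esub> f' h \<noteq> \<zero>\<^bsub>D\<^esub>" for h
      using that by (metis D.l_zero D.zero_closed)
    show ?thesis unfolding S
    proof (intro conjI ballI allI impI)
      fix h assume "h \<in> carrier GL2" "f h \<oplus>\<^bsub>D\<^esub> f' h \<noteq> \<zero>\<^bsub>D\<^esub>"
      then show "h ** g \<in> stab1" using f' ne by blast
    qed (use f' aE act_aE in simp_all)
  qed
  show sm: "(\<lambda>h. c \<odot>\<^bsub>D\<^esub> f h) \<in> Se x y" if f: "f \<in> Se x y" for c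
  proof -
    note f' = f[unfolded S]
    have ne: "f h \<noteq> \<zero>\<^bsub>D\<^esub>" if "c \<odot>\<^bsub>D\<^esub> f h \<noteq> \<zero>\<^bsub>D\<^esub>" for h
      using that by (metis D.smult_zero_vec)
    show ?thesis unfolding S
    proof (intro conjI ballI allI impI)
      fix h assume "h \<in> carrier GL2" "c \<odot>\<^bsub>D\<^esub> f h \<noteq> \<zero>\<^bsub>D\<^esub>"
      then show "h ** g \<in> stab1" using f' ne by blast
    qed (use f' sE act_sE in simp_all)
  qed
  show "(\<lambda>h. \<ominus>\<^bsub>D\<^esub> f h) \<in> Se x y" if "f \<in> Se x y"
    using sm[OF that, of "- 1"] E_closed[OF Se_value[OF assms that]] by (simp add: D.smult_minus_one)
  show "rt h f \<in> Se (vertex_act h x) (vertex_act h y)" if f: "f \<in> Se x y" and h: "h \<in> carrier GL2" for h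
  proof -
    have hg: "h ** g \<in> carrier GL2" using h g by simp
    note f' = f[unfolded S]
    show ?thesis
      unfolding g(2,3) vertex_act_mult[symmetric] Se_iff[OF hg] equivariant_E
    proof (intro conjI ballI allI impI)
      fix p k :: "'f^2^2" assume "p \<in> stab1" "k \<in> carrier GL2"
      then show "rt h f (p ** k) = act E p (rt h f k)"
        using f' h stab1_in_GL2[of p] by (simp add: right_transl_def flip: matrix_mul_assoc)
    next
      fix k :: "'f^2^2" assume "k \<in> carrier GL2" "rt h f k \<noteq> \<zero>\<^bsub>D\<^esub>"
      then show "k ** (h ** g) \<in> stab1" using f' h by (simp add: right_transl_def matrix_mul_assoc)
    qed (use f' h in \<open>simp_all add: right_transl_def\<close>)
  qed
qed

text \<open>The restriction is a definite description over all \<open>g'\<close> carrying the basic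
  edge to this oriented edge. Two choices differ by an element fixing both ends, hence by a scalar
  times an element of \<open>Iw\<close>; there the actions on \<open>E\<close> and on
  \<open>D\<close> agree, so the result is independent of the choice.\<close>

lemma res_eq:
  assumes g: "g \<in> carrier GL2" and f: "f \<in> Se (vertex_act g sigma0) (vertex_act g sigma0')"
  shows "res (vertex_act g sigma0) (vertex_act g sigma0') f = indf g (f (matrix_inv g))"
proof -
  let ?x = "vertex_act g sigma0" and ?y = "vertex_act g sigma0'"
  have ne: "?x \<noteq> ?y" using sigma0_neq vertex_act_eq_iff[OF g] by simp
  have res: "res ?x ?y f = (THE f'. f' \<in> Sp ?x \<and> (\<exists>g'\<in>carrier GL2. {?x, ?y} = simplex_act g' sigma1 \<and>
      {?x} = simplex_act g' {sigma0} \<and> f' (matrix_inv g') = f (matrix_inv g')))"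
    using ne unfolding res_def Sp_def V_gamma_def cs_of_def by (simp add: Let_def)
  note f' = f[unfolded Se_iff[OF g] equivariant_E]
  have ig: "matrix_inv g \<in> carrier GL2" using matrix_inv_GL2(3) g by blast
  have d: "f (matrix_inv g) \<in> carrier E" "f (matrix_inv g) \<in> carrier D" using f' ig E_closed by blast+
  show ?thesis
    unfolding res
  proof (rule the_equality)
    show "indf g (f (matrix_inv g)) \<in> Sp ?x \<and> (\<exists>g'\<in>carrier GL2. {?x, ?y} = simplex_act g' sigma1 \<and>
      {?x} = simplex_act g' {sigma0} \<and> indf g (f (matrix_inv g)) (matrix_inv g') = f (matrix_inv g'))"
      using Sp_iff[OF g] d g indf_at[OF g d(2)]
      by (intro conjI bexI[of _ g]) (auto simp: simplex_act_sigma1 simplex_act_sigma0)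
  next
    fix F assume F: "F \<in> Sp ?x \<and> (\<exists>g'\<in>carrier GL2. {?x, ?y} = simplex_act g' sigma1 \<and>
      {?x} = simplex_act g' {sigma0} \<and> F (matrix_inv g') = f (matrix_inv g'))"
    then obtain e g' where e: "e \<in> carrier D" "F = indf g e" and g': "g' \<in> carrier GL2"
      "{?x, ?y} = {vertex_act g' sigma0, vertex_act g' sigma0'}" "?x = vertex_act g' sigma0"
      "F (matrix_inv g') = f (matrix_inv g')"
      using Sp_iff[OF g] by (auto simp: simplex_act_sigma1 simplex_act_sigma0)
    have y: "?y = vertex_act g' sigma0'" using g'(2,3) ne by (simp add: doubleton_eq_iff)
    let ?j = "matrix_inv g' ** g"
    have ig': "matrix_inv g' \<in> carrier GL2" using matrix_inv_GL2(3) g' by blast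
    have jG: "?j \<in> carrier GL2" using ig' g by simp
    have "vertex_act ?j sigma0 = sigma0" "vertex_act ?j sigma0' = sigma0'"
      using g'(3) y by (simp_all add: vertex_act_mult vertex_act_inv[OF g'(1)])
    then obtain z k where zk: "z \<noteq> 0" "k \<in> Iw" "?j = mat z ** k" by (rule edge_stabiliser[OF jG])
    have j0: "?j \<in> stab0" unfolding zk(3) stab0_def using zk(1) Iw_subset[OF zk(2)] by blast
    have j1: "?j \<in> stab1" using zk mat_in_stab1 Iw_in_stab1 stab1_mult by simp
    have "act D ?j e = F (matrix_inv g')" using j0 ig' by (simp add: e(2) indf_def)
    also have "\<dots> = f (?j ** matrix_inv g)" using matrix_inv_cancel(3)[OF g] g'(4) by simp
    also have "\<dots> = act E ?j (f (matrix_inv g))" using f' j1 ig by blast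
    also have "\<dots> = act D ?j (f (matrix_inv g))" unfolding zk(3) by (rule act_E[OF zk(1,2) d(1)])
    finally have eq: "act D ?j e = act D ?j (f (matrix_inv g))" .
    have "act D (matrix_inv ?j ** ?j) e = act D (matrix_inv ?j ** ?j) (f (matrix_inv g))"
      using actD_mult[OF stab0_inv[OF j0] j0 e(1)] actD_mult[OF stab0_inv[OF j0] j0 d(2)] eq by simp
    then have "e = f (matrix_inv g)" using actD_one e(1) d(2) matrix_inv_GL2(2)[OF jG] by simp
    then show "F = indf g (f (matrix_inv g))" by (simp add: e(2))
  qed
qed

lemma res_simps:
  assumes a: "adjacent x y"
  shows "f \<in> Se x y \<Longrightarrow> res x y f \<in> Sp x" "res x y (\<lambda>_. \<zero>\<^bsub>D\<^esub>) = (\<lambda>_. \<zero>\<^bsub>D\<^esub>)"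
    "f \<in> Se x y \<Longrightarrow> f' \<in> Se x y \<Longrightarrow> res x y (\<lambda>h. f h \<oplus>\<^bsub>D\<^esub> f' h) = (\<lambda>h. res x y f h \<oplus>\<^bsub>D\<^esub> res x y f' h)"
    "f \<in> Se x y \<Longrightarrow> res x y (\<lambda>h. c \<odot>\<^bsub>D\<^esub> f h) = (\<lambda>h. c \<odot>\<^bsub>D\<^esub> res x y f h)"
    "f \<in> Se x y \<Longrightarrow> g \<in> carrier GL2 \<Longrightarrow> res (vertex_act g x) (vertex_act g y) (rt g f) = rt g (res x y f)"
proof -
  obtain g where g: "g \<in> carrier GL2" "x = vertex_act g sigma0" "y = vertex_act g sigma0'"
    using a by (auto simp: adjacent_iff)
  have r: "res x y f = indf g (f (matrix_inv g))" if "f \<in> Se x y" for f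
    using res_eq[OF g(1)] that g(2,3) by simp
  have v: "f h \<in> carrier D" if "f \<in> Se x y" for f h using E_closed[OF Se_value[OF a that]] .
  show "res x y f \<in> Sp x" if "f \<in> Se x y"
    using r[OF that] Sp_iff[OF g(1)] v[OF that] g(2) by auto
  show "res x y (\<lambda>_. \<zero>\<^bsub>D\<^esub>) = (\<lambda>_. \<zero>\<^bsub>D\<^esub>)" using r[OF Se_closed(1)[OF a]] by (simp add: indf_zero)
  show "res x y (\<lambda>h. f h \<oplus>\<^bsub>D\<^esub> f' h) = (\<lambda>h. res x y f h \<oplus>\<^bsub>D\<^esub> res x y f' h)" if "f \<in> Se x y" "f' \<in> Se x y"
    using r[OF that(1)] r[OF that(2)] r[OF Se_closed(2)[OF a that]] v that by (simp add: indf_add)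
  show "res x y (\<lambda>h. c \<odot>\<^bsub>D\<^esub> f h) = (\<lambda>h. c \<odot>\<^bsub>D\<^esub> res x y f h)" if "f \<in> Se x y"
    using r[OF that(1)] r[OF Se_closed(3)[OF a that]] v that by (simp add: indf_smult)
  show "res (vertex_act h x) (vertex_act h y) (rt h f) = rt h (res x y f)" if f: "f \<in> Se x y" and h: "h \<in> carrier GL2" for h
  proof -
    have hg: "h ** g \<in> carrier GL2" using h g by simp
    have "rt h f \<in> Se (vertex_act (h ** g) sigma0) (vertex_act (h ** g) sigma0')"
      using Se_closed(5)[OF a f h] by (simp add: g(2,3) vertex_act_mult)
    from res_eq[OF hg this] have "res (vertex_act h x) (vertex_act h y) (rt h f) = indf (h ** g) (rt h f (matrix_inv (h ** g)))"
      by (simp add: g(2,3) vertex_act_mult)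
    also have "rt h f (matrix_inv (h ** g)) = f (matrix_inv g)"
      using h g(1) matrix_inv_GL2(3)[OF hg] matrix_inv_cancel(4)[OF h, of "matrix_inv g"]
      by (simp add: right_transl_def matrix_inv_mult)
    finally show ?thesis using r[OF f] indf_rt[OF h] by simp
  qed
qed

subsection \<open>Chains\<close>

abbreviation "C0 \<equiv> chains0 V"

lemma C0_simps:
  "\<zero>\<^bsub>C0\<^esub> = (\<lambda>x\<in>vertices. \<lambda>_. \<zero>\<^bsub>D\<^esub>)" "om \<oplus>\<^bsub>C0\<^esub> om' = (\<lambda>x\<in>vertices. \<lambda>h. om x h \<oplus>\<^bsub>D\<^esub> om' x h)"
  "c \<odot>\<^bsub>C0\<^esub> om = (\<lambda>x\<in>vertices. \<lambda>h. c \<odot>\<^bsub>D\<^esub> om x h)"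
  "act C0 g om = (\<lambda>x\<in>vertices. rt g (om (vertex_act (matrix_inv g) x)))"
  by (simp_all add: chains0_def cs_space_vertex fun_module_simps cs_act_eq Let_def)

lemma in_C0: "om \<in> carrier C0 \<longleftrightarrow> (\<forall>x\<in>vertices. om x \<in> Sp x) \<and> (\<forall>x. x \<notin> vertices \<longrightarrow> om x = undefined) \<and>
    finite {x \<in> vertices. om x \<noteq> (\<lambda>_. \<zero>\<^bsub>D\<^esub>)}"
  by (auto simp: chains0_def cs_space_vertex fun_module_simps PiE_iff extensional_def)

lemma C0_eqI:
  assumes "om \<in> carrier C0" "om' \<in> carrier C0" "\<And>x h. x \<in> vertices \<Longrightarrow> om x h = om' x h"
  shows "om = om'"
proof
  fix x show "om x = om' x"
    using assms by (cases "x \<in> vertices") (auto simp: in_C0 fun_eq_iff)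
qed

lemma C0_closed:
  "\<zero>\<^bsub>C0\<^esub> \<in> carrier C0"
  "om \<in> carrier C0 \<Longrightarrow> om' \<in> carrier C0 \<Longrightarrow> om \<oplus>\<^bsub>C0\<^esub> om' \<in> carrier C0"
  "om \<in> carrier C0 \<Longrightarrow> c \<odot>\<^bsub>C0\<^esub> om \<in> carrier C0"
  "om \<in> carrier C0 \<Longrightarrow> g \<in> carrier GL2 \<Longrightarrow> act C0 g om \<in> carrier C0"
proof -
  show "\<zero>\<^bsub>C0\<^esub> \<in> carrier C0" by (simp add: in_C0 C0_simps Sp_closed)
  show "om \<oplus>\<^bsub>C0\<^esub> om' \<in> carrier C0" if om: "om \<in> carrier C0" "om' \<in> carrier C0"
  proof -
    have "{x \<in> vertices. (om \<oplus>\<^bsub>C0\<^esub> om') x \<noteq> (\<lambda>_. \<zero>\<^bsub>D\<^esub>)} \<subseteq>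
        {x \<in> vertices. om x \<noteq> (\<lambda>_. \<zero>\<^bsub>D\<^esub>)} \<union> {x \<in> vertices. om' x \<noteq> (\<lambda>_. \<zero>\<^bsub>D\<^esub>)}"
      by (auto simp: C0_simps)
    then have "finite {x \<in> vertices. (om \<oplus>\<^bsub>C0\<^esub> om') x \<noteq> (\<lambda>_. \<zero>\<^bsub>D\<^esub>)}"
      using om unfolding in_C0 by (meson finite_UnI finite_subset)
    then show ?thesis using om unfolding in_C0 by (simp add: C0_simps Sp_closed)
  qed
  show "c \<odot>\<^bsub>C0\<^esub> om \<in> carrier C0" if om: "om \<in> carrier C0"
  proof -
    have "{x \<in> vertices. (c \<odot>\<^bsub>C0\<^esub> om) x \<noteq> (\<lambda>_. \<zero>\<^bsub>D\<^esub>)} \<subseteq> {x \<in> vertices. om x \<noteq> (\<lambda>_. \<zero>\<^bsub>D\<^esub>)}"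
      by (auto simp: C0_simps)
    then have "finite {x \<in> vertices. (c \<odot>\<^bsub>C0\<^esub> om) x \<noteq> (\<lambda>_. \<zero>\<^bsub>D\<^esub>)}"
      using om unfolding in_C0 by (meson finite_subset)
    then show ?thesis using om unfolding in_C0 by (simp add: C0_simps Sp_closed)
  qed
  show "act C0 g om \<in> carrier C0" if om: "om \<in> carrier C0" and g: "g \<in> carrier GL2"
  proof -
    note ig = matrix_inv_GL2(3)[OF g]
    have "x \<in> vertex_act g ` {x \<in> vertices. om x \<noteq> (\<lambda>_. \<zero>\<^bsub>D\<^esub>)}"
      if "x \<in> vertices" "act C0 g om x \<noteq> (\<lambda>_. \<zero>\<^bsub>D\<^esub>)" for x
    proof (rule image_eqI)
      show "x = vertex_act g (vertex_act (matrix_inv g) x)" by (simp add: vertex_act_inv[OF g])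
      show "vertex_act (matrix_inv g) x \<in> {x \<in> vertices. om x \<noteq> (\<lambda>_. \<zero>\<^bsub>D\<^esub>)}"
        using that vertex_act_vertices[OF ig] by (auto simp: C0_simps right_transl_def fun_eq_iff split: if_splits)
    qed
    then have "{x \<in> vertices. act C0 g om x \<noteq> (\<lambda>_. \<zero>\<^bsub>D\<^esub>)} \<subseteq> vertex_act g ` {x \<in> vertices. om x \<noteq> (\<lambda>_. \<zero>\<^bsub>D\<^esub>)}"
      by blast
    then have "finite {x \<in> vertices. act C0 g om x \<noteq> (\<lambda>_. \<zero>\<^bsub>D\<^esub>)}"
      using om unfolding in_C0 by (meson finite_imageI finite_subset)
    moreover have "rt g (om (vertex_act (matrix_inv g) x)) \<in> Sp x" if "x \<in> vertices" for x
      using Sp_closed(5)[OF vertex_act_vertices[OF ig that] _ g] om vertex_act_vertices[OF ig that]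
      by (simp add: in_C0 vertex_act_inv[OF g])
    ultimately show ?thesis unfolding in_C0 by (simp add: C0_simps)
  qed
qed

lemma C0_value: "om \<in> carrier C0 \<Longrightarrow> x \<in> vertices \<Longrightarrow> om x h \<in> carrier D"
  using Sp_value by (simp add: in_C0)

lemma C0_outside: "om \<in> carrier C0 \<Longrightarrow> x \<in> vertices \<Longrightarrow> h \<notin> carrier GL2 \<Longrightarrow> om x h = \<zero>\<^bsub>D\<^esub>"
  using Sp_outside by (simp add: in_C0)

lemma repC0: "representation GL2 C0"
proof (rule representationI)
  show "group (GL2 :: ('f^2^2) monoid)" by (rule group_GL2)
  fix om om' om'' c d g h
  assume om: "om \<in> carrier C0"
  show "\<zero>\<^bsub>C0\<^esub> \<oplus>\<^bsub>C0\<^esub> om = om"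
    by (rule C0_eqI[OF C0_closed(2)[OF C0_closed(1) om] om]) (use C0_value[OF om] in \<open>simp add: C0_simps\<close>)
  show "(c + d) \<odot>\<^bsub>C0\<^esub> om = c \<odot>\<^bsub>C0\<^esub> om \<oplus>\<^bsub>C0\<^esub> d \<odot>\<^bsub>C0\<^esub> om"
    using C0_value[OF om] by (auto simp: C0_simps fun_eq_iff D.smult_add_scalar)
  show "(c * d) \<odot>\<^bsub>C0\<^esub> om = c \<odot>\<^bsub>C0\<^esub> (d \<odot>\<^bsub>C0\<^esub> om)"
    using C0_value[OF om] by (auto simp: C0_simps fun_eq_iff D.smult_assoc)
  show "1 \<odot>\<^bsub>C0\<^esub> om = om"
    by (rule C0_eqI[OF C0_closed(3)[OF om] om]) (use C0_value[OF om] in \<open>simp add: C0_simps\<close>)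
  show "0 \<odot>\<^bsub>C0\<^esub> om = \<zero>\<^bsub>C0\<^esub>"
    using C0_value[OF om] by (auto simp: C0_simps fun_eq_iff)
  show "act C0 \<one>\<^bsub>GL2\<^esub> om = om"
  proof (rule C0_eqI[OF _ om])
    show "act C0 \<one>\<^bsub>GL2\<^esub> om \<in> carrier C0" using C0_closed(4)[OF om, of "mat 1"] by simp
  qed (use C0_outside[OF om] in \<open>simp add: C0_simps matrix_inv_mat right_transl_def\<close>)
  {
    assume g: "g \<in> carrier (GL2 :: ('f^2^2) monoid)"
    note ig = matrix_inv_GL2(3)[OF g]
    show "act C0 g (c \<odot>\<^bsub>C0\<^esub> om) = c \<odot>\<^bsub>C0\<^esub> act C0 g om"
      using vertex_act_vertices[OF ig] by (auto simp: C0_simps fun_eq_iff right_transl_def)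
    {
      assume h: "h \<in> carrier (GL2 :: ('f^2^2) monoid)"
      show "act C0 (g \<otimes>\<^bsub>GL2\<^esub> h) om = act C0 g (act C0 h om)"
        using vertex_act_vertices[OF ig] g h
        by (auto simp: C0_simps fun_eq_iff right_transl_def matrix_inv_mult vertex_act_mult matrix_mul_assoc)
    }
  }
  {
    assume om': "om' \<in> carrier C0"
    show "om \<oplus>\<^bsub>C0\<^esub> om' = om' \<oplus>\<^bsub>C0\<^esub> om"
      using C0_value[OF om] C0_value[OF om'] by (auto simp: C0_simps fun_eq_iff D.a_ac)
    show "c \<odot>\<^bsub>C0\<^esub> (om \<oplus>\<^bsub>C0\<^esub> om') = c \<odot>\<^bsub>C0\<^esub> om \<oplus>\<^bsub>C0\<^esub> c \<odot>\<^bsub>C0\<^esub> om'"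
      using C0_value[OF om] C0_value[OF om'] by (auto simp: C0_simps fun_eq_iff D.smult_add_vec)
    {
      assume g: "g \<in> carrier (GL2 :: ('f^2^2) monoid)"
      show "act C0 g (om \<oplus>\<^bsub>C0\<^esub> om') = act C0 g om \<oplus>\<^bsub>C0\<^esub> act C0 g om'"
        using vertex_act_vertices[OF matrix_inv_GL2(3)[OF g]] by (auto simp: C0_simps fun_eq_iff right_transl_def)
    }
    {
      assume om'': "om'' \<in> carrier C0"
      show "om \<oplus>\<^bsub>C0\<^esub> om' \<oplus>\<^bsub>C0\<^esub> om'' = om \<oplus>\<^bsub>C0\<^esub> (om' \<oplus>\<^bsub>C0\<^esub> om'')"
        using C0_value[OF om] C0_value[OF om'] C0_value[OF om''] by (auto simp: C0_simps fun_eq_iff D.a_assoc)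
    }
  }
qed (rule C0_closed; assumption)+

end

section \<open>Boundaries of 1-chains\<close>

context basic_diagram
begin

abbreviation "C1 \<equiv> chains1 V"

lemma edge_space:
  assumes "adjacent x y"
  shows "cs_space V {x, y} = fun_module E (Se x y)"
    and "f \<in> Se x y \<Longrightarrow> \<ominus>\<^bsub>cs_space V {x, y}\<^esub> f = (\<lambda>h. \<ominus>\<^bsub>D\<^esub> f h)"
proof -
  show e: "cs_space V {x, y} = fun_module E (Se x y)"
    by (rule cs_space_edge[OF adjacent_neq[OF assms]])
  show "\<ominus>\<^bsub>cs_space V {x, y}\<^esub> f = (\<lambda>h. \<ominus>\<^bsub>D\<^esub> f h)" if "f \<in> Se x y"
  proof -
    have neg: "\<ominus>\<^bsub>E\<^esub> f h = \<ominus>\<^bsub>D\<^esub> f h" if "f \<in> Se x y" for f h by (rule neg_E[OF Se_value[OF assms that]])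
    have "\<ominus>\<^bsub>fun_module E (Se x y)\<^esub> f = (\<lambda>h. \<ominus>\<^bsub>E\<^esub> f h)"
      by (rule abelian_group_fun_module(2)[OF E.abelian_group_axioms])
        (use Se_value[OF assms] Se_closed[OF assms] neg that in \<open>simp_all add: E_simps(2,3)\<close>)
    then show ?thesis using neg[OF that] by (simp add: e)
  qed
qed

lemma in_C1: "om \<in> C1 \<longleftrightarrow> (\<forall>x y. adjacent x y \<longrightarrow> om (x, y) \<in> Se x y) \<and> (\<forall>x y. \<not> adjacent x y \<longrightarrow> om (x, y) = undefined) \<and>
    finite {(x, y). adjacent x y \<and> om (x, y) \<noteq> (\<lambda>_. \<zero>\<^bsub>D\<^esub>)} \<and>
    (\<forall>x y. adjacent x y \<longrightarrow> om (y, x) = (\<lambda>h. \<ominus>\<^bsub>D\<^esub> om (x, y) h))"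
proof -
  have "{(x, y). adjacent x y \<and> om (x, y) \<noteq> \<zero>\<^bsub>cs_space V {x, y}\<^esub>} =
      {(x, y). adjacent x y \<and> om (x, y) \<noteq> (\<lambda>_. \<zero>\<^bsub>D\<^esub>)}"
    by (auto simp: edge_space fun_module_simps E_simps(3))
  moreover have "om \<in> PiE {(x, y). adjacent x y} (\<lambda>(x, y). carrier (cs_space V {x, y})) \<longleftrightarrow>
      (\<forall>x y. adjacent x y \<longrightarrow> om (x, y) \<in> Se x y) \<and> (\<forall>x y. \<not> adjacent x y \<longrightarrow> om (x, y) = undefined)"
    by (auto simp: PiE_iff extensional_def Se_def)
  ultimately show ?thesis
    by (auto simp: chains1_def edge_space(2))
qed

text \<open>Finiteness of the set of neighbours makes \<open>finsum\<close> an actual sum, which can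
  then be evaluated value by value in \<open>D\<close>.\<close>

lemma boundary_eq:
  assumes om: "om \<in> C1" and x: "x \<in> vertices"
  shows "boundary V om x = (\<lambda>h. finsum D (\<lambda>y. res x y (om (x, y)) h) {y. adjacent x y})"
    and "boundary V om x \<in> Sp x"
proof -
  have F: "(\<lambda>y. res x y (om (x, y))) \<in> {y. adjacent x y} \<rightarrow> Sp x"
    using om res_simps(1) by (auto simp: in_C1)
  have b: "boundary V om x = finsum (fun_module D (Sp x)) (\<lambda>y. res x y (om (x, y))) {y. adjacent x y}"
    using x by (simp add: boundary_def cs_space_vertex res_def)
  have ab: "abelian_group (fun_module D (Sp x))"
    by (rule abelian_group_fun_module(1)[OF D.abelian_group_axioms]) (simp_all add: Sp_value[OF x] Sp_closed[OF x])
  show "boundary V om x = (\<lambda>h. finsum D (\<lambda>y. res x y (om (x, y)) h) {y. adjacent x y})"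
    unfolding b
    by (rule abelian_group_fun_module(3)[OF D.abelian_group_axioms])
      (simp_all add: Sp_value[OF x] Sp_closed[OF x] finite_neighbours F)
  interpret F: abelian_group "fun_module D (Sp x)" by (rule ab)
  show "boundary V om x \<in> Sp x"
    using F.finsum_closed[of "\<lambda>y. res x y (om (x, y))"] F unfolding b by (simp add: fun_module_simps)
qed

lemma D_minus_zero [simp]: "\<ominus>\<^bsub>D\<^esub> \<zero>\<^bsub>D\<^esub> = \<zero>\<^bsub>D\<^esub>"
  using D.smult_minus_one[of "\<zero>\<^bsub>D\<^esub>"] by simp

lemma res_value: "om \<in> C1 \<Longrightarrow> adjacent x y \<Longrightarrow> res x y (om (x, y)) h \<in> carrier D"
  by (rule Sp_value[OF _ res_simps(1)]) (auto simp: in_C1 dest: adjacent_vertices)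

lemma boundary_in_C0:
  assumes om: "om \<in> C1" shows "boundary V om \<in> carrier C0"
proof -
  have "x \<in> fst ` {(x, y). adjacent x y \<and> om (x, y) \<noteq> (\<lambda>_. \<zero>\<^bsub>D\<^esub>)}"
    if "x \<in> vertices" "boundary V om x \<noteq> (\<lambda>_. \<zero>\<^bsub>D\<^esub>)" for x
  proof (rule ccontr)
    assume "x \<notin> fst ` {(x, y). adjacent x y \<and> om (x, y) \<noteq> (\<lambda>_. \<zero>\<^bsub>D\<^esub>)}"
    then have "om (x, y) = (\<lambda>_. \<zero>\<^bsub>D\<^esub>)" if "adjacent x y" for y using that by force
    then have "finsum D (\<lambda>y. res x y (om (x, y)) h) {y. adjacent x y} = \<zero>\<^bsub>D\<^esub>" for h
      by (intro D.add.finprod_one_eqI) (simp add: res_simps(2))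
    then show False using that boundary_eq(1)[OF om that(1)] by simp
  qed
  then have "{x \<in> vertices. boundary V om x \<noteq> (\<lambda>_. \<zero>\<^bsub>D\<^esub>)} \<subseteq> fst ` {(x, y). adjacent x y \<and> om (x, y) \<noteq> (\<lambda>_. \<zero>\<^bsub>D\<^esub>)}"
    by blast
  moreover have "finite (fst ` {(x, y). adjacent x y \<and> om (x, y) \<noteq> (\<lambda>_. \<zero>\<^bsub>D\<^esub>)})"
    using om by (intro finite_imageI) (simp add: in_C1)
  ultimately have "finite {x \<in> vertices. boundary V om x \<noteq> (\<lambda>_. \<zero>\<^bsub>D\<^esub>)}" by (rule finite_subset)
  moreover have "boundary V om x = undefined" if "x \<notin> vertices" for x
    using that by (simp add: boundary_def)
  ultimately show ?thesis
    unfolding in_C0 using boundary_eq(2)[OF om] by blast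
qed

lemma subrep_boundary: "subrep GL2 (boundary V ` C1) C0"
proof (rule subrepI[OF repC0])
  \<comment> \<open>Chains must be \<open>undefined\<close> off the oriented edges, so the pointwise
    operations below are cut back to them.\<close>
  let ?on = "\<lambda>F p. if adjacent (fst p) (snd p) then F p else undefined"
  show "boundary V ` C1 \<subseteq> carrier C0" using boundary_in_C0 by blast
  show "\<zero>\<^bsub>C0\<^esub> \<in> boundary V ` C1"
  proof (rule image_eqI)
    let ?z = "?on (\<lambda>_ _. \<zero>\<^bsub>D\<^esub>)"
    show z: "?z \<in> C1" using adjacent_sym by (auto simp: in_C1 Se_closed(1))
    show "\<zero>\<^bsub>C0\<^esub> = boundary V ?z"
    proof (rule C0_eqI[OF C0_closed(1) boundary_in_C0[OF z]])
      fix x h assume x: "x \<in> vertices"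
      have "finsum D (\<lambda>y. res x y (?z (x, y)) h) {y. adjacent x y} = \<zero>\<^bsub>D\<^esub>"
        by (intro D.add.finprod_one_eqI) (simp add: res_simps(2))
      then show "\<zero>\<^bsub>C0\<^esub> x h = boundary V ?z x h" using x by (simp add: boundary_eq(1)[OF z x] C0_simps)
    qed
  qed
  fix b1 assume "b1 \<in> boundary V ` C1"
  then obtain om where om: "om \<in> C1" "b1 = boundary V om" by blast
  note om' = om(1)[unfolded in_C1]
  show "b1 \<oplus>\<^bsub>C0\<^esub> b2 \<in> boundary V ` C1" if b2: "b2 \<in> boundary V ` C1" for b2
  proof -
    obtain on where on: "on \<in> C1" "b2 = boundary V on" using b2 by blast
    note on' = on(1)[unfolded in_C1]
    let ?s = "?on (\<lambda>p h. om p h \<oplus>\<^bsub>D\<^esub> on p h)"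
    have "{(x, y). adjacent x y \<and> ?s (x, y) \<noteq> (\<lambda>_. \<zero>\<^bsub>D\<^esub>)} \<subseteq>
      {(x, y). adjacent x y \<and> om (x, y) \<noteq> (\<lambda>_. \<zero>\<^bsub>D\<^esub>)} \<union> {(x, y). adjacent x y \<and> on (x, y) \<noteq> (\<lambda>_. \<zero>\<^bsub>D\<^esub>)}"
      by auto
    then have fin: "finite {(x, y). adjacent x y \<and> ?s (x, y) \<noteq> (\<lambda>_. \<zero>\<^bsub>D\<^esub>)}"
      using om' on' by (meson finite_UnI finite_subset)
    have v: "om (x, y) h \<in> carrier D" "on (x, y) h \<in> carrier D" if "adjacent x y" for x y h
      using om' on' that by (auto intro: E_closed[OF Se_value[OF that]])
    have s: "?s \<in> C1"
      unfolding in_C1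
    proof (intro conjI allI impI fin)
      show "?s (x, y) \<in> Se x y" if "adjacent x y" for x y
        using that om' on' by (simp add: Se_closed(2))
      show "?s (y, x) = (\<lambda>h. \<ominus>\<^bsub>D\<^esub> ?s (x, y) h)" if a: "adjacent x y" for x y
      proof -
        have "om (y, x) = (\<lambda>h. \<ominus>\<^bsub>D\<^esub> om (x, y) h)" "on (y, x) = (\<lambda>h. \<ominus>\<^bsub>D\<^esub> on (x, y) h)" using om' on' a by blast+
        then show ?thesis using a adjacent_sym[OF a] v[OF a] by (simp add: D.minus_add)
      qed
    qed simp
    have "b1 \<oplus>\<^bsub>C0\<^esub> b2 = boundary V ?s"
    proof (rule C0_eqI[OF _ boundary_in_C0[OF s]])
      show "b1 \<oplus>\<^bsub>C0\<^esub> b2 \<in> carrier C0" using boundary_in_C0 om on C0_closed(2) by blast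
      fix x h assume x: "x \<in> vertices"
      have "finsum D (\<lambda>y. res x y (?s (x, y)) h) {y. adjacent x y} =
          finsum D (\<lambda>y. res x y (om (x, y)) h \<oplus>\<^bsub>D\<^esub> res x y (on (x, y)) h) {y. adjacent x y}"
        using res_value[OF om(1)] res_value[OF on(1)] om' on'
        by (intro D.finsum_cong') (auto simp: res_simps(3))
      also have "\<dots> = finsum D (\<lambda>y. res x y (om (x, y)) h) {y. adjacent x y} \<oplus>\<^bsub>D\<^esub>
          finsum D (\<lambda>y. res x y (on (x, y)) h) {y. adjacent x y}"
        using res_value[OF om(1)] res_value[OF on(1)] by (intro D.finsum_addf) auto
      finally show "(b1 \<oplus>\<^bsub>C0\<^esub> b2) x h = boundary V ?s x h"
        using x by (simp add: boundary_eq(1)[OF _ x] s om on C0_simps)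
    qed
    then show ?thesis using s by blast
  qed
  show "c \<odot>\<^bsub>C0\<^esub> b1 \<in> boundary V ` C1" for c
  proof -
    let ?s = "?on (\<lambda>p h. c \<odot>\<^bsub>D\<^esub> om p h)"
    have "{(x, y). adjacent x y \<and> ?s (x, y) \<noteq> (\<lambda>_. \<zero>\<^bsub>D\<^esub>)} \<subseteq>
      {(x, y). adjacent x y \<and> om (x, y) \<noteq> (\<lambda>_. \<zero>\<^bsub>D\<^esub>)}"
      by auto
    then have fin: "finite {(x, y). adjacent x y \<and> ?s (x, y) \<noteq> (\<lambda>_. \<zero>\<^bsub>D\<^esub>)}"
      using om' by (meson finite_subset)
    have v: "om (x, y) h \<in> carrier D" if "adjacent x y" for x y h
      using om' that by (auto intro: E_closed[OF Se_value[OF that]])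
    have neg: "c \<odot>\<^bsub>D\<^esub> \<ominus>\<^bsub>D\<^esub> u = \<ominus>\<^bsub>D\<^esub> (c \<odot>\<^bsub>D\<^esub> u)" if "u \<in> carrier D" for u
      using that by (simp flip: D.smult_minus_one D.smult_assoc)
    have s: "?s \<in> C1"
      unfolding in_C1
    proof (intro conjI allI impI fin)
      show "?s (x, y) \<in> Se x y" if "adjacent x y" for x y
        using that om' by (simp add: Se_closed(3))
      show "?s (y, x) = (\<lambda>h. \<ominus>\<^bsub>D\<^esub> ?s (x, y) h)" if a: "adjacent x y" for x y
      proof -
        have "om (y, x) = (\<lambda>h. \<ominus>\<^bsub>D\<^esub> om (x, y) h)" using om' a by blast
        then show ?thesis using a adjacent_sym[OF a] v[OF a] by (simp add: neg)
      qed
    qed simp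
    have "c \<odot>\<^bsub>C0\<^esub> b1 = boundary V ?s"
    proof (rule C0_eqI[OF _ boundary_in_C0[OF s]])
      show "c \<odot>\<^bsub>C0\<^esub> b1 \<in> carrier C0" using boundary_in_C0 om C0_closed(3) by blast
      fix x h assume x: "x \<in> vertices"
      have "finsum D (\<lambda>y. res x y (?s (x, y)) h) {y. adjacent x y} =
          finsum D (\<lambda>y. c \<odot>\<^bsub>D\<^esub> res x y (om (x, y)) h) {y. adjacent x y}"
        using res_value[OF om(1)] om'
        by (intro D.finsum_cong') (auto simp: res_simps(4))
      also have "\<dots> = c \<odot>\<^bsub>D\<^esub> finsum D (\<lambda>y. res x y (om (x, y)) h) {y. adjacent x y}"
        using res_value[OF om(1)] by (intro D.smult_finsum[symmetric] finite_neighbours) auto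
      finally show "(c \<odot>\<^bsub>C0\<^esub> b1) x h = boundary V ?s x h"
        using x by (simp add: boundary_eq(1)[OF _ x] s om C0_simps)
    qed
    then show ?thesis using s by blast
  qed
  show "act C0 g b1 \<in> boundary V ` C1" if g: "g \<in> carrier GL2" for g
  proof -
    note ig = matrix_inv_GL2(3)[OF g]
    let ?i = "vertex_act (matrix_inv g)"
    have adj: "adjacent (?i x) (?i y) \<longleftrightarrow> adjacent x y" for x y by (rule adjacent_act[OF ig])
    let ?s = "?on (\<lambda>p. rt g (om (?i (fst p), ?i (snd p))))"
    have "(x, y) \<in> (\<lambda>(x, y). (vertex_act g x, vertex_act g y)) ` {(x, y). adjacent x y \<and> om (x, y) \<noteq> (\<lambda>_. \<zero>\<^bsub>D\<^esub>)}"
      if "adjacent x y" "?s (x, y) \<noteq> (\<lambda>_. \<zero>\<^bsub>D\<^esub>)" for x y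
    proof (rule image_eqI)
      show "(x, y) = (\<lambda>(x, y). (vertex_act g x, vertex_act g y)) (?i x, ?i y)"
        by (simp add: vertex_act_inv[OF g])
      show "(?i x, ?i y) \<in> {(x, y). adjacent x y \<and> om (x, y) \<noteq> (\<lambda>_. \<zero>\<^bsub>D\<^esub>)}"
        using that by (auto simp: adj right_transl_def fun_eq_iff split: if_splits)
    qed
    then have "{(x, y). adjacent x y \<and> ?s (x, y) \<noteq> (\<lambda>_. \<zero>\<^bsub>D\<^esub>)} \<subseteq>
        (\<lambda>(x, y). (vertex_act g x, vertex_act g y)) ` {(x, y). adjacent x y \<and> om (x, y) \<noteq> (\<lambda>_. \<zero>\<^bsub>D\<^esub>)}"
      by blast
    then have fin: "finite {(x, y). adjacent x y \<and> ?s (x, y) \<noteq> (\<lambda>_. \<zero>\<^bsub>D\<^esub>)}"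
      using om' by (meson finite_imageI finite_subset)
    have Se: "rt g (om (?i x, ?i y)) \<in> Se x y" if "adjacent x y" for x y
      using Se_closed(5)[of "?i x" "?i y" "om (?i x, ?i y)" g] om' that adj g
      by (simp add: vertex_act_inv[OF g])
    have neg: "rt g (om (?i y, ?i x)) = (\<lambda>h. \<ominus>\<^bsub>D\<^esub> rt g (om (?i x, ?i y)) h)" if "adjacent x y" for x y
      using om' that adj by (auto simp: right_transl_def fun_eq_iff)
    have s: "?s \<in> C1"
      unfolding in_C1
    proof (intro conjI allI impI fin)
      show "?s (x, y) \<in> Se x y" if "adjacent x y" for x y using Se[OF that] that by simp
      show "?s (y, x) = (\<lambda>h. \<ominus>\<^bsub>D\<^esub> ?s (x, y) h)" if "adjacent x y" for x y
        using neg[OF that] that adjacent_sym[OF that] by simp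
    qed simp
    have "act C0 g b1 = boundary V ?s"
    proof (rule C0_eqI[OF _ boundary_in_C0[OF s]])
      show "act C0 g b1 \<in> carrier C0" using boundary_in_C0 om C0_closed(4) g by blast
      fix x h assume x: "x \<in> vertices"
      have ix: "?i x \<in> vertices" by (rule vertex_act_vertices[OF ig x])
      have r: "res x y (?s (x, y)) = rt g (res (?i x) (?i y) (om (?i x, ?i y)))" if "adjacent x y" for y
        using res_simps(5)[of "?i x" "?i y" "om (?i x, ?i y)" g] om' that adj g
        by (simp add: vertex_act_inv[OF g])
      show "act C0 g b1 x h = boundary V ?s x h"
      proof (cases "h \<in> carrier GL2")
        case True
        \<comment> \<open>The inverse of \<open>g\<close> carries the neighbours of \<open>x\<close>
          to those of its image, so the boundary of the translated chain is a reindexing of the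
          translated boundary.\<close>
        have nb: "?i ` {y. adjacent x y} = {y. adjacent (?i x) y}"
        proof (intro Set.set_eqI iffI)
          fix y assume "y \<in> {y. adjacent (?i x) y}"
          then have "adjacent x (vertex_act g y)" using adj[of x "vertex_act g y"] by (simp add: vertex_act_inv[OF g])
          then show "y \<in> ?i ` {y. adjacent x y}"
            by (intro image_eqI[of _ _ "vertex_act g y"]) (simp_all add: vertex_act_inv[OF g])
        qed (auto simp: adj)
        have "finsum D (\<lambda>y. res x y (?s (x, y)) h) {y. adjacent x y} =
            finsum D (\<lambda>y. res (?i x) (?i y) (om (?i x, ?i y)) (h ** g)) {y. adjacent x y}"
        proof (rule D.finsum_cong'[OF refl])
          show "(\<lambda>y. res (?i x) (?i y) (om (?i x, ?i y)) (h ** g)) \<in> {y. adjacent x y} \<rightarrow> carrier D"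
            using res_value[OF om(1)] adj by simp
          fix y assume "y \<in> {y. adjacent x y}"
          then show "res x y (?s (x, y)) h = res (?i x) (?i y) (om (?i x, ?i y)) (h ** g)"
            using r[of y] True by (simp add: right_transl_def)
        qed
        also have "\<dots> = finsum D (\<lambda>y. res (?i x) y (om (?i x, y)) (h ** g)) (?i ` {y. adjacent x y})"
          using res_value[OF om(1)] adj vertex_act_eq_iff[OF ig]
          by (intro D.finsum_reindex[symmetric]) (auto simp: inj_on_def)
        finally show ?thesis
          using True x ix by (simp add: nb C0_simps om(2) boundary_eq(1)[OF s x] boundary_eq(1)[OF om(1) ix] right_transl_def)
      next
        case False
        then show ?thesis
          using x C0_outside[OF boundary_in_C0[OF s] x False] by (simp add: C0_simps right_transl_def)
      qed
    qed
    then show ?thesis using s by blast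
  qed
qed

subsection \<open>Chains supported at one vertex\<close>

definition single :: "('f^2) set set \<Rightarrow> ('f^2^2 \<Rightarrow> 'v \<times> 'u) \<Rightarrow> ('f^2) set set \<Rightarrow> 'f^2^2 \<Rightarrow> 'v \<times> 'u" where
  "single x f = (\<lambda>y\<in>vertices. if y = x then f else (\<lambda>_. \<zero>\<^bsub>D\<^esub>))"

lemma single_in_C0: "x \<in> vertices \<Longrightarrow> f \<in> Sp x \<Longrightarrow> single x f \<in> carrier C0"
proof -
  assume x: "x \<in> vertices" "f \<in> Sp x"
  have "{y \<in> vertices. single x f y \<noteq> (\<lambda>_. \<zero>\<^bsub>D\<^esub>)} \<subseteq> {x}" by (auto simp: single_def)
  then show ?thesis using x unfolding in_C0
    by (auto simp: single_def Sp_closed(1) intro: finite_subset)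
qed

text \<open>The map by which \<open>D\<close> enters the chains: it is equivariant for
  \<open>stab0\<close>, and its translates are all the chains supported at one vertex.\<close>

abbreviation iota :: "'v \<times> 'u \<Rightarrow> ('f^2) set set \<Rightarrow> 'f^2^2 \<Rightarrow> 'v \<times> 'u" where
  "iota d \<equiv> single sigma0 (indf (mat 1) d)"

lemma indf_in_Sp: "g \<in> carrier GL2 \<Longrightarrow> d \<in> carrier D \<Longrightarrow> indf g d \<in> Sp (vertex_act g sigma0)"
  using Sp_iff by blast

lemma iota_in_C0: "d \<in> carrier D \<Longrightarrow> iota d \<in> carrier C0"
  using indf_in_Sp[of "mat 1" d] by (intro single_in_C0) simp_all

lemma act_iota:
  assumes "g \<in> carrier GL2" "d \<in> carrier D"
  shows "act C0 g (iota d) = single (vertex_act g sigma0) (indf g d)"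
proof
  fix x
  have "vertex_act (matrix_inv g) x = sigma0 \<longleftrightarrow> x = vertex_act g sigma0"
    using vertex_act_inv[OF assms(1)] by metis
  moreover have "rt g (\<lambda>_. \<zero>\<^bsub>D\<^esub>) = (\<lambda>_. \<zero>\<^bsub>D\<^esub>)" by (simp add: right_transl_def fun_eq_iff)
  ultimately show "act C0 g (iota d) x = single (vertex_act g sigma0) (indf g d) x"
    using vertex_act_vertices[OF matrix_inv_GL2(3)[OF assms(1)], of x] assms
    by (simp add: C0_simps single_def indf_rt)
qed

lemma single_add: "single x (\<lambda>h. f h \<oplus>\<^bsub>D\<^esub> f' h) = single x f \<oplus>\<^bsub>C0\<^esub> single x f'"
  by (auto simp: single_def C0_simps fun_eq_iff)

lemma single_smult: "single x (\<lambda>h. c \<odot>\<^bsub>D\<^esub> f h) = c \<odot>\<^bsub>C0\<^esub> single x f"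
  by (auto simp: single_def C0_simps fun_eq_iff)

text \<open>A chain has finite support, so vertices are split off one at a time; what is split off
  is a translate of some \<open>iota d\<close>.\<close>

lemma C0_generated:
  assumes W: "subrep GL2 W C0" and io: "\<And>d. d \<in> carrier D \<Longrightarrow> iota d \<in> W"
  shows "W = carrier C0"
proof -
  note Ws = subrepD[OF repC0 W]
  have sW: "single x f \<in> W" if x: "x \<in> vertices" "f \<in> Sp x" for x f
  proof -
    obtain g d where g: "g \<in> carrier GL2" "x = vertex_act g sigma0" "d \<in> carrier D" "f = indf g d"
      using Sp_cases[OF x] by blast
    then show ?thesis using Ws(6)[OF g(1) io[OF g(3)]] act_iota by simp
  qed
  have "om \<in> W" if "finite A" "om \<in> carrier C0" "{x \<in> vertices. om x \<noteq> (\<lambda>_. \<zero>\<^bsub>D\<^esub>)} \<subseteq> A" for A om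
    using that
  proof (induction A arbitrary: om)
    case empty
    then have "om = \<zero>\<^bsub>C0\<^esub>" by (intro C0_eqI C0_closed(1)) (auto simp: C0_simps)
    then show ?case using Ws(2) by simp
  next
    case (insert x A)
    show ?case
    proof (cases "x \<in> vertices")
      case False
      then show ?thesis using insert by blast
    next
      case True
      let ?om = "om(x := (\<lambda>_. \<zero>\<^bsub>D\<^esub>))"
      have "{y \<in> vertices. ?om y \<noteq> (\<lambda>_. \<zero>\<^bsub>D\<^esub>)} \<subseteq> {x \<in> vertices. om x \<noteq> (\<lambda>_. \<zero>\<^bsub>D\<^esub>)}" by auto
      then have "finite {y \<in> vertices. ?om y \<noteq> (\<lambda>_. \<zero>\<^bsub>D\<^esub>)}"
        by (rule finite_subset) (use insert.prems(1) in \<open>simp add: in_C0\<close>)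
      moreover have "\<forall>y\<in>vertices. ?om y \<in> Sp y" "\<forall>y. y \<notin> vertices \<longrightarrow> ?om y = undefined"
        using insert.prems(1) True by (auto simp: in_C0 Sp_closed(1))
      ultimately have om': "?om \<in> carrier C0" unfolding in_C0 by blast
      have "?om \<in> W" by (rule insert.IH[OF om']) (use insert.prems in auto)
      moreover have "single x (om x) \<in> W" using sW True insert.prems(1) by (simp add: in_C0)
      ultimately have "?om \<oplus>\<^bsub>C0\<^esub> single x (om x) \<in> W" by (rule Ws(3))
      moreover have "?om \<oplus>\<^bsub>C0\<^esub> single x (om x) = om"
      proof (rule C0_eqI)
        show "?om \<oplus>\<^bsub>C0\<^esub> single x (om x) \<in> carrier C0"
          using insert.prems(1) True by (intro C0_closed(2)[OF om'] single_in_C0) (simp_all add: in_C0)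
        show "(?om \<oplus>\<^bsub>C0\<^esub> single x (om x)) y h = om y h" if "y \<in> vertices" for y h
          using that C0_value[OF insert.prems(1) that] by (cases "y = x") (simp_all add: C0_simps single_def)
      qed (rule insert.prems)
      ultimately show ?thesis by simp
    qed
  qed
  then show ?thesis using Ws(1) by (force simp: in_C0)
qed

text \<open>This is the boundary of a chain on the basic edge alone, with value \<open>d\<close> at
  the identity. At \<open>sigma0\<close> it restricts to \<open>d\<close>; at
  \<open>sigma0'\<close>, identified with \<open>sigma0\<close> by \<open>Pi_mat\<close>, it gives
  minus the image of \<open>d\<close> under the inverse of \<open>Pi_mat\<close> in
  \<open>E\<close>. In homology the action of \<open>Pi_mat\<close> on \<open>D1\<close> is
  therefore the one prescribed by \<open>E\<close>.\<close>

lemma iota_edge_relation: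
  assumes d: "d \<in> carrier E"
  shows "iota d \<oplus>\<^bsub>C0\<^esub> act C0 Pi_mat (iota (\<ominus>\<^bsub>D\<^esub> act E (matrix_inv Pi_mat) d)) \<in> boundary V ` C1"
proof -
  let ?F = "\<lambda>h. if h \<in> stab1 then act E h d else \<zero>\<^bsub>D\<^esub>" and ?G = "\<lambda>h. \<ominus>\<^bsub>D\<^esub> (if h \<in> stab1 then act E h d else \<zero>\<^bsub>D\<^esub>)"
  let ?e = "act E (matrix_inv Pi_mat) d"
  have Pi1: "matrix_inv Pi_mat \<in> stab1" by (rule stab1_inv[OF Pi_in_stab1])
  have e: "?e \<in> carrier E" "?e \<in> carrier D" using E.act_closed[of "matrix_inv Pi_mat" d] d Pi1 E_closed by auto
  have cancel: "p ** h \<in> stab1 \<longleftrightarrow> h \<in> stab1" if "p \<in> stab1" "h \<in> carrier GL2" for p h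
    using that stab1_mult[of p h] stab1_mult[OF stab1_inv[OF that(1)], of "p ** h"]
      matrix_inv_cancel(2)[OF stab1_in_GL2[OF that(1)], of h] by auto
  have F: "?F \<in> Se sigma0 sigma0'"
  proof -
    have zE: "\<zero>\<^bsub>D\<^esub> \<in> carrier E" "\<And>p. p \<in> stab1 \<Longrightarrow> act E p \<zero>\<^bsub>D\<^esub> = \<zero>\<^bsub>D\<^esub>"
      using E.zero_closed E.act_zero by (simp_all add: E_simps(3))
    have "?F (p ** h) = act E p (?F h)" if "p \<in> stab1" "h \<in> carrier GL2" for p h
      using that cancel[OF that] zE E.act_mult[of p h d] d by simp
    moreover have "?F h \<in> carrier E" for h using zE E.act_closed[of h d] d by simp
    ultimately have "?F \<in> equivariant_funs GL2 stab1 E"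
      using stab1_in_GL2 by (auto simp: equivariant_E)
    then show ?thesis using Se_iff[of "mat 1" ?F] by auto
  qed
  have G: "?G \<in> Se sigma0' sigma0"
    using Se_closed(4)[OF adjacent_sigma0 F] Se_commute by simp
  \<comment> \<open>The basic edge carries \<open>?F\<close> in one direction and \<open>?G\<close>,
    its negative, in the other, as antisymmetry of chains demands; all other edges carry
    zero.\<close>
  let ?om = "\<lambda>(x, y). if x = sigma0 \<and> y = sigma0' then ?F else if x = sigma0' \<and> y = sigma0 then ?G
    else if adjacent x y then (\<lambda>_. \<zero>\<^bsub>D\<^esub>) else undefined"
  have Fv: "?F h \<in> carrier D" for h using E_closed[OF Se_value[OF adjacent_sigma0 F]] .
  have om: "?om \<in> C1"
    unfolding in_C1
  proof (intro conjI allI impI)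
    show "?om (x, y) \<in> Se x y" if "adjacent x y" for x y
      using F G Se_closed(1)[OF that] that by simp
    show "?om (x, y) = undefined" if "\<not> adjacent x y" for x y
      using that adjacent_sigma0 adjacent_sym by auto
    show "finite {(x, y). adjacent x y \<and> ?om (x, y) \<noteq> (\<lambda>_. \<zero>\<^bsub>D\<^esub>)}"
    proof (rule finite_subset)
      show "{(x, y). adjacent x y \<and> ?om (x, y) \<noteq> (\<lambda>_. \<zero>\<^bsub>D\<^esub>)} \<subseteq> {(sigma0, sigma0'), (sigma0', sigma0)}"
      proof (rule subsetI, rule ccontr)
        fix p assume p: "p \<in> {(x, y). adjacent x y \<and> ?om (x, y) \<noteq> (\<lambda>_. \<zero>\<^bsub>D\<^esub>)}"
          "p \<notin> {(sigma0, sigma0'), (sigma0', sigma0)}"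
        obtain x y where xy: "p = (x, y)" by (cases p)
        have f: "(x = sigma0 \<and> y = sigma0') = False" "(x = sigma0' \<and> y = sigma0) = False" using p(2) by (simp_all add: xy)
        show False using p(1) by (simp only: xy f mem_Collect_eq case_prod_conv if_False) (elim conjE, simp)
      qed
    qed simp
    show "?om (y, x) = (\<lambda>h. \<ominus>\<^bsub>D\<^esub> ?om (x, y) h)" if "adjacent x y" for x y
    proof -
      consider "x = sigma0" "y = sigma0'" | "x = sigma0'" "y = sigma0"
        | "\<not> (x = sigma0 \<and> y = sigma0')" "\<not> (x = sigma0' \<and> y = sigma0)" by blast
      then show ?thesis
      proof cases
        case 1
        then show ?thesis using sigma0_neq by simp
      next
        case 2
        have "?F h = \<ominus>\<^bsub>D\<^esub> (?G h)" for h using D.minus_minus[OF Fv[of h]] by simp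
        then show ?thesis using 2 sigma0_neq by simp
      next
        case 3
        then have f: "(x = sigma0 \<and> y = sigma0') = False" "(x = sigma0' \<and> y = sigma0) = False"
          "(y = sigma0 \<and> x = sigma0') = False" "(y = sigma0' \<and> x = sigma0) = False" by blast+
        have "?om (y, x) = (\<lambda>_. \<zero>\<^bsub>D\<^esub>)" "?om (x, y) = (\<lambda>_. \<zero>\<^bsub>D\<^esub>)"
          using that adjacent_sym[OF that] by (simp_all only: case_prod_conv f if_False if_True)
        then show ?thesis by simp
      qed
    qed
  qed
  have r0: "res sigma0 sigma0' ?F = indf (mat 1) d"
  proof -
    have "res (vertex_act (mat 1) sigma0) (vertex_act (mat 1) sigma0') ?F = indf (mat 1) (?F (matrix_inv (mat 1)))"
      by (rule res_eq) (use F in simp_all)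
    then show ?thesis using E.act_one[OF d] stab1_one by (simp add: matrix_inv_mat)
  qed
  have r1: "res sigma0' sigma0 ?G = indf Pi_mat (\<ominus>\<^bsub>D\<^esub> ?e)"
  proof -
    have "res (vertex_act Pi_mat sigma0) (vertex_act Pi_mat sigma0') ?G = indf Pi_mat (?G (matrix_inv Pi_mat))"
      by (rule res_eq) (use G in \<open>simp_all add: vertex_act_Pi\<close>)
    then show ?thesis using Pi1 by (simp add: vertex_act_Pi)
  qed
  have one: "finsum D (\<lambda>y. res x y (?om (x, y)) h) {y. adjacent x y} = u"
    if x: "adjacent x z" and u: "u \<in> carrier D" "\<And>y. adjacent x y \<Longrightarrow> res x y (?om (x, y)) h = (if z = y then u else \<zero>\<^bsub>D\<^esub>)"
    for x z h u
  proof -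
    have "finsum D (\<lambda>y. res x y (?om (x, y)) h) {y. adjacent x y} = finsum D (\<lambda>y. if z = y then u else \<zero>\<^bsub>D\<^esub>) {y. adjacent x y}"
      using u by (intro D.finsum_cong') auto
    also have "\<dots> = u" using x u(1) finite_neighbours[of x] by (intro D.finsum_singleton) auto
    finally show ?thesis .
  qed
  have "iota d \<oplus>\<^bsub>C0\<^esub> act C0 Pi_mat (iota (\<ominus>\<^bsub>D\<^esub> ?e)) = boundary V ?om"
  proof (rule C0_eqI[OF _ boundary_in_C0[OF om]])
    show "iota d \<oplus>\<^bsub>C0\<^esub> act C0 Pi_mat (iota (\<ominus>\<^bsub>D\<^esub> ?e)) \<in> carrier C0"
      using d e by (intro C0_closed iota_in_C0) (simp_all add: E_closed)
    fix x h assume x: "x \<in> vertices"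
    have ind: "indf g u h \<in> carrier D" if "u \<in> carrier D" for g u using that by (simp add: indf_def)
    have lhs: "(iota d \<oplus>\<^bsub>C0\<^esub> act C0 Pi_mat (iota (\<ominus>\<^bsub>D\<^esub> ?e))) x h =
        (if x = sigma0 then indf (mat 1) d h else \<zero>\<^bsub>D\<^esub>) \<oplus>\<^bsub>D\<^esub> (if x = sigma0' then indf Pi_mat (\<ominus>\<^bsub>D\<^esub> ?e) h else \<zero>\<^bsub>D\<^esub>)"
      using x e act_iota[of Pi_mat "\<ominus>\<^bsub>D\<^esub> ?e"] by (simp add: vertex_act_Pi) (simp add: C0_simps single_def)
    consider "x = sigma0" | "x = sigma0'" | "x \<noteq> sigma0" "x \<noteq> sigma0'" by blast
    then show "(iota d \<oplus>\<^bsub>C0\<^esub> act C0 Pi_mat (iota (\<ominus>\<^bsub>D\<^esub> ?e))) x h = boundary V ?om x h"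
    proof cases
      case 1
      have "finsum D (\<lambda>y. res x y (?om (x, y)) h) {y. adjacent x y} = indf (mat 1) d h"
      proof (rule one[of x sigma0'])
        show "res x y (?om (x, y)) h = (if sigma0' = y then indf (mat 1) d h else \<zero>\<^bsub>D\<^esub>)" if "adjacent x y" for y
          using that 1 sigma0_neq res_simps(2)[OF that] r0 by auto
      qed (use 1 adjacent_sigma0 ind E_closed[OF d] in auto)
      then show ?thesis unfolding lhs boundary_eq(1)[OF om x] using 1 sigma0_neq ind[OF E_closed[OF d]] by simp
    next
      case 2
      have "finsum D (\<lambda>y. res x y (?om (x, y)) h) {y. adjacent x y} = indf Pi_mat (\<ominus>\<^bsub>D\<^esub> ?e) h"
      proof (rule one[of x sigma0])
        show "res x y (?om (x, y)) h = (if sigma0 = y then indf Pi_mat (\<ominus>\<^bsub>D\<^esub> ?e) h else \<zero>\<^bsub>D\<^esub>)" if "adjacent x y" for y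
          using that 2 sigma0_neq res_simps(2)[OF that] r1 by auto
      qed (use 2 adjacent_sym[OF adjacent_sigma0] ind e in auto)
      then show ?thesis unfolding lhs boundary_eq(1)[OF om x] using 2 sigma0_neq ind[of "\<ominus>\<^bsub>D\<^esub> ?e"] e by simp
    next
      case 3
      have "finsum D (\<lambda>y. res x y (?om (x, y)) h) {y. adjacent x y} = \<zero>\<^bsub>D\<^esub>"
        using 3 by (intro D.add.finprod_one_eqI) (simp add: res_simps(2))
      then show ?thesis unfolding lhs boundary_eq(1)[OF om x] using 3 by simp
    qed
  qed
  then show ?thesis using om by blast
qed

text \<open>The map \<open>w\<close> is the surjection from chains restricted along
  \<open>iota\<close>. It is nonzero because the image of \<open>D\<close> generates all chains, and
  its compatibility with \<open>Pi_mat\<close> is the vanishing of the basic boundary.\<close>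

theorem H0_quotientE:
  fixes P :: "('c, 'w, 'f^2^2) rep"
  assumes P: "representation GL2 P" "carrier P \<noteq> {\<zero>\<^bsub>P\<^esub>}" and quot: "is_quotient GL2 P (H0 V)"
  obtains w where "w \<in> rep_hom G0 D P" "\<exists>d\<in>carrier D. w d \<noteq> \<zero>\<^bsub>P\<^esub>"
    "\<And>d. d \<in> carrier E \<Longrightarrow> act P (matrix_inv Pi_mat) (w d) = w (act E (matrix_inv Pi_mat) d)"
proof -
  interpret P: group_rep GL2 P by (rule group_rep_of[OF P(1)])
  note q = quotient_rep_canonical[OF repC0 subrep_boundary, folded H0_def]
  obtain \<phi> where \<phi>: "\<phi> \<in> rep_hom GL2 (H0 V) P" "\<phi> ` carrier (H0 V) = carrier P"
    using is_quotientE[OF q(1) P(1) quot] by blast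
  define \<Phi> where "\<Phi> = (\<lambda>x. \<phi> ((boundary V ` C1) +>\<^bsub>C0\<^esub> x))"
  have \<Phi>: "\<Phi> \<in> rep_hom GL2 C0 P"
    unfolding \<Phi>_def by (rule rep_hom_compose[OF q(2) \<phi>(1)])
  have \<Phi>_surj: "\<Phi> ` carrier C0 = carrier P"
    unfolding \<Phi>_def \<phi>(2)[symmetric] q(3)[symmetric] image_image ..
  have \<Phi>_B: "\<Phi> x = \<zero>\<^bsub>P\<^esub>" if "x \<in> boundary V ` C1" for x
  proof -
    have "x \<in> carrier C0" using that boundary_in_C0 by blast
    then have "(boundary V ` C1) +>\<^bsub>C0\<^esub> x = \<zero>\<^bsub>H0 V\<^esub>" using q(4) that by blast
    then show ?thesis unfolding \<Phi>_def by (simp add: rep_hom_zero[OF q(1) P(1) \<phi>(1)])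
  qed
  define w where "w = (\<lambda>d. \<Phi> (iota d))"
  have w: "w \<in> rep_hom G0 D P"
  proof (rule rep_homI)
    show "w d \<in> carrier P" if "d \<in> carrier D" for d
      unfolding w_def by (rule rep_hom_closed[OF \<Phi> iota_in_C0[OF that]])
    show "w (d \<oplus>\<^bsub>D\<^esub> d') = w d \<oplus>\<^bsub>P\<^esub> w d'" if "d \<in> carrier D" "d' \<in> carrier D" for d d'
      unfolding w_def indf_add[OF that] single_add
      by (rule rep_hom_add[OF \<Phi>]) (rule iota_in_C0, rule that)+
    show "w (c \<odot>\<^bsub>D\<^esub> d) = c \<odot>\<^bsub>P\<^esub> w d" if "d \<in> carrier D" for c d
      unfolding w_def indf_smult[OF that] single_smult
      by (rule rep_hom_smult[OF \<Phi> iota_in_C0[OF that]])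
    show "w (act D k d) = act P k (w d)" if "k \<in> carrier G0" "d \<in> carrier D" for k d
    proof -
      have k: "k \<in> stab0" "k \<in> carrier GL2" using that stab0_in_GL2 by simp_all
      have "act C0 k (iota d) = iota (act D k d)"
        using act_iota[OF k(2) that(2)] indf_stab0[of "mat 1" k d] k that vertex_act_sigma0_iff[OF k(2)] by simp
      then show ?thesis
        unfolding w_def using rep_hom_act[OF \<Phi> iota_in_C0[OF that(2)] k(2)] by simp
    qed
  qed
  have nz: "\<exists>d\<in>carrier D. w d \<noteq> \<zero>\<^bsub>P\<^esub>"
  proof (rule ccontr)
    assume n: "\<not> (\<exists>d\<in>carrier D. w d \<noteq> \<zero>\<^bsub>P\<^esub>)"
    let ?W = "{om \<in> carrier C0. \<Phi> om = \<zero>\<^bsub>P\<^esub>}"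
    have "subrep GL2 ?W C0"
      by (rule subrepI[OF repC0])
        (use rep_hom_add[OF \<Phi>] rep_hom_smult[OF \<Phi>] rep_hom_act[OF \<Phi>] rep_hom_zero[OF repC0 P(1) \<Phi>] C0_closed
          in auto)
    then have "?W = carrier C0"
      by (rule C0_generated) (use n iota_in_C0 in \<open>auto simp: w_def\<close>)
    then have zero: "\<Phi> om = \<zero>\<^bsub>P\<^esub>" if "om \<in> carrier C0" for om using that by blast
    have "\<Phi> ` carrier C0 \<subseteq> {\<zero>\<^bsub>P\<^esub>}" by (rule image_subsetI) (simp add: zero)
    then have "carrier P \<subseteq> {\<zero>\<^bsub>P\<^esub>}" by (simp only: \<Phi>_surj)
    then show False using P(2) P.zero_closed by blast
  qed
  have rel: "act P (matrix_inv Pi_mat) (w d) = w (act E (matrix_inv Pi_mat) d)" if d: "d \<in> carrier E" for d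
  proof -
    let ?e = "act E (matrix_inv Pi_mat) d"
    have e: "?e \<in> carrier D"
      using E.act_closed[of "matrix_inv Pi_mat" d] d stab1_inv[OF Pi_in_stab1] E_closed by auto
    have dD: "d \<in> carrier D" by (rule E_closed[OF d])
    have "\<Phi> (iota d \<oplus>\<^bsub>C0\<^esub> act C0 Pi_mat (iota (\<ominus>\<^bsub>D\<^esub> ?e))) = \<zero>\<^bsub>P\<^esub>"
      by (rule \<Phi>_B[OF iota_edge_relation[OF d]])
    moreover have "\<Phi> (iota d \<oplus>\<^bsub>C0\<^esub> act C0 Pi_mat (iota (\<ominus>\<^bsub>D\<^esub> ?e))) = w d \<oplus>\<^bsub>P\<^esub> act P Pi_mat (w (\<ominus>\<^bsub>D\<^esub> ?e))"
      unfolding w_def using rep_hom_add[OF \<Phi> iota_in_C0[OF dD] C0_closed(4)[OF iota_in_C0 Pi_mat_in_GL2]]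
        rep_hom_act[OF \<Phi> iota_in_C0 Pi_mat_in_GL2] e by simp
    moreover have we: "w ?e \<in> carrier P" "w d \<in> carrier P" using rep_hom_closed[OF w] e dD by blast+
    moreover have "w (\<ominus>\<^bsub>D\<^esub> ?e) = \<ominus>\<^bsub>P\<^esub> w ?e"
      using rep_hom_smult[OF w e, of "- 1"] e we(1) by (simp add: D.smult_minus_one P.smult_minus_one)
    moreover have "act P Pi_mat (\<ominus>\<^bsub>P\<^esub> w ?e) = \<ominus>\<^bsub>P\<^esub> act P Pi_mat (w ?e)"
      using P.act_smult[OF Pi_mat_in_GL2 we(1), of "- 1"] we(1) by (simp add: P.smult_minus_one)
    ultimately have "w d = act P Pi_mat (w ?e)"
      using P.minus_equality[of "w d" "\<ominus>\<^bsub>P\<^esub> act P Pi_mat (w ?e)"] by simp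
    then show ?thesis using P.act_inv_act[OF Pi_mat_in_GL2 we(1)] by (simp add: inv_GL2)
  qed
  show thesis by (rule that[OF w nz rel])
qed

end

section \<open>Passage from the two weights to an irreducible quotient\<close>

lemma J0_conj_s: "J0 (conj_s chi) = J0 chi"
proof -
  have "weyl_s ** (weyl_s ** h ** weyl_s) ** weyl_s = h" for h :: "'a^2^2"
    by (cases h rule: mat2_cases) (simp add: weyl_s_def mat2_mult)
  then have "conj_s (conj_s chi) h = chi h" for h
    by (simp add: conj_s_def matrix_inv_weyl_s)
  then show ?thesis by (simp add: J0_def eq_commute)
qed

context local_field
begin

lemma red_mat_up [simp]: "red_mat (upper_unip x) = upper_unip (red x)"
  and red_mat_lo [simp]: "red_mat (lower_unip x) = lower_unip (red x)"
  by (simp_all add: upper_unip_def lower_unip_def)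

lemma up_in_GK: "x \<in> integers \<Longrightarrow> upper_unip x \<in> GK"
  and lo_in_GK: "x \<in> integers \<Longrightarrow> lower_unip x \<in> GK"
  by (simp_all add: upper_unip_def lower_unip_def mat2_in_GK)

lemma Iw1_invariantsD:
  assumes "v \<in> invariants (tilde R) Iw1"
  shows "v \<in> carrier R" "act R (upper_unip x) v = v"
proof -
  show "v \<in> carrier R" using assms by (simp add: invariants_def tilde_simps)
  have "upper_unip (lift x) \<in> Iw1"
    using up_in_GK[of "lift x"] by (auto simp: Iw1_iff upper_unipotent_iff upper_unip_def)
  then have "act (tilde R) (upper_unip (lift x)) v = v" using assms by (simp add: invariants_def)
  then show "act R (upper_unip x) v = v" by (simp add: act_tilde_GK up_in_GK)
qed

text \<open>Vectors fixed by some congruence subgroup form a subrepresentation: a sum uses the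
  deeper of two levels, and a translate uses the level provided by conjugation. Irreducibility then
  spreads the property from \<open>w\<close> to every vector.\<close>

lemma smooth_repI:
  fixes P :: "('c::field, 'w, 'f^2^2) rep"
  assumes irr: "irreducible_rep GL2 P" and w: "w \<in> carrier P" "w \<noteq> \<zero>\<^bsub>P\<^esub>"
    and fixed: "1 \<le> n" "\<And>k. k \<in> congr_group n \<Longrightarrow> act P k w = w"
  shows "smooth_rep P"
proof -
  have P: "representation GL2 P" using irr by (simp add: irreducible_rep_def)
  interpret P: group_rep GL2 P by (rule group_rep_of[OF P])
  let ?fix = "\<lambda>n v. \<forall>k\<in>congr_group n. act P k v = v"
  let ?W = "{v \<in> carrier P. \<exists>n\<ge>1. ?fix n v}"
  have kG: "k \<in> carrier GL2" if "k \<in> congr_group n" "1 \<le> n" for k n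
    using congr_group_subset_GK[OF that] GK_in_GL2 by blast
  have mono: "?fix m v" if "?fix n v" "n \<le> m" for n m v
    using that ideal_pow_mono[OF that(2)] by (auto simp: congr_group_def)
  have "subrep GL2 ?W P"
  proof (rule subrepI[OF P])
    show "\<zero>\<^bsub>P\<^esub> \<in> ?W" using kG by (auto intro!: exI[of _ 1])
    show "x \<oplus>\<^bsub>P\<^esub> y \<in> ?W" if xy: "x \<in> ?W" "y \<in> ?W" for x y
    proof -
      obtain m n where mn: "m \<ge> 1" "?fix m x" "n \<ge> 1" "?fix n y" using xy by blast
      have "?fix (max m n) x" "?fix (max m n) y" using mono mn by (meson max.cobounded1 max.cobounded2)+
      then have "?fix (max m n) (x \<oplus>\<^bsub>P\<^esub> y)" using xy kG[of _ "max m n"] mn by (auto simp: P.act_add)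
      then show ?thesis using xy mn by (auto intro!: exI[of _ "max m n"])
    qed
    show "c \<odot>\<^bsub>P\<^esub> x \<in> ?W" if x: "x \<in> ?W" for c x
    proof -
      obtain n where n: "n \<ge> 1" "?fix n x" using x by blast
      then have "?fix n (c \<odot>\<^bsub>P\<^esub> x)" using x kG by (auto simp: P.act_smult)
      then show ?thesis using x n(1) by auto
    qed
    show "act P g x \<in> ?W" if g: "g \<in> carrier GL2" and x: "x \<in> ?W" for g x
    proof -
      obtain n where n: "n \<ge> 1" "?fix n x" using x by blast
      obtain m where m: "1 \<le> m" "\<And>k. k \<in> congr_group m \<Longrightarrow> matrix_inv g ** k ** g \<in> congr_group n"
        using congr_group_conj[OF g] by blast
      have "act P k (act P g x) = act P g x" if k: "k \<in> congr_group m" for k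
      proof -
        have "k ** g = g ** (matrix_inv g ** k ** g)"
          by (simp add: matrix_mul_assoc[symmetric] matrix_inv_cancel[OF g])
        moreover have "act P (k ** g) x = act P k (act P g x)"
          using P.act_mult[of k g x] kG[OF k m(1)] g x by simp
        moreover have "act P (g ** (matrix_inv g ** k ** g)) x = act P g (act P (matrix_inv g ** k ** g) x)"
          using P.act_mult[of g "matrix_inv g ** k ** g" x] kG[OF m(2)[OF k] n(1)] g x by simp
        ultimately show ?thesis using n(2) m(2)[OF k] by simp
      qed
      then show ?thesis using x g m(1) by auto
    qed
  qed auto
  moreover have "w \<in> ?W" using w fixed by auto
  ultimately have W: "?W = carrier P" using irreducible_subrep_eq[OF irr] w(2) by blast
  have "openin (top_of_set (carrier GL2)) {g \<in> carrier GL2. act P g v = v}" if v: "v \<in> carrier P" for v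
  proof -
    obtain n where n: "n \<ge> 1" "?fix n v" using v W by blast
    show ?thesis
    proof (rule openin_if_congr_group[where n = n])
      fix g k assume g: "g \<in> {g \<in> carrier GL2. act P g v = v}" and k: "k \<in> congr_group n"
      then show "g ** k \<in> {g \<in> carrier GL2. act P g v = v}"
        using P.act_mult[of g k v] kG[OF k n(1)] n(2) v by simp
    qed auto
  qed
  then show ?thesis using P by (simp add: smooth_rep_def)
qed

text \<open>Scalar matrices are central, so the vectors on which they all act through
  \<open>zeta\<close> form a subrepresentation, and it contains \<open>w\<close>.\<close>

lemma has_central_characterI:
  fixes P :: "('c::field, 'w, 'f^2^2) rep"
  assumes irr: "irreducible_rep GL2 P" and w: "w \<in> carrier P" "w \<noteq> \<zero>\<^bsub>P\<^esub>"
    and zeta: "zeta \<in> characters (mult_of (ring_of_type_algebra :: 'f ring))"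
    and eigen: "\<And>z. z \<noteq> 0 \<Longrightarrow> act P (mat z) w = zeta z \<odot>\<^bsub>P\<^esub> w"
  shows "has_central_character P"
proof -
  have P: "representation GL2 P" using irr by (simp add: irreducible_rep_def)
  interpret P: group_rep GL2 P by (rule group_rep_of[OF P])
  let ?W = "{v \<in> carrier P. \<forall>z. z \<noteq> 0 \<longrightarrow> act P (mat z) v = zeta z \<odot>\<^bsub>P\<^esub> v}"
  have "subrep GL2 ?W P"
  proof (rule subrepI[OF P])
    show "c \<odot>\<^bsub>P\<^esub> x \<in> ?W" if "x \<in> ?W" for c x
      using that by (auto simp: P.act_smult mult.commute simp flip: P.smult_assoc)
    show "act P g x \<in> ?W" if g: "g \<in> carrier GL2" and x: "x \<in> ?W" for g x
    proof -
      have "act P (mat z) (act P g x) = zeta z \<odot>\<^bsub>P\<^esub> act P g x" if z: "z \<noteq> 0" for z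
      proof -
        have "act P (mat z) (act P g x) = act P g (act P (mat z) x)"
          using P.act_mult[of "mat z" g x] P.act_mult[of g "mat z" x] mat_commute[of z g] g x z by simp
        then show ?thesis using x z g by (simp add: P.act_smult)
      qed
      then show ?thesis using x g by simp
    qed
  qed (auto simp: P.act_add P.smult_add_vec)
  moreover have "w \<in> ?W" using w eigen by simp
  ultimately have "?W = carrier P" using irreducible_subrep_eq[OF irr] w(2) by blast
  then show ?thesis unfolding has_central_character_def using zeta by blast
qed

end

context basic_diagram
begin

lemma D_simps:
  "carrier D = carrier R \<times> carrier S" "\<zero>\<^bsub>D\<^esub> = (\<zero>\<^bsub>R\<^esub>, \<zero>\<^bsub>S\<^esub>)"
  "x \<oplus>\<^bsub>D\<^esub> y = (fst x \<oplus>\<^bsub>R\<^esub> fst y, snd x \<oplus>\<^bsub>S\<^esub> snd y)" "c \<odot>\<^bsub>D\<^esub> x = (c \<odot>\<^bsub>R\<^esub> fst x, c \<odot>\<^bsub>S\<^esub> snd x)"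
  "act D g x = (act (tilde R) g (fst x), act (tilde S) g (snd x))"
  by (simp_all add: D0_rep_def direct_sum_def tilde_simps)

lemma embeddings:
  "(\<lambda>v. (v, \<zero>\<^bsub>S\<^esub>)) \<in> rep_hom G0 (tilde R) D" "(\<lambda>u. (\<zero>\<^bsub>R\<^esub>, u)) \<in> rep_hom G0 (tilde S) D"
proof -
  interpret R: group_rep GL2 R by (rule group_rep_of[OF repR])
  interpret S: group_rep GL2 S by (rule group_rep_of[OF repS])
  interpret tR: group_rep G0 "tilde R" by (rule group_rep_of[OF representation_tilde[OF repR]])
  interpret tS: group_rep G0 "tilde S" by (rule group_rep_of[OF representation_tilde[OF repS]])
  show "(\<lambda>v. (v, \<zero>\<^bsub>S\<^esub>)) \<in> rep_hom G0 (tilde R) D" "(\<lambda>u. (\<zero>\<^bsub>R\<^esub>, u)) \<in> rep_hom G0 (tilde S) D"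
    using tR.act_zero tS.act_zero by (auto intro!: rep_homI simp: D_simps tilde_simps)
qed

end

lemma representation_restrict_group:
  assumes "representation G V" "subgroup H G"
  shows "representation (G\<lparr>carrier := H\<rparr>) V"
proof -
  interpret V: group_rep G V by (rule group_rep_of) fact
  have "h \<in> H \<Longrightarrow> h \<in> carrier G" for h using subgroup.subset[OF assms(2)] by blast
  then show ?thesis
    using assms(1) group.subgroup_imp_group[OF V.group assms(2)] by (simp add: representation_def)
qed

context local_field
begin

text \<open>Elements of \<open>GK\<close> act on the image of \<open>h\<close> through their
  reduction; lower unipotents over \<open>max_ideal\<close> and \<open>congr_group 1\<close> reduce
  to the identity. For the last claim, every matrix of the finite group lifts to \<open>GK\<close>,
  so the kernel of \<open>h\<close> is a subrepresentation, which is everything once it contains the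
  generator.\<close>

lemma eigen_generator_image:
  fixes R :: "('c::field, 'v, 'k^2^2) rep" and P :: "('c, 'w, 'f^2^2) rep"
  assumes R: "representation GL2 R" and P: "representation GL2 P"
    and h: "h \<in> rep_hom (GL2\<lparr>carrier := stab0\<rparr>) (tilde R) P"
    and v: "v \<in> carrier R" "\<And>x. act R (upper_unip x) v = v" and e: "eigen_generator chi l R v"
  shows "h v \<in> carrier P"
    and "x \<in> integers \<Longrightarrow> act P (upper_unip x) (h v) = h v" "x \<in> max_ideal \<Longrightarrow> act P (lower_unip x) (h v) = h v"
    and "k \<in> congr_group 1 \<Longrightarrow> act P k (h v) = h v"
    and "finsum P (\<lambda>a. act P (upper_unip (lift a) ** weyl_s) (h v)) UNIV = l \<odot>\<^bsub>P\<^esub> h v"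
    and "a \<noteq> 0 \<Longrightarrow> d \<noteq> 0 \<Longrightarrow> act P (mat2 (lift a) 0 0 (lift d)) (h v) = chi (mat2 a 0 0 d) \<odot>\<^bsub>P\<^esub> h v"
    and "u \<in> integers \<Longrightarrow> u \<notin> max_ideal \<Longrightarrow>
      act P (mat (unif powi n * u)) (h v) = chi (mat2 (red u) 0 0 (red u)) \<odot>\<^bsub>P\<^esub> h v"
    and "h v = \<zero>\<^bsub>P\<^esub> \<Longrightarrow> w \<in> carrier R \<Longrightarrow> h w = \<zero>\<^bsub>P\<^esub>"
proof -
  let ?G0 = "GL2\<lparr>carrier := stab0\<rparr>"
  interpret R: group_rep GL2 R by (rule group_rep_of[OF R])
  interpret P: group_rep GL2 P by (rule group_rep_of[OF P])
  have tR: "representation ?G0 (tilde R)" by (rule representation_tilde[OF R])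
  have P0: "representation ?G0 P" by (rule representation_restrict_group[OF P subgroup_stab0])
  have h_smult: "h (c \<odot>\<^bsub>R\<^esub> w) = c \<odot>\<^bsub>P\<^esub> h w" if "w \<in> carrier R" for c w
    using rep_hom_smult[OF h, of w c] that by (simp add: tilde_simps)
  have h_closed: "h w \<in> carrier P" if "w \<in> carrier R" for w
    using rep_hom_closed[OF h, of w] that by (simp add: tilde_simps)
  have h_act: "act P k (h w) = h (act R (red_mat k) w)" if "k \<in> GK" "w \<in> carrier R" for k w
    using rep_hom_act[OF h, of w k] that GK_in_stab0 by (simp add: tilde_simps act_tilde_GK)
  show "h v \<in> carrier P" by (rule h_closed[OF v(1)])
  show "act P (upper_unip x) (h v) = h v" if "x \<in> integers"
    using h_act[OF up_in_GK[OF that] v(1)] v(2) by simp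
  show "act P (lower_unip x) (h v) = h v" if "x \<in> max_ideal"
    using h_act[OF lo_in_GK v(1), of x] max_ideal_subset[OF that] R.act_one[OF v(1)] that
    by (simp add: lower_unip_def mat_as_mat2)
  show "act P k (h v) = h v" if "k \<in> congr_group 1"
    using h_act[OF _ v(1), of k] congr_group_subset_GK[OF that] R.act_one[OF v(1)] by simp
  have e': "act R (mat2 a 0 0 d) v = chi (mat2 a 0 0 d) \<odot>\<^bsub>R\<^esub> v" if "a \<noteq> 0" "d \<noteq> 0" for a d
    using e that by (simp add: eigen_generator_def)
  show "finsum P (\<lambda>a. act P (upper_unip (lift a) ** weyl_s) (h v)) UNIV = l \<odot>\<^bsub>P\<^esub> h v"
  proof -
    have "h (finsum (tilde R) (\<lambda>a. act R (upper_unip a ** weyl_s) v) UNIV) =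
        finsum P (\<lambda>a. h (act R (upper_unip a ** weyl_s) v)) UNIV"
      using v(1) by (intro rep_hom_finsum[OF tR P0 h]) (auto simp: tilde_simps)
    moreover have "finsum (tilde R) (\<lambda>a. act R (upper_unip a ** weyl_s) v) UNIV = finsum R (\<lambda>a. act R (upper_unip a ** weyl_s) v) UNIV"
      by (simp add: finsum_def tilde_simps finprod_def)
    moreover have "act P (upper_unip (lift a) ** weyl_s) (h v) = h (act R (upper_unip a ** weyl_s) v)" for a
      using h_act[OF GK_mult[OF up_in_GK weyl_s_in_GK] v(1), of "lift a"] by (simp add: red_mat_mult up_in_GK)
    ultimately show ?thesis using e h_smult[OF v(1)] by (simp add: eigen_generator_def)
  qed
  show "act P (mat2 (lift a) 0 0 (lift d)) (h v) = chi (mat2 a 0 0 d) \<odot>\<^bsub>P\<^esub> h v" if "a \<noteq> 0" "d \<noteq> 0"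
  proof -
    have "mat2 (lift a) 0 0 (lift d) \<in> GK" using lift_unit that by (simp add: mat2_in_GK val_mult)
    then show ?thesis using h_act[OF _ v(1)] e'[OF that] h_smult[OF v(1)] by simp
  qed
  show "act P (mat (unif powi n * u)) (h v) = chi (mat2 (red u) 0 0 (red u)) \<odot>\<^bsub>P\<^esub> h v"
    if u: "u \<in> integers" "u \<notin> max_ideal"
  proof -
    have u0: "u \<noteq> 0" "val u = 0" "red u \<noteq> 0" using u unit_iff_val[of u] red_zero_iff[OF u(1)] by auto
    have uK: "mat u \<in> GK" using u u0 by (simp add: mat_as_mat2 mat2_in_GK val_mult)
    have m: "mat (unif powi n * u) = mat (unif powi n) ** (mat u :: 'f^2^2)" by (simp add: mat_mult_mat)
    have "mat (unif powi n * u) \<in> stab0" using u0 by (intro mat_in_stab0) (simp del: power_int_eq_0_iff)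
    then have "act P (mat (unif powi n * u)) (h v) = h (act R (red_mat (mat u)) v)"
      using rep_hom_act[OF h, of v "mat (unif powi n * u)"] v(1) by (simp add: tilde_simps m act_tilde[OF uK])
    also have "act R (red_mat (mat u)) v = chi (mat2 (red u) 0 0 (red u)) \<odot>\<^bsub>R\<^esub> v"
      using e'[OF u0(3) u0(3)] by (simp add: mat_as_mat2)
    finally show ?thesis by (simp add: h_smult[OF v(1)])
  qed
  show "h w = \<zero>\<^bsub>P\<^esub>" if hv: "h v = \<zero>\<^bsub>P\<^esub>" and w: "w \<in> carrier R"
  proof -
    let ?W = "{w \<in> carrier R. h w = \<zero>\<^bsub>P\<^esub>}"
    have "subrep GL2 ?W R"
    proof (rule subrepI[OF R])
      show "\<zero>\<^bsub>R\<^esub> \<in> ?W" using rep_hom_zero[OF tR P0 h] by (simp add: tilde_simps)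
      show "x \<oplus>\<^bsub>R\<^esub> y \<in> ?W" if "x \<in> ?W" "y \<in> ?W" for x y
        using that rep_hom_add[OF h, of x y] by (simp add: tilde_simps)
      show "act R g x \<in> ?W" if g: "g \<in> carrier GL2" and x: "x \<in> ?W" for g x
      proof -
        obtain A where A: "A \<in> GK" "red_mat A = g" by (rule GK_lift[OF g])
        then have "h (act R g x) = act P A (h x)" using h_act[OF A(1), of x] x by simp
        then show ?thesis using g x A(1) GK_in_GL2 by simp
      qed
    qed (auto simp: h_smult)
    moreover have "v \<in> ?W" using v(1) hv by simp
    ultimately have "?W = carrier R"
      using e[unfolded eigen_generator_def, THEN conjunct2, THEN conjunct2, THEN spec, THEN mp, THEN mp] by blast
    then show ?thesis using w by blast
  qed
qed

end

section \<open>Supersingularity from the two weights and the principal series computation\<close>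

theorem corollary6p6:
  fixes val :: "'f::{field,metric_space} \<Rightarrow> int"
    and unif :: 'f
    and red :: "'f \<Rightarrow> 'k::finite_field"
    and chi :: "'k^2^2 \<Rightarrow> 'c::alg_closed_field"
    and J :: "('k^2^2) set"
    and rho1 :: "('c, 'v, 'k^2^2) rep"
    and rho2 :: "('c, 'u, 'k^2^2) rep"
    and v1 :: 'v and v2 :: 'u
    and D1 :: "('c, 'v \<times> 'u, 'f^2^2) rep"
    and pi_rep :: "('c, 'w, 'f^2^2) rep"
  assumes "local_field val unif red"
    and "is_Fp_closure TYPE('c) CHAR('k)"
    and "chi \<in> characters (GL2\<lparr>carrier := diagonal\<rparr>)"
    and "J \<subseteq> J0 chi"
    and "is_rho chi J rho1"
    and "is_rho (conj_s chi) (J0 chi - J) rho2"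
    and "v1 \<in> invariants (local_field.tilde val unif red rho1) (local_field.Iw1 val red)"
    and "v1 \<noteq> \<zero>\<^bsub>rho1\<^esub>"
    and "v2 \<in> invariants (local_field.tilde val unif red rho2) (local_field.Iw1 val red)"
    and "v2 \<noteq> \<zero>\<^bsub>rho2\<^esub>"
    and "local_field.is_D1 val unif red rho1 rho2 v1 v2 D1"
    and "irreducible_rep GL2 pi_rep"
    and "is_quotient GL2 pi_rep
           (local_field.H0 val unif (local_field.V_gamma val unif red rho1 rho2 D1))"
  shows "supersingular pi_rep"
proof -
  have char: "CHAR('c) = CHAR('k)" using assms(2) by (simp add: is_Fp_closure_def)
  have rep1: "representation GL2 rho1" and rep2: "representation GL2 rho2"
    using assms(5,6) by (simp_all add: is_rho_def)
  have P: "representation GL2 pi_rep" "carrier pi_rep \<noteq> {\<zero>\<^bsub>pi_rep\<^esub>}"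
    using assms(12) by (simp_all add: irreducible_rep_def)
  interpret basic_diagram val unif red rho1 rho2 v1 v2 D1
    by (intro basic_diagram.intro basic_diagram_axioms.intro assms(1,11) rep1 rep2)
  interpret P: group_rep GL2 pi_rep by (rule group_rep_of[OF P(1)])
  note v1 = Iw1_invariantsD[OF assms(7)] and v2 = Iw1_invariantsD[OF assms(9)]
  obtain l1 where l1: "eigen_generator chi l1 rho1 v1" "J0 chi = {} \<Longrightarrow> l1 = 0"
    "J0 chi \<noteq> {} \<Longrightarrow> l1 = 0 \<longleftrightarrow> weyl_s \<in> J"
    using rho_eigen_generator[OF assms(5) char v1(1) assms(8) v1(2)] by metis
  obtain l2 where l2: "eigen_generator (conj_s chi) l2 rho2 v2" "J0 chi = {} \<Longrightarrow> l2 = 0"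
    "J0 chi \<noteq> {} \<Longrightarrow> l2 = 0 \<longleftrightarrow> weyl_s \<in> J0 chi - J"
    using rho_eigen_generator[OF assms(6) char v2(1) assms(10) v2(2)] unfolding J0_conj_s by metis
  have J0: "J0 chi = {} \<or> weyl_s \<in> J0 chi" by (simp add: J0_def)
  obtain w where w: "w \<in> rep_hom G0 D pi_rep" "\<exists>d\<in>carrier D. w d \<noteq> \<zero>\<^bsub>pi_rep\<^esub>"
    "\<And>d. d \<in> carrier D1 \<Longrightarrow> act pi_rep (matrix_inv Pi_mat) (w d) = w (act D1 (matrix_inv Pi_mat) d)"
    using H0_quotientE[OF P assms(13)] by blast
  let ?h1 = "\<lambda>v. w (v, \<zero>\<^bsub>rho2\<^esub>)" and ?h2 = "\<lambda>u. w (\<zero>\<^bsub>rho1\<^esub>, u)"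
  note h1 = rep_hom_compose[OF embeddings(1) w(1)] and h2 = rep_hom_compose[OF embeddings(2) w(1)]
  define w1 w2 where "w1 = ?h1 v1" and "w2 = ?h2 v2"
  note F1 = eigen_generator_image[OF rep1 P(1) h1 v1 l1(1), folded w1_def]
  note F2 = eigen_generator_image[OF rep2 P(1) h2 v2 l2(1), folded w2_def]
  have in_E: "(v1, \<zero>\<^bsub>rho2\<^esub>) \<in> carrier D1" "(\<zero>\<^bsub>rho1\<^esub>, v2) \<in> carrier D1"
  proof -
    interpret R: group_rep GL2 rho1 by (rule group_rep_of[OF rep1])
    interpret S: group_rep GL2 rho2 by (rule group_rep_of[OF rep2])
    have "act (tilde rho1) g \<zero>\<^bsub>rho1\<^esub> = \<zero>\<^bsub>rho1\<^esub>" "act (tilde rho2) g \<zero>\<^bsub>rho2\<^esub> = \<zero>\<^bsub>rho2\<^esub>" if "g \<in> Iw1" for g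
      using Iw_subset[OF Iw1_subset[OF that]] by (simp_all add: act_tilde_GK red_mat_in_GL2)
    then show "(v1, \<zero>\<^bsub>rho2\<^esub>) \<in> carrier D1" "(\<zero>\<^bsub>rho1\<^esub>, v2) \<in> carrier D1"
      using assms(7,9) by (auto simp: E_simps invariants_def D_simps tilde_simps)
  qed
  have Pi12: "act pi_rep (matrix_inv Pi_mat) w1 = w2" "act pi_rep (matrix_inv Pi_mat) w2 = w1"
    using w(3)[OF in_E(1)] w(3)[OF in_E(2)] assms(11) by (simp_all add: w1_def w2_def is_D1_def)
  then have Pi21: "act pi_rep Pi_mat w1 = w2" "act pi_rep Pi_mat w2 = w1"
    using P.act_act_inv[OF Pi_mat_in_GL2] F1(1) F2(1) by (metis inv_GL2 Pi_mat_in_GL2)+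
  \<comment> \<open>If \<open>w1\<close> were zero, so would be \<open>w2\<close>, its image under
    \<open>Pi_mat\<close>. Each distinguished vector generates its factor, so \<open>w\<close> would
    vanish on both summands of \<open>D\<close>.\<close>
  have w1_nz: "w1 \<noteq> \<zero>\<^bsub>pi_rep\<^esub>"
  proof
    assume w1: "w1 = \<zero>\<^bsub>pi_rep\<^esub>"
    then have w2: "w2 = \<zero>\<^bsub>pi_rep\<^esub>" using Pi21(1) by simp
    interpret R: group_rep GL2 rho1 by (rule group_rep_of[OF rep1])
    interpret S: group_rep GL2 rho2 by (rule group_rep_of[OF rep2])
    have "w d = \<zero>\<^bsub>pi_rep\<^esub>" if d': "d \<in> carrier D" for d
    proof -
      obtain x y where d: "d = (x, y)" "x \<in> carrier rho1" "y \<in> carrier rho2"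
        using d' by (auto simp: D_simps)
      have "w ((x, \<zero>\<^bsub>rho2\<^esub>) \<oplus>\<^bsub>D\<^esub> (\<zero>\<^bsub>rho1\<^esub>, y)) = w (x, \<zero>\<^bsub>rho2\<^esub>) \<oplus>\<^bsub>pi_rep\<^esub> w (\<zero>\<^bsub>rho1\<^esub>, y)"
        using d by (intro rep_hom_add[OF w(1)]) (simp_all add: D_simps)
      then show ?thesis using d F1(8)[OF w1 d(2)] F2(8)[OF w2 d(3)] by (simp add: D_simps)
    qed
    then show False using w(2) by blast
  qed
  have smooth: "smooth_rep pi_rep"
    by (rule smooth_repI[OF assms(12) F1(1) w1_nz order_refl F1(4)])
  have chi_mult: "chi (mat2 a 0 0 a) \<noteq> 0"
    "chi (mat2 (a * b) 0 0 (a * b)) = chi (mat2 a 0 0 a) * chi (mat2 b 0 0 b)" if "a \<noteq> 0" "b \<noteq> 0" for a b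
  proof -
    have diag: "mat2 c 0 0 c \<in> diagonal" if "c \<noteq> 0" for c :: 'k using that by (simp add: diagonal_iff)
    show "chi (mat2 a 0 0 a) \<noteq> 0" using assms(3) diag[OF that(1)] by (auto simp: hom_def mult_of_def)
    have "chi (mat2 a 0 0 a ** mat2 b 0 0 b) = chi (mat2 a 0 0 a) * chi (mat2 b 0 0 b)"
      using assms(3) diag[OF that(1)] diag[OF that(2)] by (auto simp: hom_def mult_of_def)
    then show "chi (mat2 (a * b) 0 0 (a * b)) = chi (mat2 a 0 0 a) * chi (mat2 b 0 0 b)" by (simp add: mat2_mult)
  qed
  \<comment> \<open>The unit part of a scalar. The uniformiser acts trivially on \<open>D\<close>,
    so the central character depends only on the residue of this unit.\<close>
  define un where "un = (\<lambda>z. unif powi (- val z) * z)"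
  define zeta where "zeta = (\<lambda>z. chi (mat2 (red (un z)) 0 0 (red (un z))))"
  have un: "un z \<in> integers" "un z \<notin> max_ideal" "z = unif powi (val z) * un z" "red (un z) \<noteq> 0" if "z \<noteq> 0" for z
  proof -
    have "un z \<noteq> 0" "val (un z) = 0" using that by (simp_all add: un_def val_mult del: power_int_eq_0_iff)
    then show i: "un z \<in> integers" "un z \<notin> max_ideal" using unit_iff_val by blast+
    show "z = unif powi (val z) * un z" by (simp add: un_def flip: power_int_add mult.assoc)
    show "red (un z) \<noteq> 0" using i red_zero_iff by simp
  qed
  have "zeta \<in> characters (mult_of (ring_of_type_algebra :: 'f ring))"
  proof -
    have "zeta (y * z) = zeta y * zeta z" if "y \<noteq> 0" "z \<noteq> 0" for y z
    proof -
      have "un (y * z) = un y * un z"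
        using that by (simp add: un_def val_mult power_int_add power_int_diff)
          (simp add: power_int_minus field_simps)
      then show ?thesis unfolding zeta_def using un(1,4)[OF that(1)] un(1,4)[OF that(2)] chi_mult(2) by (simp add: red_times)
    qed
    moreover have "zeta z \<noteq> 0" if "z \<noteq> 0" for z unfolding zeta_def using un(4)[OF that] chi_mult(1) by blast
    ultimately show ?thesis by (auto simp: hom_def mult_of_def)
  qed
  moreover have "act pi_rep (mat z) w1 = zeta z \<odot>\<^bsub>pi_rep\<^esub> w1" if "z \<noteq> 0" for z
    using F1(7)[OF un(1,2)[OF that], of "val z"] un(3)[OF that] by (simp add: zeta_def)
  ultimately have central: "has_central_character pi_rep"
    by (rule has_central_characterI[OF assms(12) F1(1) w1_nz])
  have "\<not> is_subquotient GL2 pi_rep (principal_series psi)" if psi: "smooth_borel_character psi" for psi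
  proof
    assume sub: "is_subquotient GL2 pi_rep (principal_series psi)"
    have "upper_unip x \<in> upper_unipotent" for x :: 'f by (auto simp: upper_unipotent_iff upper_unip_def)
    then interpret PS: principal_series_loc val unif red psi
      by unfold_locales (use psi char in \<open>auto simp: smooth_borel_character_def\<close>)
    obtain W where W: "subrep GL2 W (principal_series psi)"
      and quot: "is_quotient GL2 pi_rep ((principal_series psi)\<lparr>carrier := W\<rparr>)"
      using sub by (auto simp: is_subquotient_def)
    obtain \<Phi> where \<Phi>: "\<Phi> \<in> rep_hom GL2 ((principal_series psi)\<lparr>carrier := W\<rparr>) pi_rep"
      "\<Phi> ` carrier ((principal_series psi)\<lparr>carrier := W\<rparr>) = carrier pi_rep"
      by (rule is_quotientE[OF representation_subrep[OF PS.representation_PS W] P(1) quot])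
    show False
    proof (rule PS.no_supersingular_subquotient[OF P(1) W \<Phi>(1) _ F1(1) w1_nz Pi21(1)[symmetric] Pi21(2) _ _ F1(5) F2(5)])
      show "\<Phi> ` W = carrier pi_rep" using \<Phi>(2) by simp
      show "act pi_rep (upper_unip x) v = v" if "v \<in> {w1, w2}" "x \<in> integers" for v x
        using that F1(2) F2(2) by auto
      show "act pi_rep (lower_unip x) v = v" if "v \<in> {w1, w2}" "x \<in> max_ideal" for v x
        using that F1(3) F2(3) by auto
      \<comment> \<open>If \<open>J0 chi\<close> is empty both eigenvalues are 0. Otherwise
        \<open>weyl_s\<close> lies in exactly one of \<open>J\<close> and its complement, and the
        eigenvalue of that factor is 0.\<close>
      show "l1 = 0 \<or> l2 = 0" using l1(2,3) l2(3) J0 by blast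
      assume l: "l1 = 0" "l2 = 0"
      \<comment> \<open>Two vanishing eigenvalues would put \<open>weyl_s\<close> both in
        \<open>J\<close> and in its complement if \<open>J0 chi\<close> were nonempty. So
        \<open>chi\<close> is not fixed by conjugation, and some torus element separates it from its
        conjugate.\<close>
      then have "J0 chi = {}" using l1(3) l2(3) by blast
      then obtain h where h: "h \<in> diagonal" "chi h \<noteq> conj_s chi h" by (auto simp: J0_def split: if_splits)
      obtain a d where ad: "h = mat2 a 0 0 d" "a \<noteq> 0" "d \<noteq> 0"
        using h(1) mat2_eta[of h] by (auto simp: diagonal_iff)
      show "\<exists>a d c1 c2. a \<noteq> 0 \<and> d \<noteq> 0 \<and> c1 \<noteq> c2 \<and> act pi_rep (mat2 a 0 0 d) w1 = c1 \<odot>\<^bsub>pi_rep\<^esub> w1 \<and>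
          act pi_rep (mat2 d 0 0 a) w1 = c2 \<odot>\<^bsub>pi_rep\<^esub> w1"
        using F1(6)[OF ad(2,3)] F1(6)[OF ad(3,2)] h(2) lift_unit ad
        by (intro exI[of _ "lift a"] exI[of _ "lift d"] exI[of _ "chi h"] exI[of _ "conj_s chi h"])
          (simp add: conj_s_mat2)
    qed
  qed
  then show ?thesis
    unfolding supersingular_def using smooth central assms(12) by blast
qed

end
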